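(* Assume $q\ge 6$ (in addition to $2\le p\le 2^{q-2}$). Let $\sigma\in\Sigma=\{\mathrm{round}(\mathrm{ReLU}),\mathrm{round}(\mathrm{ELU}),\mathrm{round}(\mathrm{GELU}),\mathrm{round}(\mathrm{Swish}),\mathrm{round}(\mathrm{Sigmoid}),\mathrm{round}(\tanh)\}$, let $d\in\mathbb{N}$, $\mathcal{X}=[-M_\sigma,M_\sigma]_{\mathbb{F}}^d$, and let $f^*:\mathcal{X}\to\mathbb{F}$, $h^*:\mathcal{X}\to[-H_\sigma,H_\sigma]_{\mathbb{F}}$ and $g^*:\mathbb{F}^d\to\mathbb{F}^{1\times d}$ be such that $g^*(x)=0$ for every $x\in\mathcal{X}$ with $h^*(x)=0$. Then for every $L\ge 9$ there exists an $L$-layer $\sigma$ network $f:\overline{\mathbb{F}}^d\to\overline{\mathbb{F}}$ such that for all $x\in\mathcal{X}$, $$f(x)=f^*(x)\quad\text{and}\quad \mathcal{D}_{f,x}(h^*(x))=g^*(x).$$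
   Context: Floating-point setting. Fix integers $p,q$ with $2\le p\le 2^{q-2}$ and $q\ge 4$. Put $\mathfrak{e}_{\min}=-2^{q-1}+2$, $\mathfrak{e}_{\max}=2^{q-1}-1$. The finite floats are $\mathbb{F}=\{s(1+i/2^p)2^{e},\ s(i/2^p)2^{\mathfrak{e}_{\min}}: s\in\{-1,1\},\ i\in\{0,\dots,2^p-1\},\ e\in\{\mathfrak{e}_{\min},\dots,\mathfrak{e}_{\max}\}\}\subset\mathbb{R}$, and $\overline{\mathbb{F}}=\mathbb{F}\cup\{-\infty,\infty,\mathrm{NaN}\}$. A float is called even if the integer $i$ in its representation is even. $\Omega=(2-2^{-p})2^{\mathfrak{e}_{\max}}$. For $a,b\in\mathbb{R}$, $[a,b]_{\mathbb{F}}=[a,b]\cap\mathbb{F}$. Rounding: for real $x$ with $|x|<\Omega+2^{\mathfrak{e}_{\max}-p-1}$, $\mathrm{round}(x)$ is the element of $\mathbb{F}$ nearest to $x$ (ties broken toward the even float); $\mathrm{round}(x)=\infty$ if $x\ge \Omega+2^{\mathfrak{e}_{\max}-p-1}$ and $-\infty$ if $x\le -\Omega-2^{\mathfrak{e}_{\max}-p-1}$. For $x,y\in\mathbb{F}$: $x\oplus y=\mathrm{round}(x+y)$, $x\otimes y=\mathrm{round}(xy)$ (non-finite operands follow IEEE-754 conventions: NaN propagates, $\pm\infty\oplus$finite$=\pm\infty$, $\infty\oplus(-\infty)=\mathrm{NaN}$, $\pm\infty\otimes 0=\mathrm{NaN}$, $\pm\infty\otimes$nonzero is a signed infinity). Sums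 are evaluated left to right: $\bigoplus_{i=1}^n x_i=(\bigoplus_{i=1}^{n-1}x_i)\oplus x_n$, empty sum $=0$; products $a\otimes b\otimes c$ are evaluated left to right. For $\hat\sigma:\mathbb{R}\to\mathbb{R}$, $\mathrm{round}(\hat\sigma)(x)=\mathrm{round}(\hat\sigma(x))$ for $x\in\mathbb{F}$. Networks. An activation is a pair $\sigma,\sigma':\overline{\mathbb{F}}\to\overline{\mathbb{F}}$ with $\sigma'(\mathbb{F})\subset\mathbb{F}$, applied coordinatewise. A floating-point affine map $\rho:\overline{\mathbb{F}}^{m}\to\overline{\mathbb{F}}^{n}$ is $\rho(x)=A\otimes x\oplus b$ with $A=[a_{ij}]\in\mathbb{F}^{n\times m}$, $b\in\mathbb{F}^n$, where $(A\otimes x)_i=\bigoplus_{j=1}^m(a_{ij}\otimes x_j)$ and $b$ is added coordinatewise. An $L$-layer $\sigma$ network is $f=\rho_L\circ\sigma\circ\rho_{L-1}\circ\cdots\circ\sigma\circ\rho_1$ with affine $\rho_l:\overline{\mathbb{F}}^{d_{l-1}}\to\overline{\mathbb{F}}^{d_l}$. Automatic differentiation: for a row vector $g$ and matrix $A$, $(g\otimes A)_j=\bigoplus_i (g_i\otimes a_{ij})$; for the affine $\rho(x)=A\otimes x\oplus b$, $\mathcal{D}_{\rho,x}(g)=g\otimes A$; for the activation layer, $\mathcal{D}_{\sigma,x}(g)=g\otimes \mathrm{diag}(\sigma'(x_1),\dots,\sigma'(x_n))$; for compositions $\mathcal{D}_{\psi_2\circ\psi_1,x}(g)=\mathcal{D}_{\psi_1,x}(\mathcal{D}_{\psi_2,\psi_1(x)}(g))$.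 Thus $\mathcal{D}_{f,x}(g)=g\otimes A_L\otimes\sigma'(y_{L-1})\otimes\cdots\otimes\sigma'(y_1)\otimes A_1$, evaluated left to right, where $y_l=\rho_l\circ\sigma\circ\cdots\circ\sigma\circ\rho_1(x)$ and $\sigma'(y)$ is the diagonal matrix. For scalar-output $f$ and $g\in\mathbb{F}$, $\mathcal{D}_{f,x}(g)\in\overline{\mathbb{F}}^{1\times d_0}$. Activations. $\mathrm{ReLU}(x)=\max(0,x)$; $\mathrm{ELU}(x)=x$ for $x\ge0$, $e^x-1$ for $x<0$; $\mathrm{GELU}(x)=\frac{x}{2}(1+\mathrm{erf}(x/\sqrt2))$; $\mathrm{Swish}(x)=x/(1+e^{-x})$; $\mathrm{Sigmoid}(x)=1/(1+e^{-x})$; $\tanh$. For $\sigma=\mathrm{round}(\hat\sigma)\in\Sigma$, the derivative used by automatic differentiation is $\sigma'=\mathrm{round}(\hat\sigma')$ (with some fixed conventional value of $\mathrm{ReLU}'(0)$). Constants: $M_\sigma=2^{\mathfrak{e}_{\max}-2}$ and $H_\sigma=\Omega$ for $\sigma$ the rounded ReLU, ELU, GELU, Swish; $M_\sigma=2^{\mathfrak{e}_{\max}-1}$ for rounded Sigmoid and $\tanh$, with $H_\sigma=2^{p-1}$ for Sigmoid and $H_\sigma=2^{p-2}$ for $\tanh$. *)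

theory Defs
  imports "HOL-Analysis.Analysis"
begin

section \<open>Floating-point format with parameters p (mantissa bits) and q (exponent bits)\<close>

definition emin :: "nat \<Rightarrow> int" where
  "emin q = - (2 ^ (q - 1)) + 2"

definition emax :: "nat \<Rightarrow> int" where
  "emax q = 2 ^ (q - 1) - 1"

definition normal_repr :: "nat \<Rightarrow> nat \<Rightarrow> real \<Rightarrow> nat \<Rightarrow> int \<Rightarrow> real" where
  "normal_repr p q s i e = s * (1 + real i / 2 ^ p) * (2::real) powi e"

definition sub_repr :: "nat \<Rightarrow> nat \<Rightarrow> real \<Rightarrow> nat \<Rightarrow> real" where
  "sub_repr p q s i = s * (real i / 2 ^ p) * (2::real) powi (emin q)"

definition Fl :: "nat \<Rightarrow> nat \<Rightarrow> real set" where
  "Fl p q =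
     {normal_repr p q s i e | s i e. s \<in> {-1, 1} \<and> i < 2 ^ p \<and> emin q \<le> e \<and> e \<le> emax q}
   \<union> {sub_repr p q s i | s i. s \<in> {-1, 1} \<and> i < 2 ^ p}"

text \<open>A float is even if the integer i in (some, for nonzero floats the unique) representation is even.\<close>
definition even_fl :: "nat \<Rightarrow> nat \<Rightarrow> real \<Rightarrow> bool" where
  "even_fl p q y \<longleftrightarrow>
     (\<exists>s i e. s \<in> {-1, 1} \<and> i < 2 ^ p \<and> emin q \<le> e \<and> e \<le> emax q \<and> even i
              \<and> y = normal_repr p q s i e)
   \<or> (\<exists>s i. s \<in> {-1, 1} \<and> i < 2 ^ p \<and> even i \<and> y = sub_repr p q s i)"

definition Omega :: "nat \<Rightarrow> nat \<Rightarrow> real" where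
  "Omega p q = (2 - 2 powi (- int p)) * (2::real) powi (emax q)"

text \<open>Extended floats: finite values (always elements of Fl in use), +inf, -inf, NaN.\<close>
datatype ext = Fin real | PInf | NInf | NaN

definition nearest_fl :: "nat \<Rightarrow> nat \<Rightarrow> real \<Rightarrow> real \<Rightarrow> bool" where
  "nearest_fl p q x y \<longleftrightarrow> y \<in> Fl p q \<and> (\<forall>z\<in>Fl p q. \<bar>x - y\<bar> \<le> \<bar>x - z\<bar>)"

definition rnd :: "nat \<Rightarrow> nat \<Rightarrow> real \<Rightarrow> ext" where
  "rnd p q x =
     (if \<bar>x\<bar> < Omega p q + (2::real) powi (emax q - int p - 1)
      then Fin (THE y. nearest_fl p q x y \<and> (\<forall>z. nearest_fl p q x z \<and> z \<noteq> y \<longrightarrow> even_fl p q y))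
      else if x > 0 then PInf else NInf)"

fun fadd :: "nat \<Rightarrow> nat \<Rightarrow> ext \<Rightarrow> ext \<Rightarrow> ext" where
  "fadd p q NaN _ = NaN"
| "fadd p q _ NaN = NaN"
| "fadd p q (Fin a) (Fin b) = rnd p q (a + b)"
| "fadd p q PInf NInf = NaN"
| "fadd p q NInf PInf = NaN"
| "fadd p q PInf _ = PInf"
| "fadd p q NInf _ = NInf"
| "fadd p q _ PInf = PInf"
| "fadd p q _ NInf = NInf"

fun ext_sign :: "ext \<Rightarrow> real" where
  "ext_sign (Fin a) = sgn a"
| "ext_sign PInf = 1"
| "ext_sign NInf = -1"
| "ext_sign NaN = 0"

fun fmul :: "nat \<Rightarrow> nat \<Rightarrow> ext \<Rightarrow> ext \<Rightarrow> ext" where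
  "fmul p q NaN _ = NaN"
| "fmul p q _ NaN = NaN"
| "fmul p q (Fin a) (Fin b) = rnd p q (a * b)"
| "fmul p q x y =
     (if x = Fin 0 \<or> y = Fin 0 then NaN
      else if ext_sign x * ext_sign y > 0 then PInf else NInf)"

definition fsum :: "nat \<Rightarrow> nat \<Rightarrow> ext list \<Rightarrow> ext" where
  "fsum p q xs = foldl (fadd p q) (Fin 0) xs"

datatype act = ReLU | ELU | GELU | Swish | Sigmoid | Tanh

definition erf :: "real \<Rightarrow> real" where
  "erf x = 2 / sqrt pi *
     (if 0 \<le> x then integral {0..x} (\<lambda>t. exp (- (t^2))) else - integral {x..0} (\<lambda>t. exp (- (t^2))))"

fun hat_sigma :: "act \<Rightarrow> real \<Rightarrow> real" where
  "hat_sigma ReLU x = max 0 x"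
| "hat_sigma ELU x = (if x \<ge> 0 then x else exp x - 1)"
| "hat_sigma GELU x = x / 2 * (1 + erf (x / sqrt 2))"
| "hat_sigma Swish x = x / (1 + exp (- x))"
| "hat_sigma Sigmoid x = 1 / (1 + exp (- x))"
| "hat_sigma Tanh x = tanh x"

fun hat_sigma' :: "real \<Rightarrow> act \<Rightarrow> real \<Rightarrow> real" where
  "hat_sigma' c ReLU x = (if x > 0 then 1 else if x < 0 then 0 else c)"
| "hat_sigma' c a x = deriv (hat_sigma a) x"

text \<open>Rounded activation on extended floats; non-finite inputs: limit values, NaN propagates.\<close>
fun sigma :: "nat \<Rightarrow> nat \<Rightarrow> act \<Rightarrow> ext \<Rightarrow> ext" where
  "sigma p q a (Fin x) = rnd p q (hat_sigma a x)"
| "sigma p q a NaN = NaN"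
| "sigma p q a PInf = (if a \<in> {Sigmoid, Tanh} then Fin 1 else PInf)"
| "sigma p q a NInf = (if a = ELU \<or> a = Tanh then Fin (-1) else Fin 0)"

fun sigma' :: "nat \<Rightarrow> nat \<Rightarrow> real \<Rightarrow> act \<Rightarrow> ext \<Rightarrow> ext" where
  "sigma' p q c a (Fin x) = rnd p q (hat_sigma' c a x)"
| "sigma' p q c a NaN = NaN"
| "sigma' p q c a PInf = (if a \<in> {Sigmoid, Tanh} then Fin 0 else Fin 1)"
| "sigma' p q c a NInf = Fin 0"

definition M_sigma :: "nat \<Rightarrow> act \<Rightarrow> real" where
  "M_sigma q a = (if a \<in> {Sigmoid, Tanh} then (2::real) powi (emax q - 1) else (2::real) powi (emax q - 2))"

definition H_sigma :: "nat \<Rightarrow> nat \<Rightarrow> act \<Rightarrow> real" where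
  "H_sigma p q a = (if a = Sigmoid then 2 ^ (p - 1) else if a = Tanh then 2 ^ (p - 2) else Omega p q)"

text \<open>A layer is (A, b): A a list of rows (n rows of length m), b of length n.\<close>
type_synonym layer = "real list list \<times> real list"

definition affine :: "nat \<Rightarrow> nat \<Rightarrow> layer \<Rightarrow> ext list \<Rightarrow> ext list" where
  "affine p q l x =
     map2 (\<lambda>row bi. fadd p q (fsum p q (map2 (fmul p q) (map Fin row) x)) (Fin bi)) (fst l) (snd l)"

definition layer_ok :: "nat \<Rightarrow> nat \<Rightarrow> nat \<Rightarrow> nat \<Rightarrow> layer \<Rightarrow> bool" where
  "layer_ok p q m n l \<longleftrightarrow> length (fst l) = n \<and> length (snd l) = n
     \<and> (\<forall>row \<in> set (fst l). length row = m \<and> set row \<subseteq> Fl p q) \<and> set (snd l) \<subseteq> Fl p q"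

definition is_network :: "nat \<Rightarrow> nat \<Rightarrow> nat \<Rightarrow> nat \<Rightarrow> layer list \<Rightarrow> bool" where
  "is_network p q d L ls \<longleftrightarrow> length ls = L \<and> 1 \<le> L \<and>
     (\<exists>dims :: nat list. length dims = L + 1 \<and> dims ! 0 = d \<and> dims ! L = 1 \<and>
        (\<forall>l < L. layer_ok p q (dims ! l) (dims ! Suc l) (ls ! l)))"

fun net_eval :: "nat \<Rightarrow> nat \<Rightarrow> act \<Rightarrow> layer list \<Rightarrow> ext list \<Rightarrow> ext list" where
  "net_eval p q a [] x = x"
| "net_eval p q a [l] x = affine p q l x"
| "net_eval p q a (l # ls) x = net_eval p q a ls (map (sigma p q a) (affine p q l x))"

definition row_mat :: "nat \<Rightarrow> nat \<Rightarrow> ext list \<Rightarrow> ext list list \<Rightarrow> ext list" where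
  "row_mat p q g A =
     map (\<lambda>j. fsum p q (map (\<lambda>i. fmul p q (g ! i) (A ! i ! j)) [0..<length g]))
         [0..<(if A = [] then 0 else length (hd A))]"

definition diag :: "ext list \<Rightarrow> ext list list" where
  "diag s = map (\<lambda>i. map (\<lambda>j. if i = j then s ! i else Fin 0) [0..<length s]) [0..<length s]"

text \<open>Automatic differentiation: D_{psi2 o psi1, x}(g) = D_{psi1,x}(D_{psi2,psi1 x}(g)),
  D_{rho,x}(g) = g (x) A, D_{sigma,x}(g) = g (x) diag(sigma'(x)).\<close>
fun autodiff :: "nat \<Rightarrow> nat \<Rightarrow> real \<Rightarrow> act \<Rightarrow> layer list \<Rightarrow> ext list \<Rightarrow> ext list \<Rightarrow> ext list" where
  "autodiff p q c a [] x g = g"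
| "autodiff p q c a [l] x g = row_mat p q g (map (map Fin) (fst l))"
| "autodiff p q c a (l # ls) x g =
     (let y = affine p q l x;
          g1 = autodiff p q c a ls (map (sigma p q a) y) g;
          g2 = row_mat p q g1 (diag (map (sigma' p q c a) y))
      in row_mat p q g2 (map (map Fin) (fst l)))"

end

theory Submission
  imports Defs "HOL-Probability.Distributions"
begin

text \<open>The domain is a finite grid, so the network can store the values and gradients one grid point at
  a time. A threshold test on one coordinate is computed exactly by a small subnetwork whose output is
  zero when the test fails and large when it succeeds; subtracting the tests x_j > z_j and x_j < z_j
  from a bias yields a gate that is open at a single grid point z only. At all other points the gate is
  saturated, its derivative is an exact zero, and nothing flows back through it. A gate feeding a
  suitable output weight contributes to the value and not to the gradient. To contribute to one
  coordinate of the gradient, the gate also receives two copies, with opposite weights, of a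
  subnetwork whose forward output is constant and absorbed by rounding, while the product
  of its weights rescales h*(z) to an arbitrary magnitude.

  Only the order of magnitude of such a contribution can be controlled. This is enough: a float is
  reached from 0 by successive floating-point additions, one for each gap between consecutive floats,
  and an increment between one half and the whole of a gap already moves the rounded sum to the next
  float.\<close>

section \<open>Floating-point numbers and rounding\<close>

text \<open>Depth 9 is what the longest branches need. For values a detector takes 6 layers, the
  gate 1, a correcting neuron 1 and the output 1; for gradients the subnetwork feeding the gate
  takes 7, the gate 1 and the output 1. Those 7 are two layers at the input, four that shift the
  binary exponent across the whole range of the format, and one that brings the gradient seed close
  to a power of two.

  The obstacle is that at no grid point may a feature or a gradient become infinite or NaN, while
  rounding makes sums depend on their order. Hence a subnetwork is specified by its finite features
  together with the ordered list of terms it adds to the gradient, an inactive one adding the empty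
  list. The gradient parts must also leave the value alone: a gate carrying a gradient is paired
  with a second gate of equal value and opposite output weight that has no path to the input.

  The activations enter only through the locale \<open>cells\<close>: ReLU, ELU, GELU and Swish
  because they are close to the identity far to the right, Sigmoid and tanh because they saturate on
  both sides.\<close>

abbreviation pw :: "int \<Rightarrow> real" where "pw k \<equiv> 2 powi k"

lemma pw_add: "pw (a + b) = pw a * pw b"
  by (simp add: power_int_add)

lemma pw_diff: "pw (a - b) = pw a / pw b"
  by (simp add: power_int_diff)

lemma pw_neg: "pw (- a) = 1 / pw a"
  by (simp add: power_int_minus_divide)

lemma pw_pos [simp]: "0 < pw k"
  by simp

lemma pw_le_iff: "pw a \<le> pw b \<longleftrightarrow> a \<le> b"
  by (metis le_cases linorder_not_le one_less_numeral_iff order_antisym_conv pw_pos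
      power_int_increasing power_int_strict_increasing semiring_norm(76) one_le_numeral)

lemma pw_less_iff: "pw a < pw b \<longleftrightarrow> a < b"
  using pw_le_iff by (meson linorder_not_le)

lemma pw_nat: "pw (int n) = 2 ^ n"
  by simp

lemma pw_Suc: "pw (k + 1) = 2 * pw k"
  by (simp add: pw_add)

text \<open>The k-th nonnegative float is mag p k times the smallest positive float, and it is even iff k is.\<close>

definition mag :: "nat \<Rightarrow> nat \<Rightarrow> nat" where
  "mag p k = (if k < 2 ^ p then k else (2 ^ p + k mod 2 ^ p) * 2 ^ (k div 2 ^ p - 1))"

lemma divmod_block:
  fixes n i p :: nat
  assumes "i < 2 ^ p"
  shows "(2 ^ p * n + i) div 2 ^ p = n" "(2 ^ p * n + i) mod 2 ^ p = i"
  using assms by (simp_all add: div_mult_self4)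

text \<open>Truncated subtraction gives exponent 0 for \<open>k div 2 ^ p\<close> equal to 0 as well
  as 1: the subnormal numbers and the lowest binade share one spacing.\<close>

lemma mag_Suc: "mag p (Suc k) = mag p k + 2 ^ (k div 2 ^ p - 1)"
proof (cases "k < 2 ^ p")
  case True
  show ?thesis
  proof (cases "Suc k < 2 ^ p")
    case True
    then show ?thesis by (simp add: mag_def)
  next
    case False
    with True have "Suc k = 2 ^ p" by simp
    then show ?thesis using True by (simp add: mag_def)
  qed
next
  case False
  define a r where "a = k div 2 ^ p" and "r = k mod 2 ^ p"
  have k: "k = a * 2 ^ p + r" and r: "r < 2 ^ p"
    unfolding a_def r_def by (rule div_mult_mod_eq[symmetric]) simp
  have a1: "1 \<le> a"
    using False unfolding a_def by (metis One_nat_def Suc_leI div_greater_zero_iff linorder_not_le pos2 zero_less_power)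
  show ?thesis
  proof (cases "Suc r < 2 ^ p")
    case True
    have "Suc k = 2 ^ p * a + Suc r" using k by simp
    then have "Suc k div 2 ^ p = a" "Suc k mod 2 ^ p = Suc r"
      using divmod_block[OF True] by simp_all
    then show ?thesis using False
      by (simp add: mag_def a_def[symmetric] r_def[symmetric] algebra_simps)
  next
    case False
    with r have "Suc r = 2 ^ p" by simp
    then have "Suc k = (a + 1) * 2 ^ p" using k by simp
    then have "Suc k div 2 ^ p = a + 1" "Suc k mod 2 ^ p = 0" by simp_all
    moreover have "(2::nat) ^ a = 2 * 2 ^ (a - 1)"
      using a1 by (simp add: power_eq_if)
    moreover have "(2::nat) ^ p * 2 ^ (a - Suc 0) = 2 ^ (a - Suc 0) + r * 2 ^ (a - Suc 0)"
      unfolding \<open>Suc r = 2 ^ p\<close>[symmetric] by (rule mult_Suc)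
    ultimately show ?thesis using \<open>\<not> k < 2 ^ p\<close> \<open>Suc r = 2 ^ p\<close>
      by (simp add: mag_def a_def[symmetric] r_def[symmetric] algebra_simps)
  qed
qed

lemma mag_0 [simp]: "mag p 0 = 0"
  by (simp add: mag_def)

lemma mag_strict_mono: "strict_mono (mag p)"
  by (rule strict_mono_Suc_iff[THEN iffD2]) (simp add: mag_Suc)

text \<open>Measured in its own spacing, a float has at most p + 1 significant bits; with
  \<open>mag_Suc\<close> this yields the relative gap of \<open>F_ratio\<close>.\<close>

lemma mag_gap_bound: "mag p k \<le> (2 ^ (p + 1) - 1) * 2 ^ (k div 2 ^ p - 1)"
proof (cases "k < 2 ^ p")
  case True
  then have "k \<le> 2 ^ (p + 1) - 1" by simp
  with True show ?thesis by (simp add: mag_def)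
next
  case False
  have "k mod 2 ^ p < 2 ^ p" by simp
  then have "2 ^ p + k mod 2 ^ p < 2 ^ (p + 1)" by simp
  then have "2 ^ p + k mod 2 ^ p \<le> 2 ^ (p + 1) - 1" by linarith
  with False show ?thesis unfolding mag_def by (simp add: mult_le_mono)
qed

text \<open>A significand shorter than p + 1 bits is lengthened by borrowing factors 2 from the
  power, until it is normal or the power is used up.\<close>

lemma mag_surj: "n < 2 ^ (p + 1) \<Longrightarrow> \<exists>k. mag p k = n * 2 ^ j"
proof (induction j arbitrary: n)
  case 0
  show ?case
  proof (cases "n < 2 ^ p")
    case True
    then show ?thesis by (intro exI[of _ n]) (simp add: mag_def)
  next
    case False
    define r where "r = n - 2 ^ p"
    have "r < 2 ^ p" "n = 2 ^ p + r" using False 0 by (auto simp: r_def)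
    then show ?thesis by (intro exI[of _ n]) (simp add: mag_def div_add_self1)
  qed
next
  case (Suc j)
  show ?case
  proof (cases "n < 2 ^ p")
    case True
    then have "2 * n < 2 ^ (p + 1)" by simp
    from Suc.IH[OF this] show ?thesis by (simp add: algebra_simps)
  next
    case False
    define r where "r = n - 2 ^ p"
    have r: "r < 2 ^ p" "n = 2 ^ p + r" using False Suc.prems by (auto simp: r_def)
    then have "(2 ^ p * (j + 2) + r) div 2 ^ p = j + 2" "(2 ^ p * (j + 2) + r) mod 2 ^ p = r"
      using divmod_block r by blast+
    moreover have "\<not> 2 ^ p * (j + 2) + r < 2 ^ p" by simp
    ultimately have "mag p (2 ^ p * (j + 2) + r) = n * 2 ^ Suc j"
      using r by (simp add: mag_def)
    then show ?thesis by blast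
  qed
qed

locale fp =
  fixes p q :: nat
  assumes p2: "2 \<le> p" and pq: "p \<le> 2 ^ (q - 2)" and q6: "6 \<le> q"
begin

abbreviation F where "F \<equiv> Fl p q"
abbreviation E where "E \<equiv> emax q"
abbreviation P where "P \<equiv> int p"

definition \<eta> :: real where "\<eta> = pw (emin q - P)"

lemma emin_eq: "emin q = 1 - E"
  by (simp add: emin_def emax_def)

text \<open>Everything follows from \<open>E = 2 * 2 ^ (q - 2) - 1\<close>, p \<le> 2^(q-2) and q +
  10 \<le> 2^(q-2). The last is an equality at q = 6 and is what the assumption q \<ge> 6
  provides.\<close>

lemma E_bounds: "int q + P + 9 \<le> E" "2 * P - 1 \<le> E" "31 \<le> E" "P + 15 \<le> E" "2 ^ (q - 2) + P \<le> E + 1"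
proof -
  have key: "int n + 10 \<le> (2::int) ^ (n - 2) \<and> 16 \<le> (2::int) ^ (n - 2)" if "6 \<le> n" for n :: nat
    using that
  proof (induction n rule: dec_induct)
    case base
    then show ?case by simp
  next
    case (step n)
    then have "Suc n - 2 = Suc (n - 2)" by simp
    then show ?case using step by simp
  qed
  have "q - 1 = Suc (q - 2)" using q6 by simp
  then have E: "E = 2 * 2 ^ (q - 2) - 1" by (simp add: emax_def)
  have P: "P \<le> 2 ^ (q - 2)" using pq by (metis of_nat_le_iff of_nat_numeral of_nat_power)
  show "2 * P - 1 \<le> E" "31 \<le> E" "P + 15 \<le> E" "2 ^ (q - 2) + P \<le> E + 1" "int q + P + 9 \<le> E"
    using key[OF q6] E P by linarith+
qed

lemma P2: "2 \<le> P" using p2 by simp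

lemma \<eta>_pos [simp]: "0 < \<eta>" by (simp add: \<eta>_def)

definition fl :: "nat \<Rightarrow> real" where "fl k = real (mag p k) * \<eta>"

text \<open>The number of nonnegative finite floats: a block of 2^p for zero and the subnormals, and
  one more block per exponent.\<close>

definition NN :: nat where "NN = 2 ^ p * nat (E - emin q + 2)"

lemma fl_strict_mono: "strict_mono fl"
  using mag_strict_mono[of p] by (auto simp: strict_mono_def fl_def)

lemma fl_0 [simp]: "fl 0 = 0" by (simp add: fl_def)

lemma fl_sub: "i < 2 ^ p \<Longrightarrow> fl i = real i / 2 ^ p * pw (emin q)"
  by (simp add: fl_def mag_def \<eta>_def pw_diff)

lemma fl_normal:
  assumes "i < 2 ^ p" "emin q \<le> e"
  shows "fl (2 ^ p * nat (e - emin q + 1) + i) = (1 + real i / 2 ^ p) * pw e"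
proof -
  define m where "m = nat (e - emin q)"
  have m: "nat (e - emin q + 1) = Suc m" "e = emin q + int m" using assms by (auto simp: m_def)
  have d: "(2 ^ p * Suc m + i) div 2 ^ p = Suc m" "(2 ^ p * Suc m + i) mod 2 ^ p = i"
    using assms(1) divmod_block by blast+
  have nl: "\<not> 2 ^ p * Suc m + i < 2 ^ p" by simp
  have "mag p (2 ^ p * Suc m + i) = (2 ^ p + i) * 2 ^ m"
    unfolding mag_def d using nl by simp
  then show ?thesis unfolding m(1) fl_def \<eta>_def
    by (simp add: m(2) pw_add pw_diff field_simps)
qed

lemma NN_split:
  assumes "k < NN" "\<not> k < 2 ^ p"
  obtains e i where "i < 2 ^ p" "emin q \<le> e" "e \<le> E" "k = 2 ^ p * nat (e - emin q + 1) + i"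
proof -
  define a where "a = k div 2 ^ p"
  have a1: "1 \<le> a"
    using assms(2) unfolding a_def by (metis One_nat_def Suc_leI div_greater_zero_iff linorder_not_le pos2 zero_less_power)
  have "a < nat (E - emin q + 2)" unfolding a_def using assms(1) unfolding NN_def
    by (simp add: less_mult_imp_div_less mult.commute)
  then have "int a < E - emin q + 2" by simp
  define e where "e = emin q + int a - 1"
  have "nat (e - emin q + 1) = a" by (simp add: e_def)
  then have "k = 2 ^ p * nat (e - emin q + 1) + k mod 2 ^ p" by (simp add: a_def)
  moreover have "emin q \<le> e" "e \<le> E" using a1 \<open>int a < _\<close> by (auto simp: e_def)
  ultimately show ?thesis using that[of "k mod 2 ^ p" e] by simp
qed

lemma NN_ge: "2 ^ p \<le> NN"
proof -
  have "1 \<le> nat (E - emin q + 2)" using E_bounds(3) by (simp add: emin_eq)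
  then show ?thesis unfolding NN_def by (metis mult_le_mono2 mult.right_neutral)
qed

lemma NN_in:
  assumes "i < 2 ^ p" "emin q \<le> e" "e \<le> E"
  shows "2 ^ p * nat (e - emin q + 1) + i < NN"
proof -
  define m where "m = nat (e - emin q + 1)"
  have "Suc m \<le> nat (E - emin q + 2)" using assms by (auto simp: m_def)
  then have "2 ^ p * Suc m \<le> NN" unfolding NN_def by (metis mult_le_mono2)
  then show ?thesis using assms(1) unfolding m_def[symmetric] by simp
qed

lemma even_normal: "even (2 ^ p * n + i) \<longleftrightarrow> even i" for n i :: nat
  using p2 by (simp add: even_add)

text \<open>Indexing the floats by a symmetric interval of integers, in increasing order, turns
  neighbouring floats into consecutive integers and the tie-breaking rule into parity.\<close>

definition flz :: "int \<Rightarrow> real" where "flz z = (if 0 \<le> z then fl (nat z) else - fl (nat (- z)))"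

lemma flz_minus: "flz (- z) = - flz z"
  by (auto simp: flz_def)

lemma fl_less_iff [simp]: "fl a < fl b \<longleftrightarrow> a < b"
  using fl_strict_mono strict_mono_less by blast

lemma fl_le_iff [simp]: "fl a \<le> fl b \<longleftrightarrow> a \<le> b"
  using fl_strict_mono strict_mono_less_eq by blast

lemma fl_nonneg [simp]: "0 \<le> fl k" by (simp add: fl_def less_imp_le)

lemma flz_strict_mono: "strict_mono flz"
proof (rule strict_monoI)
  fix x y :: int assume "x < y"
  then show "flz x < flz y"
    using fl_nonneg[of "nat y"] fl_less_iff[of 0 "nat (- x)"] unfolding flz_def fl_0
    by (smt (verit) fl_less_iff zero_less_nat_eq nat_less_eq_zless)
qed

lemma flz_less_iff [simp]: "flz a < flz b \<longleftrightarrow> a < b"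
  using flz_strict_mono strict_mono_less by blast

lemma flz_le_iff [simp]: "flz a \<le> flz b \<longleftrightarrow> a \<le> b"
  using flz_strict_mono strict_mono_less_eq by blast

lemma flz_eq_iff [simp]: "flz a = flz b \<longleftrightarrow> a = b"
  using flz_strict_mono strict_mono_eq by blast

lemma Fl_flz: "F = flz ` {z. \<bar>z\<bar> < int NN}"
proof (intro equalityI subsetI)
  fix y assume "y \<in> F"
  then consider s i e where "s \<in> {-1, 1}" "i < 2 ^ p" "emin q \<le> e" "e \<le> E" "y = normal_repr p q s i e"
    | s i where "s \<in> {-1, 1}" "i < 2 ^ p" "y = sub_repr p q s i"
    unfolding Fl_def by blast
  then obtain s k where "s \<in> {-1, 1::real}" "k < NN" "y = s * fl k"
  proof cases
    case 1
    then show ?thesis using that[of s] fl_normal NN_in unfolding normal_repr_def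
      by (metis mult.assoc)
  next
    case 2
    then show ?thesis using that[of s i] fl_sub[of i] NN_ge unfolding sub_repr_def
      by (metis mult.assoc order_less_le_trans)
  qed
  then have "y = flz (int k) \<or> y = flz (- int k)" unfolding flz_minus by (auto simp: flz_def)
  then show "y \<in> flz ` {z. \<bar>z\<bar> < int NN}" using \<open>k < NN\<close> by (metis (mono_tags, lifting) abs_minus_cancel abs_of_nat image_eqI mem_Collect_eq of_nat_less_iff)
next
  fix y assume "y \<in> flz ` {z. \<bar>z\<bar> < int NN}"
  then obtain z where z: "\<bar>z\<bar> < int NN" "y = flz z" by auto
  define s k where "s = (if 0 \<le> z then 1 else -1::real)" and "k = nat \<bar>z\<bar>"
  have y: "y = s * fl k" "s \<in> {-1, 1}" "k < NN" using z by (auto simp: s_def k_def flz_def)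
  show "y \<in> F"
  proof (cases "k < 2 ^ p")
    case True
    have "y = sub_repr p q s k" unfolding y sub_repr_def fl_sub[OF True] by simp
    then show ?thesis unfolding Fl_def using True y(2) by blast
  next
    case False
    obtain e i where k: "i < 2 ^ p" "emin q \<le> e" "e \<le> E" "k = 2 ^ p * nat (e - emin q + 1) + i"
      using NN_split[OF y(3) False] by blast
    have "y = normal_repr p q s i e" unfolding y normal_repr_def k fl_normal[OF k(1,2)] by simp
    then show ?thesis unfolding Fl_def using k y(2) by blast
  qed
qed

lemma even_fl_flz:
  assumes "\<bar>z\<bar> < int NN"
  shows "even_fl p q (flz z) \<longleftrightarrow> even z"
proof
  assume "even_fl p q (flz z)"
  then consider s i e where "s \<in> {-1, 1}" "i < 2 ^ p" "emin q \<le> e" "e \<le> E" "even i" "flz z = normal_repr p q s i e"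
    | s i where "s \<in> {-1, 1}" "i < 2 ^ p" "even i" "flz z = sub_repr p q s i"
    unfolding even_fl_def by blast
  then obtain s k where "s \<in> {-1, 1::real}" "even k" "flz z = s * fl k"
  proof cases
    case 1
    then show ?thesis using that[of s] fl_normal even_normal unfolding normal_repr_def
      by (metis mult.assoc)
  next
    case 2
    then show ?thesis using that[of s i] fl_sub[of i] unfolding sub_repr_def
      by (metis mult.assoc)
  qed
  then have "flz z = flz (int k) \<or> flz z = flz (- int k)" unfolding flz_minus by (auto simp: flz_def)
  then show "even z" using \<open>even k\<close> by auto
next
  assume ev: "even z"
  define s k where "s = (if 0 \<le> z then 1 else -1::real)" and "k = nat \<bar>z\<bar>"
  have y: "flz z = s * fl k" "s \<in> {-1, 1}" "k < NN" "even k"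
    using assms ev by (auto simp: s_def k_def flz_def even_nat_iff)
  show "even_fl p q (flz z)"
  proof (cases "k < 2 ^ p")
    case True
    have "flz z = sub_repr p q s k" unfolding y sub_repr_def fl_sub[OF True] by simp
    then show ?thesis unfolding even_fl_def using True y by blast
  next
    case False
    obtain e i where k: "i < 2 ^ p" "emin q \<le> e" "e \<le> E" "k = 2 ^ p * nat (e - emin q + 1) + i"
      using NN_split[OF y(3) False] by blast
    have "flz z = normal_repr p q s i e" unfolding y normal_repr_def k fl_normal[OF k(1,2)] by simp
    moreover have "even i" using k(4) y(4) even_normal by simp
    ultimately show ?thesis unfolding even_fl_def using k y(2) by blast
  qed
qed

lemma finite_F [simp]: "finite F"
proof -
  have "{z. \<bar>z\<bar> < int NN} = {- int NN<..<int NN}" by auto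
  then show ?thesis by (simp add: Fl_flz)
qed

lemma NN_pos: "0 < NN" using NN_ge by (metis gr0I le_zero_eq power_not_zero zero_neq_numeral)

lemma zero_F [simp]: "0 \<in> F"
proof -
  have "flz 0 = 0" by (simp add: flz_def)
  then show ?thesis unfolding Fl_flz using NN_pos by (metis (mono_tags, lifting) abs_zero image_eqI mem_Collect_eq of_nat_0_less_iff)
qed

lemma minus_F [simp]: "- y \<in> F \<longleftrightarrow> y \<in> F"
proof -
  have "- y \<in> F" if "y \<in> F" for y
    using that unfolding Fl_flz by (auto simp: flz_minus[symmetric])
  from this[of y] this[of "- y"] show ?thesis by auto
qed

lemma fl_gap: "fl (Suc k) - fl k = \<eta> * 2 ^ (k div 2 ^ p - 1)"
  by (simp add: fl_def mag_Suc algebra_simps)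

lemma Omega_fl: "Omega p q = fl (NN - 1)"
proof -
  have "nat (E - emin q + 2) = Suc (nat (E - emin q + 1))" using E_bounds(3) by (simp add: emin_eq)
  then have "NN - 1 = 2 ^ p * nat (E - emin q + 1) + (2 ^ p - 1)"
    unfolding NN_def by (simp add: algebra_simps)
  moreover have "fl (2 ^ p * nat (E - emin q + 1) + (2 ^ p - 1)) = (1 + real (2 ^ p - 1) / 2 ^ p) * pw E"
    using E_bounds(3) by (intro fl_normal) (auto simp: emin_eq)
  ultimately show ?thesis unfolding Omega_def
    by (simp add: of_nat_diff field_simps pw_neg pw_diff)
qed

lemma Omega_bounds: "7 / 4 * pw E \<le> Omega p q" "Omega p q < 2 * pw E" "0 < Omega p q"
proof -
  have "pw (- P) \<le> pw (- 2)" by (subst pw_le_iff) (use P2 in simp)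
  moreover have "pw (- 2) = 1 / 4" by (simp add: power_int_minus)
  ultimately have 1: "pw (- P) \<le> 1 / 4" by linarith
  have 2: "0 < pw (- P)" by (rule pw_pos)
  show "7 / 4 * pw E \<le> Omega p q" unfolding Omega_def
    by (intro mult_right_mono) (use 1 in \<open>auto simp: less_imp_le\<close>)
  show "Omega p q < 2 * pw E" unfolding Omega_def
    by (intro mult_strict_right_mono) (use 2 in \<open>auto simp: less_imp_le\<close>)
  show "0 < Omega p q" using \<open>7 / 4 * pw E \<le> Omega p q\<close> pw_pos[of E] by (smt (verit) zero_less_divide_iff mult_pos_pos)
qed

lemma F_abs_le: "y \<in> F \<Longrightarrow> \<bar>y\<bar> \<le> Omega p q"
  unfolding Omega_fl Fl_flz by (auto simp: flz_def)

lemma F_fl_intro: "fl k \<le> Omega p q \<Longrightarrow> fl k \<in> F"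
proof -
  assume "fl k \<le> Omega p q"
  then have "k < NN" using NN_pos by (auto simp: Omega_fl)
  moreover have "fl k = flz (int k)" by (simp add: flz_def)
  ultimately show ?thesis unfolding Fl_flz by (auto intro!: imageI)
qed

text \<open>The significand n need not be normalised, so exactness of a product with a power of two
  becomes a question about exponents alone.\<close>

lemma F_intro:
  assumes "\<bar>n\<bar> < 2 ^ (p + 1)" "emin q - P \<le> e" "\<bar>of_int n * pw e\<bar> \<le> Omega p q"
  shows "of_int n * pw e \<in> F"
proof -
  define j where "j = nat (e - (emin q - P))"
  have e: "e = (emin q - P) + int j" using assms(2) by (simp add: j_def)
  have "nat \<bar>n\<bar> < 2 ^ (p + 1)" using assms(1) by (simp add: nat_less_iff)
  then obtain k where k: "mag p k = nat \<bar>n\<bar> * 2 ^ j" using mag_surj by blast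
  have "\<bar>of_int n * pw e\<bar> = fl k"
    unfolding fl_def k \<eta>_def e by (simp add: pw_add abs_mult)
  then have "\<bar>of_int n * pw e\<bar> \<in> F" using F_fl_intro assms(3) by simp
  then show ?thesis by (metis abs_if minus_F minus_minus)
qed

lemma F_elim:
  assumes "y \<in> F"
  obtains n e where "\<bar>n\<bar> < 2 ^ (p + 1)" "emin q - P \<le> e" "y = of_int n * pw e"
proof -
  obtain z where z: "y = flz z" using assms unfolding Fl_flz by auto
  have "\<exists>n e. \<bar>n\<bar> < (2::int) ^ (p + 1) \<and> emin q - P \<le> e \<and> fl k = of_int n * pw e" for k
  proof (cases "k < 2 ^ p")
    case True
    then have "k < 2 ^ (p + 1)" by simp
    then have "\<bar>int k\<bar> < (2::int) ^ (p + 1)" by (metis abs_of_nat of_nat_less_iff of_nat_numeral of_nat_power)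
    then show ?thesis using True
      by (intro exI[of _ "int k"] exI[of _ "emin q - P"]) (simp add: fl_def mag_def \<eta>_def)
  next
    case False
    have "2 ^ p + k mod 2 ^ p < (2::nat) ^ (p + 1)" by simp
    then have "\<bar>int (2 ^ p + k mod 2 ^ p)\<bar> < (2::int) ^ (p + 1)" by (metis abs_of_nat of_nat_less_iff of_nat_numeral of_nat_power)
    then show ?thesis using False
      by (intro exI[of _ "int (2 ^ p + k mod 2 ^ p)"] exI[of _ "emin q - P + int (k div 2 ^ p - 1)"])
        (simp add: fl_def mag_def \<eta>_def pw_add del: of_nat_diff)
  qed
  then obtain n e where ne: "\<bar>n\<bar> < (2::int) ^ (p + 1)" "emin q - P \<le> e" "fl (nat \<bar>z\<bar>) = of_int n * pw e"
    by blast
  show ?thesis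
  proof (cases "0 \<le> z")
    case True
    then show ?thesis using ne that[of n e] z by (simp add: flz_def)
  next
    case False
    then show ?thesis using ne that[of "- n" e] z by (simp add: flz_def)
  qed
qed

lemma F_multiple:
  assumes "y \<in> F" obtains n :: int where "y = of_int n * \<eta>"
proof -
  obtain n e where ne: "emin q - P \<le> e" "y = of_int n * pw e" using F_elim[OF assms] by metis
  have "e = int (nat (e - (emin q - P))) + (emin q - P)" using ne(1) by simp
  then have "pw e = 2 ^ nat (e - (emin q - P)) * \<eta>" unfolding \<eta>_def by (metis pw_add pw_nat)
  then show ?thesis using ne(2) that[of "n * 2 ^ nat (e - (emin q - P))"] by simp
qed

lemma F_diff_ge_\<eta>:
  assumes "x \<in> F" "y \<in> F" "x < y" shows "\<eta> \<le> y - x"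
proof -
  obtain m n :: int where mn: "x = of_int m * \<eta>" "y = of_int n * \<eta>" using F_multiple assms by metis
  then have "m < n" using assms(3) \<eta>_pos by (metis mult_less_cancel_right_pos of_int_less_iff)
  then have "1 * \<eta> \<le> of_int (n - m) * \<eta>" by (intro mult_right_mono) (auto simp: less_imp_le)
  then show ?thesis using mn by (simp add: algebra_simps)
qed

lemma F_pos_ge_\<eta>: "y \<in> F \<Longrightarrow> 0 < y \<Longrightarrow> \<eta> \<le> y"
  using F_diff_ge_\<eta>[of 0 y] by simp

lemma pw_F: "emin q - P \<le> k \<Longrightarrow> k \<le> E \<Longrightarrow> pw k \<in> F"
proof -
  assume k: "emin q - P \<le> k" "k \<le> E"
  have "pw k \<le> pw E" using k by (simp add: pw_le_iff)
  then have "pw k \<le> Omega p q" using Omega_bounds(1) pw_pos[of E] by linarith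
  moreover have "(1::int) < 2 ^ (p + 1)" by (rule one_less_power) auto
  ultimately show ?thesis using F_intro[of 1 k] k by simp
qed

lemma small_mult_F:
  assumes "\<bar>n\<bar> \<le> 7" "emin q - P \<le> k" "k + 2 \<le> E"
  shows "of_int n * pw k \<in> F"
proof (rule F_intro)
  have "(2::int) ^ 3 \<le> 2 ^ (p + 1)" using p2 by (intro power_increasing) auto
  then show "\<bar>n\<bar> < 2 ^ (p + 1)" using assms by simp
  have "\<bar>of_int n * pw k\<bar> \<le> 7 * pw k"
    using assms(1) by (simp add: abs_mult)
  also have "\<dots> = 7 / 4 * pw (k + 2)" by (simp add: pw_add)
  also have "\<dots> \<le> 7 / 4 * pw E" using assms by (simp add: pw_le_iff)
  finally show "\<bar>of_int n * pw k\<bar> \<le> Omega p q" using Omega_bounds by simp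
qed (use assms in auto)

lemma F_scale_up:
  assumes "y \<in> F" "0 \<le> j" "\<bar>y * pw j\<bar> \<le> Omega p q"
  shows "y * pw j \<in> F"
proof -
  obtain n e where ne: "\<bar>n\<bar> < 2 ^ (p + 1)" "emin q - P \<le> e" "y = of_int n * pw e" using F_elim[OF assms(1)] by metis
  have y: "y * pw j = of_int n * pw (e + j)" by (simp add: ne pw_add)
  show ?thesis using F_intro[of n "e + j"] ne(1,2) assms(2,3) unfolding y by simp
qed

text \<open>Scaling up never loses bits (\<open>F_scale_up\<close>). Scaling down does so only below
  2^emin, because any larger result with p + 1 bits has its last bit at 2^(emin - p) or
  higher.\<close>

lemma F_scale:
  assumes "y \<in> F" "pw (emin q) \<le> \<bar>y * pw j\<bar>" "\<bar>y * pw j\<bar> \<le> Omega p q"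
  shows "y * pw j \<in> F"
proof -
  obtain n e where ne: "\<bar>n\<bar> < 2 ^ (p + 1)" "emin q - P \<le> e" "y = of_int n * pw e" using F_elim[OF assms(1)] by metis
  have y: "y * pw j = of_int n * pw (e + j)" by (simp add: ne pw_add)
  have "emin q - P \<le> e + j"
  proof (rule ccontr)
    assume "\<not> ?thesis"
    then have le: "pw (e + j) \<le> pw (emin q - P - 1)" by (simp add: pw_le_iff del: power_int_add)
    have "\<bar>real_of_int n\<bar> < 2 ^ (p + 1)" using ne(1) by (metis of_int_abs of_int_less_iff of_int_numeral of_int_power)
    then have "\<bar>y * pw j\<bar> < 2 ^ (p + 1) * pw (e + j)" unfolding y abs_mult by simp
    also have "\<dots> \<le> pw (P + 1) * pw (emin q - P - 1)" using le by (simp add: pw_add)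
    also have "\<dots> = pw (emin q)" by (subst pw_add[symmetric]) simp
    finally show False using assms(2) by simp
  qed
  then show ?thesis using F_intro[of n "e + j"] ne(1) assms(3) unfolding y by simp
qed

end

section \<open>Existence, uniqueness and monotonicity of rounding; reaching a float by
  increments\<close>

context fp begin

abbreviation R :: "real \<Rightarrow> ext" where "R \<equiv> rnd p q"
abbreviation near where "near \<equiv> nearest_fl p q"

lemma near_ex: "\<exists>y. near x y"
proof -
  have "F \<noteq> {}" using zero_F by blast
  then have "Min ((\<lambda>y. \<bar>x - y\<bar>) ` F) \<in> (\<lambda>y. \<bar>x - y\<bar>) ` F" by (intro Min_in) auto
  then obtain y where y: "y \<in> F" "Min ((\<lambda>y. \<bar>x - y\<bar>) ` F) = \<bar>x - y\<bar>" by blast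
  have "\<bar>x - y\<bar> \<le> \<bar>x - z\<bar>" if "z \<in> F" for z
    unfolding y(2)[symmetric] using that by (intro Min_le) auto
  then show ?thesis using y(1) unfolding nearest_fl_def by blast
qed

lemma near_F: "near x y \<Longrightarrow> y \<in> F"
  by (simp add: nearest_fl_def)

lemma near_adjacent:
  assumes "near x (flz a)" "near x (flz b)" "\<bar>a\<bar> < int NN" "\<bar>b\<bar> < int NN" "a < b"
  shows "b = a + 1"
proof (rule ccontr)
  assume "b \<noteq> a + 1"
  then have ab: "a < a + 1" "a + 1 < b" using assms(5) by auto
  then have "\<bar>a + 1\<bar> < int NN" using assms by auto
  then have "flz (a + 1) \<in> F" unfolding Fl_flz by auto
  moreover have "flz a < flz (a + 1)" "flz (a + 1) < flz b" using ab by simp_all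
  ultimately show False using assms(1,2) unfolding nearest_fl_def
    by (smt (verit, best))
qed

definition selected :: "real \<Rightarrow> real \<Rightarrow> bool" where
  "selected x y \<longleftrightarrow> near x y \<and> (\<forall>z. near x z \<and> z \<noteq> y \<longrightarrow> even_fl p q y)"

text \<open>\<open>rnd\<close> is a definite description, so its value is accessible only through
  unique existence. Two nearest floats have no float between them, hence consecutive indices, of
  which exactly one is even.\<close>

lemma selected_ex1: "\<exists>!y. selected x y"
proof (rule ex_ex1I)
  have idx: "\<exists>a. y = flz a \<and> \<bar>a\<bar> < int NN" if "near x y" for y
    using near_F[OF that] unfolding Fl_flz by auto
  have adj: "b = a + 1 \<or> a = b + 1" if "near x (flz a)" "near x (flz b)" "\<bar>a\<bar> < int NN" "\<bar>b\<bar> < int NN" "a \<noteq> b" for a b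
    using near_adjacent that by (metis linorder_neqE)
  obtain y where y: "near x y" using near_ex by blast
  obtain a where a: "y = flz a" "\<bar>a\<bar> < int NN" using idx y by blast
  show "\<exists>y. selected x y"
  proof (cases "\<exists>z. near x z \<and> z \<noteq> y")
    case False
    then show ?thesis using y unfolding selected_def by blast
  next
    case True
    then obtain b where b: "near x (flz b)" "flz b \<noteq> y" "\<bar>b\<bar> < int NN" using idx by metis
    then have "b = a + 1 \<or> a = b + 1" using adj y a by (metis flz_eq_iff)
    then have "even a \<or> even b" by auto
    then have "even_fl p q y \<or> even_fl p q (flz b)" using even_fl_flz a b by metis
    then show ?thesis using y b unfolding selected_def by blast
  qed
  fix y y' assume Q: "selected x y" "selected x y'"
  show "y = y'"
  proof (rule ccontr)
    assume ne: "y \<noteq> y'"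
    have nn: "near x y" "near x y'" "even_fl p q y" "even_fl p q y'"
      using Q ne unfolding selected_def by metis+
    obtain a b where ab: "y = flz a" "\<bar>a\<bar> < int NN" "y' = flz b" "\<bar>b\<bar> < int NN" using idx nn by metis
    have "even a" "even b" using nn even_fl_flz ab by metis+
    moreover have "b = a + 1 \<or> a = b + 1" using adj nn ab ne by metis
    ultimately show False by auto
  qed
qed

lemma selected_minus: "selected (- x) (- y) \<longleftrightarrow> selected x y"
proof -
  have nm: "near (- x) (- z) \<longleftrightarrow> near x z" for x z
  proof -
    have "near (- x) (- z)" if "near x z" for x z
      using that unfolding nearest_fl_def by simp (smt (verit) minus_F)
    from this[of x z] this[of "- x" "- z"] show ?thesis by auto
  qed
  have ev: "even_fl p q (- z) \<longleftrightarrow> even_fl p q z" if zF: "z \<in> F" for z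
  proof -
    obtain a where "z = flz a" "\<bar>a\<bar> < int NN" using zF unfolding Fl_flz by auto
    then show ?thesis using even_fl_flz[of a] even_fl_flz[of "- a"] by (simp add: flz_minus)
  qed
  have "selected (- x) (- y)" if "selected x y" for x y
    unfolding selected_def
  proof (intro conjI allI impI)
    show "near (- x) (- y)" using that nm by (simp add: selected_def)
    fix z assume "near (- x) z \<and> z \<noteq> - y"
    then have "near x (- z)" "- z \<noteq> y" using nm[of x "- z"] by auto
    then show "even_fl p q (- y)" using that ev[of y] near_F[of x y] unfolding selected_def by blast
  qed
  from this[of x y] this[of "- x" "- y"] show ?thesis by auto
qed

lemma R_eq_selected: "R x = (if \<bar>x\<bar> < Omega p q + pw (E - P - 1) then Fin (THE y. selected x y)
    else if x > 0 then PInf else NInf)"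
  by (simp add: rnd_def selected_def)

lemma R_finite:
  assumes "\<bar>x\<bar> < Omega p q + pw (E - P - 1)"
  shows "\<exists>y. R x = Fin y \<and> near x y"
  using theI'[OF selected_ex1[of x]] assms R_eq_selected selected_def by metis

lemma R_unique:
  assumes "y \<in> F" "\<bar>x\<bar> < Omega p q + pw (E - P - 1)" "\<And>z. z \<in> F \<Longrightarrow> z \<noteq> y \<Longrightarrow> \<bar>x - y\<bar> < \<bar>x - z\<bar>"
  shows "R x = Fin y"
  using R_finite[OF assms(2)] assms(1,3) unfolding nearest_fl_def by (metis linorder_not_le)

lemma R_in_range: "\<bar>x\<bar> \<le> Omega p q \<Longrightarrow> \<exists>y. R x = Fin y \<and> near x y"
  by (rule R_finite) (use pw_pos[of "E - P - 1"] in linarith)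

lemma R_F: "x \<in> F \<Longrightarrow> R x = Fin x"
  using R_in_range[OF F_abs_le, of x] unfolding nearest_fl_def by fastforce

lemma near_mono: "near x a \<Longrightarrow> near y b \<Longrightarrow> x < y \<Longrightarrow> a \<le> b"
  unfolding nearest_fl_def by (smt (verit, best))

lemma R_not_NaN: "R x \<noteq> NaN"
  by (simp add: rnd_def)

lemma R_Fin_near: "R x = Fin y \<Longrightarrow> near x y"
  using R_finite[of x] unfolding rnd_def by (auto split: if_splits)

lemma R_Fin_F: "R x = Fin y \<Longrightarrow> y \<in> F"
  using R_Fin_near near_F by blast

lemma R_mono: "R x = Fin a \<Longrightarrow> R y = Fin b \<Longrightarrow> x \<le> y \<Longrightarrow> a \<le> b"
  using near_mono R_Fin_near by (metis ext.inject(1) order_le_imp_less_or_eq order_refl)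

lemma R_le: "R x = Fin a \<Longrightarrow> x \<le> b \<Longrightarrow> b \<in> F \<Longrightarrow> a \<le> b"
  using R_mono R_F by blast

lemma R_ge: "R x = Fin a \<Longrightarrow> b \<le> x \<Longrightarrow> b \<in> F \<Longrightarrow> b \<le> a"
  using R_mono R_F by blast

lemma R_between:
  assumes "a \<le> x" "x \<le> b" "a \<in> F" "b \<in> F"
  obtains y where "R x = Fin y" "y \<in> F" "a \<le> y" "y \<le> b"
proof -
  have "\<bar>x\<bar> \<le> Omega p q" using assms F_abs_le[of a] F_abs_le[of b] by auto
  then obtain y where "R x = Fin y" using R_in_range by blast
  then show ?thesis using that[of y] R_le R_ge R_Fin_F assms by metis
qed

text \<open>No lower bound on x is asked for: a sum meant to close a gate may overflow
  downwards.\<close>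

lemma R_upper:
  assumes "x \<le> b" "b \<in> F"
  obtains y where "R x = Fin y" "y \<in> F" "y \<le> b" | "R x = NInf"
proof (cases "\<bar>x\<bar> < Omega p q + pw (E - P - 1)")
  case True
  then show ?thesis using that(1) R_finite R_le R_Fin_F assms by metis
next
  case False
  have "x < Omega p q + pw (E - P - 1)" using F_abs_le[OF assms(2)] assms(1) pw_pos[of "E - P - 1"] by linarith
  then have "R x = NInf" using False Omega_bounds(3) pw_pos[of "E - P - 1"] unfolding rnd_def by auto
  then show ?thesis using that by blast
qed

lemma R_minus_Fin: 
  assumes "R x = Fin y" shows "R (- x) = Fin (- y)"
proof -
  have lt: "\<bar>x\<bar> < Omega p q + pw (E - P - 1)" and y: "y = (THE y. selected x y)"
    using assms by (auto simp: R_eq_selected split: if_splits)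
  have "selected x y" unfolding y by (rule theI'[OF selected_ex1])
  then have "selected (- x) (- y)" by (simp only: selected_minus)
  then have "(THE z. selected (- x) z) = - y" by (rule the1_equality[OF selected_ex1])
  then show ?thesis using lt by (simp add: R_eq_selected)
qed

text \<open>The extreme case is a power of two t and the float just below it, where the spacing has
  already halved. The proof therefore compares t with its lower gap.\<close>

lemma F_ratio:
  assumes "t \<in> F" "z \<in> F" "z \<noteq> t"
  shows "\<bar>t\<bar> * pw (- P - 1) \<le> \<bar>z - t\<bar>"
proof -
  have pos: "t * pw (- P - 1) \<le> \<bar>z - t\<bar>" if tz: "t \<in> F" "z \<in> F" "z \<noteq> t" "0 < t" for t z
  proof -
    obtain a b where ab: "t = flz a" "z = flz b" using tz(1,2) unfolding Fl_flz by auto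
    have "flz 0 < flz a" using tz(4) ab by (simp add: flz_def)
    then have a0: "0 < a" by simp
    define k where "k = nat (a - 1)"
    have sk: "nat a = Suc k" "nat (a + 1) = Suc (Suc k)" using a0 unfolding k_def by arith+
    then have tk: "t = fl (Suc k)" using a0 ab(1) by (simp add: flz_def)
    define s where "s = (2::nat) ^ (k div 2 ^ p - 1)"
    have s1: "1 \<le> s" by (simp add: s_def)
    have "mag p (Suc k) \<le> (2 ^ (p + 1) - 1) * s + s" using mag_gap_bound[of p k] by (simp add: mag_Suc s_def)
    also have "\<dots> = 2 ^ (p + 1) * s" by (simp add: algebra_simps)
    finally have "real (mag p (Suc k)) \<le> 2 ^ (p + 1) * real s" by (metis of_nat_le_iff of_nat_mult of_nat_numeral of_nat_power)
    then have "t \<le> 2 ^ (p + 1) * (real s * \<eta>)" unfolding tk fl_def by (simp add: mult.assoc[symmetric])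
    then have tle0: "t / 2 ^ (p + 1) \<le> real s * \<eta>" by (simp add: divide_le_eq mult.commute)
    have pwe: "pw (- P - 1) = 1 / 2 ^ (p + 1)"
    proof -
      have "- P - 1 = - int (p + 1)" by simp
      then show ?thesis by (simp only: pw_neg pw_nat)
    qed
    have tle: "t * pw (- P - 1) \<le> real s * \<eta>" using tle0 unfolding pwe by simp
    have g1: "fl (Suc k) - fl k = real s * \<eta>" by (simp add: fl_gap s_def mult.commute)
    have "s \<le> 2 ^ (Suc k div 2 ^ p - 1)" unfolding s_def
      by (intro power_increasing diff_le_mono div_le_mono) auto
    then have g2: "real s * \<eta> \<le> fl (Suc (Suc k)) - fl (Suc k)"
      unfolding fl_gap by (simp add: mult.commute)
    have "b \<le> a - 1 \<or> a + 1 \<le> b" using tz(3) ab by auto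
    then have "flz b \<le> flz (a - 1) \<or> flz (a + 1) \<le> flz b" by simp
    moreover have "flz (a - 1) = fl k" "flz (a + 1) = fl (Suc (Suc k))"
      using a0 sk by (simp_all add: flz_def k_def)
    ultimately show ?thesis using g1 g2 tle tk ab(2) by auto
  qed
  consider "0 < t" | "t = 0" | "0 < - t" by linarith
  then show ?thesis
  proof cases
    case 3
    then show ?thesis using pos[of "- t" "- z"] assms by simp
  qed (use pos assms in auto)
qed

text \<open>The tolerance is a quarter of the distance guaranteed by \<open>F_ratio\<close>, so t
  stays strictly nearest; the slack also keeps y below the overflow threshold when |t| is
  Omega.\<close>

lemma R_absorb:
  assumes "t \<in> F" "\<bar>y - t\<bar> \<le> \<bar>t\<bar> * pw (- P - 3)"
  shows "R y = Fin t"
proof (cases "t = 0")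
  case True
  then show ?thesis using assms R_F by simp
next
  case False
  have e: "pw (- P - 1) = 4 * pw (- P - 3)" by (simp add: pw_diff)
  show ?thesis
  proof (rule R_unique[OF assms(1)])
    have "\<bar>t\<bar> * pw (- P - 3) \<le> 2 * pw E * pw (- P - 3)"
      using F_abs_le[OF assms(1)] Omega_bounds(2) by (intro mult_right_mono) auto
    also have "\<dots> = pw (E - P - 2)" by (simp add: pw_diff pw_neg)
    also have "\<dots> < pw (E - P - 1)" by (simp add: pw_less_iff)
    finally show "\<bar>y\<bar> < Omega p q + pw (E - P - 1)"
      using assms(2) F_abs_le[OF assms(1)] by linarith
    fix z assume z: "z \<in> F" "z \<noteq> t"
    have "\<bar>t\<bar> * (4 * pw (- P - 3)) \<le> \<bar>z - t\<bar>" using F_ratio[OF assms(1) z] e by simp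
    moreover have "0 < \<bar>t\<bar> * pw (- P - 3)" using False by simp
    ultimately show "\<bar>y - t\<bar> < \<bar>y - z\<bar>" using assms(2) by linarith
  qed
qed

lemma R_round_\<eta>: "\<eta> / 2 < y \<Longrightarrow> R y = Fin v \<Longrightarrow> \<eta> \<le> v"
proof -
  assume y: "\<eta> / 2 < y" and v: "R y = Fin v"
  have vF: "v \<in> F" "0 \<le> v" using R_Fin_F[OF v] R_ge[OF v, of 0] y \<eta>_pos by auto
  have "\<eta> \<in> F" unfolding \<eta>_def using E_bounds P2 by (intro pw_F) (auto simp: emin_eq)
  then have "\<bar>y - v\<bar> \<le> \<bar>y - \<eta>\<bar>" using R_Fin_near[OF v] unfolding nearest_fl_def by blast
  moreover have "0 < \<eta>" by simp
  ultimately have "v \<noteq> 0" using y by (smt (verit) field_sum_of_halves)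
  then show ?thesis using F_pos_ge_\<eta> vF by simp
qed

lemma R_near: "R y = Fin v \<Longrightarrow> z \<in> F \<Longrightarrow> \<bar>v - y\<bar> \<le> \<bar>z - y\<bar>"
  using R_Fin_near unfolding nearest_fl_def by (metis abs_minus_commute)

text \<open>The strict bound \<open>g / 2 < c\<close> excludes ties: the sum is nearer to
  \<open>fl (Suc k)\<close> than to \<open>fl k\<close> whatever their parity.\<close>

lemma fl_succ_increment:
  assumes "fl (Suc k) \<in> F" "fl (Suc k) - fl k = g" "g / 2 < c" "c \<le> g"
  shows "R (fl k + c) = Fin (fl (Suc k))"
proof (rule R_unique[OF assms(1)])
  have g0: "0 < g" using assms(2) fl_less_iff[of k "Suc k"] by linarith
  show "\<bar>fl k + c\<bar> < Omega p q + pw (E - P - 1)"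
    using F_abs_le[OF assms(1)] fl_nonneg[of k] assms(2-4) g0 pw_pos[of "E - P - 1"] by linarith
  fix z assume z: "z \<in> F" "z \<noteq> fl (Suc k)"
  show "\<bar>fl k + c - fl (Suc k)\<bar> < \<bar>fl k + c - z\<bar>"
  proof (cases "z \<le> fl k")
    case True
    then show ?thesis using assms g0 by auto
  next
    case False
    obtain b where b: "z = flz b" using z unfolding Fl_flz by auto
    have fk: "fl n = flz (int n)" for n by (simp add: flz_def)
    have "int k < b" using False unfolding b fk by simp
    moreover have "b \<noteq> int (Suc k)" using z(2) unfolding b fk by simp
    ultimately have "int (Suc k) < b" by simp
    then have "fl (Suc k) < z" unfolding b fk by simp
    then show ?thesis using assms by auto
  qed
qed

lemma gap_exponent:
  assumes "fl (Suc k) \<in> F"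
  obtains e where "emin q - P \<le> e" "e \<le> E - P" "fl (Suc k) - fl k = pw e"
proof -
  define m where "m = k div 2 ^ p - 1"
  have "pw (emin q - P + int m) = fl (Suc k) - fl k"
    unfolding fl_gap \<eta>_def m_def pw_add by simp
  moreover have "emin q - P + int m \<le> E - P"
  proof -
    have "fl (Suc k) \<le> fl (NN - 1)" using F_abs_le[OF assms] by (simp add: Omega_fl)
    then have "k < NN" by simp
    then have "k div 2 ^ p < nat (E - emin q + 2)" unfolding NN_def by (simp add: less_mult_imp_div_less mult.commute)
    then show ?thesis using E_bounds(3) unfolding m_def by (auto simp: emin_eq)
  qed
  ultimately show ?thesis using that[of "emin q - P + int m"] by simp
qed

text \<open>An increment that fits a gap 2^k moves a float to its neighbour across that gap after rounding,
  whatever its exact size; s is its sign.\<close>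

definition fits :: "real \<Rightarrow> int \<Rightarrow> real \<Rightarrow> bool" where
  "fits s k c \<longleftrightarrow> c \<in> F \<and> pw k / 2 < s * c \<and> s * c \<le> pw k"

text \<open>The gap exponents are fixed before the increments because the network has to be built
  before the rounding errors in its contributions are known; of the increments only
  \<open>fits\<close> is asked.\<close>

lemma fits_fold:
  assumes "t \<in> F"
  shows "\<exists>ks s. s \<in> {1, -1} \<and> (\<forall>k\<in>set ks. emin q - P \<le> k \<and> k \<le> E - P) \<and>
    (\<forall>cs. list_all2 (fits s) ks cs \<longrightarrow> foldl (fadd p q) (Fin 0) (map Fin cs) = Fin t)"
proof -
  have main: "\<exists>ks. (\<forall>k\<in>set ks. emin q - P \<le> k \<and> k \<le> E - P) \<and>
    (\<forall>cs. list_all2 (fits s) ks cs \<longrightarrow> foldl (fadd p q) (Fin 0) (map Fin cs) = Fin (s * fl n))"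
    if "fl n \<in> F" "s = 1 \<or> s = -1" for n s
    using that(1)
  proof (induction n)
    case 0
    show ?case by (rule exI[of _ "[]"]) simp
  next
    case (Suc n)
    have "fl n \<in> F" using Suc.prems F_abs_le[OF Suc.prems] fl_le_iff[of n "Suc n"]
      by (intro F_fl_intro) (simp del: fl_le_iff)
    from Suc.IH[OF this] obtain ks where ks: "\<forall>k\<in>set ks. emin q - P \<le> k \<and> k \<le> E - P"
      "\<And>cs. list_all2 (fits s) ks cs \<Longrightarrow> foldl (fadd p q) (Fin 0) (map Fin cs) = Fin (s * fl n)" by blast
    obtain e where e: "emin q - P \<le> e" "e \<le> E - P" "fl (Suc n) - fl n = pw e"
      using gap_exponent[OF Suc.prems] by blast
    have "foldl (fadd p q) (Fin 0) (map Fin cs) = Fin (s * fl (Suc n))"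
      if "list_all2 (fits s) (ks @ [e]) cs" for cs
    proof -
      obtain cs' c where cs: "cs = cs' @ [c]" "list_all2 (fits s) ks cs'" "fits s e c"
        using \<open>list_all2 (fits s) (ks @ [e]) cs\<close> by (auto simp: list_all2_append1 list_all2_Cons1)
      have "R (fl n + s * c) = Fin (fl (Suc n))"
        using fl_succ_increment[OF Suc.prems e(3)] cs(3) unfolding fits_def by simp
      then have "R (s * fl n + c) = Fin (s * fl (Suc n))"
        using \<open>s = 1 \<or> s = -1\<close> R_minus_Fin[of "fl n + s * c"] by auto
      then show ?thesis using ks(2)[OF cs(2)] by (simp add: cs(1))
    qed
    then show ?case using ks(1) e by (intro exI[of _ "ks @ [e]"]) auto
  qed
  obtain z where z: "t = flz z" using assms unfolding Fl_flz by auto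
  define s :: real where "s = (if 0 \<le> z then 1 else -1)"
  have t: "t = s * fl (nat \<bar>z\<bar>)" "s \<in> {1, -1}" by (auto simp: z flz_def s_def)
  have "fl (nat \<bar>z\<bar>) \<in> F" using assms t by auto
  then show ?thesis using main[of "nat \<bar>z\<bar>" s] t by auto
qed

end

section \<open>Composition of networks\<close>

text \<open>Beyond the first layer two parallel networks share nothing, so their layers are block
  diagonal; in the first layer both read the same input and the rows are simply stacked.\<close>

fun par_body :: "nat \<Rightarrow> nat \<Rightarrow> layer list \<Rightarrow> layer list \<Rightarrow> layer list" where
  "par_body m1 m2 (l1 # ls1) (l2 # ls2) =
     (map (\<lambda>r. r @ replicate m2 0) (fst l1) @ map (\<lambda>r. replicate m1 0 @ r) (fst l2), snd l1 @ snd l2)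
     # par_body (length (snd l1)) (length (snd l2)) ls1 ls2"
| "par_body m1 m2 _ _ = []"

fun par :: "layer list \<Rightarrow> layer list \<Rightarrow> layer list" where
  "par (l1 # ls1) (l2 # ls2) =
     (fst l1 @ fst l2, snd l1 @ snd l2) # par_body (length (snd l1)) (length (snd l2)) ls1 ls2"
| "par _ _ = []"

locale net = fp +
  fixes a :: act and c :: real and d :: nat
begin

abbreviation fa (infixl "\<oplus>" 65) where "x \<oplus> y \<equiv> fadd p q x y"
abbreviation fm (infixl "\<otimes>" 70) where "x \<otimes> y \<equiv> fmul p q x y"
abbreviation sg where "sg \<equiv> sigma p q a"
abbreviation sg' where "sg' \<equiv> sigma' p q c a"
abbreviation fold_add where "fold_add \<equiv> foldl (fadd p q)"

text \<open>Adding 0 is the identity only on values that are already rounded; membership in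
  \<open>EE\<close> records this, with infinities and NaN included.\<close>

definition EE :: "ext set" where "EE = {s. \<forall>r. s = Fin r \<longrightarrow> r \<in> F}"

lemma EE_simps [simp]: "Fin r \<in> EE \<longleftrightarrow> r \<in> F" "PInf \<in> EE" "NInf \<in> EE" "NaN \<in> EE"
  by (auto simp: EE_def)

lemma R_EE [simp]: "R x \<in> EE"
  using R_Fin_F by (auto simp: EE_def)

lemma fadd_EE [simp]: "x \<oplus> y \<in> EE"
  by (cases x; cases y) simp_all

lemma fmul_EE [simp]: "x \<otimes> y \<in> EE"
  by (cases x; cases y) simp_all

lemma fadd_0 [simp]: "s \<in> EE \<Longrightarrow> s \<oplus> Fin 0 = s"
  by (cases s) (simp_all add: R_F)

lemma fadd_0_left [simp]: "s \<in> EE \<Longrightarrow> Fin 0 \<oplus> s = s"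
  by (cases s) (simp_all add: R_F)

lemma R_0 [simp]: "R 0 = Fin 0"
  by (simp add: R_F)

lemma fold_EE: "s \<in> EE \<Longrightarrow> fold_add s ts \<in> EE"
  by (induction ts arbitrary: s) simp_all

lemma fold_zeros: "s \<in> EE \<Longrightarrow> set ts \<subseteq> {Fin 0} \<Longrightarrow> fold_add s ts = s"
  by (induction ts arbitrary: s) simp_all

text \<open>The summation is not associative, so gradients are tracked as lists of terms; exact zeros may be
  dropped from them in any position.\<close>

definition contribs :: "ext list \<Rightarrow> real list \<Rightarrow> bool" where
  "contribs ts cs \<longleftrightarrow> (\<forall>s\<in>EE. fold_add s ts = fold_add s (map Fin cs))"

lemma contribs_append: "contribs ts cs \<Longrightarrow> contribs ts' cs' \<Longrightarrow> contribs (ts @ ts') (cs @ cs')"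
  by (simp add: contribs_def fold_EE)

lemma contribs_zeros: "set ts \<subseteq> {Fin 0} \<Longrightarrow> contribs ts []"
  by (simp add: contribs_def fold_zeros)

lemma contribs_self: "contribs (map Fin cs) cs"
  by (simp add: contribs_def)

lemma contribs_fsum: "contribs ts cs \<Longrightarrow> fsum p q ts = fold_add (Fin 0) (map Fin cs)"
  by (simp add: contribs_def fsum_def)

definition terms :: "real list \<Rightarrow> real list list \<Rightarrow> nat \<Rightarrow> ext list" where
  "terms t A j = map2 (\<otimes>) (map Fin t) (map (\<lambda>row. Fin (row ! j)) A)"

lemma terms_append: "length t1 = length A1 \<Longrightarrow> terms (t1 @ t2) (A1 @ A2) j = terms t1 A1 j @ terms t2 A2 j"
  by (simp add: terms_def)

text \<open>The pre-activation itself may be infinite; only its value and slope under the activation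
  have to be floats.\<close>

definition lay :: "layer \<Rightarrow> ext list \<Rightarrow> real list \<Rightarrow> real list \<Rightarrow> bool" where
  "lay l u v s \<longleftrightarrow> map sg (affine p q l u) = map Fin v \<and> map sg' (affine p q l u) = map Fin s
     \<and> set v \<subseteq> F \<and> set s \<subseteq> F"

definition pwm :: "real list \<Rightarrow> real list \<Rightarrow> real list \<Rightarrow> bool" where
  "pwm s g t \<longleftrightarrow> length g = length s \<and> map2 (\<otimes>) (map Fin g) (map Fin s) = map Fin t \<and> set t \<subseteq> F"

definition rowm :: "nat \<Rightarrow> real list \<Rightarrow> real list list \<Rightarrow> real list \<Rightarrow> bool" where
  "rowm m t A g \<longleftrightarrow> map (\<lambda>j. fsum p q (terms t A j)) [0..<m] = map Fin g \<and> set g \<subseteq> F"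

text \<open>Widths are positive because \<open>row_mat\<close> reads the number of columns off the
  first row of a matrix.\<close>

fun shape :: "nat \<Rightarrow> layer list \<Rightarrow> nat \<Rightarrow> bool" where
  "shape m [] n \<longleftrightarrow> m = n"
| "shape m (l # ls) n \<longleftrightarrow> (\<exists>k>0. layer_ok p q m k l \<and> shape k ls n)"

fun body_run :: "layer list \<Rightarrow> real list \<Rightarrow> real list \<Rightarrow> real list \<Rightarrow> real list \<Rightarrow> bool" where
  "body_run [] u v g h \<longleftrightarrow> v = u \<and> h = g"
| "body_run (l # ls) u v g h \<longleftrightarrow> (\<exists>w s g1 t. lay l (map Fin u) w s \<and> body_run ls w v g g1 \<and> pwm s g1 t
     \<and> rowm (length u) t (fst l) h)"

text \<open>Here the list of layers is followed by an activation after every layer, including the last. On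
  input x the features are v, and back-propagating g from them adds the terms D j, in this order, to the
  sum for coordinate j of the input gradient; all intermediate results are finite.\<close>

fun gives :: "layer list \<Rightarrow> real list \<Rightarrow> real list \<Rightarrow> real list \<Rightarrow> (nat \<Rightarrow> real list) \<Rightarrow> bool" where
  "gives [] x v g D \<longleftrightarrow> False"
| "gives (l # ls) x v g D \<longleftrightarrow> set g \<subseteq> F \<and> (\<exists>w s h t. lay l (map Fin x) w s \<and> body_run ls w v g h \<and> pwm s h t
     \<and> (\<forall>j<d. contribs (terms t (fst l) j) (D j)))"

lemma map_Fin_eq [simp]: "map Fin u = map Fin v \<longleftrightarrow> u = v"
  by (simp add: inj_map_eq_map inj_def)

lemma layer_okD:
  assumes "layer_ok p q m n l"
  shows "length (fst l) = n" "length (snd l) = n" "\<And>row. row \<in> set (fst l) \<Longrightarrow> length row = m"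
    "\<And>row. row \<in> set (fst l) \<Longrightarrow> set row \<subseteq> F" "set (snd l) \<subseteq> F"
  using assms by (auto simp: layer_ok_def)

lemma length_affine: "length (affine p q l u) = min (length (fst l)) (length (snd l))"
  by (simp add: affine_def)

lemma lay_length: "lay l u v s \<Longrightarrow> layer_ok p q m n l \<Longrightarrow> length v = n \<and> length s = n"
  unfolding lay_def by (metis layer_okD(1,2) length_affine length_map min.idem)

lemma pwm_length: "pwm s g t \<Longrightarrow> length g = length s \<and> length t = length s"
  unfolding pwm_def by (metis length_map length_zip min.idem)

lemma shape_snoc: "shape m ls k \<Longrightarrow> layer_ok p q k n l \<Longrightarrow> 0 < n \<Longrightarrow> shape m (ls @ [l]) n"
  by (induction ls arbitrary: m) auto

lemma body_run_snoc:
  assumes "body_run ls u v g' h" "lay l (map Fin v) w s" "pwm s g t" "rowm (length v) t (fst l) g'"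
  shows "body_run (ls @ [l]) u w g h"
  using assms(1)
proof (induction ls arbitrary: u h)
  case Nil
  then show ?case using assms by auto
next
  case (Cons l' ls)
  from Cons.prems obtain w' s' g1 t' where *: "lay l' (map Fin u) w' s'" "body_run ls w' v g' g1" "pwm s' g1 t'"
    "rowm (length u) t' (fst l') h" by auto
  show ?case unfolding append_Cons body_run.simps using * Cons.IH[OF *(2)] by blast
qed

lemma gives_snoc:
  assumes "gives N x v g' D" "lay l (map Fin v) w s" "pwm s g t" "rowm (length v) t (fst l) g'" "set g \<subseteq> F"
  shows "gives (N @ [l]) x w g D"
proof (cases N)
  case (Cons l' ls)
  from assms(1) obtain w' s' h t' where *: "lay l' (map Fin x) w' s'" "body_run ls w' v g' h" "pwm s' h t'"
    "\<forall>j<d. contribs (terms t' (fst l') j) (D j)" unfolding Cons gives.simps by blast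
  show ?thesis unfolding Cons append_Cons gives.simps
    using * body_run_snoc[OF *(2) assms(2-4)] assms(5) by blast
qed (use assms in simp)

lemma lay_append:
  assumes "affine p q l u = affine p q l1 u1 @ affine p q l2 u2" "lay l1 u1 v1 s1" "lay l2 u2 v2 s2"
  shows "lay l u (v1 @ v2) (s1 @ s2)"
  using assms by (simp add: lay_def)

lemma pwm_append:
  assumes "pwm s1 g1 t1" "pwm s2 g2 t2" shows "pwm (s1 @ s2) (g1 @ g2) (t1 @ t2)"
  using assms by (simp add: pwm_def)

lemma fsum_zeros_right: "set ts \<subseteq> {Fin 0} \<Longrightarrow> fsum p q (xs @ ts) = fsum p q xs"
  by (simp add: fsum_def fold_zeros fold_EE)

lemma fsum_zeros_left: "set ts \<subseteq> {Fin 0} \<Longrightarrow> fsum p q (ts @ xs) = fsum p q xs"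
  by (simp add: fsum_def fold_zeros)

lemma map2_zero_left: "set (map2 (\<otimes>) (map Fin (replicate n 0)) (map Fin u)) \<subseteq> {Fin 0}"
  by (auto simp: set_zip)

lemma affine_stack:
  "length (fst l1) = length (snd l1) \<Longrightarrow>
   affine p q (fst l1 @ fst l2, snd l1 @ snd l2) u = affine p q l1 u @ affine p q l2 u"
  by (simp add: affine_def)

definition dot :: "real list \<Rightarrow> ext list \<Rightarrow> ext" where
  "dot r u = fsum p q (map2 (\<otimes>) (map Fin r) u)"

lemma affine_dot: "affine p q l u = map2 (\<lambda>r b. dot r u \<oplus> Fin b) (fst l) (snd l)"
  by (simp add: affine_def dot_def)

lemma map2_map_cong:
  "(\<And>x y. x \<in> set xs \<Longrightarrow> f (g x) y = h x y) \<Longrightarrow> map2 f (map g xs) ys = map2 h xs ys"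
  by (auto simp: zip_map1 dest: set_zip_leftD)

text \<open>The zero padding is harmless because features are finite (an infinite feature times 0
  would be NaN) and because exact zeros at either end of a sum leave it unchanged.\<close>

lemma affine_block:
  assumes "layer_ok p q m1 n1 l1" "layer_ok p q m2 n2 l2" "length u1 = m1" "length u2 = m2"
  shows "affine p q (map (\<lambda>r. r @ replicate m2 0) (fst l1) @ map (\<lambda>r. replicate m1 0 @ r) (fst l2), snd l1 @ snd l2)
    (map Fin (u1 @ u2)) = affine p q l1 (map Fin u1) @ affine p q l2 (map Fin u2)"
proof -
  have 1: "dot (r @ replicate m2 0) (map Fin (u1 @ u2)) = dot r (map Fin u1)" if "length r = m1" for r
    using that assms(3) fsum_zeros_right[OF map2_zero_left[of m2 u2]] unfolding dot_def by (simp del: map_replicate)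
  have 2: "dot (replicate m1 0 @ r) (map Fin (u1 @ u2)) = dot r (map Fin u2)" if "length r = m2" for r
    using that assms(3) fsum_zeros_left[OF map2_zero_left[of m1 u1]] unfolding dot_def by (simp del: map_replicate)
  define U where "U = map Fin (u1 @ u2)"
  note 1 = 1[folded U_def] and 2 = 2[folded U_def]
  note ok = layer_okD[OF assms(1)] layer_okD[OF assms(2)]
  have "map2 (\<lambda>r b. dot r U \<oplus> Fin b) (map (\<lambda>r. r @ replicate m2 0) (fst l1)) (snd l1)
      = affine p q l1 (map Fin u1)"
    unfolding affine_dot by (rule map2_map_cong) (use 1 ok in simp)
  moreover have "map2 (\<lambda>r b. dot r U \<oplus> Fin b) (map (\<lambda>r. replicate m1 0 @ r) (fst l2)) (snd l2)
      = affine p q l2 (map Fin u2)"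
    unfolding affine_dot by (rule map2_map_cong) (use 2 ok in simp)
  ultimately show ?thesis
    unfolding affine_dot[of "(_, _)"] fst_conv snd_conv U_def[symmetric] using ok by simp
qed

lemma terms_block_left:
  "(\<And>r. r \<in> set A \<Longrightarrow> length r = m1) \<Longrightarrow> j < m1 \<Longrightarrow> terms t (map (\<lambda>r. r @ replicate m2 0) A) j = terms t A j"
  unfolding terms_def by (intro arg_cong2[where f = "\<lambda>x y. map2 (\<otimes>) x y"]) (auto simp: nth_append)

lemma terms_block_left_zero:
  "(\<And>r. r \<in> set A \<Longrightarrow> length r = m1) \<Longrightarrow> j < m2 \<Longrightarrow> set (terms t (map (\<lambda>r. r @ replicate m2 0) A) (m1 + j)) \<subseteq> {Fin 0}"
  unfolding terms_def by (auto simp: nth_append set_zip)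

lemma terms_block_right:
  "terms t (map (\<lambda>r. replicate m1 0 @ r) A) (m1 + j) = terms t A j"
  unfolding terms_def by (intro arg_cong2[where f = "\<lambda>x y. map2 (\<otimes>) x y"]) (auto simp: nth_append)

lemma terms_block_right_zero:
  "j < m1 \<Longrightarrow> set (terms t (map (\<lambda>r. replicate m1 0 @ r) A) j) \<subseteq> {Fin 0}"
  unfolding terms_def by (auto simp: nth_append set_zip)

lemma rowm_block:
  assumes "layer_ok p q m1 n1 l1" "layer_ok p q m2 n2 l2" "length t1 = n1" "length t2 = n2"
    and "rowm m1 t1 (fst l1) g1" "rowm m2 t2 (fst l2) g2"
  shows "rowm (m1 + m2) (t1 @ t2)
    (map (\<lambda>r. r @ replicate m2 0) (fst l1) @ map (\<lambda>r. replicate m1 0 @ r) (fst l2)) (g1 @ g2)"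
proof -
  let ?A = "map (\<lambda>r. r @ replicate m2 0) (fst l1) @ map (\<lambda>r. replicate m1 0 @ r) (fst l2)"
  note ok = layer_okD[OF assms(1)] layer_okD[OF assms(2)]
  have l: "length t1 = length (map (\<lambda>r. r @ replicate m2 0) (fst l1))" using ok assms by simp
  have 1: "fsum p q (terms (t1 @ t2) ?A j) = fsum p q (terms t1 (fst l1) j)" if "j < m1" for j
    unfolding terms_append[OF l] using fsum_zeros_right[OF terms_block_right_zero[OF that]]
      terms_block_left[OF ok(3) that] by simp
  have 2: "fsum p q (terms (t1 @ t2) ?A (m1 + j)) = fsum p q (terms t2 (fst l2) j)" if "j < m2" for j
    unfolding terms_append[OF l] using fsum_zeros_left[OF terms_block_left_zero[OF ok(3) that]]
      terms_block_right by simp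
  have "[0..<m1 + m2] = [0..<m1] @ map ((+) m1) [0..<m2]"
    by (auto intro!: nth_equalityI simp: nth_append)
  then have "map (\<lambda>j. fsum p q (terms (t1 @ t2) ?A j)) [0..<m1 + m2] =
     map (\<lambda>j. fsum p q (terms t1 (fst l1) j)) [0..<m1] @ map (\<lambda>j. fsum p q (terms t2 (fst l2) j)) [0..<m2]"
    using 1 2 by simp
  then show ?thesis using assms(5,6) by (simp add: rowm_def)
qed

lemma layer_ok_block:
  assumes "layer_ok p q m1 n1 l1" "layer_ok p q m2 n2 l2"
  shows "layer_ok p q (m1 + m2) (n1 + n2)
    (map (\<lambda>r. r @ replicate m2 0) (fst l1) @ map (\<lambda>r. replicate m1 0 @ r) (fst l2), snd l1 @ snd l2)"
  using assms by (auto simp: layer_ok_def subset_iff)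

lemma shape_par_body:
  "shape m1 ls1 n1 \<Longrightarrow> shape m2 ls2 n2 \<Longrightarrow> length ls1 = length ls2 \<Longrightarrow>
   shape (m1 + m2) (par_body m1 m2 ls1 ls2) (n1 + n2) \<and> length (par_body m1 m2 ls1 ls2) = length ls1"
proof (induction m1 m2 ls1 ls2 rule: par_body.induct)
  case (1 m1 m2 l1 ls1 l2 ls2)
  then obtain k1 k2 where k: "0 < k1" "layer_ok p q m1 k1 l1" "shape k1 ls1 n1"
    "0 < k2" "layer_ok p q m2 k2 l2" "shape k2 ls2 n2" unfolding shape.simps by blast
  have "shape (k1 + k2) (par_body k1 k2 ls1 ls2) (n1 + n2) \<and> length (par_body k1 k2 ls1 ls2) = length ls1"
    using 1(1)[unfolded layer_okD(2)[OF k(2)] layer_okD(2)[OF k(5)], OF k(3,6)] 1(4) by simp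
  then show ?case
    unfolding par_body.simps shape.simps layer_okD(2)[OF k(2)] layer_okD(2)[OF k(5)]
    using layer_ok_block[OF k(2,5)] k(1) by (metis add_gr_0 length_Cons)
qed auto

lemma body_run_par_body:
  assumes "shape m1 ls1 n1" "shape m2 ls2 n2" "length ls1 = length ls2" "length u1 = m1" "length u2 = m2"
    "body_run ls1 u1 v1 g1 h1" "body_run ls2 u2 v2 g2 h2"
  shows "body_run (par_body m1 m2 ls1 ls2) (u1 @ u2) (v1 @ v2) (g1 @ g2) (h1 @ h2)"
  using assms
proof (induction m1 m2 ls1 ls2 arbitrary: u1 u2 h1 h2 rule: par_body.induct)
  case (1 m1 m2 l1 ls1 l2 ls2)
  obtain k1 k2 where k: "layer_ok p q m1 k1 l1" "shape k1 ls1 n1" "layer_ok p q m2 k2 l2" "shape k2 ls2 n2"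
    using 1 by auto
  obtain w1 s1 e1 t1 where b1: "lay l1 (map Fin u1) w1 s1" "body_run ls1 w1 v1 g1 e1" "pwm s1 e1 t1"
    "rowm (length u1) t1 (fst l1) h1" using 1 by auto
  obtain w2 s2 e2 t2 where b2: "lay l2 (map Fin u2) w2 s2" "body_run ls2 w2 v2 g2 e2" "pwm s2 e2 t2"
    "rowm (length u2) t2 (fst l2) h2" using 1 by auto
  have len: "length w1 = k1" "length s1 = k1" "length w2 = k2" "length s2 = k2" "length (snd l1) = k1" "length (snd l2) = k2"
    using lay_length b1 b2 k layer_okD(2) by blast+
  have lt: "length t1 = k1" "length t2 = k2" using pwm_length b1(3) b2(3) len by metis+
  have "body_run (par_body k1 k2 ls1 ls2) (w1 @ w2) (v1 @ v2) (g1 @ g2) (e1 @ e2)"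
    using 1(1)[of w1 w2 e1 e2] 1(4) k b1 b2 len by simp
  moreover have "rowm (length (u1 @ u2)) (t1 @ t2) (fst (map (\<lambda>r. r @ replicate m2 0) (fst l1) @ map (\<lambda>r. replicate m1 0 @ r) (fst l2), snd l1 @ snd l2)) (h1 @ h2)"
    using rowm_block[OF k(1,3) lt, of h1 h2] b1 b2 1(5,6) by simp
  ultimately show ?case
    unfolding par_body.simps body_run.simps len(5,6)
    using lay_append[OF affine_block[OF k(1,3) 1(5,6)] b1(1) b2(1)] pwm_append[OF b1(3) b2(3)]
    by (intro exI conjI)
qed auto

definition hnet :: "nat \<Rightarrow> nat \<Rightarrow> layer list \<Rightarrow> bool" where
  "hnet m n N \<longleftrightarrow> length N = m \<and> N \<noteq> [] \<and> shape d N n"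

lemma hnet_snoc: "hnet m k N \<Longrightarrow> layer_ok p q k n l \<Longrightarrow> 0 < n \<Longrightarrow> hnet (Suc m) n (N @ [l])"
  unfolding hnet_def using shape_snoc[of d N k n l] by simp

lemma hnet_par: "hnet m n1 N1 \<Longrightarrow> hnet m n2 N2 \<Longrightarrow> hnet m (n1 + n2) (par N1 N2)"
proof -
  assume h: "hnet m n1 N1" "hnet m n2 N2"
  obtain l1 ls1 l2 ls2 where N: "N1 = l1 # ls1" "N2 = l2 # ls2" using h unfolding hnet_def by (meson list.exhaust)
  obtain k1 k2 where k: "0 < k1" "layer_ok p q d k1 l1" "shape k1 ls1 n1"
    "0 < k2" "layer_ok p q d k2 l2" "shape k2 ls2 n2" using h N unfolding hnet_def by auto
  have "layer_ok p q d (k1 + k2) (fst l1 @ fst l2, snd l1 @ snd l2)"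
    using k by (auto simp: layer_ok_def)
  moreover have "shape (k1 + k2) (par_body k1 k2 ls1 ls2) (n1 + n2) \<and> length (par_body k1 k2 ls1 ls2) = length ls1"
    using shape_par_body[OF k(3,6)] h unfolding hnet_def N by simp
  moreover have "length (l1 # ls1) = m" using h unfolding hnet_def N by simp
  ultimately show ?thesis
    unfolding hnet_def N par.simps shape.simps layer_okD(2)[OF k(2)] layer_okD(2)[OF k(5)] length_Cons
    using k(1) by (metis add_gr_0 list.distinct(1))
qed

text \<open>The gradient sum of the stacked first layer visits the neurons of \<open>N1\<close>
  before those of \<open>N2\<close>, which is why the term lists are concatenated.\<close>

lemma gives_par:
  assumes "hnet m n1 N1" "hnet m n2 N2" "gives N1 x v1 g1 D1" "gives N2 x v2 g2 D2"
  shows "gives (par N1 N2) x (v1 @ v2) (g1 @ g2) (\<lambda>j. D1 j @ D2 j)"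
proof -
  obtain l1 ls1 l2 ls2 where N: "N1 = l1 # ls1" "N2 = l2 # ls2" using assms unfolding hnet_def by (meson list.exhaust)
  obtain k1 k2 where k: "layer_ok p q d k1 l1" "shape k1 ls1 n1" "layer_ok p q d k2 l2" "shape k2 ls2 n2"
    using assms N unfolding hnet_def by auto
  obtain w1 s1 e1 t1 where b1: "lay l1 (map Fin x) w1 s1" "body_run ls1 w1 v1 g1 e1" "pwm s1 e1 t1"
    "\<forall>j<d. contribs (terms t1 (fst l1) j) (D1 j)" "set g1 \<subseteq> F" using assms N by auto
  obtain w2 s2 e2 t2 where b2: "lay l2 (map Fin x) w2 s2" "body_run ls2 w2 v2 g2 e2" "pwm s2 e2 t2"
    "\<forall>j<d. contribs (terms t2 (fst l2) j) (D2 j)" "set g2 \<subseteq> F" using assms N by auto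
  have len: "length w1 = k1" "length s1 = k1" "length w2 = k2" "length s2 = k2" "length (snd l1) = k1" "length (snd l2) = k2"
    "length (fst l1) = k1"
    using lay_length b1 b2 k layer_okD(1,2) by blast+
  have lt: "length t1 = k1" "length t2 = k2" using pwm_length b1(3) b2(3) len by metis+
  have "body_run (par_body k1 k2 ls1 ls2) (w1 @ w2) (v1 @ v2) (g1 @ g2) (e1 @ e2)"
    using body_run_par_body[OF k(2,4) _ len(1,3)] assms(1,2) b1 b2 N unfolding hnet_def by auto
  moreover have "lay (fst l1 @ fst l2, snd l1 @ snd l2) (map Fin x) (w1 @ w2) (s1 @ s2)"
    using lay_append[OF affine_stack b1(1) b2(1)] len by simp
  moreover have "\<forall>j<d. contribs (terms (t1 @ t2) (fst l1 @ fst l2) j) (D1 j @ D2 j)"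
    using terms_append[of t1 "fst l1" t2 "fst l2"] lt len b1(4) b2(4) contribs_append by simp
  moreover have "set (g1 @ g2) \<subseteq> F" using b1(5) b2(5) by simp
  ultimately show ?thesis using pwm_append[OF b1(3) b2(3)] unfolding N par.simps gives.simps len fst_conv
    by blast
qed

lemma rowm_zeros: "(\<And>r. r \<in> set A \<Longrightarrow> length r = m) \<Longrightarrow> rowm m (replicate n 0) A (replicate m 0)"
proof -
  have "set (terms (replicate n 0) A j) \<subseteq> {Fin 0}" for j by (auto simp: terms_def set_zip)
  then have "fsum p q (terms (replicate n 0) A j) = Fin 0" for j by (simp add: fsum_def fold_zeros)
  then show ?thesis by (auto simp: rowm_def map_replicate_const)
qed

lemma pwm_zeros: "pwm s (replicate (length s) 0) (replicate (length s) 0)"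
  by (auto simp: pwm_def intro!: nth_equalityI)

lemma body_run_zeros:
  "shape m ls n \<Longrightarrow> length u = m \<Longrightarrow> body_run ls u v g h \<Longrightarrow> body_run ls u v (replicate n 0) (replicate m 0)"
proof (induction ls arbitrary: m u h)
  case (Cons l ls)
  then obtain k w s g1 t where k: "layer_ok p q m k l" "shape k ls n" "lay l (map Fin u) w s"
    "body_run ls w v g g1" "pwm s g1 t" "rowm (length u) t (fst l) h" by auto
  have w: "length w = k" "length s = k" using lay_length k by blast+
  have "rowm (length u) (replicate k 0) (fst l) (replicate m 0)"
    using rowm_zeros[of "fst l" m k] layer_okD(3)[OF k(1)] Cons.prems(2) by simp
  moreover have "pwm s (replicate k 0) (replicate k 0)" using pwm_zeros[of s] w by simp
  ultimately show ?case unfolding body_run.simps using Cons.IH[OF k(2) w(1) k(4)] k(3) by blast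
qed auto

text \<open>All weights and slopes on the way are finite, so a zero gradient stays an exact zero
  down to the input.\<close>

lemma gives_zeros:
  assumes "hnet m n N" "gives N x v g D" shows "gives N x v (replicate n 0) (\<lambda>_. [])"
proof -
  obtain l ls where N: "N = l # ls" using assms unfolding hnet_def by (meson list.exhaust)
  obtain k where k: "layer_ok p q d k l" "shape k ls n" using assms N unfolding hnet_def by auto
  obtain w s e t where b: "lay l (map Fin x) w s" "body_run ls w v g e" using assms N by auto
  have len: "length w = k" "length s = k" using lay_length b k by blast+
  have "set (terms (replicate k 0) (fst l) j) \<subseteq> {Fin 0}" for j by (auto simp: terms_def set_zip)
  then have "\<forall>j<d. contribs (terms (replicate k 0) (fst l) j) []" using contribs_zeros by blast
  moreover have "pwm s (replicate k 0) (replicate k 0)" using pwm_zeros[of s] len by simp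
  moreover have "set (replicate n 0) \<subseteq> F" by auto
  ultimately show ?thesis unfolding N gives.simps
    using b(1) body_run_zeros[OF k(2) len(1) b(2)] by blast
qed

end

section \<open>Evaluation, differentiation and elementary layers\<close>

context net
begin

lemma row_mat_terms:
  assumes "layer_ok p q m k l" "0 < k" "length t = k"
  shows "row_mat p q (map Fin t) (map (map Fin) (fst l)) = map (\<lambda>j. fsum p q (terms t (fst l) j)) [0..<m]"
proof -
  note ok = layer_okD[OF assms(1)]
  have ne: "fst l \<noteq> []" using ok(1) assms(2) by auto
  then have hd: "length (hd (map (map Fin) (fst l))) = m" using ok(3)[of "hd (fst l)"] by (simp add: hd_map)
  have "map (\<lambda>i. map Fin t ! i \<otimes> map (map Fin) (fst l) ! i ! j) [0..<length t] = terms t (fst l) j" if "j < m" for j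
    using ok(1,3) assms(3) that by (auto simp: terms_def intro!: nth_equalityI)
  then show ?thesis unfolding row_mat_def using ne hd by auto
qed

lemma fold_single:
  assumes "i < length zs" "\<And>k. k < length zs \<Longrightarrow> k \<noteq> i \<Longrightarrow> zs ! k = Fin 0" "s \<in> EE"
  shows "fold_add s zs = s \<oplus> zs ! i"
proof -
  have zs: "zs = take i zs @ zs ! i # drop (Suc i) zs" using id_take_nth_drop[OF assms(1)] .
  have "set (take i zs) \<subseteq> {Fin 0}" using assms(1,2) by (auto simp: in_set_conv_nth)
  moreover have "set (drop (Suc i) zs) \<subseteq> {Fin 0}" using assms(1,2) by (auto simp: in_set_conv_nth)
  ultimately show ?thesis using assms(3) by (subst zs) (simp add: fold_zeros)
qed

text \<open>Each sum has one possibly nonzero term; the others are finite floats times 0.\<close>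

lemma row_mat_diag:
  assumes "length g = length s"
  shows "row_mat p q (map Fin g) (diag (map Fin s)) = map2 (\<otimes>) (map Fin g) (map Fin s)"
proof (cases "s = []")
  case True
  then show ?thesis using assms by (simp add: row_mat_def diag_def)
next
  case False
  define n where "n = length s"
  have n: "0 < n" "length g = n" using False assms by (auto simp: n_def)
  have hd: "diag (map Fin s) \<noteq> []" "length (hd (diag (map Fin s))) = n"
    using n(1) by (auto simp: diag_def n_def hd_map)
  have "fsum p q (map (\<lambda>i. map Fin g ! i \<otimes> diag (map Fin s) ! i ! j) [0..<n]) = Fin (g ! j) \<otimes> Fin (s ! j)" if j: "j < n" for j
  proof -
    let ?z = "map (\<lambda>i. map Fin g ! i \<otimes> diag (map Fin s) ! i ! j) [0..<n]"
    have "fold_add (Fin 0) ?z = Fin 0 \<oplus> ?z ! j"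
      using j n by (intro fold_single) (auto simp: diag_def n_def)
    then show ?thesis using j n unfolding fsum_def by (simp add: diag_def n_def)
  qed
  then show ?thesis using hd n unfolding row_mat_def by (auto intro!: nth_equalityI simp: n_def)
qed

lemma net_eval_Cons: "ls \<noteq> [] \<Longrightarrow> net_eval p q a (l # ls) x = net_eval p q a ls (map sg (affine p q l x))"
  by (cases ls) auto

lemma autodiff_Cons: "ls \<noteq> [] \<Longrightarrow> autodiff p q c a (l # ls) x g =
   row_mat p q (row_mat p q (autodiff p q c a ls (map sg (affine p q l x)) g) (diag (map sg' (affine p q l x))))
     (map (map Fin) (fst l))"
  by (cases ls) (auto simp: Let_def)

lemma body_run_eval: "body_run ls u v g h \<Longrightarrow> net_eval p q a (ls @ [out]) (map Fin u) = affine p q out (map Fin v)"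
  by (induction ls arbitrary: u h) (auto simp: net_eval_Cons lay_def)

lemma body_run_autodiff:
  "shape m ls n \<Longrightarrow> body_run ls u v g h \<Longrightarrow> length u = m \<Longrightarrow>
   row_mat p q G (map (map Fin) (fst out)) = map Fin g \<Longrightarrow>
   autodiff p q c a (ls @ [out]) (map Fin u) G = map Fin h"
proof (induction ls arbitrary: m u h)
  case (Cons l ls)
  from Cons.prems obtain k where k: "0 < k" "layer_ok p q m k l" "shape k ls n" by auto
  from Cons.prems obtain w s g1 t where *: "lay l (map Fin u) w s" "body_run ls w v g g1" "pwm s g1 t"
    "rowm (length u) t (fst l) h" by auto
  have len: "length w = k" "length s = k" using lay_length * k by blast+
  have lt: "length t = k" "length g1 = length s" using pwm_length[OF *(3)] len by auto
  have "autodiff p q c a (ls @ [out]) (map Fin w) G = map Fin g1"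
    using Cons.IH[OF k(3) *(2) len(1)] Cons.prems by blast
  moreover have "row_mat p q (map Fin g1) (diag (map Fin s)) = map Fin t"
    using row_mat_diag[OF lt(2)] *(3) unfolding pwm_def by simp
  moreover have "row_mat p q (map Fin t) (map (map Fin) (fst l)) = map Fin h"
    using row_mat_terms[OF k(2,1) lt(1)] *(4) Cons.prems(3) unfolding rowm_def by simp
  ultimately show ?case using *(1) unfolding lay_def by (simp add: autodiff_Cons)
qed auto

text \<open>The output layer has bias 0 and hands h times w to the feature with weight w; these
  rounded products are the gradients for which \<open>gives\<close> has to be established.\<close>

lemma gives_net:
  assumes "hnet m n N" "gives N x v g D" "length x = d"
    and "length ws = n" "0 < n" "set ws \<subseteq> F" "list_all2 (\<lambda>r gi. Fin h \<otimes> Fin r = Fin gi) ws g"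
  shows "net_eval p q a (N @ [([ws], [0])]) (map Fin x) = [dot ws (map Fin v)]"
    and "autodiff p q c a (N @ [([ws], [0])]) (map Fin x) [Fin h] = map (\<lambda>j. fold_add (Fin 0) (map Fin (D j))) [0..<d]"
proof -
  obtain l ls where N: "N = l # ls" using assms unfolding hnet_def by (meson list.exhaust)
  obtain k where k: "0 < k" "layer_ok p q d k l" "shape k ls n" using assms(1) N unfolding hnet_def by auto
  obtain w s g1 t where *: "lay l (map Fin x) w s" "body_run ls w v g g1" "pwm s g1 t"
    "\<forall>j<d. contribs (terms t (fst l) j) (D j)" "set g \<subseteq> F" using assms(2) N by auto
  have len: "length w = k" "length s = k" using lay_length * k by blast+
  have lt: "length t = k" "length g1 = length s" using pwm_length[OF *(3)] len by auto
  have "dot r u \<in> EE" for r u unfolding dot_def fsum_def by (intro fold_EE) simp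
  then show "net_eval p q a (N @ [([ws], [0])]) (map Fin x) = [dot ws (map Fin v)]"
    using *(1) body_run_eval[OF *(2)] unfolding N by (simp add: net_eval_Cons lay_def affine_dot)
  have "row_mat p q [Fin h] [map Fin ws] = map Fin g"
  proof -
    have "length g = n" "\<And>i. i < n \<Longrightarrow> Fin h \<otimes> Fin (ws ! i) = Fin (g ! i)"
      using assms(4,7) by (auto simp: list_all2_conv_all_nth)
    moreover from this(2) have "Fin 0 \<oplus> (Fin h \<otimes> Fin (ws ! i)) = Fin (g ! i)" if "i < n" for i
      using that fadd_0_left[OF fmul_EE, of "Fin h" "Fin (ws ! i)"] by simp
    ultimately show ?thesis using assms(4) unfolding row_mat_def fsum_def
      by (auto intro!: nth_equalityI simp del: fmul.simps fadd.simps)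
  qed
  then have "autodiff p q c a (ls @ [([ws], [0])]) (map Fin w) [Fin h] = map Fin g1"
    using body_run_autodiff[OF k(3) *(2) len(1)] by simp
  moreover have "row_mat p q (map Fin g1) (diag (map Fin s)) = map Fin t"
    using row_mat_diag[OF lt(2)] *(3) unfolding pwm_def by simp
  ultimately show "autodiff p q c a (N @ [([ws], [0])]) (map Fin x) [Fin h] = map (\<lambda>j. fold_add (Fin 0) (map Fin (D j))) [0..<d]"
    using *(1,4) row_mat_terms[OF k(2,1) lt(1)] contribs_fsum unfolding N lay_def by (simp add: autodiff_Cons)
qed

definition urow :: "nat \<Rightarrow> real \<Rightarrow> real list" where "urow j w = (replicate d 0)[j := w]"

lemma dot_urow:
  assumes "j < d" "length x = d"
  shows "dot (urow j w) (map Fin x) = Fin w \<otimes> Fin (x ! j)"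
proof -
  let ?z = "map2 (\<otimes>) (map Fin (urow j w)) (map Fin x)"
  have "fold_add (Fin 0) ?z = Fin 0 \<oplus> ?z ! j"
    using assms by (intro fold_single) (auto simp: urow_def)
  then show ?thesis using assms unfolding dot_def fsum_def by (simp add: urow_def)
qed

lemma layer_ok_base: "w \<in> F \<Longrightarrow> b \<in> F \<Longrightarrow> layer_ok p q d 1 ([urow j w], [b])"
  by (auto simp: layer_ok_def urow_def dest!: subsetD[OF set_update_subset_insert])

lemma hnet_base: "w \<in> F \<Longrightarrow> b \<in> F \<Longrightarrow> hnet 1 1 [([urow j w], [b])]"
  using layer_ok_base by (simp add: hnet_def)

lemma gives_base:
  assumes "length x = d" "j < d" "sg (Fin w \<otimes> Fin (x ! j) \<oplus> Fin b) = Fin v" "sg' (Fin w \<otimes> Fin (x ! j) \<oplus> Fin b) = Fin s"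
    and "v \<in> F" "s \<in> F" "g \<in> F" "Fin g \<otimes> Fin s = Fin t" "Fin t \<otimes> Fin w = Fin e"
  shows "gives [([urow j w], [b])] x [v] [g] (\<lambda>i. if i = j then [e] else [])"
proof -
  have "t \<in> F" using fmul_EE[of "Fin g" "Fin s"] unfolding assms(8) by simp
  moreover have "lay ([urow j w], [b]) (map Fin x) [v] [s]"
    using assms by (simp add: lay_def affine_dot dot_urow del: fmul.simps)
  moreover have "contribs (terms [t] [urow j w] i) (if i = j then [e] else [])" if "i < d" for i
  proof (cases "i = j")
    case True
    have "terms [t] [urow j w] i = map Fin [e]" using assms(2,9) True by (simp add: terms_def urow_def)
    then show ?thesis using True contribs_self[of "[e]"] by simp
  next
    case False
    then have "terms [t] [urow j w] i = [Fin 0]" using that by (simp add: terms_def urow_def)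
    then show ?thesis using False contribs_zeros by simp
  qed
  ultimately show ?thesis using assms unfolding gives.simps body_run.simps pwm_def
    by (intro conjI exI[of _ "[v]"] exI[of _ "[s]"] exI[of _ "[g]"] exI[of _ "[t]"]) auto
qed

lemma hnet_const: "b \<in> F \<Longrightarrow> hnet 1 1 [([replicate d 0], [b])]"
  by (auto simp: hnet_def layer_ok_def)

lemma gives_const:
  assumes "length x = d" "sg (Fin b) = Fin v" "sg' (Fin b) = Fin s"
    and "b \<in> F" "v \<in> F" "s \<in> F" "g \<in> F" "Fin g \<otimes> Fin s = Fin t"
  shows "gives [([replicate d 0], [b])] x [v] [g] (\<lambda>i. [])"
proof -
  have "t \<in> F" using fmul_EE[of "Fin g" "Fin s"] unfolding assms(8) by simp
  moreover have "dot (replicate d 0) (map Fin x) = Fin 0"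
    unfolding dot_def fsum_def using map2_zero_left fold_zeros zero_F EE_simps(1) by blast
  then have "lay ([replicate d 0], [b]) (map Fin x) [v] [s]"
    using assms by (simp add: lay_def affine_dot R_F del: fmul.simps)
  moreover have "contribs (terms [t] [replicate d 0] i) []" if "i < d" for i
    using that by (intro contribs_zeros) (simp add: terms_def)
  ultimately show ?thesis using assms unfolding gives.simps body_run.simps pwm_def
    by (intro conjI exI[of _ "[v]"] exI[of _ "[s]"] exI[of _ "[g]"] exI[of _ "[t]"]) auto
qed

lemma layer_ok_row: "set ws \<subseteq> F \<Longrightarrow> b \<in> F \<Longrightarrow> layer_ok p q (length ws) 1 ([ws], [b])"
  by (auto simp: layer_ok_def)

lemma gives_row:
  assumes "gives N x us gs D" "length ws = length us"
    and "sg (dot ws (map Fin us) \<oplus> Fin b) = Fin v" "sg' (dot ws (map Fin us) \<oplus> Fin b) = Fin s"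
    and "v \<in> F" "s \<in> F" "g \<in> F" "Fin g \<otimes> Fin s = Fin t" "list_all2 (\<lambda>w g. Fin t \<otimes> Fin w = Fin g) ws gs"
  shows "gives (N @ [([ws], [b])]) x [v] [g] D"
proof (rule gives_snoc[OF assms(1)])
  have tF: "t \<in> F" using fmul_EE[of "Fin g" "Fin s"] unfolding assms(8) by simp
  show "lay ([ws], [b]) (map Fin us) [v] [s]" using assms by (simp add: lay_def affine_dot)
  show "pwm [s] [g] [t]" using assms tF by (simp add: pwm_def)
  show "set [g] \<subseteq> F" using assms by simp
  have nth: "length gs = length us" "\<And>i. i < length us \<Longrightarrow> Fin t \<otimes> Fin (ws ! i) = Fin (gs ! i)"
    using assms(2,9) by (auto simp: list_all2_conv_all_nth)
  have gF: "gs ! i \<in> F" if "i < length us" for i using fmul_EE[of "Fin t" "Fin (ws ! i)"] unfolding nth(2)[OF that] by simp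
  have "fsum p q (terms [t] [ws] i) = Fin (gs ! i)" if "i < length us" for i
    using nth(2)[OF that] gF[OF that] assms(2) that by (simp add: terms_def fsum_def R_F)
  then show "rowm (length us) [t] (fst ([ws], [b])) gs"
    using nth(1) gF unfolding rowm_def by (auto intro!: nth_equalityI simp: in_set_conv_nth)
qed

lemma gives_unary:
  assumes "gives N x [u] [g'] D"
    and "sg (Fin w \<otimes> Fin u \<oplus> Fin b) = Fin v" "sg' (Fin w \<otimes> Fin u \<oplus> Fin b) = Fin s"
    and "v \<in> F" "s \<in> F" "g \<in> F" "Fin g \<otimes> Fin s = Fin t" "Fin t \<otimes> Fin w = Fin g'"
  shows "gives (N @ [([[w]], [b])]) x [v] [g] D"
proof -
  have "dot [w] (map Fin [u]) = Fin w \<otimes> Fin u" by (simp add: dot_def fsum_def)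
  then show ?thesis using gives_row[OF assms(1), of "[w]" b v s g t] assms by (simp del: fmul.simps)
qed

text \<open>The first row takes the difference of the twin features. The second discards them and
  recreates a constant twin, so that a difference can be taken again in the next layer.\<close>

definition relay_layer :: "real \<Rightarrow> real \<Rightarrow> layer" where "relay_layer w b = ([[w, - w], [0, 0]], [b, b])"

lemma layer_ok_relay: "w \<in> F \<Longrightarrow> b \<in> F \<Longrightarrow> layer_ok p q 2 2 (relay_layer w b)"
  by (auto simp: layer_ok_def relay_layer_def)

text \<open>The neuron of the second row sends back exact zeros, as its weights are 0; its own
  gradient only has to stay finite under its slope.\<close>

lemma gives_relay:
  assumes "gives N x [r, r'] [e, e'] D"
    and "(Fin w \<otimes> Fin r) \<oplus> (Fin (- w) \<otimes> Fin r') \<oplus> Fin b = y" "sg y = Fin v" "sg' y = Fin s"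
    and "sg (Fin b) = Fin v'" "sg' (Fin b) = Fin s'" "b \<in> F"
    and "v \<in> F" "s \<in> F" "v' \<in> F" "s' \<in> F" "g \<in> F" "g' \<in> F"
    and "Fin g \<otimes> Fin s = Fin t" "Fin g' \<otimes> Fin s' = Fin t'" "Fin t \<otimes> Fin w = Fin e" "Fin t \<otimes> Fin (- w) = Fin e'"
  shows "gives (N @ [relay_layer w b]) x [v, v'] [g, g'] D"
proof (rule gives_snoc[OF assms(1)])
  have tF: "t \<in> F" using fmul_EE[of "Fin g" "Fin s"] unfolding assms by simp
  have tF': "t' \<in> F" using fmul_EE[of "Fin g'" "Fin s'"] unfolding assms by simp
  have eF: "e \<in> F" using fmul_EE[of "Fin t" "Fin w"] unfolding assms by simp
  have eF': "e' \<in> F" using fmul_EE[of "Fin t" "Fin (- w)"] unfolding assms by simp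
  have d1: "dot [w, - w] [Fin r, Fin r'] = (Fin w \<otimes> Fin r) \<oplus> (Fin (- w) \<otimes> Fin r')"
    by (simp add: dot_def fsum_def)
  have d2: "dot [0, 0] [Fin r, Fin r'] = Fin 0" by (simp add: dot_def fsum_def)
  show "lay (relay_layer w b) (map Fin [r, r']) [v, v'] [s, s']"
    using assms(2-11) d1 d2 by (simp add: lay_def relay_layer_def affine_dot R_F del: fmul.simps)
  show "pwm [s, s'] [g, g'] [t, t']" using assms tF tF' by (simp add: pwm_def)
  show "set [g, g'] \<subseteq> F" using assms by simp
  have 0: "[0..<2] = [0, Suc 0]" by (simp add: upt_rec)
  have "terms [t, t'] [[w, - w], [0, 0]] 0 = [Fin e, Fin 0]" "terms [t, t'] [[w, - w], [0, 0]] (Suc 0) = [Fin e', Fin 0]"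
    using assms(16,17) by (simp_all add: terms_def)
  then show "rowm (length [r, r']) [t, t'] (fst (relay_layer w b)) [e, e']"
    using eF eF' by (simp add: rowm_def relay_layer_def 0 fsum_def R_F numeral_2_eq_2)
qed

inductive allg :: "layer list list \<Rightarrow> real list \<Rightarrow> real list \<Rightarrow> real list \<Rightarrow> (nat \<Rightarrow> real list) \<Rightarrow> bool" where
  Nil: "allg [] x [] [] (\<lambda>_. [])"
| Cons: "gives N x [v] [g] D \<Longrightarrow> allg Ns x vs gs Ds \<Longrightarrow> allg (N # Ns) x (v # vs) (g # gs) (\<lambda>j. D j @ Ds j)"

lemma hnet_foldr_par:
  "hnet m n N0 \<Longrightarrow> (\<And>N. N \<in> set Ns \<Longrightarrow> hnet m 1 N) \<Longrightarrow> hnet m (length Ns + n) (foldr par Ns N0)"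
proof (induction Ns)
  case (Cons N Ns)
  then show ?case using hnet_par[of m 1 N "length Ns + n" "foldr par Ns N0"] by simp
qed simp

lemma gives_foldr_par:
  assumes "hnet m n N0"
  shows "allg Ns x vs gs D \<Longrightarrow> gives N0 x v0 g0 D0 \<Longrightarrow> (\<And>N. N \<in> set Ns \<Longrightarrow> hnet m 1 N) \<Longrightarrow>
    gives (foldr par Ns N0) x (vs @ v0) (gs @ g0) (\<lambda>j. D j @ D0 j)"
proof (induction rule: allg.induct)
  case (Cons N x v g D Ns vs gs Ds)
  have "hnet m (length Ns + n) (foldr par Ns N0)" using assms(1) Cons.prems by (intro hnet_foldr_par) auto
  then show ?case using gives_par[of m 1 N "length Ns + n" "foldr par Ns N0" x "[v]" "[g]" D "vs @ v0" "gs @ g0"] Cons by simp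
qed simp

lemma allg_append: "allg Ns x vs gs D \<Longrightarrow> allg Ns' x vs' gs' D' \<Longrightarrow> allg (Ns @ Ns') x (vs @ vs') (gs @ gs') (\<lambda>j. D j @ D' j)"
  by (induction rule: allg.induct) (auto intro: allg.Cons)

end

section \<open>Memorising networks from elementary cells\<close>

context net
begin

text \<open>Since 2^q = 2 * (E + 1), the factor exp (- B) \<le> 2^(-2^q) is far below half the least
  positive float, which is what makes saturation exact after rounding.\<close>

definition B :: real where "B = pw (int q)"

lemma B_pos [simp]: "0 < B"
  by (simp add: B_def)

lemma B_F [simp]: "B \<in> F" "- B \<in> F"
proof -
  show "B \<in> F" unfolding B_def using E_bounds by (intro pw_F) (simp_all add: emin_eq)
  then show "- B \<in> F" by simp
qed

text \<open>Arguments at which every activation has, after rounding, its limit at minus infinity and derivative exactly 0.\<close>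

definition neg :: "ext \<Rightarrow> bool" where
  "neg v \<longleftrightarrow> v = NInf \<or> (\<exists>r\<in>F. v = Fin r \<and> r \<le> - B)"

definition grid :: "real \<Rightarrow> real list set" where
  "grid M = {x. length x = d \<and> set x \<subseteq> F \<inter> {-M..M}}"

definition fires :: "bool \<Rightarrow> real \<Rightarrow> real \<Rightarrow> bool" where
  "fires u z y \<longleftrightarrow> (if u then z < y else y < z)"

text \<open>A firing detector has to cope only with a zero gradient, since the gate it closes passes
  back exact zeros. A silent one must output an exact 0 and absorb any gradient coming from an open
  gate. K is its weight in the gate and 2^kt the unit in which the gate counts.\<close>

definition detects :: "real \<Rightarrow> real \<Rightarrow> int \<Rightarrow> nat \<Rightarrow> nat \<Rightarrow> real \<Rightarrow> bool \<Rightarrow> layer list \<Rightarrow> bool" where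
  "detects M K kt m j z u N \<longleftrightarrow> hnet m 1 N \<and> (\<forall>x\<in>grid M. if fires u z (x ! j)
     then (\<exists>v e. gives N x [v] [0] (\<lambda>_. []) \<and> Fin (- K) \<otimes> Fin v = Fin e \<and> e \<le> - pw kt)
     else (\<forall>g\<in>F. gives N x [0] [g] (\<lambda>_. [])))"

text \<open>The bounds by 2^kt prevent the twin features from reopening a gate closed by the
  detectors.\<close>

definition relays :: "real \<Rightarrow> int \<Rightarrow> nat \<Rightarrow> real \<Rightarrow> layer list \<Rightarrow> bool" where
  "relays M kt m W N \<longleftrightarrow> hnet m 2 N \<and> W \<in> F \<and> (\<forall>x\<in>grid M. \<exists>r r' y y'. gives N x [r, r'] [0, 0] (\<lambda>_. []) \<and>
     Fin W \<otimes> Fin r = Fin y \<and> Fin (- W) \<otimes> Fin r' = Fin y' \<and> \<bar>y\<bar> \<le> pw kt \<and> \<bar>y'\<bar> \<le> pw kt)"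

text \<open>The twin features r and r' enter a gate with the weights \<omega> and -\<omega>; at x they cancel in the
  forward pass, whereas the backward pass of h delivers a single term for coordinate j.\<close>

definition path_relay :: "real \<Rightarrow> int \<Rightarrow> real \<Rightarrow> nat \<Rightarrow> nat \<Rightarrow> real list \<Rightarrow> real \<Rightarrow> real \<Rightarrow> int \<Rightarrow> layer list \<Rightarrow> bool" where
  "path_relay M kt \<omega> m j x h s k N \<longleftrightarrow> relays M kt m \<omega> N \<and> (\<exists>r r' y f f' e.
     Fin \<omega> \<otimes> Fin r = Fin y \<and> Fin (- \<omega>) \<otimes> Fin r' = Fin (- y) \<and> Fin h \<otimes> Fin \<omega> = Fin f \<and> Fin h \<otimes> Fin (- \<omega>) = Fin f' \<and>
     gives N x [r, r'] [f, f'] (\<lambda>i. if i = j then [e] else []) \<and> fits s k e)"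

text \<open>Two neurons in series behind a gate: bI is the bias of the gate, seen only when it is open, and
  \<kappa> is the output of a closed gate. The output is 0 or fits the gap 2^k, and the backward pass stays
  finite, with K the weight of the detectors in the gate.\<close>

definition value_cell :: "real \<Rightarrow> real \<Rightarrow> int \<Rightarrow> real \<Rightarrow> real \<Rightarrow> int \<Rightarrow> bool" where
  "value_cell H K kt \<kappa> s k \<longleftrightarrow> (\<exists>bI vI sI w' \<beta> v s0 s1 w e.
     {bI, vI, sI, w', \<beta>, v, s0, s1, w} \<subseteq> F \<and> \<bar>bI\<bar> \<le> 4 * pw kt \<and>
     sg (Fin bI) = Fin vI \<and> sg' (Fin bI) = Fin sI \<and>
     sg (Fin w' \<otimes> Fin \<kappa> \<oplus> Fin \<beta>) = Fin 0 \<and> sg' (Fin w' \<otimes> Fin \<kappa> \<oplus> Fin \<beta>) = Fin s0 \<and>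
     sg (Fin w' \<otimes> Fin vI \<oplus> Fin \<beta>) = Fin v \<and> sg' (Fin w' \<otimes> Fin vI \<oplus> Fin \<beta>) = Fin s1 \<and>
     Fin w \<otimes> Fin v = Fin e \<and> fits s k e \<and>
     (\<forall>h\<in>F. \<bar>h\<bar> \<le> H \<longrightarrow> (\<exists>g t0 e0 t1 e1 t2 e2. Fin h \<otimes> Fin w = Fin g \<and>
        Fin g \<otimes> Fin s0 = Fin t0 \<and> Fin t0 \<otimes> Fin w' = Fin e0 \<and>
        Fin g \<otimes> Fin s1 = Fin t1 \<and> Fin t1 \<otimes> Fin w' = Fin e1 \<and>
        Fin e1 \<otimes> Fin sI = Fin t2 \<and> Fin t2 \<otimes> Fin (- K) = Fin e2)))"

text \<open>Each neuron ignores its input and is saturated by the bias - B, so the chain exists at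
  every depth and blocks all gradients. It fills up branches to a common depth.\<close>

lemma constant_chain:
  assumes "1 \<le> m" "sg (Fin (- B)) = Fin \<kappa>" "sg' (Fin (- B)) = Fin 0" "\<kappa> \<in> F"
  shows "\<exists>N. hnet m 1 N \<and> (\<forall>x\<in>grid M. \<forall>g\<in>F. gives N x [\<kappa>] [g] (\<lambda>_. []))"
  using assms(1)
proof (induction m rule: nat_induct_at_least)
  case base
  show ?case
    by (rule exI[of _ "[([replicate d 0], [- B])]"])
      (use hnet_const[of "- B"] gives_const[OF _ assms(2,3), of _ _ 0] assms(4) in \<open>auto simp: grid_def\<close>)
next
  case (Suc m)
  then obtain N where N: "hnet m 1 N" "\<forall>x\<in>grid M. \<forall>g\<in>F. gives N x [\<kappa>] [g] (\<lambda>_. [])" by blast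
  have y: "Fin 0 \<otimes> Fin \<kappa> \<oplus> Fin (- B) = Fin (- B)" by (simp add: R_F)
  have "layer_ok p q 1 1 ([[0]], [- B])" by (simp add: layer_ok_def)
  then have "hnet (Suc m) 1 (N @ [([[0]], [- B])])" using hnet_snoc[OF N(1) _ zero_less_one] by blast
  moreover have "gives (N @ [([[0]], [- B])]) x [\<kappa>] [g] (\<lambda>_. [])" if "x \<in> grid M" "g \<in> F" for x g
  proof -
    have "gives N x [\<kappa>] [0] (\<lambda>_. [])" using N(2) that zero_F by blast
    then show ?thesis by (rule gives_unary[where s = 0 and t = 0]) (use y assms that in auto)
  qed
  ultimately show ?case by blast
qed

end

text \<open>The interface through which activations enter. \<kappa> is the output of a closed gate.
  A gate on a gradient path has bias \<open>bp\<close>, hence value \<open>vp\<close> and slope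
  \<delta>, and its output weight is \<omega> or - \<omega>; \<open>path_out\<close> says that
  \<delta> undoes \<omega> exactly, so that the gate passes on the seed h itself, up to
  sign.\<close>

locale cells = net +
  fixes M H K \<kappa> \<omega> \<delta> bp vp :: real and kt :: int
  assumes kt: "emin q - P \<le> kt" "kt + 3 \<le> E" "int q \<le> kt"
    and neg_val: "\<And>v. neg v \<Longrightarrow> sg v = Fin \<kappa> \<and> sg' v = Fin 0"
    and const_F: "\<kappa> \<in> F" "K \<in> F" "\<omega> \<in> F" "\<delta> \<in> F" "bp \<in> F" "vp \<in> F" "\<bar>bp\<bar> \<le> 4 * pw kt"
    and detector: "\<And>m j z u. 6 \<le> m \<Longrightarrow> j < d \<Longrightarrow> z \<in> F \<Longrightarrow> \<bar>z\<bar> \<le> M \<Longrightarrow> \<exists>N. detects M K kt m j z u N"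
    and path: "\<And>m j x h s k. 7 \<le> m \<Longrightarrow> j < d \<Longrightarrow> x \<in> grid M \<Longrightarrow> h \<in> F \<Longrightarrow> h \<noteq> 0 \<Longrightarrow> \<bar>h\<bar> \<le> H \<Longrightarrow> s \<in> {1, -1} \<Longrightarrow>
      emin q - P \<le> k \<Longrightarrow> k \<le> E - P \<Longrightarrow> \<exists>N. path_relay M kt \<omega> m j x h s k N"
    and path_bias: "sg (Fin bp) = Fin vp" "sg' (Fin bp) = Fin \<delta>"
    and path_out: "\<And>h. h \<in> F \<Longrightarrow> \<bar>h\<bar> \<le> H \<Longrightarrow> \<exists>g e g'. Fin h \<otimes> Fin \<omega> = Fin g \<and> Fin g \<otimes> Fin \<delta> = Fin h \<and> Fin h \<otimes> Fin (- K) = Fin e \<and>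
      Fin h \<otimes> Fin (- \<omega>) = Fin (- g) \<and> Fin (- g) \<otimes> Fin \<delta> = Fin (- h) \<and> Fin (- h) \<otimes> Fin (- K) = Fin g'"
    and path_val: "\<And>v. v \<in> {vp, \<kappa>} \<Longrightarrow> \<exists>y. Fin \<omega> \<otimes> Fin v = Fin y \<and> Fin (- \<omega>) \<otimes> Fin v = Fin (- y)"
    and cell: "\<And>s k. s \<in> {1, -1} \<Longrightarrow> emin q - P \<le> k \<Longrightarrow> k \<le> E - P \<Longrightarrow> value_cell H K kt \<kappa> s k"
begin

lemma minus_const_F: "- K \<in> F" "- \<omega> \<in> F"
  using const_F by simp_all

text \<open>For p = 2 a significand has three bits, so integers up to 7 are covered by
  \<open>small_mult_F\<close>, while 8 is treated as a power of two.\<close>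

lemma tau_F: "n \<le> 8 \<Longrightarrow> - (real n * pw kt) \<in> F"
proof -
  assume "n \<le> 8"
  then consider "n \<le> 7" | "n = 8" by linarith
  then show ?thesis
  proof cases
    case 1
    then show ?thesis using small_mult_F[of "int n" kt] kt by simp
  next
    case 2
    have "pw (kt + 3) \<in> F" using kt by (intro pw_F) auto
    then show ?thesis using 2 by (simp add: pw_add mult.commute)
  qed
qed

text \<open>Sums are measured against thresholds that are floats, because rounding cannot carry a
  number across a float: an upper bound of this form survives every addition.\<close>

definition below :: "nat \<Rightarrow> ext \<Rightarrow> bool" where
  "below n s \<longleftrightarrow> s = NInf \<or> (\<exists>r\<in>F. s = Fin r \<and> r \<le> - (real n * pw kt))"

lemma below_add:
  assumes "below m s" "y \<le> (real m - real n) * pw kt" "n \<le> 8"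
  shows "below n (s \<oplus> Fin y)"
proof (cases "s = NInf")
  case False
  then obtain r where r: "s = Fin r" "r \<le> - (real m * pw kt)" using assms(1) by (auto simp: below_def)
  have "r + y \<le> - (real n * pw kt)" using r assms(2) by (simp add: algebra_simps)
  then show ?thesis using r(1) tau_F[OF assms(3)]
    by (auto simp: below_def elim!: R_upper[of "r + y" "- (real n * pw kt)"])
qed (simp add: below_def)

lemma below_fold:
  assumes "below n s" "n \<le> 8" "\<And>t. t \<in> set ts \<Longrightarrow> \<exists>y. t = Fin y \<and> y \<le> 0"
  shows "below n (fold_add s ts)"
  using assms(1,3)
proof (induction ts arbitrary: s)
  case (Cons t ts)
  obtain y where "t = Fin y" "y \<le> 0" using Cons.prems by auto
  then have "below n (s \<oplus> t)" using below_add[OF Cons.prems(1) _ assms(2), of y] by simp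
  then show ?case using Cons by simp
qed simp

text \<open>The other terms are only known to be nonpositive, so one pass over the detectors is
  credited with a single unit; several units are obtained by repeating the pass.\<close>

lemma below_pass:
  assumes "below n s" "n < 8" "\<And>t. t \<in> set ts \<Longrightarrow> \<exists>y. t = Fin y \<and> y \<le> 0" "Fin y \<in> set ts" "y \<le> - pw kt"
  shows "below (Suc n) (fold_add s ts)"
proof -
  obtain xs ys where ts: "ts = xs @ Fin y # ys" using assms(4) by (meson split_list)
  have "below n (fold_add s xs)" using assms(1-3) ts by (intro below_fold) auto
  then have "below (Suc n) (fold_add s xs \<oplus> Fin y)"
    using assms(2,5) by (intro below_add[of n]) (auto simp: algebra_simps)
  then show ?thesis unfolding ts using assms(2,3) ts by simp (intro below_fold, auto)
qed

lemma below_passes: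
  assumes "n \<le> 8" "\<And>t. t \<in> set ts \<Longrightarrow> \<exists>y. t = Fin y \<and> y \<le> 0" "Fin y \<in> set ts" "y \<le> - pw kt"
  shows "below n (fold_add (Fin 0) (concat (replicate n ts)))"
  using assms(1)
proof (induction n)
  case 0
  then show ?case by (simp add: below_def)
next
  case (Suc n)
  have "concat (replicate (Suc n) ts) = concat (replicate n ts) @ ts"
    by (metis append_Nil2 concat.simps concat_append replicate_Suc replicate_append_same)
  then show ?case using below_pass[OF _ _ assms(2-4), of n] Suc by simp
qed

lemma below_neg: "below 2 s \<Longrightarrow> neg s"
proof -
  have "B \<le> pw kt" unfolding B_def using kt by (subst pw_le_iff)
  moreover have "0 < pw kt" by simp
  ultimately have "- (2 * pw kt) \<le> - B" by linarith
  then have "- (real 2 * pw kt) \<le> - B" by simp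
  then show "below 2 s \<Longrightarrow> neg s" unfolding below_def neg_def by (meson order_trans)
qed

abbreviation X where "X \<equiv> grid M"

lemma Xnth: "x \<in> X \<Longrightarrow> j < d \<Longrightarrow> x ! j \<in> F \<and> \<bar>x ! j\<bar> \<le> M"
proof -
  assume "x \<in> X" "j < d"
  then have "x ! j \<in> F \<inter> {-M..M}" unfolding grid_def using nth_mem by blast
  then show ?thesis by auto
qed

lemma concat_replicate_replicate: "concat (replicate n (replicate k z)) = replicate (n * k) z"
  by (induction n) (simp_all add: replicate_add)

lemma detector_list:
  assumes "6 \<le> m" "x0 \<in> X"
  shows "\<exists>Ns. (\<forall>N\<in>set Ns. hnet m 1 N) \<and> (\<forall>g\<in>F. allg Ns x0 (replicate (length Ns) 0) (replicate (length Ns) g) (\<lambda>_. [])) \<and>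
    (\<forall>x\<in>X. x \<noteq> x0 \<longrightarrow> (\<exists>vs. length vs = length Ns \<and> allg Ns x vs (replicate (length Ns) 0) (\<lambda>_. []) \<and>
       below 8 (fold_add (Fin 0) (map (\<lambda>v. Fin (- K) \<otimes> Fin v) vs))))"
proof -
  obtain dN where dN: "\<And>j u. j < d \<Longrightarrow> detects M K kt m j (x0 ! j) u (dN j u)"
  proof -
    have "\<forall>j u. \<exists>N. j < d \<longrightarrow> detects M K kt m j (x0 ! j) u N"
      using detector[OF assms(1)] Xnth[OF assms(2)] by blast
    then show ?thesis using that by metis
  qed
  define Ds where "Ds = map (\<lambda>(j, u). dN j u) (List.product [0..<d] [True, False])"
  have DsE: "\<exists>j u. j < d \<and> N = dN j u" if "N \<in> set Ds" for N using that by (auto simp: Ds_def)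
  have hD: "\<forall>N\<in>set Ds. hnet m 1 N" using DsE dN unfolding detects_def by metis
  have K0: "Fin (- K) \<otimes> Fin 0 = Fin 0" by simp
  have one: "\<exists>v. gives N x [v] [0] (\<lambda>_. []) \<and> (\<exists>e. Fin (- K) \<otimes> Fin v = Fin e \<and> e \<le> 0)" if N: "N \<in> set Ds" and x: "x \<in> X" for N x
  proof -
    obtain j u where ju: "j < d" "N = dN j u" using DsE[OF N] by blast
    have "0 < pw kt" by simp
    show ?thesis
    proof (cases "fires u (x0 ! j) (x ! j)")
      case True
      then have "\<exists>v e. gives N x [v] [0] (\<lambda>_. []) \<and> Fin (- K) \<otimes> Fin v = Fin e \<and> e \<le> - pw kt"
        using bspec[OF conjunct2[OF dN[OF ju(1), of u, unfolded detects_def]] x] True ju(2) by simp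
      then show ?thesis using \<open>0 < pw kt\<close> by (meson neg_le_0_iff_le order_less_imp_le order_trans)
    next
      case False
      then have "gives N x [0] [0] (\<lambda>_. [])"
        using bspec[OF conjunct2[OF dN[OF ju(1), of u, unfolded detects_def]] x] False ju(2) zero_F by simp
      then show ?thesis using K0 by blast
    qed
  qed
  have rep_allg: "allg (concat (replicate n Ds)) x (concat (replicate n vs)) (replicate (n * length Ds) g) (\<lambda>_. [])"
    if "allg Ds x vs (replicate (length Ds) g) (\<lambda>_. [])" for n x vs g
  proof (induction n)
    case 0
    then show ?case by (simp add: allg.Nil)
  next
    case (Suc n)
    from allg_append[OF that Suc] show ?case by (simp add: replicate_add)
  qed
  \<comment> \<open>Eight units are the budget of \<open>gate_ex\<close>: one may be lost to each
    twin feature and four to the bias, and the remaining two reach below - B.\<close>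
  define Ns where "Ns = concat (replicate 8 Ds)"
  have len: "length Ns = 8 * length Ds" by (simp add: Ns_def length_concat sum_list_replicate)
  have on: "allg Ns x0 (replicate (length Ns) 0) (replicate (length Ns) g) (\<lambda>_. [])" if g: "g \<in> F" for g
  proof -
    have "allg Ds' x0 (replicate (length Ds') 0) (replicate (length Ds') g) (\<lambda>_. [])" if "set Ds' \<subseteq> set Ds" for Ds'
      using that
    proof (induction Ds')
      case (Cons N Ds')
      obtain j u where ju: "j < d" "N = dN j u" using DsE[of N] Cons.prems by (metis list.set_intros(1) subsetD)
      have "gives N x0 [0] [g] (\<lambda>_. [])" using bspec[OF conjunct2[OF dN[OF ju(1), of u, unfolded detects_def]] assms(2)] g ju(2)
        by (simp add: fires_def)
      from allg.Cons[OF this Cons.IH] Cons.prems show ?case by simp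
    qed (simp add: allg.Nil)
    from rep_allg[OF this[OF order_refl], of 8, unfolded concat_replicate_replicate] show ?thesis
      unfolding len unfolding Ns_def .
  qed
  have off: "\<exists>vs. length vs = length Ns \<and> allg Ns x vs (replicate (length Ns) 0) (\<lambda>_. []) \<and>
       below 8 (fold_add (Fin 0) (map (\<lambda>v. Fin (- K) \<otimes> Fin v) vs))" if x: "x \<in> X" "x \<noteq> x0" for x
  proof -
    have "length x = length x0" using x assms(2) by (simp add: grid_def)
    then obtain j where j: "j < d" "x ! j \<noteq> x0 ! j" using x assms(2) nth_equalityI[of x x0] by (auto simp: grid_def)
    define u where "u \<longleftrightarrow> x0 ! j < x ! j"
    have "dN j u \<in> set Ds" using j(1) by (cases u) (force simp: Ds_def)+
    have f: "fires u (x0 ! j) (x ! j)" using j(2) by (auto simp: fires_def u_def)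
    obtain v0 e0 where v0: "gives (dN j u) x [v0] [0] (\<lambda>_. [])" "Fin (- K) \<otimes> Fin v0 = Fin e0" "e0 \<le> - pw kt"
    proof -
      have "\<exists>v e. gives (dN j u) x [v] [0] (\<lambda>_. []) \<and> Fin (- K) \<otimes> Fin v = Fin e \<and> e \<le> - pw kt"
        using bspec[OF conjunct2[OF dN[OF j(1), of u, unfolded detects_def]] x(1)] f by simp
      then show ?thesis using that by blast
    qed
    have "0 < pw kt" by simp
    then have e00: "e0 \<le> 0" using v0(3) by linarith
    obtain V where V: "\<And>N. N \<in> set Ds \<Longrightarrow> gives N x [V N] [0] (\<lambda>_. []) \<and> (\<exists>e. Fin (- K) \<otimes> Fin (V N) = Fin e \<and> e \<le> 0)"
      using one[OF _ x(1)] by metis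
    define V' where "V' = V(dN j u := v0)"
    have V': "gives N x [V' N] [0] (\<lambda>_. []) \<and> (\<exists>e. Fin (- K) \<otimes> Fin (V' N) = Fin e \<and> e \<le> 0)" if "N \<in> set Ds" for N
      using V[OF that] v0 e00 by (auto simp: V'_def)
    define vs where "vs = map V' Ds"
    have "allg Ds' x (map V' Ds') (replicate (length Ds') 0) (\<lambda>_. [])" if "set Ds' \<subseteq> set Ds" for Ds'
      using that
    proof (induction Ds')
      case (Cons N Ds')
      then have "N \<in> set Ds" "set Ds' \<subseteq> set Ds" by auto
      from allg.Cons[OF conjunct1[OF V'[OF this(1)]] Cons.IH[OF this(2)]] show ?case by simp
    qed (simp add: allg.Nil)
    from rep_allg[OF this[OF order_refl], of 8]
    have A: "allg Ns x (concat (replicate 8 vs)) (replicate (length Ns) 0) (\<lambda>_. [])"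
      unfolding len unfolding Ns_def vs_def by simp
    let ?ts = "map (\<lambda>v. Fin (- K) \<otimes> Fin v) vs"
    have "below 8 (fold_add (Fin 0) (concat (replicate 8 ?ts)))"
    proof (rule below_passes)
      show "\<exists>y. t = Fin y \<and> y \<le> 0" if "t \<in> set ?ts" for t using that V' by (auto simp: vs_def)
      show "Fin e0 \<in> set ?ts" using \<open>dN j u \<in> set Ds\<close> v0(2)
        by (force simp: vs_def V'_def simp del: fmul.simps intro!: image_eqI[of _ _ "dN j u"])
    qed (use v0(3) in auto)
    moreover have "concat (replicate 8 ?ts) = map (\<lambda>v. Fin (- K) \<otimes> Fin v) (concat (replicate 8 vs))"
      by (simp add: map_concat)
    moreover have "length (concat (replicate 8 vs)) = length Ns" by (simp add: len length_concat sum_list_replicate vs_def)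
    ultimately show ?thesis using A by metis
  qed
  have "\<forall>N\<in>set Ns. hnet m 1 N" using hD by (auto simp: Ns_def)
  then show ?thesis using on off by blast
qed

definition gate_on :: "real list \<Rightarrow> real \<Rightarrow> real \<Rightarrow> layer list \<Rightarrow> layer list \<Rightarrow> bool" where
  "gate_on x0 W b Rl N \<longleftrightarrow> (\<forall>r r' y v s g t e f f' D. gives Rl x0 [r, r'] [f, f'] D \<and>
     Fin W \<otimes> Fin r = Fin y \<and> Fin (- W) \<otimes> Fin r' = Fin (- y) \<and> sg (Fin b) = Fin v \<and> sg' (Fin b) = Fin s \<and>
     v \<in> F \<and> s \<in> F \<and> g \<in> F \<and> Fin g \<otimes> Fin s = Fin t \<and> Fin t \<otimes> Fin (- K) = Fin e \<and>
     Fin t \<otimes> Fin W = Fin f \<and> Fin t \<otimes> Fin (- W) = Fin f' \<longrightarrow> gives N x0 [v] [g] D)"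

lemma gate_onD:
  assumes "gate_on x0 W b Rl N" "gives Rl x0 [r, r'] [f, f'] D" "Fin W \<otimes> Fin r = Fin y" "Fin (- W) \<otimes> Fin r' = Fin (- y)"
    "sg (Fin b) = Fin v" "sg' (Fin b) = Fin s" "v \<in> F" "s \<in> F" "g \<in> F" "Fin g \<otimes> Fin s = Fin t"
    "Fin t \<otimes> Fin (- K) = Fin e" "Fin t \<otimes> Fin W = Fin f" "Fin t \<otimes> Fin (- W) = Fin f'"
  shows "gives N x0 [v] [g] D"
  by (rule assms(1)[unfolded gate_on_def, rule_format]) (intro conjI, (rule assms)+)

text \<open>At \<open>x0\<close> the running sum is y, then y - y = 0, then b, all without rounding
  error, so the gate is driven by its bias alone and cannot see what the relay computed. Elsewhere
  the detectors outweigh relay and bias together.\<close>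

lemma gate_ex:
  assumes "6 \<le> m" "x0 \<in> X" "relays M kt m W Rl" "b \<in> F" "\<bar>b\<bar> \<le> 4 * pw kt"
  obtains N where "hnet (Suc m) 1 N" "\<And>x g. x \<in> X \<Longrightarrow> x \<noteq> x0 \<Longrightarrow> g \<in> F \<Longrightarrow> gives N x [\<kappa>] [g] (\<lambda>_. [])"
    "gate_on x0 W b Rl N"
proof -
  obtain Ns where Ns: "\<And>N. N \<in> set Ns \<Longrightarrow> hnet m 1 N"
    "\<And>g. g \<in> F \<Longrightarrow> allg Ns x0 (replicate (length Ns) 0) (replicate (length Ns) g) (\<lambda>_. [])"
    "\<And>x. x \<in> X \<Longrightarrow> x \<noteq> x0 \<Longrightarrow> \<exists>vs. length vs = length Ns \<and> allg Ns x vs (replicate (length Ns) 0) (\<lambda>_. []) \<and>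
       below 8 (fold_add (Fin 0) (map (\<lambda>v. Fin (- K) \<otimes> Fin v) vs))"
    using detector_list[OF assms(1,2)] by metis
  have hR: "hnet m 2 Rl" and WF: "W \<in> F" using assms(3) by (auto simp: relays_def)
  define ws where "ws = replicate (length Ns) (- K) @ [W, - W]"
  define N1 where "N1 = foldr par Ns Rl"
  define N where "N = N1 @ [([ws], [b])]"
  have wsF: "set ws \<subseteq> F" using minus_const_F WF by (auto simp: ws_def)
  have h1: "hnet m (length Ns + 2) N1" unfolding N1_def using hnet_foldr_par[OF hR Ns(1)] by blast
  have "layer_ok p q (length Ns + 2) 1 ([ws], [b])" using layer_ok_row[OF wsF assms(4)] by (simp add: ws_def)
  then have hN: "hnet (Suc m) 1 N" unfolding N_def using hnet_snoc[OF h1 _ zero_less_one] by blast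
  have dot: "dot ws (map Fin (vs @ [r, r'])) = fold_add (Fin 0) (map (\<lambda>v. Fin (- K) \<otimes> Fin v) vs) \<oplus> (Fin W \<otimes> Fin r) \<oplus> (Fin (- W) \<otimes> Fin r')"
    if "length vs = length Ns" for vs r r'
  proof -
    have "map2 (\<otimes>) (map Fin (replicate (length Ns) (- K))) (map Fin vs) = map (\<lambda>v. Fin (- K) \<otimes> Fin v) vs"
      using that by (auto intro!: nth_equalityI)
    then show ?thesis using that unfolding dot_def fsum_def ws_def by (simp del: map_replicate fmul.simps)
  qed
  have off: "gives N x [\<kappa>] [g] (\<lambda>_. [])" if x: "x \<in> X" "x \<noteq> x0" and g: "g \<in> F" for x g
  proof -
    obtain vs where vs: "length vs = length Ns" "allg Ns x vs (replicate (length Ns) 0) (\<lambda>_. [])"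
      "below 8 (fold_add (Fin 0) (map (\<lambda>v. Fin (- K) \<otimes> Fin v) vs))" using Ns(3) x by blast
    obtain r r' y y' where r: "gives Rl x [r, r'] [0, 0] (\<lambda>_. [])" "Fin W \<otimes> Fin r = Fin y" "Fin (- W) \<otimes> Fin r' = Fin y'"
      "\<bar>y\<bar> \<le> pw kt" "\<bar>y'\<bar> \<le> pw kt" using assms(3) x unfolding relays_def by blast
    let ?S = "dot ws (map Fin (vs @ [r, r']))"
    have "below 7 (fold_add (Fin 0) (map (\<lambda>v. Fin (- K) \<otimes> Fin v) vs) \<oplus> Fin y)"
      by (rule below_add[OF vs(3)]) (use r(4) in auto)
    then have "below 6 (fold_add (Fin 0) (map (\<lambda>v. Fin (- K) \<otimes> Fin v) vs) \<oplus> Fin y \<oplus> Fin y')"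
      by (rule below_add) (use r(5) in auto)
    then have "below 6 ?S" using dot[OF vs(1)] r(2,3) by simp
    then have "below 2 (?S \<oplus> Fin b)" by (rule below_add) (use assms(5) in auto)
    then have n: "sg (?S \<oplus> Fin b) = Fin \<kappa>" "sg' (?S \<oplus> Fin b) = Fin 0" using neg_val below_neg by blast+
    have "gives N1 x (vs @ [r, r']) (replicate (length Ns) 0 @ [0, 0]) (\<lambda>_. [])"
      using gives_foldr_par[OF hR vs(2) r(1) Ns(1)] by (simp add: N1_def)
    moreover have "list_all2 (\<lambda>w g. Fin 0 \<otimes> Fin w = Fin g) ws (replicate (length Ns) 0 @ [0, 0])"
      unfolding ws_def by (intro list_all2_appendI) (simp_all add: list_all2_conv_all_nth[of _ "replicate _ _"])
    moreover have "length ws = length (vs @ [r, r'])" using vs(1) by (simp add: ws_def)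
    ultimately show ?thesis unfolding N_def using n g const_F(1)
      by (intro gives_row[where s = 0 and t = 0]) auto
  qed
  have on: "gives N x0 [v] [g] D" if r: "gives Rl x0 [r, r'] [f, f'] D" and y: "Fin W \<otimes> Fin r = Fin y" "Fin (- W) \<otimes> Fin r' = Fin (- y)"
    and v: "sg (Fin b) = Fin v" "sg' (Fin b) = Fin s" "v \<in> F" "s \<in> F" "g \<in> F" "Fin g \<otimes> Fin s = Fin t"
    and t: "Fin t \<otimes> Fin (- K) = Fin e" "Fin t \<otimes> Fin W = Fin f" "Fin t \<otimes> Fin (- W) = Fin f'" for r r' y v s g t e f f' D
  proof -
    have eF: "e \<in> F" using fmul_EE[of "Fin t" "Fin (- K)"] unfolding t by simp
    have yF: "y \<in> F" using fmul_EE[of "Fin W" "Fin r"] unfolding y by simp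
    have "set (map (\<lambda>v. Fin (- K) \<otimes> Fin v) (replicate (length Ns) 0)) \<subseteq> {Fin 0}" by auto
    then have "fold_add (Fin 0) (map (\<lambda>v. Fin (- K) \<otimes> Fin v) (replicate (length Ns) 0)) = Fin 0"
      by (intro fold_zeros) auto
    then have S: "dot ws (map Fin (replicate (length Ns) 0 @ [r, r'])) \<oplus> Fin b = Fin b"
      using dot[of "replicate (length Ns) 0" r r'] y yF assms(4) by (simp add: R_F del: fmul.simps)
    have "gives N1 x0 (replicate (length Ns) 0 @ [r, r']) (replicate (length Ns) e @ [f, f']) D"
      using gives_foldr_par[OF hR Ns(2)[OF eF] r Ns(1)] by (simp add: N1_def)
    moreover have "list_all2 (\<lambda>w g. Fin t \<otimes> Fin w = Fin g) ws (replicate (length Ns) e @ [f, f'])"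
      unfolding ws_def by (intro list_all2_appendI) (use t in \<open>simp_all add: list_all2_conv_all_nth[of _ "replicate _ _"] del: fmul.simps\<close>)
    moreover have "length ws = length (replicate (length Ns) 0 @ [r, r'])" by (simp add: ws_def)
    moreover have "sg (dot ws (map Fin (replicate (length Ns) 0 @ [r, r'])) \<oplus> Fin b) = Fin v"
      "sg' (dot ws (map Fin (replicate (length Ns) 0 @ [r, r'])) \<oplus> Fin b) = Fin s" unfolding S by (rule v)+
    ultimately show ?thesis unfolding N_def using v(3-6)
      by (intro gives_row[where s = s and t = t])
  qed
  have "gate_on x0 W b Rl N" unfolding gate_on_def
    by (intro allI impI, elim conjE) (rule on)
  then show ?thesis using that[of N] hN off by blast
qed

lemma dummy_chain: "1 \<le> m \<Longrightarrow> \<exists>N. hnet m 1 N \<and> (\<forall>x\<in>X. \<forall>g\<in>F. gives N x [\<kappa>] [g] (\<lambda>_. []))"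
  using constant_chain[of m \<kappa> M] neg_val[of "Fin (- B)"] const_F(1) by (simp add: neg_def)

text \<open>With weight 0 this gives gates without a path to the input the same form as the
  others.\<close>

lemma dummy_relay:
  assumes "1 \<le> m"
  shows "\<exists>N. relays M kt m 0 N \<and> (\<forall>x\<in>X. \<forall>g\<in>F. \<forall>g'\<in>F. gives N x [\<kappa>, \<kappa>] [g, g'] (\<lambda>_. []))"
proof -
  obtain N where N: "hnet m 1 N" "\<forall>x\<in>X. \<forall>g\<in>F. gives N x [\<kappa>] [g] (\<lambda>_. [])" using dummy_chain[OF assms] by blast
  have g: "gives (par N N) x [\<kappa>, \<kappa>] [g, g'] (\<lambda>_. [])" if "x \<in> X" "g \<in> F" "g' \<in> F" for x g g'
    using gives_par[OF N(1,1), of x "[\<kappa>]" "[g]" "\<lambda>_. []" "[\<kappa>]" "[g']" "\<lambda>_. []"] N(2) that by simp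
  have "hnet m 2 (par N N)" using hnet_par[OF N(1,1)] by (simp add: numeral_2_eq_2)
  then have "relays M kt m 0 (par N N)" unfolding relays_def using g by (auto intro!: exI[of _ \<kappa>])
  then show ?thesis using g by blast
qed

text \<open>A unit pairs a one-feature network with its weight in the output layer. Its terms in the
  output sum and in the gradient sums are collected in the order of the list.\<close>

inductive ugives :: "(layer list \<times> real) list \<Rightarrow> real list \<Rightarrow> real \<Rightarrow> real list \<Rightarrow> (nat \<Rightarrow> real list) \<Rightarrow> bool" where
  Nil: "ugives [] x h [] (\<lambda>_. [])"
| Cons: "gives N x [v] [g] D \<Longrightarrow> Fin h \<otimes> Fin w = Fin g \<Longrightarrow> Fin w \<otimes> Fin v = Fin f \<Longrightarrow> ugives us x h fs Ds \<Longrightarrow>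
    ugives ((N, w) # us) x h (f # fs) (\<lambda>j. D j @ Ds j)"

lemma ugives_append: "ugives us x h fs D \<Longrightarrow> ugives us' x h fs' D' \<Longrightarrow> ugives (us @ us') x h (fs @ fs') (\<lambda>j. D j @ D' j)"
  by (induction rule: ugives.induct) (auto dest: ugives.Cons)

lemma ugives_single: "gives N x [v] [g] D \<Longrightarrow> Fin h \<otimes> Fin w = Fin g \<Longrightarrow> Fin w \<otimes> Fin v = Fin f \<Longrightarrow> ugives [(N, w)] x h [f] D"
  using ugives.Cons[OF _ _ _ ugives.Nil, of N x v g D h w f] by simp

lemma ugives_allg:
  "ugives us x h fs D \<Longrightarrow> \<exists>vs gs. allg (map fst us) x vs gs D \<and> length vs = length us \<and>
     list_all2 (\<lambda>w g. Fin h \<otimes> Fin w = Fin g) (map snd us) gs \<and> map2 (\<otimes>) (map Fin (map snd us)) (map Fin vs) = map Fin fs"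
proof (induction rule: ugives.induct)
  case (Cons N x v g D h w f us fs Ds)
  then obtain vs gs where "allg (map fst us) x vs gs Ds" "length vs = length us"
    "list_all2 (\<lambda>w g. Fin h \<otimes> Fin w = Fin g) (map snd us) gs" "map2 (\<otimes>) (map Fin (map snd us)) (map Fin vs) = map Fin fs" by blast
  then show ?case using Cons.hyps allg.Cons[OF Cons.hyps(1)]
    by (intro exI[of _ "v # vs"] exI[of _ "g # gs"]) (simp del: fmul.simps)
qed (auto intro: allg.Nil)

definition units_ok :: "nat \<Rightarrow> (layer list \<times> real) list \<Rightarrow> bool" where
  "units_ok L us \<longleftrightarrow> (\<forall>(N, w)\<in>set us. hnet (L - 1) 1 N \<and> w \<in> F)"

lemma units_ok_append: "units_ok L us \<Longrightarrow> units_ok L us' \<Longrightarrow> units_ok L (us @ us')"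
  by (auto simp: units_ok_def)

text \<open>The gate \<open>NP\<close> carries the path to coordinate j, the gate \<open>NQ\<close>
  does not. Both have the same bias and the same value at every grid point, and opposite output
  weights, so they cancel in the value while only \<open>NP\<close> reaches the gradient.\<close>

lemma path_unit:
  assumes "9 \<le> L" "x0 \<in> X" "j < d" "s \<in> {1, -1}" "emin q - P \<le> k" "k \<le> E - P"
    and hs: "\<And>x. x \<in> X \<Longrightarrow> hs x \<in> F \<and> \<bar>hs x\<bar> \<le> H" and "hs x0 \<noteq> 0"
  shows "\<exists>us. units_ok L us \<and> (\<forall>x\<in>X. \<exists>y D. y \<in> F \<and> ugives us x (hs x) [y, - y] D \<and>
     (if x = x0 then \<exists>e. fits s k e \<and> D = (\<lambda>i. if i = j then [e] else []) else D = (\<lambda>_. [])))"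
proof -
  \<comment> \<open>The gate and the output layer come after the relay.\<close>
  define m where "m = L - 2"
  have m: "7 \<le> m" "6 \<le> m" "1 \<le> m" "L - 1 = Suc m" using assms(1) by (auto simp: m_def)
  obtain Rl where Rl: "path_relay M kt \<omega> m j x0 (hs x0) s k Rl"
    using path[OF m(1) assms(3,2)] hs[OF assms(2)] assms by blast
  then obtain r r' y f f' e where rr: "Fin \<omega> \<otimes> Fin r = Fin y" "Fin (- \<omega>) \<otimes> Fin r' = Fin (- y)" "Fin (hs x0) \<otimes> Fin \<omega> = Fin f"
    "Fin (hs x0) \<otimes> Fin (- \<omega>) = Fin f'" "gives Rl x0 [r, r'] [f, f'] (\<lambda>i. if i = j then [e] else [])" "fits s k e"
    and Rl': "relays M kt m \<omega> Rl" unfolding path_relay_def by blast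
  obtain Dm where Dm: "relays M kt m 0 Dm" "\<forall>x\<in>X. \<forall>g\<in>F. \<forall>g'\<in>F. gives Dm x [\<kappa>, \<kappa>] [g, g'] (\<lambda>_. [])"
    using dummy_relay[OF m(3)] by blast
  obtain NP where NP: "hnet (Suc m) 1 NP" "\<And>x g. x \<in> X \<Longrightarrow> x \<noteq> x0 \<Longrightarrow> g \<in> F \<Longrightarrow> gives NP x [\<kappa>] [g] (\<lambda>_. [])"
    "gate_on x0 \<omega> bp Rl NP"
    using gate_ex[OF m(2) assms(2) Rl' const_F(5,7)] by blast
  obtain NQ where NQ: "hnet (Suc m) 1 NQ" "\<And>x g. x \<in> X \<Longrightarrow> x \<noteq> x0 \<Longrightarrow> g \<in> F \<Longrightarrow> gives NQ x [\<kappa>] [g] (\<lambda>_. [])"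
    "gate_on x0 0 bp Dm NQ"
    using gate_ex[OF m(2) assms(2) Dm(1) const_F(5,7)] by blast
  define us where "us = [(NP, \<omega>), (NQ, - \<omega>)]"
  have "units_ok L us" using NP NQ const_F minus_const_F m(4) by (simp add: units_ok_def us_def)
  moreover have "\<exists>y D. y \<in> F \<and> ugives us x (hs x) [y, - y] D \<and>
     (if x = x0 then \<exists>e. fits s k e \<and> D = (\<lambda>i. if i = j then [e] else []) else D = (\<lambda>_. []))" if x: "x \<in> X" for x
  proof -
    obtain g e1 e2 where g: "Fin (hs x) \<otimes> Fin \<omega> = Fin g" "Fin g \<otimes> Fin \<delta> = Fin (hs x)" "Fin (hs x) \<otimes> Fin (- K) = Fin e1"
      "Fin (hs x) \<otimes> Fin (- \<omega>) = Fin (- g)" "Fin (- g) \<otimes> Fin \<delta> = Fin (- hs x)" "Fin (- hs x) \<otimes> Fin (- K) = Fin e2"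
      using path_out hs[OF x] by blast
    have gF: "g \<in> F" using fmul_EE[of "Fin (hs x)" "Fin \<omega>"] unfolding g by simp
    define v where "v = (if x = x0 then vp else \<kappa>)"
    obtain y where y: "Fin \<omega> \<otimes> Fin v = Fin y" "Fin (- \<omega>) \<otimes> Fin v = Fin (- y)" 
    proof -
      have "v \<in> {vp, \<kappa>}" by (simp add: v_def)
      then show ?thesis using path_val that by blast
    qed
    have yF: "y \<in> F" using fmul_EE[of "Fin \<omega>" "Fin v"] unfolding y by simp
    define D :: "nat \<Rightarrow> real list" where "D = (if x = x0 then (\<lambda>i. if i = j then [e] else []) else (\<lambda>_. []))"
    have P: "gives NP x [v] [g] D"
    proof (cases "x = x0")
      case True
      show ?thesis using gate_onD[OF NP(3) rr(5,1,2) path_bias const_F(6,4) gF] g rr True by (simp add: v_def D_def del: fmul.simps)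
    qed (use NP(2) x gF in \<open>simp add: v_def D_def\<close>)
    have Q: "gives NQ x [v] [- g] (\<lambda>_. [])"
    proof (cases "x = x0")
      case True
      have d: "gives Dm x0 [\<kappa>, \<kappa>] [0, 0] (\<lambda>_. [])" using Dm(2) assms(2) zero_F by blast
      have y0: "Fin 0 \<otimes> Fin \<kappa> = Fin 0" "Fin (- 0) \<otimes> Fin \<kappa> = Fin (- 0)" by simp_all
      have "- g \<in> F" using gF by simp
      from gate_onD[OF NQ(3) d y0 path_bias const_F(6,4) this g(5) g(6)] True show ?thesis by (simp add: v_def)
    qed (use NQ(2) x gF in \<open>simp add: v_def\<close>)
    have "ugives us x (hs x) [y, - y] (\<lambda>i. D i @ [])"
      unfolding us_def by (rule ugives.Cons[OF P g(1) y(1) ugives_single[OF Q g(4) y(2)]])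
    then show ?thesis using yF rr(6) by (intro exI[of _ y] exI[of _ D]) (auto simp: D_def)
  qed
  ultimately show ?thesis by blast
qed

text \<open>A closed gate outputs \<kappa>, which may be - 1; the additional neuron turns it into an
  exact 0. At \<open>x0\<close> a gradient may pass through the open gate, but it ends in the
  detectors and the dummy relay.\<close>

lemma value_unit:
  assumes "9 \<le> L" "x0 \<in> X" "s \<in> {1, -1}" "emin q - P \<le> k" "k \<le> E - P"
    and hs: "\<And>x. x \<in> X \<Longrightarrow> hs x \<in> F \<and> \<bar>hs x\<bar> \<le> H"
  shows "\<exists>us. units_ok L us \<and> (\<forall>x\<in>X. \<exists>f. ugives us x (hs x) [f] (\<lambda>_. []) \<and> (if x = x0 then fits s k f else f = 0))"
proof -
  \<comment> \<open>The gate, the correcting neuron and the output layer come after the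
    detectors.\<close>
  define m where "m = L - 3"
  have m: "6 \<le> m" "1 \<le> m" "L - 1 = Suc (Suc m)" using assms(1) by (auto simp: m_def)
  obtain bI vI sI w' \<beta> v s0 s1 w e where c: "{bI, vI, sI, w', \<beta>, v, s0, s1, w} \<subseteq> F" "\<bar>bI\<bar> \<le> 4 * pw kt"
     "sg (Fin bI) = Fin vI" "sg' (Fin bI) = Fin sI"
     "sg (Fin w' \<otimes> Fin \<kappa> \<oplus> Fin \<beta>) = Fin 0" "sg' (Fin w' \<otimes> Fin \<kappa> \<oplus> Fin \<beta>) = Fin s0"
     "sg (Fin w' \<otimes> Fin vI \<oplus> Fin \<beta>) = Fin v" "sg' (Fin w' \<otimes> Fin vI \<oplus> Fin \<beta>) = Fin s1"
     "Fin w \<otimes> Fin v = Fin e" "fits s k e"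
     "\<forall>h\<in>F. \<bar>h\<bar> \<le> H \<longrightarrow> (\<exists>g t0 e0 t1 e1 t2 e2. Fin h \<otimes> Fin w = Fin g \<and>
        Fin g \<otimes> Fin s0 = Fin t0 \<and> Fin t0 \<otimes> Fin w' = Fin e0 \<and>
        Fin g \<otimes> Fin s1 = Fin t1 \<and> Fin t1 \<otimes> Fin w' = Fin e1 \<and>
        Fin e1 \<otimes> Fin sI = Fin t2 \<and> Fin t2 \<otimes> Fin (- K) = Fin e2)"
    using cell[OF assms(3-5)] unfolding value_cell_def by (elim exE conjE) (rule that)
  obtain Dm where Dm: "relays M kt m 0 Dm" "\<forall>x\<in>X. \<forall>g\<in>F. \<forall>g'\<in>F. gives Dm x [\<kappa>, \<kappa>] [g, g'] (\<lambda>_. [])"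
    using dummy_relay[OF m(2)] by blast
  have bI: "bI \<in> F" using c(1) by simp
  obtain N0 where N0: "hnet (Suc m) 1 N0" "\<And>x g. x \<in> X \<Longrightarrow> x \<noteq> x0 \<Longrightarrow> g \<in> F \<Longrightarrow> gives N0 x [\<kappa>] [g] (\<lambda>_. [])"
    "gate_on x0 0 bI Dm N0"
    using gate_ex[OF m(1) assms(2) Dm(1) bI c(2)] by blast
  define N where "N = N0 @ [([[w']], [\<beta>])]"
  have "layer_ok p q 1 1 ([[w']], [\<beta>])" using c(1) by (simp add: layer_ok_def)
  then have hN: "hnet (L - 1) 1 N" unfolding N_def m(3) using hnet_snoc[OF N0(1) _ zero_less_one] by blast
  have "\<exists>f. ugives [(N, w)] x (hs x) [f] (\<lambda>_. []) \<and> (if x = x0 then fits s k f else f = 0)" if x: "x \<in> X" for x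
  proof -
    obtain g t0 e0 t1 e1 t2 e2 where g: "Fin (hs x) \<otimes> Fin w = Fin g"
      "Fin g \<otimes> Fin s0 = Fin t0" "Fin t0 \<otimes> Fin w' = Fin e0" "Fin g \<otimes> Fin s1 = Fin t1" "Fin t1 \<otimes> Fin w' = Fin e1"
      "Fin e1 \<otimes> Fin sI = Fin t2" "Fin t2 \<otimes> Fin (- K) = Fin e2" using c(11) hs[OF x] by blast
    have gF: "g \<in> F" using fmul_EE[of "Fin (hs x)" "Fin w"] unfolding g by simp
    have e0F: "e0 \<in> F" using fmul_EE[of "Fin t0" "Fin w'"] unfolding g by simp
    have e1F: "e1 \<in> F" using fmul_EE[of "Fin t1" "Fin w'"] unfolding g by simp
    show ?thesis
    proof (cases "x = x0")
      case True
      have d: "gives Dm x0 [\<kappa>, \<kappa>] [0, 0] (\<lambda>_. [])" using Dm(2) assms(2) zero_F by blast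
      have y0: "Fin 0 \<otimes> Fin \<kappa> = Fin 0" "Fin (- 0) \<otimes> Fin \<kappa> = Fin (- 0)" by simp_all
      have F2: "vI \<in> F" "sI \<in> F" using c(1) by auto
      have "gives N0 x0 [vI] [e1] (\<lambda>_. [])" using gate_onD[OF N0(3) d y0 c(3,4) F2 e1F g(6,7)] by simp
      then have "gives N x0 [v] [g] (\<lambda>_. [])" unfolding N_def
        by (rule gives_unary[where s = s1 and t = t1]) (use c(1,7,8) g gF in auto)
      from ugives_single[OF this _ c(9)] g(1) show ?thesis using True c(10) by auto
    next
      case False
      have "gives N0 x [\<kappa>] [e0] (\<lambda>_. [])" using N0(2) False x e0F by blast
      then have "gives N x [0] [g] (\<lambda>_. [])" unfolding N_def
        by (rule gives_unary[where s = s0 and t = t0]) (use c(1,5,6) g gF in auto)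
      from ugives_single[OF this g(1), of 0] show ?thesis using False by auto
    qed
  qed
  moreover have "units_ok L [(N, w)]" using hN c(1) by (simp add: units_ok_def)
  ultimately show ?thesis by blast
qed

end

section \<open>Collecting units over gaps, coordinates and grid points\<close>

context cells begin

lemma path_list:
  assumes "9 \<le> L" "x0 \<in> X" "j < d" "s \<in> {1, -1}"
    and hs: "\<And>x. x \<in> X \<Longrightarrow> hs x \<in> F \<and> \<bar>hs x\<bar> \<le> H" and "hs x0 \<noteq> 0"
    and "\<forall>k\<in>set ks. emin q - P \<le> k \<and> k \<le> E - P"
  shows "\<exists>us. units_ok L us \<and> (\<forall>x\<in>X. \<exists>fs D. ugives us x (hs x) fs D \<and> fold_add (Fin 0) (map Fin fs) = Fin 0 \<and>
     (if x = x0 then \<exists>es. list_all2 (fits s) ks es \<and> D = (\<lambda>i. if i = j then es else []) else D = (\<lambda>_. [])))"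
  using assms(7)
proof (induction ks)
  case Nil
  show ?case
    by (rule exI[of _ "[]"]) (auto simp: units_ok_def intro!: exI[of _ "[]"] exI[of _ "\<lambda>_. []"] ugives.Nil)
next
  case (Cons k ks)
  then obtain us where us: "units_ok L us" "\<And>x. x \<in> X \<Longrightarrow> \<exists>fs D. ugives us x (hs x) fs D \<and> fold_add (Fin 0) (map Fin fs) = Fin 0 \<and>
     (if x = x0 then \<exists>es. list_all2 (fits s) ks es \<and> D = (\<lambda>i. if i = j then es else []) else D = (\<lambda>_. []))"
    by auto
  obtain us' where us': "units_ok L us'" "\<And>x. x \<in> X \<Longrightarrow> \<exists>y D. y \<in> F \<and> ugives us' x (hs x) [y, - y] D \<and>
     (if x = x0 then \<exists>e. fits s k e \<and> D = (\<lambda>i. if i = j then [e] else []) else D = (\<lambda>_. []))"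
    using path_unit[of L x0 j s k hs] assms Cons.prems by auto
  have "\<exists>fs D. ugives (us' @ us) x (hs x) fs D \<and> fold_add (Fin 0) (map Fin fs) = Fin 0 \<and>
     (if x = x0 then \<exists>es. list_all2 (fits s) (k # ks) es \<and> D = (\<lambda>i. if i = j then es else []) else D = (\<lambda>_. []))" if x: "x \<in> X" for x
  proof -
    obtain fs D where 1: "ugives us x (hs x) fs D" "fold_add (Fin 0) (map Fin fs) = Fin 0"
      "if x = x0 then \<exists>es. list_all2 (fits s) ks es \<and> D = (\<lambda>i. if i = j then es else []) else D = (\<lambda>_. [])" using us(2)[OF x] by blast
    obtain y D' where 2: "y \<in> F" "ugives us' x (hs x) [y, - y] D'"
      "if x = x0 then \<exists>e. fits s k e \<and> D' = (\<lambda>i. if i = j then [e] else []) else D' = (\<lambda>_. [])" using us'(2)[OF x] by blast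
    \<comment> \<open>The two terms are adjacent in the output sum, and the sum is 0 when they
      arrive, so they cancel without rounding.\<close>
    have z: "fold_add (Fin 0) (map Fin ([y, - y] @ fs)) = Fin 0" using 1(2) 2(1) by (simp add: R_F)
    show ?thesis
    proof (cases "x = x0")
      case True
      then obtain es e where e: "list_all2 (fits s) ks es" "D = (\<lambda>i. if i = j then es else [])" "fits s k e"
        "D' = (\<lambda>i. if i = j then [e] else [])" using 1(3) 2(3) by auto
      have "(\<lambda>i. D' i @ D i) = (\<lambda>i. if i = j then e # es else [])" unfolding e by auto
      then have "ugives (us' @ us) x (hs x) ([y, - y] @ fs) (\<lambda>i. if i = j then e # es else [])"
        using ugives_append[OF 2(2) 1(1)] by simp
      moreover have "list_all2 (fits s) (k # ks) (e # es)" using e by simp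
      ultimately show ?thesis unfolding if_P[OF True] using z by blast
    next
      case False
      then have "(\<lambda>i. D' i @ D i) = (\<lambda>_. [])" using 1(3) 2(3) by auto
      then have "ugives (us' @ us) x (hs x) ([y, - y] @ fs) (\<lambda>_. [])" using ugives_append[OF 2(2) 1(1)] by simp
      then show ?thesis unfolding if_not_P[OF False] using z by blast
    qed
  qed
  then show ?case using units_ok_append[OF us'(1) us(1)] by blast
qed

lemma gradient_prefix:
  assumes "9 \<le> L" "x0 \<in> X" "n \<le> d" "length t = d" "set t \<subseteq> F"
    and hs: "\<And>x. x \<in> X \<Longrightarrow> hs x \<in> F \<and> \<bar>hs x\<bar> \<le> H" and "hs x0 \<noteq> 0"
  shows "\<exists>us. units_ok L us \<and> (\<forall>x\<in>X. \<exists>fs D. ugives us x (hs x) fs D \<and> fold_add (Fin 0) (map Fin fs) = Fin 0 \<and>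
     (if x = x0 then \<forall>i. if i < n then fold_add (Fin 0) (map Fin (D i)) = Fin (t ! i) else D i = [] else D = (\<lambda>_. [])))"
  using assms(3)
proof (induction n)
  case 0
  show ?case
    by (rule exI[of _ "[]"]) (auto simp: units_ok_def intro!: exI[of _ "[]"] exI[of _ "\<lambda>_. []"] ugives.Nil)
next
  case (Suc n)
  then have nd: "n < d" by simp
  obtain us where us: "units_ok L us" "\<And>x. x \<in> X \<Longrightarrow> \<exists>fs D. ugives us x (hs x) fs D \<and> fold_add (Fin 0) (map Fin fs) = Fin 0 \<and>
     (if x = x0 then \<forall>i. if i < n then fold_add (Fin 0) (map Fin (D i)) = Fin (t ! i) else D i = [] else D = (\<lambda>_. []))"
    using Suc by auto
  have "t ! n \<in> F" using assms(4,5) nd nth_mem by blast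
  then obtain ks s where ks: "s \<in> {1, -1}" "\<forall>k\<in>set ks. emin q - P \<le> k \<and> k \<le> E - P"
    "\<And>cs. list_all2 (fits s) ks cs \<Longrightarrow> fold_add (Fin 0) (map Fin cs) = Fin (t ! n)"
    using fits_fold by blast
  obtain us' where us': "units_ok L us'" "\<And>x. x \<in> X \<Longrightarrow> \<exists>fs D. ugives us' x (hs x) fs D \<and> fold_add (Fin 0) (map Fin fs) = Fin 0 \<and>
     (if x = x0 then \<exists>es. list_all2 (fits s) ks es \<and> D = (\<lambda>i. if i = n then es else []) else D = (\<lambda>_. []))"
    using path_list[where hs = hs, OF assms(1,2) nd ks(1) hs assms(7) ks(2)] by blast
  have "\<exists>fs D. ugives (us @ us') x (hs x) fs D \<and> fold_add (Fin 0) (map Fin fs) = Fin 0 \<and>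
     (if x = x0 then \<forall>i. if i < Suc n then fold_add (Fin 0) (map Fin (D i)) = Fin (t ! i) else D i = [] else D = (\<lambda>_. []))" if x: "x \<in> X" for x
  proof -
    obtain fs D where 1: "ugives us x (hs x) fs D" "fold_add (Fin 0) (map Fin fs) = Fin 0"
      "if x = x0 then \<forall>i. if i < n then fold_add (Fin 0) (map Fin (D i)) = Fin (t ! i) else D i = [] else D = (\<lambda>_. [])" using us(2)[OF x] by blast
    obtain fs' D' where 2: "ugives us' x (hs x) fs' D'" "fold_add (Fin 0) (map Fin fs') = Fin 0"
      "if x = x0 then \<exists>es. list_all2 (fits s) ks es \<and> D' = (\<lambda>i. if i = n then es else []) else D' = (\<lambda>_. [])" using us'(2)[OF x] by blast
    have z: "fold_add (Fin 0) (map Fin (fs @ fs')) = Fin 0" using 1(2) 2(2) by simp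
    show ?thesis
    proof (cases "x = x0")
      case True
      then obtain es where e: "list_all2 (fits s) ks es" "D' = (\<lambda>i. if i = n then es else [])" using 2(3) by auto
      have D: "if i < n then fold_add (Fin 0) (map Fin (D i)) = Fin (t ! i) else D i = []" for i using 1(3) True by simp
      have "if i < Suc n then fold_add (Fin 0) (map Fin (D i @ D' i)) = Fin (t ! i) else D i @ D' i = []" for i
        using D[of i] ks(3)[OF e(1)] unfolding e(2) by (auto split: if_splits)
      then have "\<forall>i. if i < Suc n then fold_add (Fin 0) (map Fin (D i @ D' i)) = Fin (t ! i) else D i @ D' i = []" by blast
      then show ?thesis unfolding if_P[OF True] using ugives_append[OF 1(1) 2(1)] z by blast
    next
      case False
      then have "(\<lambda>i. D i @ D' i) = (\<lambda>_. [])" using 1(3) 2(3) by auto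
      then have "ugives (us @ us') x (hs x) (fs @ fs') (\<lambda>_. [])" using ugives_append[OF 1(1) 2(1)] by simp
      then show ?thesis unfolding if_not_P[OF False] using z by blast
    qed
  qed
  then show ?case using units_ok_append[OF us(1) us'(1)] by blast
qed

text \<open>Units of different grid points do not interfere although the sum is not associative: at
  a given x all units except those for x contribute empty lists.\<close>

lemma gradient_all:
  assumes "9 \<le> L" "set xs \<subseteq> X" "distinct xs"
    and hs: "\<And>x. x \<in> X \<Longrightarrow> hs x \<in> F \<and> \<bar>hs x\<bar> \<le> H"
    and gst: "\<And>x. x \<in> X \<Longrightarrow> length (gst x) = d \<and> set (gst x) \<subseteq> F \<and> (hs x = 0 \<longrightarrow> gst x = replicate d 0)"
  shows "\<exists>us. units_ok L us \<and> (\<forall>x\<in>X. \<exists>fs D. ugives us x (hs x) fs D \<and> fold_add (Fin 0) (map Fin fs) = Fin 0 \<and>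
     (if x \<in> set xs then \<forall>i<d. fold_add (Fin 0) (map Fin (D i)) = Fin (gst x ! i) else \<forall>i<d. D i = []))"
  using assms(2,3)
proof (induction xs)
  case Nil
  show ?case
    by (rule exI[of _ "[]"]) (auto simp: units_ok_def intro!: exI[of _ "[]"] exI[of _ "\<lambda>_. []"] ugives.Nil)
next
  case (Cons x0 xs)
  then have x0: "x0 \<in> X" "x0 \<notin> set xs" by auto
  obtain us where us: "units_ok L us" "\<And>x. x \<in> X \<Longrightarrow> \<exists>fs D. ugives us x (hs x) fs D \<and> fold_add (Fin 0) (map Fin fs) = Fin 0 \<and>
     (if x \<in> set xs then \<forall>i<d. fold_add (Fin 0) (map Fin (D i)) = Fin (gst x ! i) else \<forall>i<d. D i = [])"
    using Cons by auto
  have "\<exists>us'. units_ok L us' \<and> (\<forall>x\<in>X. \<exists>fs D. ugives us' x (hs x) fs D \<and> fold_add (Fin 0) (map Fin fs) = Fin 0 \<and>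
     (if x = x0 then \<forall>i<d. fold_add (Fin 0) (map Fin (D i)) = Fin (gst x0 ! i) else D = (\<lambda>_. [])))"
  \<comment> \<open>Nothing nonzero can be made from a zero seed; here the assumption on
    \<open>gst\<close> asks for zeros only, and the empty list of units serves.\<close>
  proof (cases "hs x0 = 0")
    case True
    then have "gst x0 = replicate d 0" using gst x0 by blast
    then show ?thesis
      by (intro exI[of _ "[]"]) (auto simp: units_ok_def intro!: exI[of _ "[]"] exI[of _ "\<lambda>_. []"] ugives.Nil)
  next
    case False
    have gs: "length (gst x0) = d" "set (gst x0) \<subseteq> F" using gst x0 by blast+
    obtain us' where u: "units_ok L us'" "\<And>x. x \<in> X \<Longrightarrow> \<exists>fs D. ugives us' x (hs x) fs D \<and> fold_add (Fin 0) (map Fin fs) = Fin 0 \<and>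
     (if x = x0 then \<forall>i. if i < d then fold_add (Fin 0) (map Fin (D i)) = Fin (gst x0 ! i) else D i = [] else D = (\<lambda>_. []))"
      using gradient_prefix[where hs = hs, OF assms(1) x0(1) order_refl gs hs False] by blast
    have "\<exists>fs D. ugives us' x (hs x) fs D \<and> fold_add (Fin 0) (map Fin fs) = Fin 0 \<and>
     (if x = x0 then \<forall>i<d. fold_add (Fin 0) (map Fin (D i)) = Fin (gst x0 ! i) else D = (\<lambda>_. []))" if x: "x \<in> X" for x
      using u(2)[OF x] by (elim exE conjE) (intro exI conjI, assumption, assumption, auto split: if_splits)
    then show ?thesis using u(1) by blast
  qed
  then obtain us' where us': "units_ok L us'" "\<And>x. x \<in> X \<Longrightarrow> \<exists>fs D. ugives us' x (hs x) fs D \<and> fold_add (Fin 0) (map Fin fs) = Fin 0 \<and>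
     (if x = x0 then \<forall>i<d. fold_add (Fin 0) (map Fin (D i)) = Fin (gst x0 ! i) else D = (\<lambda>_. []))" by blast
  have "\<exists>fs D. ugives (us @ us') x (hs x) fs D \<and> fold_add (Fin 0) (map Fin fs) = Fin 0 \<and>
     (if x \<in> set (x0 # xs) then \<forall>i<d. fold_add (Fin 0) (map Fin (D i)) = Fin (gst x ! i) else \<forall>i<d. D i = [])" if x: "x \<in> X" for x
  proof -
    obtain fs D where 1: "ugives us x (hs x) fs D" "fold_add (Fin 0) (map Fin fs) = Fin 0"
      "if x \<in> set xs then \<forall>i<d. fold_add (Fin 0) (map Fin (D i)) = Fin (gst x ! i) else \<forall>i<d. D i = []" using us(2)[OF x] by blast
    obtain fs' D' where 2: "ugives us' x (hs x) fs' D'" "fold_add (Fin 0) (map Fin fs') = Fin 0"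
      "if x = x0 then \<forall>i<d. fold_add (Fin 0) (map Fin (D' i)) = Fin (gst x0 ! i) else D' = (\<lambda>_. [])" using us'(2)[OF x] by blast
    have z: "fold_add (Fin 0) (map Fin (fs @ fs')) = Fin 0" using 1(2) 2(2) by simp
    have "if x \<in> set (x0 # xs) then \<forall>i<d. fold_add (Fin 0) (map Fin (D i @ D' i)) = Fin (gst x ! i) else \<forall>i<d. D i @ D' i = []"
      using 1(3) 2(3) x0(2) by (cases "x = x0"; cases "x \<in> set xs") auto
    then show ?thesis using ugives_append[OF 1(1) 2(1)] z by blast
  qed
  then show ?case using units_ok_append[OF us(1) us'(1)] by blast
qed

lemma value_list:
  assumes "9 \<le> L" "x0 \<in> X" "s \<in> {1, -1}"
    and hs: "\<And>x. x \<in> X \<Longrightarrow> hs x \<in> F \<and> \<bar>hs x\<bar> \<le> H"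
    and "\<forall>k\<in>set ks. emin q - P \<le> k \<and> k \<le> E - P"
  shows "\<exists>us. units_ok L us \<and> (\<forall>x\<in>X. \<exists>fs. ugives us x (hs x) fs (\<lambda>_. []) \<and>
     (if x = x0 then list_all2 (fits s) ks fs else set fs \<subseteq> {0}))"
  using assms(5)
proof (induction ks)
  case Nil
  show ?case
    by (rule exI[of _ "[]"]) (auto simp: units_ok_def intro!: exI[of _ "[]"] ugives.Nil)
next
  case (Cons k ks)
  then obtain us where us: "units_ok L us" "\<And>x. x \<in> X \<Longrightarrow> \<exists>fs. ugives us x (hs x) fs (\<lambda>_. []) \<and>
     (if x = x0 then list_all2 (fits s) ks fs else set fs \<subseteq> {0})" by auto
  obtain us' where us': "units_ok L us'" "\<And>x. x \<in> X \<Longrightarrow> \<exists>f. ugives us' x (hs x) [f] (\<lambda>_. []) \<and> (if x = x0 then fits s k f else f = 0)"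
    using value_unit[of L x0 s k hs] assms Cons.prems by auto
  have "\<exists>fs. ugives (us' @ us) x (hs x) fs (\<lambda>_. []) \<and>
     (if x = x0 then list_all2 (fits s) (k # ks) fs else set fs \<subseteq> {0})" if x: "x \<in> X" for x
  proof -
    obtain fs where 1: "ugives us x (hs x) fs (\<lambda>_. [])" "if x = x0 then list_all2 (fits s) ks fs else set fs \<subseteq> {0}" using us(2)[OF x] by blast
    obtain f where 2: "ugives us' x (hs x) [f] (\<lambda>_. [])" "if x = x0 then fits s k f else f = 0" using us'(2)[OF x] by blast
    show ?thesis using ugives_append[OF 2(1) 1(1)] 1(2) 2(2) by (intro exI[of _ "f # fs"]) auto
  qed
  then show ?case using units_ok_append[OF us'(1) us(1)] by blast
qed

lemma value_all:
  assumes "9 \<le> L" "set xs \<subseteq> X" "distinct xs"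
    and hs: "\<And>x. x \<in> X \<Longrightarrow> hs x \<in> F \<and> \<bar>hs x\<bar> \<le> H" and fst': "\<And>x. x \<in> X \<Longrightarrow> fst' x \<in> F"
  shows "\<exists>us. units_ok L us \<and> (\<forall>x\<in>X. \<exists>fs. ugives us x (hs x) fs (\<lambda>_. []) \<and>
     (if x \<in> set xs then fold_add (Fin 0) (map Fin fs) = Fin (fst' x) else set fs \<subseteq> {0}))"
  using assms(2,3)
proof (induction xs)
  case Nil
  show ?case
    by (rule exI[of _ "[]"]) (auto simp: units_ok_def intro!: exI[of _ "[]"] ugives.Nil)
next
  case (Cons x0 xs)
  then have x0: "x0 \<in> X" "x0 \<notin> set xs" by auto
  obtain us where us: "units_ok L us" "\<And>x. x \<in> X \<Longrightarrow> \<exists>fs. ugives us x (hs x) fs (\<lambda>_. []) \<and>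
     (if x \<in> set xs then fold_add (Fin 0) (map Fin fs) = Fin (fst' x) else set fs \<subseteq> {0})" using Cons by auto
  obtain ks s where ks: "s \<in> {1, -1}" "\<forall>k\<in>set ks. emin q - P \<le> k \<and> k \<le> E - P"
    "\<And>cs. list_all2 (fits s) ks cs \<Longrightarrow> fold_add (Fin 0) (map Fin cs) = Fin (fst' x0)"
    using fits_fold[OF fst'[OF x0(1)]] by blast
  obtain us' where us': "units_ok L us'" "\<And>x. x \<in> X \<Longrightarrow> \<exists>fs. ugives us' x (hs x) fs (\<lambda>_. []) \<and>
     (if x = x0 then list_all2 (fits s) ks fs else set fs \<subseteq> {0})"
    using value_list[where hs = hs, OF assms(1) x0(1) ks(1) hs ks(2)] by blast
  have "\<exists>fs. ugives (us @ us') x (hs x) fs (\<lambda>_. []) \<and>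
     (if x \<in> set (x0 # xs) then fold_add (Fin 0) (map Fin fs) = Fin (fst' x) else set fs \<subseteq> {0})" if x: "x \<in> X" for x
  proof -
    obtain fs where 1: "ugives us x (hs x) fs (\<lambda>_. [])"
      "if x \<in> set xs then fold_add (Fin 0) (map Fin fs) = Fin (fst' x) else set fs \<subseteq> {0}" using us(2)[OF x] by blast
    obtain fs' where 2: "ugives us' x (hs x) fs' (\<lambda>_. [])" "if x = x0 then list_all2 (fits s) ks fs' else set fs' \<subseteq> {0}" using us'(2)[OF x] by blast
    have z: "fold_add v (map Fin gs) = v" if "set gs \<subseteq> {0}" "v \<in> EE" for v gs using that by (intro fold_zeros) auto
    have "if x \<in> set (x0 # xs) then fold_add (Fin 0) (map Fin (fs @ fs')) = Fin (fst' x) else set (fs @ fs') \<subseteq> {0}"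
      using 1(2) 2(2) x0(2) ks(3)[of fs'] z[of fs "Fin 0"] z[of fs' "Fin (fst' x)"] fst'[OF x]
      by (cases "x = x0"; cases "x \<in> set xs") auto
    moreover have "ugives (us @ us') x (hs x) (fs @ fs') (\<lambda>_. [])" using ugives_append[OF 1(1) 2(1)] by simp
    ultimately show ?thesis by blast
  qed
  then show ?case using units_ok_append[OF us(1) us'(1)] by blast
qed

lemma shape_dims:
  "shape m ls n \<Longrightarrow> \<exists>dims. length dims = length ls + 1 \<and> dims ! 0 = m \<and> dims ! length ls = n \<and>
     (\<forall>l<length ls. layer_ok p q (dims ! l) (dims ! Suc l) (ls ! l))"
proof (induction ls arbitrary: m)
  case Nil
  then show ?case by (intro exI[of _ "[m]"]) simp
next
  case (Cons l ls)
  then obtain k where k: "layer_ok p q m k l" "shape k ls n" by auto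
  from Cons.IH[OF k(2)] obtain dims where dims: "length dims = length ls + 1" "dims ! 0 = k" "dims ! length ls = n"
    "\<forall>l<length ls. layer_ok p q (dims ! l) (dims ! Suc l) (ls ! l)" by blast
  then show ?case using k(1)
    by (intro exI[of _ "m # dims"]) (auto simp: nth_Cons split: nat.splits)
qed

lemma finite_X: "finite X"
proof -
  have "X \<subseteq> {x. set x \<subseteq> F \<and> length x = d}" by (auto simp: grid_def)
  then show ?thesis using finite_lists_length_eq[OF finite_F] by (rule finite_subset)
qed

theorem memorise:
  assumes "9 \<le> L"
    and hs: "\<And>x. x \<in> X \<Longrightarrow> hs x \<in> F \<and> \<bar>hs x\<bar> \<le> H" and fst': "\<And>x. x \<in> X \<Longrightarrow> fst' x \<in> F"
    and gst: "\<And>x. x \<in> X \<Longrightarrow> length (gst x) = d \<and> set (gst x) \<subseteq> F \<and> (hs x = 0 \<longrightarrow> gst x = replicate d 0)"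
  shows "\<exists>ls. is_network p q d L ls \<and> (\<forall>x\<in>X. net_eval p q a ls (map Fin x) = [Fin (fst' x)] \<and>
     autodiff p q c a ls (map Fin x) [Fin (hs x)] = map Fin (gst x))"
proof -
  obtain xs where xs: "set xs = X" "distinct xs" using finite_distinct_list[OF finite_X] by blast
  obtain us1 where us1: "units_ok L us1" "\<And>x. x \<in> X \<Longrightarrow> \<exists>fs D. ugives us1 x (hs x) fs D \<and> fold_add (Fin 0) (map Fin fs) = Fin 0 \<and>
     (if x \<in> set xs then \<forall>i<d. fold_add (Fin 0) (map Fin (D i)) = Fin (gst x ! i) else \<forall>i<d. D i = [])"
    using gradient_all[where hs = hs and gst = gst, OF assms(1) _ xs(2) hs gst] xs(1) by blast
  obtain us2 where us2: "units_ok L us2" "\<And>x. x \<in> X \<Longrightarrow> \<exists>fs. ugives us2 x (hs x) fs (\<lambda>_. []) \<and>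
     (if x \<in> set xs then fold_add (Fin 0) (map Fin fs) = Fin (fst' x) else set fs \<subseteq> {0})"
    using value_all[where hs = hs and fst' = fst', OF assms(1) _ xs(2) hs fst'] xs(1) by blast
  \<comment> \<open>The gradient units come first: their output terms sum to an exact 0, from which
    the value terms start.\<close>
  define us where "us = us1 @ us2"
  have units_ok: "units_ok L us" unfolding us_def by (rule units_ok_append[OF us1(1) us2(1)])
  have "1 \<le> L - 1" using assms(1) by simp
  \<comment> \<open>A feature with output weight 0 keeps the last hidden layer nonempty even when
    the list of units is empty.\<close>
  from dummy_chain[OF this] obtain N0 where N0: "hnet (L - 1) 1 N0" "\<forall>x\<in>X. \<forall>g\<in>F. gives N0 x [\<kappa>] [g] (\<lambda>_. [])" by blast
  define N where "N = foldr par (map fst us) N0"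
  define ws where "ws = map snd us @ [0]"
  have hu: "hnet (L - 1) 1 M" if "M \<in> set (map fst us)" for M using that units_ok by (auto simp: units_ok_def)
  have hN: "hnet (L - 1) (length us + 1) N" 
  proof -
    have "hnet (L - 1) (length (map fst us) + 1) N" unfolding N_def by (rule hnet_foldr_par[OF N0(1) hu])
    then show ?thesis by simp
  qed
  have wsF: "set ws \<subseteq> F" using units_ok by (auto simp: ws_def units_ok_def)
  have lo: "layer_ok p q (length us + 1) 1 ([ws], [0])" using layer_ok_row[OF wsF zero_F] by (simp add: ws_def)
  define ls where "ls = N @ [([ws], [0])]"
  have "shape d ls 1" "length ls = L" using hN shape_snoc[OF _ lo zero_less_one] assms(1) unfolding hnet_def ls_def by auto
  then have net: "is_network p q d L ls" using shape_dims[of d ls 1] assms(1) unfolding is_network_def by auto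
  have "net_eval p q a ls (map Fin x) = [Fin (fst' x)] \<and> autodiff p q c a ls (map Fin x) [Fin (hs x)] = map Fin (gst x)"
    if x: "x \<in> X" for x
  proof -
    obtain fs1 D where 1: "ugives us1 x (hs x) fs1 D" "fold_add (Fin 0) (map Fin fs1) = Fin 0"
      "\<forall>i<d. fold_add (Fin 0) (map Fin (D i)) = Fin (gst x ! i)" using us1(2)[OF x] x xs by auto
    obtain fs2 where 2: "ugives us2 x (hs x) fs2 (\<lambda>_. [])" "fold_add (Fin 0) (map Fin fs2) = Fin (fst' x)"
      using us2(2)[OF x] x xs by auto
    have "ugives us x (hs x) (fs1 @ fs2) D" using ugives_append[OF 1(1) 2(1)] by (simp add: us_def)
    from ugives_allg[OF this] obtain vs gs where vg: "allg (map fst us) x vs gs D" "length vs = length us"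
     "list_all2 (\<lambda>w g. Fin (hs x) \<otimes> Fin w = Fin g) (map snd us) gs"
     "map2 (\<otimes>) (map Fin (map snd us)) (map Fin vs) = map Fin (fs1 @ fs2)" by blast
    have "gives N0 x [\<kappa>] [0] (\<lambda>_. [])" using N0(2) x zero_F by blast
    from gives_foldr_par[OF N0(1) vg(1) this hu]
    have gN: "gives N x (vs @ [\<kappa>]) (gs @ [0]) D" by (simp add: N_def)
    have lx: "length x = d" using x by (simp add: grid_def)
    have lw: "length ws = length us + 1" "0 < length us + 1" by (simp_all add: ws_def)
    have la: "list_all2 (\<lambda>w g. Fin (hs x) \<otimes> Fin w = Fin g) ws (gs @ [0])"
      unfolding ws_def using vg(3) by (intro list_all2_appendI) auto
    have "map2 (\<otimes>) (map Fin ws) (map Fin (vs @ [\<kappa>])) = map Fin (fs1 @ fs2) @ [Fin 0]"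
      using vg(2,4) unfolding ws_def by (simp del: map_map fmul.simps) simp
    then have "dot ws (map Fin (vs @ [\<kappa>])) = Fin (fst' x)"
      unfolding dot_def fsum_def using 1(2) 2(2) fst'[OF x] by (simp add: R_F)
    moreover have "map (\<lambda>j. fold_add (Fin 0) (map Fin (D j))) [0..<d] = map Fin (gst x)"
      using 1(3) gst[OF x] by (auto intro!: nth_equalityI)
    ultimately show ?thesis unfolding ls_def
      using gives_net[OF hN gN lx lw wsF la] by simp
  qed
  then show ?thesis using net by blast
qed

end

section \<open>Normalising and rescaling a gradient\<close>

context fp begin

lemma F_gt_pw:
  assumes "z \<in> F" "pw e < z" "emin q \<le> e"
  shows "pw e + pw (e - P) \<le> z"
proof -
  obtain n i where ne: "\<bar>n\<bar> < 2 ^ (p + 1)" "emin q - P \<le> i" "z = of_int n * pw i" using F_elim[OF assms(1)] by metis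
  have "e - P \<le> i"
  proof (rule ccontr)
    assume "\<not> ?thesis"
    then have "pw i \<le> pw (e - P - 1)" by (simp only: pw_le_iff)
    moreover have "real_of_int n \<le> 2 ^ (p + 1)" using ne(1) by (simp add: abs_less_iff) (metis of_int_less_iff of_int_mult of_int_numeral of_int_power order_less_imp_le)
    ultimately have "z \<le> 2 ^ (p + 1) * pw (e - P - 1)" unfolding ne(3) by (intro mult_mono) auto
    also have "\<dots> = pw (int (p + 1)) * pw (e - P - 1)" by (simp only: pw_nat)
    also have "\<dots> = pw e" by (simp only: pw_add[symmetric]) simp
    finally show False using assms(2) by simp
  qed
  define m where "m = nat (i - (e - P))"
  have i: "i = (e - P) + int m" using \<open>e - P \<le> i\<close> by (simp add: m_def)
  have z: "z = of_int (n * 2 ^ m) * pw (e - P)" unfolding ne(3) i pw_add by simp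
  have e: "pw e = of_int (2 ^ p) * pw (e - P)" using pw_add[of P "e - P"] by simp
  have "(2::int) ^ p < n * 2 ^ m" using assms(2) unfolding z e by (simp only: mult_less_cancel_right_pos pw_pos of_int_less_iff)
  then have "(2::int) ^ p + 1 \<le> n * 2 ^ m" by simp
  then have "of_int (2 ^ p + 1) * pw (e - P) \<le> of_int (n * 2 ^ m) * pw (e - P)"
    by (intro mult_right_mono) (simp_all only: of_int_le_iff pw_pos less_imp_le)
  then show ?thesis unfolding z e by (simp add: algebra_simps)
qed

lemma pw_bracket:
  fixes y :: real
  assumes "0 < y"
  obtains e where "pw e \<le> y" "y < pw (e + 1)"
proof -
  define e where "e = \<lfloor>log 2 y\<rfloor>"
  have "real_of_int e \<le> log 2 y" "log 2 y < real_of_int (e + 1)" by (simp_all add: e_def)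
  then have "2 powr real_of_int e \<le> y" "y < 2 powr real_of_int (e + 1)" using assms
    by (simp_all only: le_log_iff log_less_iff one_less_numeral_iff semiring_norm)
  then have "pw e \<le> y" "y < pw (e + 1)" using powr_real_of_int'[of 2 e] powr_real_of_int'[of 2 "e + 1"] by linarith+
  then show ?thesis using that by blast
qed

lemma small_frac_F:
  assumes "\<bar>n\<bar> \<le> 7" "emin q \<le> e - 3 + P" "e - 1 \<le> E"
  shows "of_int n / 8 * pw e \<in> F"
proof -
  have "of_int n / 8 * pw e = of_int n * pw (e - 3)" by (simp add: pw_diff)
  then show ?thesis using small_mult_F[OF assms(1), of "e - 3"] assms(2,3) by (simp only:)
qed

text \<open>Up to sign, w is 2^e / |h| rounded to p + 1 bits. The error of w changes the product by
  less than half the gap above 2^e, so the rounded product does not exceed 2^e. This side is the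
  delicate one, because an increment larger than its gap would not fit.\<close>

lemma normaliser:
  assumes h: "h \<in> F" "h \<noteq> 0" and s: "s \<in> {1, -1}"
  shows "\<exists>w e g. w \<in> F \<and> \<bar>w\<bar> \<le> pw (P + 6) \<and> R (h * w) = Fin g \<and> 7 / 8 * pw e \<le> s * g \<and> s * g \<le> pw e \<and>
     emin q + 4 \<le> e \<and> e \<le> E \<and> (e \<le> P + 6 \<or> pw e \<le> \<bar>h\<bar>)"
proof -
  have h0: "0 < \<bar>h\<bar>" using h by simp
  obtain e0 where e0: "pw e0 \<le> \<bar>h\<bar>" "\<bar>h\<bar> < pw (e0 + 1)" using pw_bracket[OF h0] by blast
  have "\<bar>h\<bar> \<in> F" using h by (simp add: abs_if)
  then have "\<eta> \<le> \<bar>h\<bar>" using F_pos_ge_\<eta> h0 by blast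
  then have "pw (emin q - P) < pw (e0 + 1)" using e0 unfolding \<eta>_def by linarith
  then have e0min: "emin q - P \<le> e0" unfolding pw_less_iff by simp
  have "pw e0 < 2 * pw E" using e0 F_abs_le[OF h(1)] Omega_bounds(2) by linarith
  then have "pw e0 < pw (E + 1)" by (simp add: pw_add)
  then have e0max: "e0 \<le> E" unfolding pw_less_iff by simp
  \<comment> \<open>For |h| < 1, possibly subnormal, the shift moves the product into the normal
    range; otherwise the exponent of h is kept.\<close>
  define b where "b = (if e0 < 0 then P + 6 else 0)"
  define e where "e = e0 + b"
  have eb: "emin q + 4 \<le> e" "e \<le> E" "e \<le> P + 6 \<or> pw e \<le> \<bar>h\<bar>" "0 \<le> b" "b \<le> P + 6"
    using e0min e0max e0 E_bounds P2 by (auto simp: e_def b_def emin_eq)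
  have pe: "pw e = pw e0 * pw b" by (simp add: e_def pw_add)
  define y where "y = pw e / \<bar>h\<bar> / pw (b - P - 1)"
  define n where "n = round y"
  define z where "z = of_int n * pw (b - P - 1)"
  have yeq: "y = pw e0 / \<bar>h\<bar> * 2 ^ (p + 1)" unfolding y_def pe by (simp add: pw_diff)
  have y2: "y \<le> 2 ^ (p + 1)"
  proof -
    have "pw e0 / \<bar>h\<bar> \<le> 1" using e0 h0 by simp
    then have "pw e0 / \<bar>h\<bar> * 2 ^ (p + 1) \<le> 1 * 2 ^ (p + 1)" by (intro mult_right_mono) auto
    then show ?thesis using yeq by simp
  qed
  have y1: "2 ^ p < y"
  proof -
    have "1 / 2 < pw e0 / \<bar>h\<bar>" using e0 h0 by (simp add: pw_add field_simps)
    then have "1 / 2 * 2 ^ (p + 1) < pw e0 / \<bar>h\<bar> * 2 ^ (p + 1)" by (intro mult_strict_right_mono) auto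
    then show ?thesis using yeq by simp
  qed
  have n: "\<bar>of_int n - y\<bar> \<le> 1 / 2" unfolding n_def by (rule of_int_round_abs_le)
  have "of_int n < (2::real) ^ (p + 1) + 1" using n y2 by linarith
  then have "real_of_int n < real_of_int (2 ^ (p + 1) + 1)" by simp
  then have n2: "n \<le> 2 ^ (p + 1)" by (simp only: of_int_less_iff)
  have "(4::real) \<le> 2 ^ p" using power_increasing[of 2 p "2::real"] p2 by simp
  then have "0 < real_of_int n" using n y1 by linarith
  then have n1: "0 < n" by simp
  have pb: "of_int (2 ^ (p + 1)) * pw (b - P - 1) = pw b" by (simp add: pw_diff)
  have zpw: "z \<le> pw b"
    unfolding z_def pb[symmetric] using n2 by (intro mult_right_mono) (simp_all only: of_int_le_iff pw_pos less_imp_le)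
  have z0: "0 < z" unfolding z_def using n1 by simp
  have bE: "b \<le> E" "emin q - P \<le> b - P - 1" using eb E_bounds by (simp_all add: b_def emin_eq)
  have zF: "z \<in> F"
  proof (cases "n = 2 ^ (p + 1)")
    case True
    then have "z = pw b" unfolding z_def pb[symmetric] by simp
    then show ?thesis using pw_F[of b] bE P2 by simp
  next
    case False
    have "pw b \<le> pw E" using bE by (simp add: pw_le_iff)
    then have "pw b \<le> Omega p q" using Omega_bounds(1) pw_pos[of E] by linarith
    then show ?thesis unfolding z_def using False n1 n2 bE zpw z0 unfolding z_def by (intro F_intro) auto
  qed
  have err: "\<bar>\<bar>h\<bar> * z - pw e\<bar> < pw (e - P) / 2"
  proof -
    have "\<bar>h\<bar> * z - pw e = \<bar>h\<bar> * pw (b - P - 1) * (of_int n - y)" unfolding z_def y_def using h0 by (simp add: field_simps)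
    then have "\<bar>\<bar>h\<bar> * z - pw e\<bar> = \<bar>h\<bar> * pw (b - P - 1) * \<bar>of_int n - y\<bar>" by (simp add: abs_mult)
    also have "\<dots> \<le> \<bar>h\<bar> * pw (b - P - 1) * (1 / 2)" using n by (intro mult_left_mono) auto
    also have "\<dots> < pw (e0 + 1) * pw (b - P - 1) * (1 / 2)" using e0 by (intro mult_strict_right_mono) auto
    also have "\<dots> = pw (e - P) / 2" unfolding e_def by (simp add: pw_add pw_diff)
    finally show ?thesis .
  qed
  have eP: "pw (e - P) \<le> pw e / 4"
  proof -
    have "pw (e - P) \<le> pw (e - 2)" using P2 by (simp only: pw_le_iff)
    then show ?thesis by (simp add: pw_diff)
  qed
  have "pw e \<le> pw E" using eb by (simp only: pw_le_iff)
  then have "\<bar>\<bar>h\<bar> * z\<bar> \<le> Omega p q" using err eP Omega_bounds(1) pw_pos[of e] by linarith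
  then obtain g where g: "R (\<bar>h\<bar> * z) = Fin g" using R_in_range by blast
  have "of_int 7 / 8 * pw e \<in> F" using eb P2 by (intro small_frac_F) auto
  moreover have "7 / 8 * pw e \<le> \<bar>h\<bar> * z" using err eP by linarith
  ultimately have g1: "7 / 8 * pw e \<le> g" using R_ge[OF g, of "7 / 8 * pw e"] by (simp only: of_int_numeral)
  have g2: "g \<le> pw e"
  proof (rule ccontr)
    assume "\<not> g \<le> pw e"
    then have "pw e + pw (e - P) \<le> g" using eb R_Fin_F[OF g] by (intro F_gt_pw) auto
    moreover have "pw e \<in> F" using eb P2 by (intro pw_F) auto
    then have "\<bar>g - \<bar>h\<bar> * z\<bar> \<le> \<bar>pw e - \<bar>h\<bar> * z\<bar>" by (rule R_near[OF g])
    ultimately show False using err by linarith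
  qed
  define w where "w = s * sgn h * z"
  have "R (h * w) = Fin (s * g)"
  proof -
    have "h * w = s * (\<bar>h\<bar> * z)" by (simp add: w_def abs_sgn mult_ac)
    then show ?thesis using s g R_minus_Fin[OF g] by auto
  qed
  moreover have "w \<in> F" using s h zF by (auto simp: w_def sgn_if)
  moreover have "\<bar>w\<bar> \<le> pw (P + 6)"
  proof -
    have "\<bar>w\<bar> = z" using s h z0 by (auto simp: w_def abs_mult sgn_if)
    moreover have "pw b \<le> pw (P + 6)" using eb by (simp only: pw_le_iff)
    ultimately show ?thesis using zpw by linarith
  qed
  ultimately show ?thesis using g1 g2 eb s by (intro exI[of _ w] exI[of _ e] exI[of _ "s * g"]) auto
qed

end

text \<open>A neuron with bias \<beta>, value \<rho> and slope \<delta> = 1 / \<omega> fed by twin neurons with weights w and -w: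
  its value is \<rho> again when the twins agree, and it multiplies the gradient by w * \<delta>.\<close>

locale relayer = net +
  fixes M \<omega> \<delta> \<rho> \<beta> :: real and J kt :: int and ok :: "real \<Rightarrow> bool"
  assumes \<omega>: "\<omega> \<in> {1, 4}" "\<delta> * \<omega> = 1"
    and rF: "\<rho> \<in> F" "\<beta> \<in> F" "\<delta> \<in> F"
    and bias: "sg (Fin \<beta>) = Fin \<rho>" "sg' (Fin \<beta>) = Fin \<delta>"
    and J: "P + 6 \<le> J" "2 * E + 2 \<le> 4 * (J - 2)" "J \<le> E" "pw J * \<bar>\<rho>\<bar> \<le> Omega p q"
    and ok: "ok \<rho>" "\<And>r. ok r \<Longrightarrow> \<omega> * \<bar>r\<bar> \<le> pw kt" "pw kt \<in> F"
    and forward: "\<And>r w. ok r \<Longrightarrow> w \<in> F \<Longrightarrow> \<bar>w\<bar> \<le> pw J \<Longrightarrow>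
      \<exists>y v s. (Fin w \<otimes> Fin r) \<oplus> (Fin (- w) \<otimes> Fin \<rho>) \<oplus> Fin \<beta> = y \<and> sg y = Fin v \<and> sg' y = Fin s \<and> v \<in> F \<and> s \<in> F \<and> ok v"
begin

text \<open>The gradient is stated as \<omega> * t because the twins have slope \<delta> = 1 /
  \<omega>: having passed their activation it is t and - t. Away from \<open>x0\<close> only the
  first feature may differ from \<rho>, and only within \<open>ok\<close>.\<close>

definition pstate :: "nat \<Rightarrow> layer list \<Rightarrow> real list \<Rightarrow> real \<Rightarrow> (nat \<Rightarrow> real list) \<Rightarrow> bool" where
  "pstate m N x0 t D \<longleftrightarrow> hnet m 2 N \<and> (\<forall>x\<in>grid M. \<exists>r. ok r \<and> gives N x [r, \<rho>] [0, 0] (\<lambda>_. [])) \<and>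
     gives N x0 [\<rho>, \<rho>] [\<omega> * t, - (\<omega> * t)] D"

lemma weight_rho: "w \<in> F \<Longrightarrow> \<bar>w\<bar> \<le> pw J \<Longrightarrow> \<exists>y\<in>F. Fin w \<otimes> Fin \<rho> = Fin y \<and> Fin (- w) \<otimes> Fin \<rho> = Fin (- y)"
proof -
  assume w: "w \<in> F" "\<bar>w\<bar> \<le> pw J"
  have "\<bar>w * \<rho>\<bar> \<le> pw J * \<bar>\<rho>\<bar>" unfolding abs_mult using w by (intro mult_right_mono) auto
  then obtain y where y: "R (w * \<rho>) = Fin y" using J(4) R_in_range[of "w * \<rho>"] by auto
  show ?thesis using y R_minus_Fin[OF y] R_Fin_F[OF y] by auto
qed

text \<open>Layers are added on the output side while the gradient runs towards the input: a new
  layer that receives \<omega> * t must deliver the \<omega> * t' on which the older layers rely,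
  hence the condition on \<open>t * w\<close>.\<close>

lemma pstate_step:
  assumes "pstate m N x0 t' D" "w \<in> F" "\<bar>w\<bar> \<le> pw J" "t \<in> F" "\<omega> * t \<in> F" "R (t * w) = Fin (\<omega> * t')"
  shows "pstate (Suc m) (N @ [relay_layer w \<beta>]) x0 t D"
proof -
  have h: "hnet m 2 N" and f: "\<forall>x\<in>grid M. \<exists>r. ok r \<and> gives N x [r, \<rho>] [0, 0] (\<lambda>_. [])"
    and g: "gives N x0 [\<rho>, \<rho>] [\<omega> * t', - (\<omega> * t')] D" using assms(1) by (auto simp: pstate_def)
  have "hnet (Suc m) 2 (N @ [relay_layer w \<beta>])" using layer_ok_relay[OF assms(2) rF(2)] hnet_snoc[OF h] by simp
  moreover have "\<exists>r. ok r \<and> gives (N @ [relay_layer w \<beta>]) x [r, \<rho>] [0, 0] (\<lambda>_. [])" if x: "x \<in> grid M" for x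
  proof -
    obtain r where r: "ok r" "gives N x [r, \<rho>] [0, 0] (\<lambda>_. [])" using f x by blast
    obtain y v s where y: "(Fin w \<otimes> Fin r) \<oplus> (Fin (- w) \<otimes> Fin \<rho>) \<oplus> Fin \<beta> = y" "sg y = Fin v" "sg' y = Fin s" "v \<in> F" "s \<in> F" "ok v"
      using forward[OF r(1) assms(2,3)] by blast
    have "gives (N @ [relay_layer w \<beta>]) x [v, \<rho>] [0, 0] (\<lambda>_. [])"
      by (rule gives_relay[OF r(2) y(1-3) bias rF(2) y(4,5) rF(1,3) zero_F zero_F, where t = 0 and t' = 0]) simp_all
    then show ?thesis using y(6) by blast
  qed
  moreover have "gives (N @ [relay_layer w \<beta>]) x0 [\<rho>, \<rho>] [\<omega> * t, - (\<omega> * t)] D"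
  proof -
    obtain y where y: "y \<in> F" "Fin w \<otimes> Fin \<rho> = Fin y" "Fin (- w) \<otimes> Fin \<rho> = Fin (- y)" using weight_rho[OF assms(2,3)] by blast
    have z: "(Fin w \<otimes> Fin \<rho>) \<oplus> (Fin (- w) \<otimes> Fin \<rho>) \<oplus> Fin \<beta> = Fin \<beta>" unfolding y using rF(2) by (simp add: R_F)
    have d: "\<omega> * t * \<delta> = t" using \<omega>(2) by (simp add: mult.commute mult.left_commute)
    have d1: "R (\<omega> * t * \<delta>) = Fin t" unfolding d by (rule R_F[OF assms(4)])
    have "- (\<omega> * t) * \<delta> = - t" using d by (simp only: mult_minus_left)
    then have d2: "R (- (\<omega> * t * \<delta>)) = Fin (- t)" using R_minus_Fin[OF d1] by blast
    have mF: "- (\<omega> * t) \<in> F" using assms(5) by simp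
    show ?thesis
      by (rule gives_relay[OF g z bias bias rF(2) rF(1,3) rF(1,3) assms(5) mF, where t = t and t' = "- t"])
        (use d1 d2 assms(6) R_minus_Fin[OF assms(6)] in simp_all)
  qed
  ultimately show ?thesis by (simp add: pstate_def)
qed

lemma omega_F: "pw (emin q) \<le> \<bar>t\<bar> \<Longrightarrow> t \<in> F \<Longrightarrow> \<omega> * \<bar>t\<bar> \<le> Omega p q \<Longrightarrow> \<omega> * t \<in> F"
  using \<omega>(1) F_scale_up[of t 2] by (auto simp: abs_mult mult.commute)

lemma omega_pw: "\<exists>l. (l = 0 \<or> l = 2) \<and> \<omega> = pw l"
proof -
  have "(4::real) = pw 2" by simp
  then show ?thesis using \<omega>(1) by (metis insertE power_int_0_right singletonD)
qed

text \<open>The shift by 2^i is spread over n layers, each taking at most J - 2; the 2 is room for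
  \<omega> in the weight. Every intermediate gradient lies between t and t' in magnitude, hence is
  normal and finite, so no step rounds.\<close>

lemma pstate_chain:
  assumes "pstate m N x0 t' D" "t' \<in> F" "pw (emin q) \<le> \<bar>t'\<bar>" "\<omega> * \<bar>t'\<bar> \<le> Omega p q"
    and "t \<in> F" "pw (emin q) \<le> \<bar>t\<bar>" "\<omega> * \<bar>t\<bar> \<le> Omega p q" "t' = t * pw i" "\<bar>i\<bar> \<le> int n * (J - 2)"
  shows "\<exists>N. pstate (m + n) N x0 t D"
  using assms(5-9)
proof (induction n arbitrary: t i)
  case 0
  then have "t = t'" by simp
  then show ?case using assms(1) by auto
next
  case (Suc n)
  have J0: "0 \<le> J - 2" using J(1) P2 by simp
  define i1 where "i1 = max (- (J - 2)) (min (J - 2) i)"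
  define i2 where "i2 = i - i1"
  define t1 where "t1 = t * pw i1"
  have i1: "\<bar>i1\<bar> \<le> J - 2" using J0 by (auto simp: i1_def)
  have "\<bar>i\<bar> \<le> int n * (J - 2) + (J - 2)" using Suc.prems(5) by (simp add: algebra_simps)
  moreover have "0 \<le> int n * (J - 2)" using J0 by simp
  ultimately have i2: "\<bar>i2\<bar> \<le> int n * (J - 2)" using J0 unfolding i2_def i1_def max_def min_def
    by (smt (verit))
  have t't: "t' = t1 * pw i2" by (simp add: t1_def i2_def Suc.prems(4) pw_diff)
  have tabs: "\<bar>t'\<bar> = \<bar>t\<bar> * pw i" "\<bar>t1\<bar> = \<bar>t\<bar> * pw i1" by (simp_all add: Suc.prems(4) t1_def abs_mult)
  have btw: "(\<bar>t\<bar> \<le> \<bar>t1\<bar> \<and> \<bar>t1\<bar> \<le> \<bar>t'\<bar>) \<or> (\<bar>t'\<bar> \<le> \<bar>t1\<bar> \<and> \<bar>t1\<bar> \<le> \<bar>t\<bar>)"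
  proof (cases "0 \<le> i")
    case True
    then have "0 \<le> i1" "i1 \<le> i" using J0 by (auto simp: i1_def)
    then have "pw 0 \<le> pw i1" "pw i1 \<le> pw i" by (simp_all only: pw_le_iff)
    then have "\<bar>t\<bar> * pw 0 \<le> \<bar>t\<bar> * pw i1" "\<bar>t\<bar> * pw i1 \<le> \<bar>t\<bar> * pw i" by (intro mult_left_mono; simp)+
    then show ?thesis unfolding tabs by simp
  next
    case False
    then have "i1 \<le> 0" "i \<le> i1" using J0 by (auto simp: i1_def)
    then have "pw i1 \<le> pw 0" "pw i \<le> pw i1" by (simp_all only: pw_le_iff)
    then have "\<bar>t\<bar> * pw i1 \<le> \<bar>t\<bar> * pw 0" "\<bar>t\<bar> * pw i \<le> \<bar>t\<bar> * pw i1" by (intro mult_left_mono; simp)+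
    then show ?thesis unfolding tabs by simp
  qed
  have w0: "0 < \<omega>" using \<omega>(1) by auto
  have t1b: "pw (emin q) \<le> \<bar>t1\<bar>" "\<omega> * \<bar>t1\<bar> \<le> Omega p q"
  proof -
    show "pw (emin q) \<le> \<bar>t1\<bar>" using btw Suc.prems assms(3) by linarith
    have "\<omega> * \<bar>t1\<bar> \<le> \<omega> * \<bar>t\<bar> \<or> \<omega> * \<bar>t1\<bar> \<le> \<omega> * \<bar>t'\<bar>" using btw w0 by auto
    then show "\<omega> * \<bar>t1\<bar> \<le> Omega p q" using Suc.prems assms(4) by linarith
  qed
  have "\<bar>t1\<bar> \<le> \<omega> * \<bar>t1\<bar>" using \<omega>(1) by auto
  then have t1O: "\<bar>t1\<bar> \<le> Omega p q" using t1b by linarith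
  have t1F: "t1 \<in> F" unfolding t1_def using Suc.prems(1) t1b(1) t1O unfolding t1_def by (intro F_scale)
  obtain N where N: "pstate (m + n) N x0 t1 D"
    using Suc.IH[OF t1F t1b t't i2] by blast
  obtain l where l: "l = 0 \<or> l = 2" "\<omega> = pw l" using omega_pw by blast
  define w where "w = pw (i1 + l)"
  have wF: "w \<in> F" unfolding w_def using i1 l J E_bounds by (intro pw_F) (auto simp: emin_eq)
  have wJ: "\<bar>w\<bar> \<le> pw J"
  proof -
    have "i1 + l \<le> J" using i1 l by auto
    then have "pw (i1 + l) \<le> pw J" by (simp only: pw_le_iff)
    then show ?thesis unfolding w_def by (simp only: abs_of_pos pw_pos)
  qed
  have "t * w = \<omega> * t1" unfolding w_def t1_def l(2) pw_add by simp
  then have "R (t * w) = Fin (\<omega> * t1)" using omega_F[OF t1b(1) t1F t1b(2)] by (simp add: R_F)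
  from pstate_step[OF N wF wJ Suc.prems(1) omega_F[OF Suc.prems(2,1,3)] this] show ?case by auto
qed

text \<open>Seen from the output, one layer normalises h, m - 3 layers shift the exponent, and two
  base layers end at coordinate j. The normalised and the required exponent differ by at most 2 * E
  + 2, which four layers cover by the assumption on J; hence m \<ge> 7.\<close>

lemma path_relay_ex:
  assumes base: "\<And>t. t \<in> F \<Longrightarrow> 7 / 8 * pw e' \<le> s * t \<Longrightarrow> s * t \<le> pw e' \<Longrightarrow>
      \<exists>N e. pstate 2 N x0 t (\<lambda>i. if i = j then [e] else []) \<and> fits s k e"
    and e': "emin q + 2 \<le> e'" "\<omega> * pw e' \<le> Omega p q"
    and h: "h \<in> F" "h \<noteq> 0" "\<omega> * max \<bar>h\<bar> (pw (P + 6)) \<le> Omega p q" and s: "s \<in> {1, -1}" and m: "7 \<le> m"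
  shows "\<exists>N. path_relay M kt \<omega> m j x0 h s k N"
proof -
  obtain w e g where w: "w \<in> F" "\<bar>w\<bar> \<le> pw (P + 6)" "R (h * w) = Fin g" "7 / 8 * pw e \<le> s * g" "s * g \<le> pw e"
     "emin q + 4 \<le> e" "e \<le> E" "e \<le> P + 6 \<or> pw e \<le> \<bar>h\<bar>" using normaliser[OF h(1,2) s] by blast
  have gF: "g \<in> F" using R_Fin_F[OF w(3)] .
  obtain l where l: "l = 0 \<or> l = 2" "\<omega> = pw l" using omega_pw by blast
  have \<omega>0: "0 < \<omega>" "1 \<le> \<omega>" using \<omega>(1) by auto
  have "0 < pw e" by simp
  then have "0 < s * g" using w(4) by linarith
  then have sg: "\<bar>g\<bar> = s * g" using s by auto
  have ewb: "\<omega> * pw e \<le> Omega p q"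
  proof -
    have "pw e \<le> max \<bar>h\<bar> (pw (P + 6))" using w(8) pw_le_iff[of e "P + 6"] by auto
    then have "\<omega> * pw e \<le> \<omega> * max \<bar>h\<bar> (pw (P + 6))" using \<omega>0 by (intro mult_left_mono) auto
    then show ?thesis using h(3) by linarith
  qed
  have low: "pw (emin q) \<le> 7 / 8 * pw i" if "emin q + 1 \<le> i" for i
  proof -
    have "pw (emin q + 1) \<le> pw i" using that by (simp only: pw_le_iff)
    moreover have "pw (emin q + 1) = 2 * pw (emin q)" by (simp add: pw_add)
    moreover have "0 < pw (emin q)" by simp
    ultimately show ?thesis by linarith
  qed
  \<comment> \<open>The normalising layer delivers g, which has to be \<omega> * t for the layer
    below it.\<close>
  define t where "t = g * pw (- l)"
  have tg: "\<omega> * t = g" unfolding t_def l(2) by (simp add: pw_neg)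
  have tabs: "\<bar>t\<bar> = s * t" unfolding t_def abs_mult using sg by simp
  have tb: "7 / 8 * pw (e - l) \<le> s * t" "s * t \<le> pw (e - l)"
  proof -
    have pel: "pw (e - l) = pw e * pw (- l)" using pw_add[of e "- l"] by simp
    have "7 / 8 * pw e * pw (- l) \<le> s * g * pw (- l)" "s * g * pw (- l) \<le> pw e * pw (- l)"
      using w(4,5) by (intro mult_right_mono; simp)+
    then show "7 / 8 * pw (e - l) \<le> s * t" "s * t \<le> pw (e - l)" unfolding pel t_def by (simp_all only: mult.assoc)
  qed
  have tlow: "pw (emin q) \<le> \<bar>t\<bar>" using tb low[of "e - l"] w(6) l(1) tabs by auto
  have tO: "\<omega> * \<bar>t\<bar> \<le> Omega p q" using tg F_abs_le[OF gF] \<omega>0 by (metis abs_mult abs_of_pos)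
  have tF: "t \<in> F" unfolding t_def
  proof (rule F_scale[OF gF])
    show "pw (emin q) \<le> \<bar>g * pw (- l)\<bar>" using tlow unfolding t_def .
    have "\<bar>t\<bar> \<le> \<omega> * \<bar>t\<bar>" using \<omega>0 by (simp add: mult_le_cancel_right1)
    then show "\<bar>g * pw (- l)\<bar> \<le> Omega p q" using tO unfolding t_def by linarith
  qed
  define i where "i = e' - (e - l)"
  define t' where "t' = t * pw i"
  have t'b: "7 / 8 * pw e' \<le> s * t'" "s * t' \<le> pw e'"
  proof -
    have "pw e' = pw (e - l) * pw i" by (simp only: pw_add[symmetric]) (simp add: i_def)
    moreover have "7 / 8 * pw (e - l) * pw i \<le> s * t * pw i" "s * t * pw i \<le> pw (e - l) * pw i"
      using tb by (intro mult_right_mono; simp)+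
    ultimately show "7 / 8 * pw e' \<le> s * t'" "s * t' \<le> pw e'" by (simp_all add: t'_def mult.assoc)
  qed
  have "0 < pw e'" by simp
  then have "0 < s * t'" using t'b(1) by linarith
  then have t'abs: "\<bar>t'\<bar> = s * t'" using s by auto
  have t'low: "pw (emin q) \<le> \<bar>t'\<bar>" using t'b low[of e'] e' t'abs by auto
  have t'O: "\<omega> * \<bar>t'\<bar> \<le> Omega p q"
  proof -
    have "\<omega> * \<bar>t'\<bar> \<le> \<omega> * pw e'" using t'b t'abs \<omega>0 by (intro mult_left_mono) auto
    then show ?thesis using e' by linarith
  qed
  have "\<bar>t'\<bar> \<le> \<omega> * \<bar>t'\<bar>" using \<omega>0 by (simp add: mult_le_cancel_right1)
  then have t'F: "t' \<in> F" using t'low t'O tF unfolding t'_def by (intro F_scale) auto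
  obtain N0 c0 where N0: "pstate 2 N0 x0 t' (\<lambda>i. if i = j then [c0] else [])" "fits s k c0" using base[OF t'F t'b] by blast
  have "pw e' \<le> \<omega> * pw e'" using \<omega>0 by simp
  then have "pw e' < 2 * pw E" using e'(2) Omega_bounds(2) by linarith
  then have "pw e' < pw (E + 1)" by (simp add: pw_add)
  then have "e' \<le> E" unfolding pw_less_iff by simp
  then have "\<bar>i\<bar> \<le> 2 * E + 2" using e'(1) w(6,7) l(1) unfolding i_def emin_eq by auto
  also have "\<dots> \<le> 4 * (J - 2)" by (rule J)
  also have "\<dots> \<le> int (m - 3) * (J - 2)" using m J(1) P2 by (intro mult_right_mono) auto
  finally have i: "\<bar>i\<bar> \<le> int (m - 3) * (J - 2)" .
  obtain N1 where N1: "pstate (2 + (m - 3)) N1 x0 t (\<lambda>i. if i = j then [c0] else [])"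
    using pstate_chain[OF N0(1) t'F t'low t'O tF tlow tO t'_def i] by blast
  have wJ: "\<bar>w\<bar> \<le> pw J" using w(2) J(1) pw_le_iff[of "P + 6" J] by linarith
  have hO: "\<bar>h * pw l\<bar> \<le> Omega p q"
  proof -
    have "\<omega> * \<bar>h\<bar> \<le> \<omega> * max \<bar>h\<bar> (pw (P + 6))" using \<omega>0 by (intro mult_left_mono) auto
    then have "\<omega> * \<bar>h\<bar> \<le> Omega p q" using h(3) by linarith
    moreover have "\<bar>h * pw l\<bar> = \<omega> * \<bar>h\<bar>" by (simp add: abs_mult l(2))
    ultimately show ?thesis by simp
  qed
  then have hF: "\<omega> * h \<in> F" using F_scale_up[OF h(1) _ hO] l by (auto simp: mult.commute)
  have "R (h * w) = Fin (\<omega> * t)" using w(3) tg by simp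
  from pstate_step[OF N1 w(1) wJ h(1) hF this]
  moreover have "Suc (2 + (m - 3)) = m" using m by simp
  ultimately have N: "pstate m (N1 @ [relay_layer w \<beta>]) x0 h (\<lambda>i. if i = j then [c0] else [])" by (simp only:)
  define N' where "N' = N1 @ [relay_layer w \<beta>]"
  have \<omega>F: "\<omega> \<in> F" using l pw_F[of l] E_bounds by (auto simp: emin_eq)
  have prod: "\<exists>y. Fin \<omega> \<otimes> Fin r = Fin y \<and> Fin (- \<omega>) \<otimes> Fin r = Fin (- y) \<and> \<bar>y\<bar> \<le> pw kt" if "ok r" for r
  proof -
    have "\<bar>\<omega> * r\<bar> \<le> pw kt" using ok(2)[OF that] \<omega>0 by (simp add: abs_mult)
    then have "- pw kt \<le> \<omega> * r" "\<omega> * r \<le> pw kt" by linarith+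
    then obtain y where y: "R (\<omega> * r) = Fin y" "- pw kt \<le> y" "y \<le> pw kt" using ok(3)
      by (meson R_between minus_F)
    then show ?thesis using R_minus_Fin[OF y(1)] by auto
  qed
  have "relays M kt m \<omega> N'"
    unfolding relays_def
  proof (intro conjI ballI)
    show "hnet m 2 N'" using N by (simp add: pstate_def N'_def)
    show "\<omega> \<in> F" by (rule \<omega>F)
    fix x assume "x \<in> grid M"
    then obtain r where r: "ok r" "gives N' x [r, \<rho>] [0, 0] (\<lambda>_. [])" using N by (auto simp: pstate_def N'_def)
    obtain y1 where "Fin \<omega> \<otimes> Fin r = Fin y1" "\<bar>y1\<bar> \<le> pw kt" using prod[OF r(1)] by blast
    moreover obtain y2 where "Fin (- \<omega>) \<otimes> Fin \<rho> = Fin (- y2)" "\<bar>y2\<bar> \<le> pw kt" using prod[OF ok(1)] by blast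
    moreover have "\<bar>- y2\<bar> \<le> pw kt" using \<open>\<bar>y2\<bar> \<le> pw kt\<close> by simp
    ultimately show "\<exists>r r' y y'. gives N' x [r, r'] [0, 0] (\<lambda>_. []) \<and> Fin \<omega> \<otimes> Fin r = Fin y \<and> Fin (- \<omega>) \<otimes> Fin r' = Fin y' \<and>
       \<bar>y\<bar> \<le> pw kt \<and> \<bar>y'\<bar> \<le> pw kt" using r(2) by blast
  qed
  moreover obtain y where "Fin \<omega> \<otimes> Fin \<rho> = Fin y" "Fin (- \<omega>) \<otimes> Fin \<rho> = Fin (- y)" using prod[OF ok(1)] by blast
  moreover have "Fin h \<otimes> Fin \<omega> = Fin (\<omega> * h)" "Fin h \<otimes> Fin (- \<omega>) = Fin (- (\<omega> * h))"
    using R_F[OF hF] R_minus_Fin[OF R_F[OF hF]] by (simp_all add: mult.commute)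
  moreover have "gives N' x0 [\<rho>, \<rho>] [\<omega> * h, - (\<omega> * h)] (\<lambda>i. if i = j then [c0] else [])"
    using N by (simp add: pstate_def N'_def)
  ultimately show ?thesis unfolding path_relay_def using N0(2) by blast
qed

end

section \<open>Activations that are eventually the identity\<close>

context fp begin

lemma E_bound_q: "2 * int q + 9 \<le> E"
proof -
  have "2 * int n + 10 \<le> 2 ^ (n - 1)" if "6 \<le> n" for n
    using that
  proof (induction n rule: dec_induct)
    case (step n)
    then have "(2::int) ^ (Suc n - 1) = 2 * 2 ^ (n - 1)" by (simp add: power_eq_if)
    then show ?case using step by simp
  qed simp
  from this[OF q6] show ?thesis by (simp add: emax_def)
qed

end

context net begin

lemma forward_base:
  assumes "x \<in> grid M" "j < d" "w \<in> F" "b \<in> F" "Fin w \<otimes> Fin (x ! j) \<oplus> Fin b = y"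
    "sg y = Fin v" "sg' y = Fin s" "v \<in> F" "s \<in> F"
  shows "gives [([urow j w], [b])] x [v] [0] (\<lambda>_. [])"
proof -
  have "length x = d" using assms(1) by (simp add: grid_def)
  from gives_base[OF this assms(2), of w b v s 0 0 0] assms(5-9)
  have "gives [([urow j w], [b])] x [v] [0] (\<lambda>i. if i = j then [0] else [])" by simp
  from gives_zeros[OF hnet_base[OF assms(3,4)] this] show ?thesis by simp
qed

lemma forward_step:
  assumes "gives N x [u] [0] (\<lambda>_. [])" "Fin w \<otimes> Fin u \<oplus> Fin b = y" "sg y = Fin v" "sg' y = Fin s" "v \<in> F" "s \<in> F"
  shows "gives (N @ [([[w]], [b])]) x [v] [0] (\<lambda>_. [])"
  by (rule gives_unary[OF assms(1), where s = s and t = 0]) (use assms in simp_all)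

text \<open>A slope that is an exact 0 blocks every gradient, which is how detectors and closed
  gates become independent of g.\<close>

lemma dead_step:
  assumes "gives N x [u] [0] (\<lambda>_. [])" "Fin w \<otimes> Fin u \<oplus> Fin b = y" "sg y = Fin v" "sg' y = Fin 0" "v \<in> F" "g \<in> F"
  shows "gives (N @ [([[w]], [b])]) x [v] [g] (\<lambda>_. [])"
  by (rule gives_unary[OF assms(1), where s = 0 and t = 0]) (use assms in simp_all)

lemma hnet_unary: "hnet m 1 N \<Longrightarrow> w \<in> F \<Longrightarrow> b \<in> F \<Longrightarrow> hnet (Suc m) 1 (N @ [([[w]], [b])])"
proof -
  assume h: "hnet m 1 N" "w \<in> F" "b \<in> F"
  have "layer_ok p q 1 1 ([[w]], [b])" using h by (simp add: layer_ok_def)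
  then show ?thesis using hnet_snoc[OF h(1) _ zero_less_one] by blast
qed

lemma grid_nth: "x \<in> grid M \<Longrightarrow> j < d \<Longrightarrow> x ! j \<in> F \<and> \<bar>x ! j\<bar> \<le> M"
proof -
  assume "x \<in> grid M" "j < d"
  then have "x ! j \<in> F \<inter> {-M..M}" unfolding grid_def using nth_mem by blast
  then show ?thesis by auto
qed

lemma R_range:
  assumes "lo \<le> x" "x \<le> hi" "lo \<in> F" "hi \<in> F"
  shows "\<exists>y\<in>F. R x = Fin y \<and> lo \<le> y \<and> y \<le> hi"
  using R_between[OF assms] by metis

lemma R_upper_neg: "x \<le> - B \<Longrightarrow> neg (R x)"
  using R_upper[of x "- B"] unfolding neg_def by (metis B_F(2))

text \<open>The signal is either exactly \<kappa> or in a band of values, large ones in the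
  application, so that a single neuron can invert it.\<close>

definition band_detector :: "real \<Rightarrow> real \<Rightarrow> (real \<Rightarrow> bool) \<Rightarrow> real \<Rightarrow> real \<Rightarrow> nat \<Rightarrow> nat \<Rightarrow> layer list \<Rightarrow> bool" where
  "band_detector M \<kappa> S lo hi m j N \<longleftrightarrow> hnet m 1 N \<and> (\<forall>x\<in>grid M. if S (x ! j) then \<exists>v\<in>F. gives N x [v] [0] (\<lambda>_. []) \<and> lo \<le> v \<and> v \<le> hi
     else (\<forall>g\<in>F. gives N x [\<kappa>] [g] (\<lambda>_. [])))"

text \<open>On the finite grid the negation of a threshold test is again a threshold test, or constant.\<close>

lemma not_fires:
  assumes "j < d"
  shows "(\<exists>z'\<in>F. \<bar>z'\<bar> \<le> M \<and> (\<forall>x\<in>grid M. fires u z (x ! j) \<longleftrightarrow> \<not> fires (\<not> u) z' (x ! j))) \<or> (\<forall>x\<in>grid M. \<not> fires u z (x ! j))"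
proof -
  let ?A = "{y \<in> F. \<bar>y\<bar> \<le> M \<and> fires u z y}"
  have fin: "finite ?A" using finite_F by simp
  show ?thesis
  proof (cases "?A = {}")
    case True
    then show ?thesis using grid_nth[OF _ assms] by blast
  next
    case False
    define z' where "z' = (if u then Min ?A else Max ?A)"
    have z': "z' \<in> ?A" using Min_in[OF fin False] Max_in[OF fin False] unfolding z'_def by (cases u) (simp_all only: if_True if_False)
    have "fires u z y \<longleftrightarrow> \<not> fires (\<not> u) z' y" if y: "y \<in> F" "\<bar>y\<bar> \<le> M" for y
    proof
      assume "fires u z y"
      then have "y \<in> ?A" using y by blast
      then show "\<not> fires (\<not> u) z' y" using Min_le[OF fin] Max_ge[OF fin] by (auto simp: fires_def z'_def not_less)
    next
      assume "\<not> fires (\<not> u) z' y"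
      then show "fires u z y" using z' by (auto simp: fires_def split: if_splits)
    qed
    then show ?thesis using z' grid_nth[OF _ assms] by blast
  qed
qed

text \<open>An additional layer negates a test. Since the negation of a threshold test is again one,
  or constant, asking the shallower network for the opposite test yields every depth from
  \<open>mb\<close> on.\<close>

lemma band_detector_all:
  assumes base: "\<And>z u. z \<in> F \<Longrightarrow> \<bar>z\<bar> \<le> M \<Longrightarrow> \<exists>N. band_detector M \<kappa> (fires u z) lo hi mb j N"
    and flip: "\<And>m S N. band_detector M \<kappa> S lo hi m j N \<Longrightarrow> \<exists>N. band_detector M \<kappa> (\<lambda>y. \<not> S y) lo hi (Suc m) j N"
    and c: "sg (Fin (- B)) = Fin \<kappa>" "sg' (Fin (- B)) = Fin 0" "\<kappa> \<in> F"
    and j: "j < d" and m: "mb \<le> m"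
  shows "z \<in> F \<Longrightarrow> \<bar>z\<bar> \<le> M \<Longrightarrow> \<exists>N. band_detector M \<kappa> (fires u z) lo hi m j N"
  using m
proof (induction m arbitrary: z u rule: dec_induct)
  case base
  then show ?case using assms(1) by blast
next
  case (step m)
  from not_fires[OF j, of M u z] show ?case
  proof (elim disjE bexE conjE)
    fix z' assume z': "z' \<in> F" "\<bar>z'\<bar> \<le> M" "\<forall>x\<in>grid M. fires u z (x ! j) \<longleftrightarrow> \<not> fires (\<not> u) z' (x ! j)"
    obtain N where "band_detector M \<kappa> (fires (\<not> u) z') lo hi m j N" using step.IH[OF z'(1,2)] by blast
    from flip[OF this] obtain N where "band_detector M \<kappa> (\<lambda>y. \<not> fires (\<not> u) z' y) lo hi (Suc m) j N" by blast
    then show ?thesis using z'(3) unfolding band_detector_def by (intro exI[of _ N]) simp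
  next
    assume n: "\<forall>x\<in>grid M. \<not> fires u z (x ! j)"
    have "1 \<le> Suc m" by simp
    from constant_chain[OF this c, of M] n show ?thesis unfolding band_detector_def by auto
  qed
qed

end

text \<open>Near 0 only crude bounds on values are assumed, which suffices for the forward pass of a
  detector. Path relays and closed gates operate beyond B and - B, where value and slope are exact.
  \<open>zero_bias\<close> replaces \<kappa> by 0 without spoiling large values.\<close>

locale eventual_identity = net +
  fixes \<kappa> :: real
  assumes \<kappa>: "\<kappa> \<in> {0, -1}"
    and act_nonpos: "\<And>t. t \<in> F \<Longrightarrow> t \<le> 0 \<Longrightarrow> \<exists>v\<in>F. sg (Fin t) = Fin v \<and> - 1 \<le> v \<and> v \<le> 0"
    and act_pos: "\<And>t. t \<in> F \<Longrightarrow> 0 < t \<Longrightarrow> \<exists>v\<in>F. sg (Fin t) = Fin v \<and> \<eta> \<le> v \<and> v \<le> t \<and> (\<forall>z\<in>F. 2 * z \<le> t \<longrightarrow> z \<le> v)"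
    and act_large: "\<And>t. t \<in> F \<Longrightarrow> B \<le> t \<Longrightarrow> sg (Fin t) = Fin t \<and> sg' (Fin t) = Fin 1"
    and act_neg: "\<And>v. neg v \<Longrightarrow> sg v = Fin \<kappa> \<and> sg' v = Fin 0"
    and deriv_F: "\<And>t. t \<in> F \<Longrightarrow> \<exists>s\<in>F. sg' (Fin t) = Fin s"
    and zero_bias: "\<exists>bt s0. bt \<in> F \<and> s0 \<in> F \<and> \<bar>s0\<bar> \<le> 1 \<and> sg (Fin \<kappa> \<oplus> Fin bt) = Fin 0 \<and> sg' (Fin \<kappa> \<oplus> Fin bt) = Fin s0 \<and>
      (\<forall>n\<in>F. pw (E - P - 2) \<le> n \<longrightarrow> n \<le> 5 / 4 * pw E \<longrightarrow> (\<exists>n'\<in>F. Fin n \<oplus> Fin bt = Fin n' \<and> pw (E - P - 2) \<le> n'))"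
    and value_cells: "\<And>s k. s \<in> {1, -1} \<Longrightarrow> emin q - P \<le> k \<Longrightarrow> k \<le> E - P \<Longrightarrow> value_cell (Omega p q) 1 (E - P - 2) \<kappa> s k"
begin

abbreviation \<tau> where "\<tau> \<equiv> pw (E - P - 2)"
abbreviation hi where "hi \<equiv> 5 / 4 * pw E"
abbreviation MM where "MM \<equiv> pw (E - 2)"

lemma hi_F: "hi \<in> F" "5 / 4 \<in> F" "- hi \<in> F" "- 1 \<in> F" "1 \<in> F" "2 \<in> F"
proof -
  have "of_int 5 * pw (E - 2) \<in> F" using E_bounds by (intro small_mult_F) (auto simp: emin_eq)
  then show "hi \<in> F" by (simp add: pw_diff)
  then show "- hi \<in> F" by simp
  have "of_int 5 * pw (- 2) \<in> F" using E_bounds by (intro small_mult_F) (auto simp: emin_eq)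
  then show "5 / 4 \<in> F" by (simp add: power_int_minus)
  have "pw 0 \<in> F" using E_bounds by (intro pw_F) (auto simp: emin_eq)
  then show "1 \<in> F" by simp
  then show "- 1 \<in> F" by simp
  have "pw 1 \<in> F" using E_bounds by (intro pw_F) (auto simp: emin_eq)
  then show "2 \<in> F" by simp
qed

lemma pws_F: "pw E \<in> F" "pw (- P) \<in> F" "pw (- P - 1) \<in> F" "\<tau> \<in> F" "\<eta> \<in> F" "pw (1 - P) \<in> F" "pw (E - 1) \<in> F"
  using E_bounds unfolding \<eta>_def by (auto intro!: pw_F simp: emin_eq)

lemma B_tau: "B \<le> \<tau>" "4 * B \<le> \<tau>" "B \<le> pw E" "B + 2 \<le> \<tau>"
proof -
  have "pw (int q + 2) \<le> \<tau>" using E_bounds by (subst pw_le_iff) auto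
  then show 1: "4 * B \<le> \<tau>" unfolding B_def by (simp only: pw_add) simp
  have "B \<le> 4 * B" by simp
  with 1 show "B \<le> \<tau>" by linarith
  have "\<tau> \<le> pw E" by (subst pw_le_iff) auto
  then show "B \<le> pw E" using \<open>B \<le> \<tau>\<close> by linarith
  have "pw 0 \<le> B" unfolding B_def by (subst pw_le_iff) auto
  then show "B + 2 \<le> \<tau>" using 1 by simp
qed

lemma kF: "\<kappa> \<in> F" using \<kappa> hi_F by auto

lemma sgB: "sg (Fin (- B)) = Fin \<kappa>" "sg' (Fin (- B)) = Fin 0"
  using act_neg[of "Fin (- B)"] by (auto simp: neg_def)

lemma pos_step:
  assumes "y \<in> F" "cc \<longrightarrow> 0 < y \<and> y \<le> h" "\<not> cc \<longrightarrow> y \<le> 0"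
  shows "\<exists>v s. sg (Fin y) = Fin v \<and> sg' (Fin y) = Fin s \<and> v \<in> F \<and> s \<in> F \<and>
    (cc \<longrightarrow> \<eta> \<le> v \<and> v \<le> h \<and> (\<forall>z\<in>F. 2 * z \<le> y \<longrightarrow> z \<le> v)) \<and> (\<not> cc \<longrightarrow> - 1 \<le> v \<and> v \<le> 0)"
proof -
  obtain s where s: "s \<in> F" "sg' (Fin y) = Fin s" using deriv_F[OF assms(1)] by blast
  show ?thesis
  proof (cases cc)
    case True
    then obtain v where "v \<in> F" "sg (Fin y) = Fin v" "\<eta> \<le> v" "v \<le> y" "\<forall>z\<in>F. 2 * z \<le> y \<longrightarrow> z \<le> v"
      using act_pos assms by blast
    then show ?thesis using s True assms(2) by (intro exI[of _ v] exI[of _ s]) auto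
  next
    case False
    then obtain v where "v \<in> F" "sg (Fin y) = Fin v" "- 1 \<le> v" "v \<le> 0" using act_nonpos assms by blast
    then show ?thesis using s False by (intro exI[of _ v] exI[of _ s]) auto
  qed
qed

text \<open>The tested difference is at least \<eta> or nonpositive, but the activation confines
  only the nonpositive side, to [- 1, 0]. Subtracting the value from the bias \<eta> exchanges the
  sides and confines the other one too, by 5/4, so that multiplication by 2^E cannot overflow; it
  lifts \<eta> to 2^(1 - p). A second round, with bias 2^(-p), restores the orientation and lifts
  the separation to 2^(E - p - 1), that is 2 * \<tau>.\<close>

lemma band_detector_base:
  assumes "j < d" "z \<in> F" "\<bar>z\<bar> \<le> MM"
  shows "\<exists>N. band_detector MM \<kappa> (fires u z) \<tau> hi 5 j N"
proof -
  define w where "w = (if u then 1 else -1 :: real)"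
  have wF: "w \<in> F" "- (w * z) \<in> F" using hi_F assms by (auto simp: w_def)
  define N1 where "N1 = [([urow j w], [- (w * z)])]"
  define N2 where "N2 = N1 @ [([[- 1]], [\<eta>])]"
  define N3 where "N3 = N2 @ [([[pw E]], [0])]"
  define N4 where "N4 = N3 @ [([[- 1]], [pw (- P)])]"
  define N5 where "N5 = N4 @ [([[pw E]], [- B])]"
  have h1: "hnet 1 1 N1" using hnet_base wF by (simp add: N1_def)
  have "hnet (Suc (Suc (Suc (Suc 1)))) 1 N5" unfolding N5_def N4_def N3_def N2_def
    using h1 hi_F pws_F B_F by (intro hnet_unary) auto
  then have h5: "hnet 5 1 N5" by (simp add: eval_nat_numeral)
  have "if fires u z (x ! j) then \<exists>v\<in>F. gives N5 x [v] [0] (\<lambda>_. []) \<and> \<tau> \<le> v \<and> v \<le> hi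
     else (\<forall>g\<in>F. gives N5 x [\<kappa>] [g] (\<lambda>_. []))" if x: "x \<in> grid MM" for x
  proof -
    define cc where "cc = fires u z (x ! j)"
    define \<xi> where "\<xi> = x ! j"
    have \<xi>: "\<xi> \<in> F" "\<bar>\<xi>\<bar> \<le> MM" using grid_nth[OF x assms(1)] by (auto simp: \<xi>_def)
    have MM2: "2 * MM = pw (E - 1)" by (simp add: pw_diff)
    have "- pw (E - 1) \<le> w * \<xi> - w * z" "w * \<xi> - w * z \<le> pw (E - 1)" using \<xi> assms MM2 by (auto simp: w_def)
    then obtain y1 where y1: "y1 \<in> F" "R (w * \<xi> - w * z) = Fin y1" "y1 \<le> pw (E - 1)"
      using R_range[of "- pw (E - 1)" "w * \<xi> - w * z" "pw (E - 1)"] pws_F by auto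
    have c1: "cc \<longrightarrow> 0 < y1 \<and> y1 \<le> pw (E - 1)"
    proof
      assume cc
      then have "\<eta> \<le> w * \<xi> - w * z" using F_diff_ge_\<eta>[OF assms(2) \<xi>(1)] F_diff_ge_\<eta>[OF \<xi>(1) assms(2)]
        by (auto simp: cc_def fires_def w_def \<xi>_def split: if_splits)
      then have "\<eta> \<le> y1" using R_ge[OF y1(2)] pws_F by blast
      then show "0 < y1 \<and> y1 \<le> pw (E - 1)" using y1 \<eta>_pos by linarith
    qed
    have d1: "\<not> cc \<longrightarrow> y1 \<le> 0"
    proof
      assume "\<not> cc"
      then have "w * \<xi> - w * z \<le> 0" by (auto simp: cc_def fires_def w_def \<xi>_def split: if_splits)
      then show "y1 \<le> 0" using R_le[OF y1(2)] by simp
    qed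
    obtain v1 s1 where v1: "sg (Fin y1) = Fin v1" "sg' (Fin y1) = Fin s1" "v1 \<in> F" "s1 \<in> F"
      "cc \<longrightarrow> \<eta> \<le> v1 \<and> v1 \<le> pw (E - 1)" "\<not> cc \<longrightarrow> - 1 \<le> v1 \<and> v1 \<le> 0"
      using pos_step[OF y1(1) c1 d1] by blast
    have "w * \<xi> \<in> F" using \<xi> by (auto simp: w_def)
    then have "Fin w \<otimes> Fin (x ! j) \<oplus> Fin (- (w * z)) = Fin y1" using y1(2) by (simp add: R_F \<xi>_def)
    from forward_base[OF x assms(1) wF this v1(1-4)] have g1: "gives N1 x [v1] [0] (\<lambda>_. [])" by (simp add: N1_def)
    have eta1: "\<eta> \<le> 1 / 4"
    proof -
      have "\<eta> \<le> pw (- 2)" unfolding \<eta>_def using E_bounds by (subst pw_le_iff) (auto simp: emin_eq)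
      then show ?thesis by (simp add: power_int_minus)
    qed
    have pE1: "1 \<le> pw (E - 1)"
    proof -
      have "pw 0 \<le> pw (E - 1)" using E_bounds by (subst pw_le_iff) auto
      then show ?thesis by simp
    qed
    have "- pw (E - 1) \<le> - v1 + \<eta>" "- v1 + \<eta> \<le> 5 / 4" 
    proof -
      have "0 < \<eta>" by simp
      have "- 1 \<le> v1 \<and> v1 \<le> pw (E - 1)"
      proof (cases cc)
        case True
        then have "\<eta> \<le> v1" "v1 \<le> pw (E - 1)" using v1(5) by blast+
        then show ?thesis using \<open>0 < \<eta>\<close> by linarith
      next
        case False
        then have "- 1 \<le> v1" "v1 \<le> 0" using v1(6) by blast+
        then show ?thesis using pE1 by linarith
      qed
      then show "- pw (E - 1) \<le> - v1 + \<eta>" "- v1 + \<eta> \<le> 5 / 4" using eta1 \<open>0 < \<eta>\<close> by linarith+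
    qed
    then obtain y2 where y2: "y2 \<in> F" "R (- v1 + \<eta>) = Fin y2" "y2 \<le> 5 / 4"
      using R_range[of "- pw (E - 1)" "- v1 + \<eta>" "5 / 4"] pws_F hi_F by auto
    have c2: "\<not> cc \<longrightarrow> 0 < y2 \<and> y2 \<le> 5 / 4"
    proof
      assume "\<not> cc"
      then have "\<eta> \<le> - v1 + \<eta>" using v1 by simp
      then have "\<eta> \<le> y2" using R_ge[OF y2(2)] pws_F by blast
      then show "0 < y2 \<and> y2 \<le> 5 / 4" using y2 \<eta>_pos by linarith
    qed
    have d2: "\<not> \<not> cc \<longrightarrow> y2 \<le> 0" using R_le[OF y2(2), of 0] v1(5) by auto
    obtain v2 s2 where v2: "sg (Fin y2) = Fin v2" "sg' (Fin y2) = Fin s2" "v2 \<in> F" "s2 \<in> F"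
      "\<not> cc \<longrightarrow> \<eta> \<le> v2 \<and> v2 \<le> 5 / 4" "\<not> \<not> cc \<longrightarrow> - 1 \<le> v2 \<and> v2 \<le> 0"
      using pos_step[OF y2(1) c2 d2] by blast
    have "Fin (- 1) \<otimes> Fin v1 \<oplus> Fin \<eta> = Fin y2" using y2(2) v1(3) by (simp add: R_F)
    from forward_step[OF g1 this v2(1-4)] have g2: "gives N2 x [v2] [0] (\<lambda>_. [])" by (simp add: N2_def)
    have pE: "0 < pw E" "pw E * \<eta> = pw (1 - P)"
      unfolding \<eta>_def by (simp, simp only: pw_add[symmetric], simp add: emin_eq)
    have "- hi \<le> pw E * v2" "pw E * v2 \<le> hi"
    proof -
      have "- (5 / 4) \<le> v2 \<and> v2 \<le> 5 / 4"
      proof (cases cc)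
        case False
        then have "\<eta> \<le> v2" "v2 \<le> 5 / 4" using v2(5) by blast+
        moreover have "0 < \<eta>" by simp
        ultimately show ?thesis by linarith
      next
        case True
        then have "- 1 \<le> v2" "v2 \<le> 0" using v2(6) by blast+
        then show ?thesis by linarith
      qed
      then have "pw E * - (5 / 4) \<le> pw E * v2" "pw E * v2 \<le> pw E * (5 / 4)" using pE(1) by (intro mult_left_mono; simp)+
      then show "- hi \<le> pw E * v2" "pw E * v2 \<le> hi" by simp_all
    qed
    then obtain y3 where y3: "y3 \<in> F" "R (pw E * v2) = Fin y3" "y3 \<le> hi"
      using R_range[of "- hi" "pw E * v2" hi] hi_F by auto
    have l3: "\<not> cc \<longrightarrow> pw (1 - P) \<le> y3"
    proof
      assume "\<not> cc"
      then have "pw E * \<eta> \<le> pw E * v2" using v2 pE(1) by (intro mult_left_mono) auto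
      then show "pw (1 - P) \<le> y3" using R_ge[OF y3(2)] pws_F pE(2) by auto
    qed
    then have c3: "\<not> cc \<longrightarrow> 0 < y3 \<and> y3 \<le> hi" using y3(3) pw_pos[of "1 - P"] by linarith
    have d3: "\<not> \<not> cc \<longrightarrow> y3 \<le> 0"
      using R_le[OF y3(2), of 0] v2(6) pE(1) by (auto simp: mult_le_0_iff)
    obtain v3 s3 where v3: "sg (Fin y3) = Fin v3" "sg' (Fin y3) = Fin s3" "v3 \<in> F" "s3 \<in> F"
      "\<not> cc \<longrightarrow> v3 \<le> hi \<and> (\<forall>z\<in>F. 2 * z \<le> y3 \<longrightarrow> z \<le> v3)" "\<not> \<not> cc \<longrightarrow> - 1 \<le> v3 \<and> v3 \<le> 0"
      using pos_step[OF y3(1) c3 d3] by blast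
    have "2 * pw (- P) = pw (1 - P)" using pw_add[of 1 "- P"] by simp
    then have l3': "\<not> cc \<longrightarrow> pw (- P) \<le> v3" using v3(5) l3 pws_F by auto
    have "Fin (pw E) \<otimes> Fin v2 \<oplus> Fin 0 = Fin y3" using y3 by (simp add: R_F)
    from forward_step[OF g2 this v3(1-4)] have g3: "gives N3 x [v3] [0] (\<lambda>_. [])" by (simp add: N3_def)
    have pP: "pw (- P) \<le> 1 / 4" "0 < pw (- P)"
    proof -
      have "pw (- P) \<le> pw (- 2)" using P2 by (subst pw_le_iff) auto
      then show "pw (- P) \<le> 1 / 4" by (simp add: power_int_minus)
    qed simp
    have pE2: "1 \<le> pw E"
    proof -
      have "pw 0 \<le> pw E" using E_bounds by (subst pw_le_iff) auto
      then show ?thesis by simp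
    qed
    have "- hi \<le> - v3 + pw (- P)" "- v3 + pw (- P) \<le> 5 / 4"
    proof -
      have "- 1 \<le> v3 \<and> v3 \<le> hi"
      proof (cases cc)
        case False
        then have "pw (- P) \<le> v3" "v3 \<le> hi" using v3(5) l3' by blast+
        then show ?thesis using pP by linarith
      next
        case True
        then have "- 1 \<le> v3" "v3 \<le> 0" using v3(6) by blast+
        then show ?thesis using pE2 by linarith
      qed
      then show "- hi \<le> - v3 + pw (- P)" "- v3 + pw (- P) \<le> 5 / 4" using pP pE2 by linarith+
    qed
    then obtain y4 where y4: "y4 \<in> F" "R (- v3 + pw (- P)) = Fin y4" "y4 \<le> 5 / 4"
      using R_range[of "- hi" "- v3 + pw (- P)" "5 / 4"] hi_F by auto
    have l4: "cc \<longrightarrow> pw (- P) \<le> y4" using R_ge[OF y4(2), of "pw (- P)"] v3(6) pws_F by auto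
    then have c4: "cc \<longrightarrow> 0 < y4 \<and> y4 \<le> 5 / 4" using y4(3) pP(2) by linarith
    have d4: "\<not> cc \<longrightarrow> y4 \<le> 0" using R_le[OF y4(2), of 0] l3' by auto
    obtain v4 s4 where v4: "sg (Fin y4) = Fin v4" "sg' (Fin y4) = Fin s4" "v4 \<in> F" "s4 \<in> F"
      "cc \<longrightarrow> v4 \<le> 5 / 4 \<and> (\<forall>z\<in>F. 2 * z \<le> y4 \<longrightarrow> z \<le> v4)" "\<not> cc \<longrightarrow> - 1 \<le> v4 \<and> v4 \<le> 0"
      using pos_step[OF y4(1) c4 d4] by blast
    have "2 * pw (- P - 1) = pw (- P)" using pw_add[of 1 "- P - 1"] by simp
    then have l4': "cc \<longrightarrow> pw (- P - 1) \<le> v4" using v4(5) l4 pws_F by auto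
    have "Fin (- 1) \<otimes> Fin v3 \<oplus> Fin (pw (- P)) = Fin y4" using y4(2) v3(3) by (simp add: R_F)
    from forward_step[OF g3 this v4(1-4)] have g4: "gives N4 x [v4] [0] (\<lambda>_. [])" by (simp add: N4_def)
    have tau2: "2 * \<tau> = pw E * pw (- P - 1)"
    proof -
      have "pw (E - P - 1) = 2 * pw (E - P - 2)" using pw_add[of 1 "E - P - 2"] by simp
      moreover have e: "E + (- P - 1) = E - P - 1" by simp
      ultimately show ?thesis using pw_add[of E "- P - 1", unfolded e] by simp
    qed
    have m4: "- pw E \<le> pw E * v4" "pw E * v4 \<le> hi"
    proof -
      have "- 1 \<le> v4 \<and> v4 \<le> 5 / 4"
      proof (cases cc)
        case True
        then have "pw (- P - 1) \<le> v4" "v4 \<le> 5 / 4" using v4(5) l4' by blast+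
        moreover have "0 < pw (- P - 1)" by simp
        ultimately show ?thesis by linarith
      next
        case False
        then have "- 1 \<le> v4" "v4 \<le> 0" using v4(6) by blast+
        then show ?thesis by linarith
      qed
      then have "pw E * - 1 \<le> pw E * v4" "pw E * v4 \<le> pw E * (5 / 4)" using pE(1) by (intro mult_left_mono; simp)+
      then show "- pw E \<le> pw E * v4" "pw E * v4 \<le> hi" by simp_all
    qed
    obtain r where r: "r \<in> F" "R (pw E * v4) = Fin r" "- pw E \<le> r" "r \<le> hi"
      using R_range[of "- pw E" "pw E * v4" hi] m4 hi_F pws_F by auto
    show ?thesis
    proof (cases cc)
      case True
      then have "2 * \<tau> \<le> pw E * v4" unfolding tau2 using l4' pE(1) by (intro mult_left_mono) auto
      moreover have "2 * \<tau> \<in> F"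
      proof -
        have "pw (E - P - 1) \<in> F" using E_bounds by (intro pw_F) (auto simp: emin_eq)
        moreover have "2 * \<tau> = pw (E - P - 1)" using pw_add[of 1 "E - P - 2"] by simp
        ultimately show ?thesis by simp
      qed
      ultimately have "2 * \<tau> \<le> r" using R_ge[OF r(2)] by blast
      then have "\<tau> \<le> r - B" "r - B \<le> hi" using B_tau r(4) B_pos by linarith+
      then obtain y5 where y5: "y5 \<in> F" "R (r - B) = Fin y5" "\<tau> \<le> y5" "y5 \<le> hi"
        using R_range[of \<tau> "r - B" hi] pws_F hi_F by auto
      have s5: "sg (Fin y5) = Fin y5" "sg' (Fin y5) = Fin 1" using act_large[OF y5(1)] y5(3) B_tau by auto
      have "Fin (pw E) \<otimes> Fin v4 \<oplus> Fin (- B) = Fin y5" using r y5 by simp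
      from forward_step[OF g4 this s5 y5(1) hi_F(5)] show ?thesis using y5 True by (auto simp: N5_def cc_def)
    next
      case False
      then have "pw E * v4 \<le> 0" using v4(6) pE(1) by (auto simp: mult_le_0_iff)
      then have "r \<le> 0" using R_le[OF r(2), of 0] by simp
      then have "neg (Fin (pw E) \<otimes> Fin v4 \<oplus> Fin (- B))" using r(2) R_upper_neg[of "r - B"] by simp
      then have s5: "sg (Fin (pw E) \<otimes> Fin v4 \<oplus> Fin (- B)) = Fin \<kappa>" "sg' (Fin (pw E) \<otimes> Fin v4 \<oplus> Fin (- B)) = Fin 0"
        using act_neg by blast+
      have "gives N5 x [\<kappa>] [g] (\<lambda>_. [])" if "g \<in> F" for g
        unfolding N5_def by (rule dead_step[OF g4 refl s5 kF that])
      then show ?thesis using False by (simp add: cc_def)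
    qed
  qed
  then show ?thesis unfolding band_detector_def using h5 by blast
qed

text \<open>A firing value is at least \<tau>, so twice it subtracted from \<tau> is at most -
  \<tau> and saturates; \<kappa> is 0 or - 1 and leads to a value between \<tau> and \<tau> +
  2.\<close>

lemma band_detector_flip:
  assumes "band_detector MM \<kappa> S \<tau> hi m j N"
  shows "\<exists>N. band_detector MM \<kappa> (\<lambda>y. \<not> S y) \<tau> hi (Suc m) j N"
proof -
  define N' where "N' = N @ [([[- 2]], [\<tau>])]"
  have h: "hnet (Suc m) 1 N'" using assms hi_F pws_F unfolding N'_def band_detector_def by (intro hnet_unary) auto
  have "if \<not> S (x ! j) then \<exists>v\<in>F. gives N' x [v] [0] (\<lambda>_. []) \<and> \<tau> \<le> v \<and> v \<le> hi
     else (\<forall>g\<in>F. gives N' x [\<kappa>] [g] (\<lambda>_. []))" if x: "x \<in> grid MM" for x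
  proof (cases "S (x ! j)")
    case True
    then obtain v where v: "v \<in> F" "gives N x [v] [0] (\<lambda>_. [])" "\<tau> \<le> v" using bspec[OF conjunct2[OF assms[unfolded band_detector_def]] x] True by auto
    have "neg (Fin (- 2) \<otimes> Fin v \<oplus> Fin \<tau>)"
    proof -
      have "- (2 * \<tau>) \<in> F"
      proof -
        have "pw (E - P - 1) \<in> F" using E_bounds by (intro pw_F) (auto simp: emin_eq)
        moreover have "2 * \<tau> = pw (E - P - 1)" using pw_add[of 1 "E - P - 2"] by simp
        ultimately show ?thesis by simp
      qed
      moreover have "- 2 * v \<le> - (2 * \<tau>)" using v by simp
      ultimately consider y where "R (- 2 * v) = Fin y" "y \<le> - (2 * \<tau>)" | "R (- 2 * v) = NInf"
        using R_upper by metis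
      then show ?thesis
      proof cases
        case 1
        then have "y + \<tau> \<le> - B" using B_tau(1) by linarith
        then show ?thesis using 1 R_upper_neg by simp
      qed (simp add: neg_def)
    qed
    then have s: "sg (Fin (- 2) \<otimes> Fin v \<oplus> Fin \<tau>) = Fin \<kappa>" "sg' (Fin (- 2) \<otimes> Fin v \<oplus> Fin \<tau>) = Fin 0" using act_neg by blast+
    have "gives N' x [\<kappa>] [g] (\<lambda>_. [])" if "g \<in> F" for g
      unfolding N'_def by (rule dead_step[OF v(2) refl s kF that])
    then show ?thesis using True by simp
  next
    case False
    then have g: "gives N x [\<kappa>] [0] (\<lambda>_. [])" using bspec[OF conjunct2[OF assms[unfolded band_detector_def]] x] False by simp
    have "- 2 * \<kappa> \<in> F" "0 \<le> - 2 * \<kappa>" "- 2 * \<kappa> \<le> 2" using \<kappa> hi_F by auto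
    moreover have "\<tau> + 2 \<le> hi"
    proof -
      have "\<tau> \<le> pw (E - 2)" using P2 by (subst pw_le_iff) auto
      moreover have "pw 1 \<le> pw (E - 2)" using E_bounds by (subst pw_le_iff) auto
      ultimately show ?thesis by (simp add: pw_diff)
    qed
    ultimately obtain y where y: "y \<in> F" "R (- 2 * \<kappa> + \<tau>) = Fin y" "\<tau> \<le> y" "y \<le> hi"
      using R_range[of \<tau> "- 2 * \<kappa> + \<tau>" hi] pws_F hi_F by auto
    have s5: "sg (Fin y) = Fin y" "sg' (Fin y) = Fin 1" using act_large[OF y(1)] y(3) B_tau by auto
    have "Fin (- 2) \<otimes> Fin \<kappa> \<oplus> Fin \<tau> = Fin y" using y \<open>- 2 * \<kappa> \<in> F\<close> by (simp add: R_F)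
    from forward_step[OF g this s5 y(1) hi_F(5)] show ?thesis using y False by (auto simp: N'_def)
  qed
  then show ?thesis unfolding band_detector_def using h by blast
qed

text \<open>The sixth layer moves \<kappa> to an exact 0 by the bias of \<open>zero_bias\<close>.
  Its slope \<open>s0\<close> may be nonzero there, but the gradient it lets through ends in the
  saturated neuron before it.\<close>

lemma detector_ex:
  assumes "6 \<le> m" "j < d" "z \<in> F" "\<bar>z\<bar> \<le> MM"
  shows "\<exists>N. detects MM 1 (E - P - 2) m j z u N"
proof -
  obtain m' where m': "m = Suc m'" "5 \<le> m'" using assms(1) by (cases m) auto
  obtain N where N: "band_detector MM \<kappa> (fires u z) \<tau> hi m' j N"
  proof -
    have base: "\<exists>N. band_detector MM \<kappa> (fires u z) \<tau> hi 5 j N" if "z \<in> F" "\<bar>z\<bar> \<le> MM" for z u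
      using band_detector_base[OF assms(2) that] .
    have "\<exists>N. band_detector MM \<kappa> (fires u z) \<tau> hi m' j N"
    proof (rule band_detector_all[where mb = 5])
      show "\<exists>N. band_detector MM \<kappa> (\<lambda>y. \<not> S y) \<tau> hi (Suc m) j N" if "band_detector MM \<kappa> S \<tau> hi m j N" for m S N
        using band_detector_flip[OF that] .
    qed (fact base sgB kF assms m')+
    then show ?thesis using that by blast
  qed
  obtain bt s0 where bt: "bt \<in> F" "s0 \<in> F" "\<bar>s0\<bar> \<le> 1" "sg (Fin \<kappa> \<oplus> Fin bt) = Fin 0" "sg' (Fin \<kappa> \<oplus> Fin bt) = Fin s0"
    "\<And>n. n \<in> F \<Longrightarrow> \<tau> \<le> n \<Longrightarrow> n \<le> hi \<Longrightarrow> \<exists>n'\<in>F. Fin n \<oplus> Fin bt = Fin n' \<and> \<tau> \<le> n'" using zero_bias by blast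
  define N' where "N' = N @ [([[1]], [bt])]"
  have h: "hnet m 1 N'" using N hi_F bt unfolding N'_def band_detector_def m'(1) by (intro hnet_unary) auto
  have "if fires u z (x ! j) then (\<exists>v e. gives N' x [v] [0] (\<lambda>_. []) \<and> Fin (- 1) \<otimes> Fin v = Fin e \<and> e \<le> - \<tau>)
     else (\<forall>g\<in>F. gives N' x [0] [g] (\<lambda>_. []))" if x: "x \<in> grid MM" for x
  proof (cases "fires u z (x ! j)")
    case True
    then obtain v where v: "v \<in> F" "gives N x [v] [0] (\<lambda>_. [])" "\<tau> \<le> v" "v \<le> hi" using bspec[OF conjunct2[OF N[unfolded band_detector_def]] x] True by auto
    then obtain n' where n': "n' \<in> F" "Fin v \<oplus> Fin bt = Fin n'" "\<tau> \<le> n'" using bt(6) by blast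
    have s5: "sg (Fin n') = Fin n'" "sg' (Fin n') = Fin 1" using act_large[OF n'(1)] n'(3) B_tau by auto
    have "Fin 1 \<otimes> Fin v \<oplus> Fin bt = Fin n'" using n' v(1) by (simp add: R_F)
    from forward_step[OF v(2) this s5 n'(1) hi_F(5)] have "gives N' x [n'] [0] (\<lambda>_. [])" by (simp add: N'_def)
    moreover have "Fin (- 1) \<otimes> Fin n' = Fin (- n')" using n'(1) by (simp add: R_F)
    ultimately show ?thesis using True n'(3) by auto
  next
    case False
    have "gives N' x [0] [g] (\<lambda>_. [])" if g: "g \<in> F" for g
    proof -
      have "\<bar>g * s0\<bar> \<le> Omega p q"
        unfolding abs_mult using F_abs_le[OF g] bt(3) mult_mono[of "\<bar>g\<bar>" "Omega p q" "\<bar>s0\<bar>" 1] by simp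
      then obtain t where t: "R (g * s0) = Fin t" using R_in_range by blast
      have tF: "t \<in> F" using R_Fin_F[OF t] .
      have gN: "gives N x [\<kappa>] [t] (\<lambda>_. [])" using bspec[OF conjunct2[OF N[unfolded band_detector_def]] x] False tF by simp
      have y: "Fin 1 \<otimes> Fin \<kappa> \<oplus> Fin bt = Fin \<kappa> \<oplus> Fin bt" using kF by (simp add: R_F)
      show ?thesis unfolding N'_def
        by (rule gives_unary[OF gN, where s = s0 and t = t]) (use y bt t tF g in \<open>simp_all add: R_F del: fadd.simps\<close>)
    qed
    then show ?thesis using False by simp
  qed
  then show ?thesis unfolding detects_def using h by blast
qed

text \<open>The relay features are the constant B on the whole grid. The weight bound J = E - q - 1
  keeps a product with B within 2^(E - 1).\<close>

lemma relayer_identity: "relayer p q a c 1 1 B B (E - int q - 1) (E - P - 2) (\<lambda>r. r = B)"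
proof (unfold_locales)
  show "P + 6 \<le> E - int q - 1" using E_bounds by simp
  show "2 * E + 2 \<le> 4 * (E - int q - 1 - 2)" using E_bound_q by simp
  show "E - int q - 1 \<le> E" by simp
  have "pw (E - int q - 1) * \<bar>B\<bar> = pw (E - 1)" unfolding B_def by (simp add: pw_diff)
  also have "\<dots> \<le> pw E" by (subst pw_le_iff) simp
  also have "\<dots> \<le> Omega p q" using Omega_bounds(1) pw_pos[of E] by linarith
  finally show "pw (E - int q - 1) * \<bar>B\<bar> \<le> Omega p q" .
  have "\<bar>B\<bar> = B" using B_pos by (simp only: abs_of_pos)
  then show "\<And>r. r = B \<Longrightarrow> 1 * \<bar>r\<bar> \<le> \<tau>" using B_tau(1) by simp
  show "sg (Fin B) = Fin B" "sg' (Fin B) = Fin 1" using act_large[of B] by auto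
  fix r w assume r: "r = B" and w: "w \<in> F" "\<bar>w\<bar> \<le> pw (E - int q - 1)"
  have "pw (E - int q - 1) * B = pw (E - 1)" unfolding B_def by (simp add: pw_diff)
  moreover have "\<bar>w\<bar> * B \<le> pw (E - int q - 1) * B" using w(2) B_pos by (intro mult_right_mono) (auto simp: less_imp_le)
  moreover have "\<bar>w * B\<bar> = \<bar>w\<bar> * B" by (simp only: abs_mult abs_of_pos[OF B_pos])
  ultimately have "\<bar>w * B\<bar> \<le> pw (E - 1)" by linarith
  moreover have "pw (E - 1) \<le> pw E" by (subst pw_le_iff) simp
  ultimately have "\<bar>w * B\<bar> \<le> Omega p q" using Omega_bounds(1) pw_pos[of E] by linarith
  then obtain y where y: "R (w * B) = Fin y" using R_in_range by blast
  have "(Fin w \<otimes> Fin r) \<oplus> (Fin (- w) \<otimes> Fin B) \<oplus> Fin B = Fin B"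
    using y R_minus_Fin[OF y] R_Fin_F[OF y] r by (simp add: R_F)
  then show "\<exists>y v s. (Fin w \<otimes> Fin r) \<oplus> (Fin (- w) \<otimes> Fin B) \<oplus> Fin B = y \<and> sg y = Fin v \<and> sg' y = Fin s \<and> v \<in> F \<and> s \<in> F \<and> v = B"
    using act_large[of B] hi_F by auto
qed (use hi_F pws_F B_F in simp_all)

text \<open>A huge bias absorbs the weighted input, so the forward pass is constant on the grid
  while the weight \<epsilon> still enters the gradient. The next layer takes the difference to a
  twin with the same bias and returns to B.\<close>

lemma path_ex:
  assumes "7 \<le> m" "j < d" "x0 \<in> grid MM" "h \<in> F" "h \<noteq> 0" "\<bar>h\<bar> \<le> Omega p q" "s \<in> {1, -1}"
    "emin q - P \<le> k" "k \<le> E - P"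
  shows "\<exists>N. path_relay MM (E - P - 2) 1 m j x0 h s k N"
proof -
  interpret relayer p q a c d MM 1 1 B B "E - int q - 1" "E - P - 2" "\<lambda>r. r = B" by (rule relayer_identity)
  \<comment> \<open>The weighted input is at most \<tau>. With 2^E as bias this could already be a
    tie with the float below; the factor 3 / 2 leaves a margin and stays below Omega.\<close>
  define R3 where "R3 = 3 / 2 * pw E"
  \<comment> \<open>The absorption requires \<epsilon> \<le> 2^(-p). For k \<le> 0 it is smaller
    still, so that the gradient multiplied by it has a normal exponent e' even if 2^k is subnormal;
    for large k that would push e' beyond E.\<close>
  define i where "i = (if k \<le> 0 then - P - 3 else - P)"
  define \<epsilon> where "\<epsilon> = pw i"
  define e' where "e' = k - i"
  have "of_int 6 * pw (E - 2) \<in> F" using E_bounds by (intro small_mult_F) (auto simp: emin_eq)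
  then have R3F: "R3 \<in> F" by (simp add: R3_def pw_diff)
  have R3B: "B \<le> R3" using B_tau pw_pos[of E] unfolding R3_def by linarith
  have R3s: "sg (Fin R3) = Fin R3" "sg' (Fin R3) = Fin 1" using act_large[OF R3F R3B] by auto
  have Bs: "sg (Fin B) = Fin B" "sg' (Fin B) = Fin 1" using act_large[of B] by auto
  have \<epsilon>F: "\<epsilon> \<in> F" unfolding \<epsilon>_def i_def using E_bounds P2 by (intro pw_F) (auto simp: emin_eq)
  have \<epsilon>le: "\<epsilon> \<le> pw (- P)" unfolding \<epsilon>_def i_def by (subst pw_le_iff) simp
  define N where "N = par [([urow j \<epsilon>], [R3])] [([replicate d 0], [R3])] @ [relay_layer 1 B]"
  have h1: "hnet 1 1 [([urow j \<epsilon>], [R3])]" "hnet 1 1 [([replicate d 0], [R3])]"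
    using hnet_base[OF \<epsilon>F R3F] hnet_const[OF R3F] by auto
  have "hnet 1 2 (par [([urow j \<epsilon>], [R3])] [([replicate d 0], [R3])])" using hnet_par[OF h1] by (simp add: numeral_2_eq_2)
  from hnet_snoc[OF this layer_ok_relay[OF hi_F(5) B_F(1)] zero_less_numeral]
  have hN: "hnet 2 2 N" by (simp only: N_def Suc_1)
  have y1: "Fin \<epsilon> \<otimes> Fin (x ! j) \<oplus> Fin R3 = Fin R3" if x: "x \<in> grid MM" for x
  proof -
    have "\<bar>\<epsilon> * (x ! j)\<bar> \<le> pw (- P) * MM" unfolding abs_mult using \<epsilon>le grid_nth[OF x assms(2)] \<epsilon>_def
      by (intro mult_mono) auto
    also have "\<dots> = pw (E - P - 2)" using pw_add[of "- P" "E - 2"] by (simp add: algebra_simps)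
    finally have 1: "\<bar>\<epsilon> * (x ! j)\<bar> \<le> \<tau>" .
    then have "- \<tau> \<le> \<epsilon> * (x ! j)" "\<epsilon> * (x ! j) \<le> \<tau>" by linarith+
    then obtain y where y: "y \<in> F" "R (\<epsilon> * (x ! j)) = Fin y" "- \<tau> \<le> y" "y \<le> \<tau>"
      using R_range[of "- \<tau>" "\<epsilon> * (x ! j)" \<tau>] pws_F by auto
    have "R (y + R3) = Fin R3"
    proof (rule R_unique[OF R3F])
      have pE: "\<tau> < pw (E - P - 1)" "\<tau> \<le> pw E / 4" "0 < pw E"
      proof -
        show "\<tau> < pw (E - P - 1)" by (subst pw_less_iff) simp
        have "\<tau> \<le> pw (E - 2)" using P2 by (subst pw_le_iff) simp
        then show "\<tau> \<le> pw E / 4" by (simp add: pw_diff)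
      qed simp
      show "\<bar>y + R3\<bar> < Omega p q + pw (E - P - 1)"
        using y pE Omega_bounds(1) unfolding R3_def by linarith
      fix z assume z: "z \<in> F" "z \<noteq> R3"
      have "\<bar>R3\<bar> * pw (- P - 1) \<le> \<bar>z - R3\<bar>" by (rule F_ratio[OF R3F z])
      moreover have "\<bar>R3\<bar> * pw (- P - 1) = 3 * \<tau>"
      proof -
        have "\<bar>R3\<bar> = 3 / 2 * pw E" unfolding R3_def by simp
        then have "\<bar>R3\<bar> * pw (- P - 1) = 3 / 2 * (pw E * pw (- P - 1))" by simp
        also have "pw E * pw (- P - 1) = pw (E - P - 1)"
        proof -
          have e: "E + (- P - 1) = E - P - 1" by simp
          show ?thesis using pw_add[of E "- P - 1", unfolded e] by simp
        qed
        also have "\<dots> = 2 * \<tau>" using pw_add[of 1 "E - P - 2"] by simp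
        finally show ?thesis by simp
      qed
      moreover have "0 < \<tau>" by simp
      ultimately show "\<bar>y + R3 - R3\<bar> < \<bar>y + R3 - z\<bar>" using y by linarith
    qed
    then show ?thesis using y by simp
  qed
  have z2: "(Fin 1 \<otimes> Fin R3) \<oplus> (Fin (- 1) \<otimes> Fin R3) \<oplus> Fin B = Fin B" using R3F by (simp add: R_F)
  have step: "gives N x [B, B] [g, - g] (\<lambda>i. if i = j then [e] else [])"
    if x: "x \<in> grid MM" and g: "g \<in> F" "Fin g \<otimes> Fin \<epsilon> = Fin e" for x g e
  proof -
    have lx: "length x = d" using x by (simp add: grid_def)
    have gF: "g \<in> F" "- g \<in> F" using g by auto
    have G1: "gives [([urow j \<epsilon>], [R3])] x [R3] [g] (\<lambda>i. if i = j then [e] else [])"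
      using gives_base[OF lx assms(2), of \<epsilon> R3 R3 1 g g e] y1[OF x] R3s R3F hi_F gF g(2) by (simp add: R_F)
    have G2: "gives [([replicate d 0], [R3])] x [R3] [- g] (\<lambda>_. [])"
      using gives_const[OF lx R3s R3F R3F hi_F(5) gF(2), of "- g"] gF by (simp add: R_F)
    have "gives (par [([urow j \<epsilon>], [R3])] [([replicate d 0], [R3])]) x [R3, R3] [g, - g] (\<lambda>i. if i = j then [e] else [])"
      using gives_par[OF h1 G1 G2] by simp
    from gives_relay[OF this z2 Bs Bs B_F(1) B_F(1) hi_F(5) B_F(1) hi_F(5) gF, of g "- g"]
    show ?thesis unfolding N_def using gF by (simp add: R_F)
  qed
  have base: "\<exists>N e. pstate 2 N x0 t (\<lambda>i. if i = j then [e] else []) \<and> fits s k e"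
    if t: "t \<in> F" "7 / 8 * pw e' \<le> s * t" "s * t \<le> pw e'" for t
  proof -
    have pk: "pw e' * \<epsilon> = pw k" unfolding \<epsilon>_def by (simp only: pw_add[symmetric]) (simp add: e'_def)
    have b: "7 / 8 * pw k \<le> s * (t * \<epsilon>)" "s * (t * \<epsilon>) \<le> pw k"
    proof -
      have "0 < \<epsilon>" by (simp add: \<epsilon>_def)
      then have "7 / 8 * pw e' * \<epsilon> \<le> s * t * \<epsilon>" "s * t * \<epsilon> \<le> pw e' * \<epsilon>" using t by (intro mult_right_mono; simp)+
      then show "7 / 8 * pw k \<le> s * (t * \<epsilon>)" "s * (t * \<epsilon>) \<le> pw k" unfolding pk[symmetric] by (simp_all only: mult.assoc)
    qed
    have kF': "pw k \<in> F" using assms P2 by (intro pw_F) auto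
    obtain e where e: "R (s * (t * \<epsilon>)) = Fin e" "e \<in> F" "e \<le> pw k"
    proof -
      have "0 \<le> s * (t * \<epsilon>)" using b(1) pw_pos[of k] by linarith
      then show ?thesis using R_range[of 0 "s * (t * \<epsilon>)" "pw k"] b(2) kF' that by auto
    qed
    \<comment> \<open>2^k is itself a float within 2^k / 8 of the product, so rounding, even to a
      subnormal, loses at most another 1/8 and the result stays above one half of 2^k.\<close>
    have "\<bar>e - s * (t * \<epsilon>)\<bar> \<le> \<bar>pw k - s * (t * \<epsilon>)\<bar>" by (rule R_near[OF e(1) kF'])
    moreover have "0 < pw k" by simp
    ultimately have e2: "pw k / 2 < e" using b by linarith
    have se: "Fin t \<otimes> Fin \<epsilon> = Fin (s * e)" using assms(7) e(1) R_minus_Fin[OF e(1)] by auto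
    have f: "fits s k (s * e)" using e e2 assms(7) by (auto simp: fits_def)
    have "pstate 2 N x0 t (\<lambda>i. if i = j then [s * e] else [])" unfolding pstate_def
    proof (intro conjI ballI)
      show "hnet 2 2 N" by (rule hN)
      show "gives N x0 [B, B] [1 * t, - (1 * t)] (\<lambda>i. if i = j then [s * e] else [])" using step[OF assms(3) t(1) se] by simp
      fix x assume x: "x \<in> grid MM"
      from step[OF x t(1) se] have "gives N x [B, B] (replicate 2 0) (\<lambda>_. [])" by (rule gives_zeros[OF hN])
      then show "\<exists>r. r = B \<and> gives N x [r, B] [0, 0] (\<lambda>_. [])" by (simp add: numeral_2_eq_2)
    qed
    then show ?thesis using f by blast
  qed
  have "emin q + 2 \<le> e'" using assms(8) E_bounds P2 by (auto simp: e'_def i_def emin_eq)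
  have "e' \<le> E" using assms(9) P2 E_bounds by (auto simp: e'_def i_def)
  then have "pw e' \<le> pw E" by (simp only: pw_le_iff)
  moreover have PE: "pw (P + 6) \<le> pw E" using E_bounds by (subst pw_le_iff) auto
  moreover have "pw E \<le> Omega p q" using Omega_bounds(1) pw_pos[of E] by linarith
  ultimately have "1 * pw e' \<le> Omega p q" "1 * max \<bar>h\<bar> (pw (P + 6)) \<le> Omega p q" using assms(6) by auto
  from path_relay_ex[OF base \<open>emin q + 2 \<le> e'\<close> this(1) assms(4,5) this(2) assms(7,1)] show ?thesis by blast
qed

lemma eventual_identity_cells: "cells p q a c d MM (Omega p q) 1 \<kappa> 1 1 B B (E - P - 2)"
proof (unfold_locales)
  show "emin q - P \<le> E - P - 2" "E - P - 2 + 3 \<le> E" "int q \<le> E - P - 2" using E_bounds P2 by (auto simp: emin_eq)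
  show "\<And>v. neg v \<Longrightarrow> sg v = Fin \<kappa> \<and> sg' v = Fin 0" by (rule act_neg)
  have "0 < B" by simp
  then show "\<bar>B\<bar> \<le> 4 * \<tau>" using B_tau by linarith
  show "sg (Fin B) = Fin B" "sg' (Fin B) = Fin 1" using act_large[of B] by auto
  show "\<And>h. h \<in> F \<Longrightarrow> \<bar>h\<bar> \<le> Omega p q \<Longrightarrow> \<exists>g e g'. Fin h \<otimes> Fin 1 = Fin g \<and> Fin g \<otimes> Fin 1 = Fin h \<and> Fin h \<otimes> Fin (- 1) = Fin e \<and>
      Fin h \<otimes> Fin (- 1) = Fin (- g) \<and> Fin (- g) \<otimes> Fin 1 = Fin (- h) \<and> Fin (- h) \<otimes> Fin (- 1) = Fin g'"
    by (simp add: R_F)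
  show "\<And>v. v \<in> {B, \<kappa>} \<Longrightarrow> \<exists>y. Fin 1 \<otimes> Fin v = Fin y \<and> Fin (- 1) \<otimes> Fin v = Fin (- y)"
    using kF by (auto simp: R_F)
qed (use kF hi_F B_F detector_ex path_ex value_cells in auto)

end

section \<open>Saturating activations\<close>

text \<open>\<rho> and \<delta> are value and slope at 0: 1/2 and 1/4 for Sigmoid, 0 and 1 for tanh.
  Both ends saturate, so a neuron can pass on a gradient only between - B and B, and the relays are
  built to have pre-activation 0 at the chosen point. \<open>pass_cell\<close> maps \<kappa> to 0 in
  the last layer of a detector.\<close>

locale saturating = net +
  fixes \<kappa> \<omega> \<delta> \<rho> H :: real
  assumes \<kappa>: "\<kappa> \<in> {0, -1}" and \<omega>: "\<omega> \<in> {1, 4}" "\<delta> * \<omega> = 1" and \<rho>: "\<rho> \<in> {0, 1 / 2}" "\<kappa> \<le> \<rho>"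
    and H: "H \<le> pw (P - 1)"
    and act_neg: "\<And>v. neg v \<Longrightarrow> sg v = Fin \<kappa> \<and> sg' v = Fin 0"
    and act_top: "\<And>v. v = PInf \<or> (\<exists>t\<in>F. v = Fin t \<and> B \<le> t) \<Longrightarrow> sg v = Fin 1 \<and> sg' v = Fin 0"
    and act_zero: "sg (Fin 0) = Fin \<rho>" "sg' (Fin 0) = Fin \<delta>"
    and act_range: "\<And>t. t \<in> F \<Longrightarrow> \<exists>v\<in>F. \<exists>s\<in>F. sg (Fin t) = Fin v \<and> sg' (Fin t) = Fin s \<and> \<kappa> \<le> v \<and> v \<le> 1"
    and act_sides: "\<And>t v. t \<in> F \<Longrightarrow> sg (Fin t) = Fin v \<Longrightarrow> t \<le> 0 \<Longrightarrow> v \<le> \<rho>"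
      "\<And>t v. t \<in> F \<Longrightarrow> sg (Fin t) = Fin v \<Longrightarrow> pw (1 - P) \<le> t \<Longrightarrow> \<rho> + pw (- P - 1) \<le> v"
    and pass_cell: "\<exists>wt bt s0 v s1. {wt, bt, s0, v, s1} \<subseteq> F \<and> sg (Fin wt \<otimes> Fin \<kappa> \<oplus> Fin bt) = Fin 0 \<and> sg' (Fin wt \<otimes> Fin \<kappa> \<oplus> Fin bt) = Fin s0 \<and>
      (\<forall>g\<in>F. \<exists>t e. Fin g \<otimes> Fin s0 = Fin t \<and> Fin t \<otimes> Fin wt = Fin e) \<and>
      sg (Fin wt \<otimes> Fin 1 \<oplus> Fin bt) = Fin v \<and> sg' (Fin wt \<otimes> Fin 1 \<oplus> Fin bt) = Fin s1 \<and> 1 / 2 \<le> v \<and> v \<le> 1"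
    and value_cells: "\<And>s k. s \<in> {1, -1} \<Longrightarrow> emin q - P \<le> k \<Longrightarrow> k \<le> E - P \<Longrightarrow> value_cell H (2 * B) (int q) \<kappa> s k"
begin

abbreviation MM where "MM \<equiv> pw (E - 1)"

lemma const_in_F: "1 \<in> F" "- 1 \<in> F" "2 \<in> F" "4 \<in> F" "1 / 2 \<in> F" "1 / 4 \<in> F" "\<kappa> \<in> F" "\<rho> \<in> F" "\<omega> \<in> F" "\<delta> \<in> F"
proof -
  have "pw 0 \<in> F" "pw 1 \<in> F" "pw 2 \<in> F" "pw (- 1) \<in> F" "pw (- 2) \<in> F"
    using E_bounds by (auto intro!: pw_F simp only: emin_eq)
  then show F: "1 \<in> F" "2 \<in> F" "4 \<in> F" "1 / 2 \<in> F" "1 / 4 \<in> F" by (simp_all add: power_int_minus)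
  then show "- 1 \<in> F" by simp
  then show "\<kappa> \<in> F" "\<omega> \<in> F" using \<kappa> \<omega> F by auto
  have "\<rho> = 0 \<or> \<rho> = 1 / 2" using \<rho> by blast
  then show "\<rho> \<in> F" using F zero_F by metis
  have "\<delta> = 1 \<or> \<delta> = 1 / 4" using \<omega> by auto
  then show "\<delta> \<in> F" using F by metis
qed

lemma B_mult_F: "2 * B \<in> F" "3 * B \<in> F" "4 * B \<in> F" "pw (int q + P + 1) \<in> F" "pw E \<in> F" "MM \<in> F"
proof -
  have "of_int n * pw (int q) \<in> F" if "\<bar>n\<bar> \<le> 7" for n using E_bounds that by (intro small_mult_F) (auto simp: emin_eq)
  from this[of 2] this[of 3] this[of 4] show "2 * B \<in> F" "3 * B \<in> F" "4 * B \<in> F" by (simp_all add: B_def)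
  show "pw (int q + P + 1) \<in> F" "pw E \<in> F" "MM \<in> F" using E_bounds by (auto intro!: pw_F simp: emin_eq)
qed

lemma pwE_le: "pw E \<le> Omega p q" "MM \<le> pw E" "2 * MM = pw E" "1 \<le> MM"
proof -
  show "pw E \<le> Omega p q" using Omega_bounds(1) pw_pos[of E] by linarith
  show "MM \<le> pw E" by (subst pw_le_iff) simp
  show "2 * MM = pw E" by (simp add: pw_diff)
  have "pw 0 \<le> MM" using E_bounds by (subst pw_le_iff) auto
  then show "1 \<le> MM" by simp
qed

lemma sgB: "sg (Fin (- B)) = Fin \<kappa>" "sg' (Fin (- B)) = Fin 0"
  using act_neg[of "Fin (- B)"] by (auto simp: neg_def)

definition pos :: "ext \<Rightarrow> bool" where "pos v \<longleftrightarrow> v = PInf \<or> (\<exists>t\<in>F. v = Fin t \<and> B \<le> t)"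

text \<open>4 * B * v - 3 * B separates v = 1 from v \<le> 1 / 2 with margin B on both sides, so one
  layer restores the values 1 and \<kappa>.\<close>

lemma saturate_neg:
  assumes "s \<le> 1 / 2" shows "neg (Fin (4 * B) \<otimes> Fin s \<oplus> Fin (- (3 * B)))"
proof -
  have "4 * B * s \<le> 4 * B * (1 / 2)" using assms B_pos by (intro mult_left_mono) (auto simp: less_imp_le)
  then have "4 * B * s \<le> 2 * B" by simp
  then consider y where "R (4 * B * s) = Fin y" "y \<le> 2 * B" | "R (4 * B * s) = NInf" using R_upper B_mult_F(1) by metis
  then show ?thesis
  proof cases
    case 1
    then show ?thesis using R_upper_neg[of "y + - (3 * B)"] by simp
  qed (simp add: neg_def)
qed

lemma saturate_pos: "Fin (4 * B) \<otimes> Fin 1 \<oplus> Fin (- (3 * B)) = Fin B"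
  using B_mult_F by (simp add: R_F)

lemma B_val: "sg (Fin B) = Fin 1" "sg' (Fin B) = Fin 0"
  using act_top[of "Fin B"] by auto

text \<open>Floats of magnitude at least 1 are multiples of 2^(-p). If |x| < 1, then z < - 1 < x,
  and - 1 takes the place of x.\<close>

lemma float_gap_ge1:
  assumes "x \<in> F" "z \<in> F" "z < x" "1 < \<bar>z\<bar>"
  shows "pw (- P) \<le> x - z"
proof -
  have mult: "\<exists>n::int. y = of_int n * pw (- P)" if y: "y \<in> F" "1 \<le> \<bar>y\<bar>" for y
  proof -
    obtain n e where ne: "\<bar>n\<bar> < 2 ^ (p + 1)" "emin q - P \<le> e" "y = of_int n * pw e" using F_elim[OF y(1)] by metis
    have "- P \<le> e"
    proof (rule ccontr)
      assume "\<not> ?thesis"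
      then have le: "pw e \<le> pw (- P - 1)" by (subst pw_le_iff) simp
      have "real_of_int \<bar>n\<bar> < real_of_int (2 ^ (p + 1))" using ne(1) by (simp only: of_int_less_iff)
      then have "\<bar>real_of_int n\<bar> < 2 ^ (p + 1)" by simp
      then have "\<bar>y\<bar> < 2 ^ (p + 1) * pw e" unfolding ne(3) abs_mult by simp
      also have "\<dots> \<le> 2 ^ (p + 1) * pw (- P - 1)" using le by (intro mult_left_mono) auto
      also have "\<dots> = pw (int (p + 1)) * pw (- P - 1)" by (simp only: pw_nat)
      also have "\<dots> = 1" by (simp only: pw_add[symmetric]) simp
      finally show False using y(2) by simp
    qed
    then have "e = int (nat (e + P)) + - P" by simp
    then have "pw e = 2 ^ nat (e + P) * pw (- P)" by (metis pw_add pw_nat)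
    then show ?thesis using ne(3) by (intro exI[of _ "n * 2 ^ nat (e + P)"]) simp
  qed
  have step: "pw (- P) \<le> y - y'" if y: "\<exists>n::int. y = of_int n * pw (- P)" "\<exists>n::int. y' = of_int n * pw (- P)" "y' < y" for y y'
  proof -
    obtain n n' :: int where n: "y = of_int n * pw (- P)" "y' = of_int n' * pw (- P)" using y by blast
    then have "n' < n" using y(3) by (simp only: mult_less_cancel_right_pos pw_pos of_int_less_iff)
    then have "1 * pw (- P) \<le> of_int (n - n') * pw (- P)" by (intro mult_right_mono) (auto simp del: of_int_diff)
    then show ?thesis unfolding n by (simp add: algebra_simps)
  qed
  have one: "1 \<in> F" "-1 \<in> F" using const_in_F by auto
  show ?thesis
  proof (cases "1 \<le> \<bar>x\<bar>")
    case True
    then show ?thesis using step[OF mult mult assms(3)] assms by auto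
  next
    case False
    then have "z < - 1" "- 1 < x" using assms by auto
    then show ?thesis using step[OF mult[OF one(2)] mult[OF assms(2)]] assms(4) by auto
  qed
qed

text \<open>The scaling by K1 may overflow, but an infinite pre-activation only saturates the neuron.\<close>

lemma scaled_difference:
  assumes "\<xi> \<in> F" "\<zeta> \<in> F" "\<bar>\<zeta>\<bar> \<le> MM" "K1 = (if \<bar>\<zeta>\<bar> \<le> 1 then pw E else 2)"
  shows "\<zeta> < \<xi> \<Longrightarrow> R (K1 * \<xi>) \<oplus> Fin (- (K1 * \<zeta>)) = PInf \<or> (\<exists>y\<in>F. R (K1 * \<xi>) \<oplus> Fin (- (K1 * \<zeta>)) = Fin y \<and> pw (1 - P) \<le> y)"
    and "\<xi> \<le> \<zeta> \<Longrightarrow> R (K1 * \<xi>) \<oplus> Fin (- (K1 * \<zeta>)) = NInf \<or> (\<exists>y\<in>F. R (K1 * \<xi>) \<oplus> Fin (- (K1 * \<zeta>)) = Fin y \<and> y \<le> 0)"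
    and "K1 * \<zeta> \<in> F" "K1 \<in> F" "0 < K1"
proof -
  obtain i where i: "K1 = pw i" "0 \<le> i" "i \<le> E"
  proof (cases "\<bar>\<zeta>\<bar> \<le> 1")
    case True
    then show ?thesis using that[of E] assms(4) E_bounds by simp
  next
    case False
    then show ?thesis using that[of 1] assms(4) E_bounds by simp
  qed
  show K1: "K1 \<in> F" "0 < K1" unfolding i using i E_bounds P2 by (auto intro!: pw_F simp: emin_eq)
  have Kz: "K1 * \<bar>\<zeta>\<bar> \<le> pw E"
  proof (cases "\<bar>\<zeta>\<bar> \<le> 1")
    case True
    then have "pw E * \<bar>\<zeta>\<bar> \<le> pw E * 1" by (intro mult_left_mono) auto
    then show ?thesis using True assms(4) by simp
  next
    case False
    then show ?thesis using assms(3,4) pwE_le by simp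
  qed
  then have absKz: "\<bar>K1 * \<zeta>\<bar> \<le> pw E" using K1 by (simp add: abs_mult)
  show KzF: "K1 * \<zeta> \<in> F" using F_scale_up[OF assms(2) i(2)] absKz pwE_le unfolding i by (simp add: mult.commute)
  have mKzF: "- (K1 * \<zeta>) \<in> F" using KzF by simp
  have OF: "Omega p q \<in> F" unfolding Omega_fl by (rule F_fl_intro) (simp add: Omega_fl)
  have p1P: "pw (1 - P) \<in> F" "pw (1 - P) \<le> 1 / 2"
  proof -
    show "pw (1 - P) \<in> F" using E_bounds P2 by (intro pw_F) (auto simp: emin_eq)
    have "pw (1 - P) \<le> pw (- 1)" using P2 by (subst pw_le_iff) simp
    then show "pw (1 - P) \<le> 1 / 2" by (simp add: power_int_minus)
  qed
  \<comment> \<open>For a product K1 * \<xi> that lies beyond Omega but still rounds to it: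
    subtracting K1 * \<zeta> leaves at least 1/2, hence at least 2^(1 - p).\<close>
  have OE: "1 / 2 \<le> Omega p q - pw E" using Omega_bounds(1) pwE_le by linarith
  have low: "R y = PInf \<or> (\<exists>v\<in>F. R y = Fin v \<and> pw (1 - P) \<le> v)" if y: "pw (1 - P) \<le> y" for y
  proof -
    have "- y \<le> - pw (1 - P)" using y by simp
    have "R y \<noteq> NInf" using y pw_pos[of "1 - P"] unfolding rnd_def by (smt (verit) ext.distinct)
    then consider "R y = PInf" | v where "R y = Fin v" using R_not_NaN by (cases "R y") auto
    then show ?thesis
    proof cases
      case 2
      then show ?thesis using R_ge[OF 2 y p1P(1)] R_Fin_F[OF 2] by blast
    qed simp
  qed
  have up: "R y = NInf \<or> (\<exists>v\<in>F. R y = Fin v \<and> v \<le> 0)" if y: "y \<le> 0" for y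
    using R_upper[OF y zero_F] by metis
  consider "\<bar>K1 * \<xi>\<bar> \<le> Omega p q" | "Omega p q < K1 * \<xi>" | "K1 * \<xi> < - Omega p q" by linarith
  note cs = this
  have exact: "R (K1 * \<xi>) = Fin (K1 * \<xi>)" if "\<bar>K1 * \<xi>\<bar> \<le> Omega p q"
    using R_F[OF F_scale_up[OF assms(1) i(2)]] that unfolding i by (simp add: mult.commute)
  have over: "R (K1 * \<xi>) = PInf \<or> R (K1 * \<xi>) = Fin (Omega p q)" if o: "Omega p q < K1 * \<xi>"
  proof -
    have "R (K1 * \<xi>) \<noteq> NInf" using o Omega_bounds(3) unfolding rnd_def by (smt (verit) ext.distinct)
    then consider "R (K1 * \<xi>) = PInf" | v where "R (K1 * \<xi>) = Fin v" using R_not_NaN by (cases "R (K1 * \<xi>)") auto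
    then show ?thesis
    proof cases
      case 2
      then have "Omega p q \<le> v" using R_ge[OF 2 _ OF] o by simp
      moreover have "v \<le> Omega p q" using F_abs_le[OF R_Fin_F[OF 2]] by simp
      ultimately show ?thesis using 2 by simp
    qed simp
  qed
  have under: "R (K1 * \<xi>) = NInf \<or> R (K1 * \<xi>) = Fin (- Omega p q)" if o: "K1 * \<xi> < - Omega p q"
  proof -
    have mOF: "- Omega p q \<in> F" using OF by simp
    consider v where "R (K1 * \<xi>) = Fin v" "v \<le> - Omega p q" | "R (K1 * \<xi>) = NInf"
      using R_upper[OF less_imp_le[OF o] mOF] by metis
    then show ?thesis
    proof cases
      case 1
      moreover have "- Omega p q \<le> v" using F_abs_le[OF R_Fin_F[OF 1(1)]] by simp
      ultimately show ?thesis by simp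
    qed simp
  qed
  show "R (K1 * \<xi>) \<oplus> Fin (- (K1 * \<zeta>)) = PInf \<or> (\<exists>y\<in>F. R (K1 * \<xi>) \<oplus> Fin (- (K1 * \<zeta>)) = Fin y \<and> pw (1 - P) \<le> y)" if lt: "\<zeta> < \<xi>"
  proof -
    have gap: "pw (1 - P) \<le> K1 * (\<xi> - \<zeta>)"
    proof (cases "\<bar>\<zeta>\<bar> \<le> 1")
      case True
      have "pw (1 - P) = pw E * \<eta>" unfolding \<eta>_def by (simp only: pw_add[symmetric]) (simp add: emin_eq)
      also have "\<dots> \<le> pw E * (\<xi> - \<zeta>)" using F_diff_ge_\<eta>[OF assms(2,1) lt] by (intro mult_left_mono) auto
      finally show ?thesis using True assms(4) by simp
    next
      case False
      have "pw (1 - P) = 2 * pw (- P)" using pw_add[of 1 "- P"] by simp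
      then show ?thesis using float_gap_ge1[OF assms(1,2) lt] False assms(4) by simp
    qed
    show ?thesis
    proof (rule cs)
      assume "\<bar>K1 * \<xi>\<bar> \<le> Omega p q"
      then show ?thesis using exact low[of "K1 * \<xi> + - (K1 * \<zeta>)"] gap by (simp add: algebra_simps)
    next
      assume o: "Omega p q < K1 * \<xi>"
      have "pw (1 - P) \<le> Omega p q + - (K1 * \<zeta>)" using absKz OE p1P by linarith
      then show ?thesis using over[OF o] low[of "Omega p q + - (K1 * \<zeta>)"] by auto
    next
      assume o: "K1 * \<xi> < - Omega p q"
      have "K1 * \<zeta> < K1 * \<xi>" using lt K1 by simp
      then show ?thesis using o absKz pwE_le by linarith
    qed
  qed
  show "R (K1 * \<xi>) \<oplus> Fin (- (K1 * \<zeta>)) = NInf \<or> (\<exists>y\<in>F. R (K1 * \<xi>) \<oplus> Fin (- (K1 * \<zeta>)) = Fin y \<and> y \<le> 0)" if le: "\<xi> \<le> \<zeta>"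
  proof -
    have kle: "K1 * \<xi> \<le> K1 * \<zeta>" using le K1 by simp
    show ?thesis
    proof (rule cs)
      assume "\<bar>K1 * \<xi>\<bar> \<le> Omega p q"
      then show ?thesis using exact up[of "K1 * \<xi> + - (K1 * \<zeta>)"] kle by simp
    next
      assume o: "Omega p q < K1 * \<xi>"
      then show ?thesis using kle absKz pwE_le by linarith
    next
      assume o: "K1 * \<xi> < - Omega p q"
      have "- Omega p q + - (K1 * \<zeta>) \<le> 0" using absKz pwE_le by linarith
      then show ?thesis using under[OF o] up[of "- Omega p q + - (K1 * \<zeta>)"] by auto
    qed
  qed
qed

lemma first_value:
  assumes "y = PInf \<or> (\<exists>t\<in>F. y = Fin t \<and> pw (1 - P) \<le> t)"
  shows "\<exists>v\<in>F. \<exists>s\<in>F. sg y = Fin v \<and> sg' y = Fin s \<and> \<rho> + pw (- P - 1) \<le> v \<and> v \<le> 1"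
proof -
  have pP: "\<rho> + pw (- P - 1) \<le> 1"
  proof -
    have "pw (- P - 1) \<le> pw (- 1)" by (subst pw_le_iff) simp
    then have "pw (- P - 1) \<le> 1 / 2" by (simp add: power_int_minus)
    then show ?thesis using \<rho> by auto
  qed
  show ?thesis
  proof (cases "y = PInf")
    case True
    then show ?thesis using act_top[of y] pP const_in_F(1) by auto
  next
    case False
    then obtain t where t: "t \<in> F" "y = Fin t" "pw (1 - P) \<le> t" using assms by blast
    then show ?thesis using act_range[OF t(1)] act_sides(2)[OF t(1) _ t(3)] by blast
  qed
qed

lemma first_value_neg:
  assumes "y = NInf \<or> (\<exists>t\<in>F. y = Fin t \<and> t \<le> 0)"
  shows "\<exists>v\<in>F. \<exists>s\<in>F. sg y = Fin v \<and> sg' y = Fin s \<and> \<kappa> \<le> v \<and> v \<le> \<rho>"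
proof (cases "y = NInf")
  case True
  then show ?thesis using act_neg[of y] \<rho>(2) const_in_F(7) by (auto simp: neg_def)
next
  case False
  then obtain t where t: "t \<in> F" "y = Fin t" "t \<le> 0" using assms by blast
  then show ?thesis using act_range[OF t(1)] act_sides(1)[OF t(1) _ t(3)] by blast
qed

definition unit_detector :: "(real \<Rightarrow> bool) \<Rightarrow> nat \<Rightarrow> nat \<Rightarrow> layer list \<Rightarrow> bool" where
  "unit_detector S m j N \<longleftrightarrow> hnet m 1 N \<and> (\<forall>x\<in>grid MM. if S (x ! j) then gives N x [1] [0] (\<lambda>_. [])
     else (\<forall>g\<in>F. gives N x [\<kappa>] [g] (\<lambda>_. [])))"

lemma sat_layer:
  assumes "hnet m 1 N" "\<And>x. x \<in> grid MM \<Longrightarrow> \<exists>v. gives N x [v] [0] (\<lambda>_. []) \<and> (if S (x ! j) then v = 1 else v \<le> 1 / 2)"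
  shows "\<exists>N. unit_detector S (Suc m) j N"
proof -
  define N' where "N' = N @ [([[4 * B]], [- (3 * B)])]"
  have h: "hnet (Suc m) 1 N'" unfolding N'_def using assms(1) B_mult_F by (intro hnet_unary) auto
  have "if S (x ! j) then gives N' x [1] [0] (\<lambda>_. []) else (\<forall>g\<in>F. gives N' x [\<kappa>] [g] (\<lambda>_. []))" if x: "x \<in> grid MM" for x
  proof -
    obtain v where v: "gives N x [v] [0] (\<lambda>_. [])" "if S (x ! j) then v = 1 else v \<le> 1 / 2" using assms(2)[OF x] by blast
    show ?thesis
    proof (cases "S (x ! j)")
      case True
      then have v1: "gives N x [1] [0] (\<lambda>_. [])" using v by simp
      from forward_step[OF v1 saturate_pos B_val const_in_F(1) zero_F] show ?thesis using True by (simp add: N'_def)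
    next
      case False
      then have "neg (Fin (4 * B) \<otimes> Fin v \<oplus> Fin (- (3 * B)))" using saturate_neg v by simp
      then have s: "sg (Fin (4 * B) \<otimes> Fin v \<oplus> Fin (- (3 * B))) = Fin \<kappa>" "sg' (Fin (4 * B) \<otimes> Fin v \<oplus> Fin (- (3 * B))) = Fin 0" using act_neg by blast+
      have "gives N' x [\<kappa>] [g] (\<lambda>_. [])" if "g \<in> F" for g
        unfolding N'_def by (rule dead_step[OF v(1) refl s const_in_F(7) that])
      then show ?thesis using False by simp
    qed
  qed
  then show ?thesis unfolding unit_detector_def using h by blast
qed

text \<open>The first layer separates the two cases by 2^(-p-1) above \<rho>, the second multiplies
  this distance by K2 and saturates the firing side, and \<open>sat_layer\<close> saturates the
  other side as well.\<close>

lemma unit_detector_base: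
  assumes "j < d" "z \<in> F" "\<bar>z\<bar> \<le> MM"
  shows "\<exists>N. unit_detector (fires u z) 3 j N"
proof -
  define \<nu> where "\<nu> = (if u then 1 else -1 :: real)"
  have \<nu>: "\<nu> = 1 \<or> \<nu> = -1" by (simp add: \<nu>_def)
  \<comment> \<open>Both choices stretch the gap above the threshold to at least 2^(1 - p) and keep
    K1 * z within 2^E. For |z| > 1 the latter uses the bound 2^(E - 1) on z.\<close>
  define K1 where "K1 = (if \<bar>\<nu> * z\<bar> \<le> 1 then pw E else 2)"
  \<comment> \<open>K2 times the separation 2^(-p-1) is B.\<close>
  define K2 where "K2 = pw (int q + P + 1)"
  have zF: "\<nu> * z \<in> F" "\<bar>\<nu> * z\<bar> \<le> MM" using \<nu> assms by auto
  note sd = scaled_difference[OF _ zF K1_def]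
  have KF: "K1 \<in> F" "K1 * (\<nu> * z) \<in> F" using sd[OF zero_F] by auto
  have nKF: "\<nu> * K1 \<in> F" "- (K1 * (\<nu> * z)) \<in> F" using \<nu> KF by auto
  have K2F: "K2 \<in> F" "- (K2 * \<rho>) \<in> F" "0 < K2"
  proof -
    show "K2 \<in> F" "0 < K2" using B_mult_F by (auto simp: K2_def)
    have "K2 * (1 / 2) = pw (int q + P)" by (simp add: K2_def pw_add)
    moreover have "pw (int q + P) \<in> F" using E_bounds by (intro pw_F) (auto simp: emin_eq)
    ultimately have "K2 * (1 / 2) \<in> F" by simp
    moreover have "\<rho> = 0 \<or> \<rho> = 1 / 2" using \<rho> by blast
    ultimately have "K2 * \<rho> \<in> F" using zero_F by (metis mult_zero_right)
    then show "- (K2 * \<rho>) \<in> F" by simp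
  qed
  define N1 where "N1 = [([urow j (\<nu> * K1)], [- (K1 * (\<nu> * z))])]"
  define N2 where "N2 = N1 @ [([[K2]], [- (K2 * \<rho>)])]"
  have h: "hnet (Suc 1) 1 N2" unfolding N2_def N1_def using hnet_base[OF nKF] K2F by (intro hnet_unary) auto
  have "\<exists>v. gives N2 x [v] [0] (\<lambda>_. []) \<and> (if fires u z (x ! j) then v = 1 else v \<le> 1 / 2)" if x: "x \<in> grid MM" for x
  proof -
    define \<xi> where "\<xi> = \<nu> * (x ! j)"
    have \<xi>: "\<xi> \<in> F" using \<nu> grid_nth[OF x assms(1)] by (auto simp: \<xi>_def)
    have f: "fires u z (x ! j) \<longleftrightarrow> \<nu> * z < \<xi>" by (auto simp: fires_def \<nu>_def \<xi>_def)
    define y where "y = R (K1 * \<xi>) \<oplus> Fin (- (K1 * (\<nu> * z)))"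
    have y: "Fin (\<nu> * K1) \<otimes> Fin (x ! j) \<oplus> Fin (- (K1 * (\<nu> * z))) = y" unfolding y_def \<xi>_def by (simp add: mult_ac)
    have "\<exists>v\<in>F. \<exists>s\<in>F. sg y = Fin v \<and> sg' y = Fin s \<and> \<kappa> \<le> v \<and> v \<le> 1 \<and> (if \<nu> * z < \<xi> then \<rho> + pw (- P - 1) \<le> v else v \<le> \<rho>)"
    proof (cases "\<nu> * z < \<xi>")
      case True
      obtain v s where vs: "v \<in> F" "s \<in> F" "sg y = Fin v" "sg' y = Fin s" "\<rho> + pw (- P - 1) \<le> v" "v \<le> 1"
        using first_value[OF sd(1)[OF \<xi> True, folded y_def]] by blast
      have "0 < pw (- P - 1)" by simp
      then have "\<kappa> \<le> v" using vs(5) \<rho>(2) by linarith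
      then show ?thesis using vs True by auto
    next
      case False
      then have "\<xi> \<le> \<nu> * z" by simp
      have "\<rho> \<le> 1" using \<rho>(1) by auto
      moreover obtain v s where vs: "v \<in> F" "s \<in> F" "sg y = Fin v" "sg' y = Fin s" "\<kappa> \<le> v" "v \<le> \<rho>"
        using first_value_neg[OF sd(2)[OF \<xi> \<open>\<xi> \<le> \<nu> * z\<close>, folded y_def]] by blast
      ultimately have "v \<le> 1" by linarith
      then show ?thesis using vs False by auto
    qed
    then obtain v s where v: "v \<in> F" "s \<in> F" "sg y = Fin v" "sg' y = Fin s" "\<kappa> \<le> v" "v \<le> 1"
      "if \<nu> * z < \<xi> then \<rho> + pw (- P - 1) \<le> v else v \<le> \<rho>" by blast
    have g1: "gives N1 x [v] [0] (\<lambda>_. [])"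
      unfolding N1_def by (rule forward_base[OF x assms(1) nKF y v(3,4,1,2)])
    have vabs: "\<bar>v\<bar> \<le> 1" using v(5,6) \<kappa> by auto
    have K2E: "K2 \<le> pw (E - 1)" unfolding K2_def using E_bounds by (subst pw_le_iff) auto
    have Kv: "\<bar>K2 * v\<bar> \<le> pw (E - 1)"
    proof -
      have "K2 * \<bar>v\<bar> \<le> K2 * 1" using vabs K2F(3) by (intro mult_left_mono) auto
      then have "K2 * \<bar>v\<bar> \<le> pw (E - 1)" using K2E by linarith
      then show ?thesis by (simp add: abs_mult abs_of_pos[OF K2F(3)])
    qed
    have KvF: "K2 * v \<in> F"
      using F_scale_up[OF v(1), of "int q + P + 1"] Kv pwE_le unfolding K2_def by (simp add: mult.commute)
    have y2: "Fin K2 \<otimes> Fin v \<oplus> Fin (- (K2 * \<rho>)) = R (K2 * (v - \<rho>))"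
      using KvF by (simp add: R_F algebra_simps)
    have K2\<rho>: "\<bar>K2 * \<rho>\<bar> \<le> pw (E - 1)"
    proof -
      have "K2 * \<bar>\<rho>\<bar> \<le> K2 * 1" using \<rho>(1) K2F(3) by (intro mult_left_mono) auto
      then have "K2 * \<bar>\<rho>\<bar> \<le> pw (E - 1)" using K2E by linarith
      then show ?thesis by (simp add: abs_mult abs_of_pos[OF K2F(3)])
    qed
    have "\<bar>K2 * (v - \<rho>)\<bar> \<le> \<bar>K2 * v\<bar> + \<bar>K2 * \<rho>\<bar>" by (simp add: right_diff_distrib)
    then have "\<bar>K2 * (v - \<rho>)\<bar> \<le> Omega p q" using Kv K2\<rho> pwE_le by linarith
    then obtain r where r: "R (K2 * (v - \<rho>)) = Fin r" using R_in_range by blast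
    have rF: "r \<in> F" using R_Fin_F[OF r] .
    show ?thesis
    proof (cases "\<nu> * z < \<xi>")
      case True
      then have "K2 * pw (- P - 1) \<le> K2 * (v - \<rho>)" using v(7) K2F(3) by (intro mult_left_mono) auto
      moreover have "K2 * pw (- P - 1) = B" unfolding K2_def B_def by (simp only: pw_add[symmetric]) simp
      ultimately have "B \<le> r" using R_ge[OF r] by simp
      then have s: "sg (Fin r) = Fin 1" "sg' (Fin r) = Fin 0" using act_top[of "Fin r"] rF by auto
      have "gives N2 x [1] [0] (\<lambda>_. [])"
        unfolding N2_def by (rule forward_step[OF g1 _ s const_in_F(1) zero_F]) (use y2 r in simp)
      then show ?thesis using True f by auto
    next
      case False
      then have "K2 * (v - \<rho>) \<le> 0" using v(7) K2F(3) by (auto simp: mult_le_0_iff)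
      then have r0: "r \<le> 0" using R_le[OF r] by simp
      obtain v' s' where v': "v' \<in> F" "s' \<in> F" "sg (Fin r) = Fin v'" "sg' (Fin r) = Fin s'" using act_range[OF rF] by blast
      have "v' \<le> \<rho>" using act_sides(1)[OF rF v'(3) r0] .
      moreover have "\<rho> \<le> 1 / 2" using \<rho>(1) by auto
      moreover have "gives N2 x [v'] [0] (\<lambda>_. [])"
        unfolding N2_def by (rule forward_step[OF g1 _ v'(3,4,1,2)]) (use y2 r in simp)
      ultimately show ?thesis using False f by fastforce
    qed
  qed
  from sat_layer[OF h this] show ?thesis by (simp add: eval_nat_numeral)
qed

text \<open>\<open>sat_layer\<close> reproduces the values 1 and \<kappa>, so here depth is added
  without negating the test.\<close>

lemma unit_detector_all:
  assumes "j < d" "z \<in> F" "\<bar>z\<bar> \<le> MM" "3 \<le> m"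
  shows "\<exists>N. unit_detector (fires u z) m j N"
  using assms(4)
proof (induction m rule: dec_induct)
  case base
  then show ?case using unit_detector_base[OF assms(1-3)] by simp
next
  case (step m)
  then obtain N where N: "unit_detector (fires u z) m j N" by blast
  have h: "hnet m 1 N" using N by (simp add: unit_detector_def)
  have "\<exists>v. gives N x [v] [0] (\<lambda>_. []) \<and> (if fires u z (x ! j) then v = 1 else v \<le> 1 / 2)" if x: "x \<in> grid MM" for x
  proof (cases "fires u z (x ! j)")
    case True
    then show ?thesis using bspec[OF conjunct2[OF N[unfolded unit_detector_def]] x] by auto
  next
    case False
    then have "gives N x [\<kappa>] [0] (\<lambda>_. [])" using bspec[OF conjunct2[OF N[unfolded unit_detector_def]] x] zero_F by simp
    moreover have "\<kappa> \<le> 1 / 2" using \<kappa> by auto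
    ultimately show ?thesis using False by auto
  qed
  from sat_layer[OF h this] show ?case .
qed

text \<open>After the shift by \<open>pass_cell\<close> a firing detector has a value of at least 1
  / 2, hence the weight 2 * B and the unit 2^q = B.\<close>

lemma detector_ex:
  assumes "6 \<le> m" "j < d" "z \<in> F" "\<bar>z\<bar> \<le> MM"
  shows "\<exists>N. detects MM (2 * B) (int q) m j z u N"
proof -
  obtain m' where m': "m = Suc m'" "3 \<le> m'" using assms(1) by (cases m) auto
  obtain N where N: "unit_detector (fires u z) m' j N" using unit_detector_all[OF assms(2-4) m'(2)] by blast
  obtain wt bt s0 v s1 where w: "{wt, bt, s0, v, s1} \<subseteq> F" "sg (Fin wt \<otimes> Fin \<kappa> \<oplus> Fin bt) = Fin 0" "sg' (Fin wt \<otimes> Fin \<kappa> \<oplus> Fin bt) = Fin s0"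
      "\<forall>g\<in>F. \<exists>t e. Fin g \<otimes> Fin s0 = Fin t \<and> Fin t \<otimes> Fin wt = Fin e"
      "sg (Fin wt \<otimes> Fin 1 \<oplus> Fin bt) = Fin v" "sg' (Fin wt \<otimes> Fin 1 \<oplus> Fin bt) = Fin s1" "1 / 2 \<le> v" "v \<le> 1"
    using pass_cell by blast
  define N' where "N' = N @ [([[wt]], [bt])]"
  have h: "hnet m 1 N'" using N w(1) unfolding N'_def unit_detector_def m'(1) by (intro hnet_unary) auto
  have "if fires u z (x ! j) then (\<exists>v e. gives N' x [v] [0] (\<lambda>_. []) \<and> Fin (- (2 * B)) \<otimes> Fin v = Fin e \<and> e \<le> - pw (int q))
     else (\<forall>g\<in>F. gives N' x [0] [g] (\<lambda>_. []))" if x: "x \<in> grid MM" for x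
  proof (cases "fires u z (x ! j)")
    case True
    then have g: "gives N x [1] [0] (\<lambda>_. [])" using bspec[OF conjunct2[OF N[unfolded unit_detector_def]] x] by simp
    have F': "v \<in> F" "s1 \<in> F" using w(1) by auto
    have g': "gives N' x [v] [0] (\<lambda>_. [])" unfolding N'_def by (rule forward_step[OF g refl w(5,6) F'])
    have "2 * B * (1 / 2) \<le> 2 * B * v" "2 * B * v \<le> 2 * B * 1" using w(7,8) B_pos by (intro mult_left_mono; simp add: less_imp_le)+
    then have "- (2 * B) \<le> - (2 * B) * v" "- (2 * B) * v \<le> - B" by simp_all
    then obtain e where "R (- (2 * B) * v) = Fin e" "e \<le> - B" using R_range[of "- (2 * B)" "- (2 * B) * v" "- B"] B_mult_F by auto
    then show ?thesis using True g' by (auto simp: B_def)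
  next
    case False
    have "gives N' x [0] [g] (\<lambda>_. [])" if g: "g \<in> F" for g
    proof -
      obtain t e where t: "Fin g \<otimes> Fin s0 = Fin t" "Fin t \<otimes> Fin wt = Fin e" using w(4) g by blast
      have eF: "e \<in> F" using fmul_EE[of "Fin t" "Fin wt"] unfolding t by simp
      have gN: "gives N x [\<kappa>] [e] (\<lambda>_. [])" using bspec[OF conjunct2[OF N[unfolded unit_detector_def]] x] False eF by simp
      show ?thesis unfolding N'_def
        by (rule gives_unary[OF gN w(2,3) zero_F _ g t]) (use w(1) in simp)
    qed
    then show ?thesis using False by simp
  qed
  then show ?thesis unfolding detects_def using h by blast
qed

lemma omega_delta: "0 < \<omega>" "1 \<le> \<omega>" "\<omega> \<le> 4" "\<exists>l. (l = 0 \<or> l = 2) \<and> \<omega> = pw l"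
proof -
  show "0 < \<omega>" "1 \<le> \<omega>" "\<omega> \<le> 4" using \<omega> by auto
  have "(4::real) = pw 2" by simp
  then show "\<exists>l. (l = 0 \<or> l = 2) \<and> \<omega> = pw l" using \<omega>(1) by (metis insertE power_int_0_right singletonD)
qed

lemma omega_mult_F:
  assumes "t \<in> F" "\<bar>t\<bar> \<le> pw (E - 2)" shows "\<omega> * t \<in> F" "\<bar>\<omega> * t\<bar> \<le> pw E" "Fin (\<omega> * t) \<otimes> Fin \<delta> = Fin t"
    "Fin (- (\<omega> * t)) \<otimes> Fin \<delta> = Fin (- t)"
proof -
  obtain l where l: "l = 0 \<or> l = 2" "\<omega> = pw l" using omega_delta(4) by blast
  have "\<omega> * \<bar>t\<bar> \<le> 4 * pw (E - 2)" using omega_delta assms(2) by (intro mult_mono) auto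
  also have "\<dots> = pw E" by (simp add: pw_diff)
  finally show 1: "\<bar>\<omega> * t\<bar> \<le> pw E" using omega_delta by (simp add: abs_mult)
  then have "\<bar>t * pw l\<bar> \<le> Omega p q" using pwE_le l by (simp add: mult.commute)
  then show "\<omega> * t \<in> F" using F_scale_up[OF assms(1), of l] l by (auto simp: mult.commute)
  have d: "\<omega> * t * \<delta> = t" using \<omega>(2) by (simp add: mult.commute mult.left_commute)
  then have d': "- (\<omega> * t) * \<delta> = - t" by (simp only: mult_minus_left)
  have mt: "- t \<in> F" using assms(1) by simp
  show "Fin (\<omega> * t) \<otimes> Fin \<delta> = Fin t" unfolding fmul.simps d by (rule R_F[OF assms(1)])
  show "Fin (- (\<omega> * t)) \<otimes> Fin \<delta> = Fin (- t)" unfolding fmul.simps d' by (rule R_F[OF mt])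
qed

abbreviation okr where "okr \<equiv> \<lambda>r. r \<in> F \<and> \<bar>r\<bar> \<le> 1"

lemma q_pw: "4 \<le> pw (int q)" "pw (int q) \<in> F"
proof -
  have "pw 2 \<le> pw (int q)" using q6 by (subst pw_le_iff) auto
  then show "4 \<le> pw (int q)" by (simp only: power_int_numeral) simp
  show "pw (int q) \<in> F" using E_bounds by (intro pw_F) (auto simp: emin_eq)
qed

lemma rho_abs: "okr \<rho>" using \<rho> const_in_F by auto

text \<open>Away from the chosen point the relay features may be anything in [- 1, 1]; the
  boundedness of the activation keeps every later pre-activation within 2^E.\<close>

lemma relayer_saturating: "relayer p q a c \<omega> \<delta> \<rho> 0 (E - 1) (int q) okr"
proof (unfold_locales)
  show "P + 6 \<le> E - 1" "2 * E + 2 \<le> 4 * (E - 1 - 2)" "E - 1 \<le> E" using E_bounds by simp_all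
  have "MM * \<bar>\<rho>\<bar> \<le> MM * 1" using rho_abs by (intro mult_left_mono) auto
  then show "MM * \<bar>\<rho>\<bar> \<le> Omega p q" using pwE_le by linarith
  show "\<omega> * \<bar>r\<bar> \<le> pw (int q)" if "okr r" for r
  proof -
    have "\<omega> * \<bar>r\<bar> \<le> 4 * 1" using that omega_delta by (intro mult_mono) auto
    then show ?thesis using q_pw(1) by linarith
  qed
  fix r w assume r: "okr r" and w: "w \<in> F" "\<bar>w\<bar> \<le> MM"
  have b: "\<bar>w * r'\<bar> \<le> MM" if "\<bar>r'\<bar> \<le> 1" for r'
  proof -
    have "\<bar>w\<bar> * \<bar>r'\<bar> \<le> MM * 1" using w that by (intro mult_mono) auto
    then show ?thesis by (simp add: abs_mult)
  qed
  have bb: "- MM \<le> w * r \<and> w * r \<le> MM" "- MM \<le> - w * \<rho> \<and> - w * \<rho> \<le> MM" using b[of r] b[of \<rho>] r rho_abs by auto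
  have mF: "- MM \<in> F" "- pw E \<in> F" using B_mult_F by auto
  obtain y1 where y1: "R (w * r) = Fin y1" "- MM \<le> y1" "y1 \<le> MM" using R_range[of "- MM" "w * r" MM] bb B_mult_F mF by auto
  obtain y2 where y2: "R (- w * \<rho>) = Fin y2" "- MM \<le> y2" "y2 \<le> MM" using R_range[of "- MM" "- w * \<rho>" MM] bb B_mult_F mF by auto
  have "- pw E \<le> y1 + y2" "y1 + y2 \<le> pw E" using y1 y2 pwE_le by linarith+
  then obtain y3 where y3: "y3 \<in> F" "R (y1 + y2) = Fin y3" using R_range[of "- pw E" "y1 + y2" "pw E"] B_mult_F mF by auto
  have y: "(Fin w \<otimes> Fin r) \<oplus> (Fin (- w) \<otimes> Fin \<rho>) \<oplus> Fin 0 = Fin y3" using y1 y2 y3 by (simp add: R_F)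
  obtain v s where v: "v \<in> F" "s \<in> F" "sg (Fin y3) = Fin v" "sg' (Fin y3) = Fin s" "\<kappa> \<le> v" "v \<le> 1" using act_range[OF y3(1)] by blast
  have "\<bar>v\<bar> \<le> 1" using v(5,6) \<kappa> by auto
  then show "\<exists>y v s. (Fin w \<otimes> Fin r) \<oplus> (Fin (- w) \<otimes> Fin \<rho>) \<oplus> Fin 0 = y \<and> sg y = Fin v \<and> sg' y = Fin s \<and> v \<in> F \<and> s \<in> F \<and> okr v"
    using y v by blast
qed (use \<omega> const_in_F act_zero q_pw rho_abs in simp_all)

lemma path_ex:
  assumes "7 \<le> m" "j < d" "x0 \<in> grid MM" "h \<in> F" "h \<noteq> 0" "\<bar>h\<bar> \<le> H" "s \<in> {1, -1}"
    "emin q - P \<le> k" "k \<le> E - P"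
  shows "\<exists>N. path_relay MM (int q) \<omega> m j x0 h s k N"
proof -
  interpret relayer p q a c d MM \<omega> \<delta> \<rho> 0 "E - 1" "int q" okr by (rule relayer_saturating)
  \<comment> \<open>For k \<le> 0 the weight \<epsilon> bridges the distance from a possibly
    subnormal 2^k to a normal gradient exponent e'; for other k the weight is 1.\<close>
  define i where "i = (if k \<le> 0 then - P - 3 else 0)"
  define \<epsilon> where "\<epsilon> = pw i"
  define e' where "e' = k - i"
  have \<epsilon>F: "\<epsilon> \<in> F" unfolding \<epsilon>_def i_def using E_bounds P2 by (intro pw_F) (auto simp: emin_eq)
  have "\<epsilon> \<le> pw 0" unfolding \<epsilon>_def i_def by (subst pw_le_iff) simp
  then have \<epsilon>1: "\<epsilon> \<le> 1" "0 < \<epsilon>" by (simp_all add: \<epsilon>_def)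
  have mF: "- MM \<in> F" "- pw E \<in> F" using B_mult_F by auto
  have prod: "\<exists>y\<in>F. R (\<epsilon> * (x ! j)) = Fin y \<and> - MM \<le> y \<and> y \<le> MM" if x: "x \<in> grid MM" for x
  proof -
    have "\<epsilon> * \<bar>x ! j\<bar> \<le> 1 * MM" using \<epsilon>1 grid_nth[OF x assms(2)] by (intro mult_mono) auto
    then have "\<bar>\<epsilon> * (x ! j)\<bar> \<le> MM" using \<epsilon>1 by (simp add: abs_mult)
    then have "- MM \<le> \<epsilon> * (x ! j)" "\<epsilon> * (x ! j) \<le> MM" by linarith+
    then show ?thesis using R_range[of "- MM" "\<epsilon> * (x ! j)" MM] B_mult_F mF by auto
  qed
  \<comment> \<open>The bias - b cancels the weighted coordinate of \<open>x0\<close> exactly as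
    rounded, so that the pre-activation at \<open>x0\<close> is 0 and the slope there is
    \<delta>.\<close>
  obtain b where b: "b \<in> F" "R (\<epsilon> * (x0 ! j)) = Fin b" "- MM \<le> b" "b \<le> MM" using prod[OF assms(3)] by blast
  have mb: "- b \<in> F" using b(1) by simp
  define A1 where "A1 = [([urow j \<epsilon>], [- b])]"
  define A2 where "A2 = [([replicate d (0 :: real)], [0 :: real])]"
  define N where "N = par A1 A2 @ [relay_layer \<omega> 0]"
  have h1: "hnet 1 1 A1" "hnet 1 1 A2" unfolding A1_def A2_def using hnet_base[OF \<epsilon>F mb] hnet_const[OF zero_F] by auto
  have "hnet 1 2 (par A1 A2)" using hnet_par[OF h1] by (simp add: numeral_2_eq_2)
  from hnet_snoc[OF this layer_ok_relay[OF const_in_F(9) zero_F] zero_less_numeral]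
  have hN: "hnet 2 2 N" by (simp only: N_def Suc_1)
  have wJ: "\<bar>\<omega>\<bar> \<le> MM"
  proof -
    have "pw 2 \<le> MM" using E_bounds by (subst pw_le_iff) auto
    then have "4 \<le> MM" by (simp only: power_int_numeral) simp
    then show ?thesis using omega_delta by simp
  qed
  have fwd: "\<exists>r. okr r \<and> gives N x [r, \<rho>] [0, 0] (\<lambda>_. [])" if x: "x \<in> grid MM" for x
  proof -
    obtain y where y: "y \<in> F" "R (\<epsilon> * (x ! j)) = Fin y" "- MM \<le> y" "y \<le> MM" using prod[OF x] by blast
    have "- pw E \<le> y + - b" "y + - b \<le> pw E" using y b pwE_le by linarith+
    then obtain y3 where y3: "y3 \<in> F" "R (y + - b) = Fin y3" using R_range[of "- pw E" "y + - b" "pw E"] B_mult_F mF by auto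
    obtain v s' where v: "v \<in> F" "s' \<in> F" "sg (Fin y3) = Fin v" "sg' (Fin y3) = Fin s'" "\<kappa> \<le> v" "v \<le> 1" using act_range[OF y3(1)] by blast
    have okv: "okr v" using v \<kappa> by auto
    have yy: "Fin \<epsilon> \<otimes> Fin (x ! j) \<oplus> Fin (- b) = Fin y3" using y y3 by simp
    have G1: "gives A1 x [v] [0] (\<lambda>_. [])" unfolding A1_def by (rule forward_base[OF x assms(2) \<epsilon>F mb yy v(3,4,1,2)])
    have lx: "length x = d" using x by (simp add: grid_def)
    have G2: "gives A2 x [\<rho>] [0] (\<lambda>_. [])" unfolding A2_def
      by (rule gives_const[OF lx act_zero zero_F const_in_F(8,10) zero_F, of 0]) simp
    have G: "gives (par A1 A2) x [v, \<rho>] [0, 0] (\<lambda>_. [])" using gives_par[OF h1 G1 G2] by simp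
    obtain y4 v4 s4 where v4: "(Fin \<omega> \<otimes> Fin v) \<oplus> (Fin (- \<omega>) \<otimes> Fin \<rho>) \<oplus> Fin 0 = y4" "sg y4 = Fin v4" "sg' y4 = Fin s4" "v4 \<in> F" "s4 \<in> F" "okr v4"
      using forward[OF okv const_in_F(9) wJ] by blast
    have "gives N x [v4, \<rho>] [0, 0] (\<lambda>_. [])" unfolding N_def
      by (rule gives_relay[OF G v4(1-3) act_zero zero_F v4(4,5) const_in_F(8,10) zero_F zero_F, where t = 0 and t' = 0]) simp_all
    then show ?thesis using v4(6) by blast
  qed
  have base: "\<exists>N e. pstate 2 N x0 t (\<lambda>i. if i = j then [e] else []) \<and> fits s k e"
    if t: "t \<in> F" "7 / 8 * pw e' \<le> s * t" "s * t \<le> pw e'" for t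
  proof -
    have pk: "pw e' * \<epsilon> = pw k" unfolding \<epsilon>_def by (simp only: pw_add[symmetric]) (simp add: e'_def)
    have bd: "7 / 8 * pw k \<le> s * (t * \<epsilon>)" "s * (t * \<epsilon>) \<le> pw k"
    proof -
      have "7 / 8 * pw e' * \<epsilon> \<le> s * t * \<epsilon>" "s * t * \<epsilon> \<le> pw e' * \<epsilon>" using t \<epsilon>1 by (intro mult_right_mono; simp)+
      then show "7 / 8 * pw k \<le> s * (t * \<epsilon>)" "s * (t * \<epsilon>) \<le> pw k" unfolding pk[symmetric] by (simp_all only: mult.assoc)
    qed
    have kF': "pw k \<in> F" using assms P2 by (intro pw_F) auto
    obtain e where e: "R (s * (t * \<epsilon>)) = Fin e" "e \<in> F" "e \<le> pw k"
    proof -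
      have "0 \<le> s * (t * \<epsilon>)" using bd(1) pw_pos[of k] by linarith
      then show ?thesis using R_range[of 0 "s * (t * \<epsilon>)" "pw k"] bd(2) kF' that by auto
    qed
    have "\<bar>e - s * (t * \<epsilon>)\<bar> \<le> \<bar>pw k - s * (t * \<epsilon>)\<bar>" by (rule R_near[OF e(1) kF'])
    moreover have "0 < pw k" by simp
    ultimately have e2: "pw k / 2 < e" using bd by linarith
    have se: "Fin t \<otimes> Fin \<epsilon> = Fin (s * e)" using assms(7) e(1) R_minus_Fin[OF e(1)] by auto
    have f: "fits s k (s * e)" using e e2 assms(7) by (auto simp: fits_def)
    have tabs: "\<bar>t\<bar> \<le> pw (E - 2)"
    proof -
      have "e' \<le> E - 2" using assms(9) P2 E_bounds by (auto simp: e'_def i_def)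
      then have "pw e' \<le> pw (E - 2)" by (simp only: pw_le_iff)
      moreover have "0 < pw e'" by simp
      then have "0 \<le> s * t" using t by linarith
      then have "\<bar>t\<bar> = s * t" using assms(7) by auto
      ultimately show ?thesis using t by linarith
    qed
    note om = omega_mult_F[OF t(1) tabs]
    have mom: "- (\<omega> * t) \<in> F" using om by simp
    have y0: "Fin \<epsilon> \<otimes> Fin (x0 ! j) \<oplus> Fin (- b) = Fin 0" using b by simp
    have lx: "length x0 = d" using assms(3) by (simp add: grid_def)
    have s0: "sg (Fin \<epsilon> \<otimes> Fin (x0 ! j) \<oplus> Fin (- b)) = Fin \<rho>" "sg' (Fin \<epsilon> \<otimes> Fin (x0 ! j) \<oplus> Fin (- b)) = Fin \<delta>" unfolding y0 by (rule act_zero)+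
    have G1: "gives A1 x0 [\<rho>] [\<omega> * t] (\<lambda>i. if i = j then [s * e] else [])" unfolding A1_def
      by (rule gives_base[OF lx assms(2) s0 const_in_F(8,10) om(1,3) se])
    have G2: "gives A2 x0 [\<rho>] [- (\<omega> * t)] (\<lambda>_. [])" unfolding A2_def
      by (rule gives_const[OF lx act_zero zero_F const_in_F(8,10) mom om(4)])
    have G: "gives (par A1 A2) x0 [\<rho>, \<rho>] [\<omega> * t, - (\<omega> * t)] (\<lambda>i. if i = j then [s * e] else [])" using gives_par[OF h1 G1 G2] by simp
    obtain y where y: "y \<in> F" "Fin \<omega> \<otimes> Fin \<rho> = Fin y" "Fin (- \<omega>) \<otimes> Fin \<rho> = Fin (- y)" using weight_rho[OF const_in_F(9) wJ] by blast
    have z: "(Fin \<omega> \<otimes> Fin \<rho>) \<oplus> (Fin (- \<omega>) \<otimes> Fin \<rho>) \<oplus> Fin 0 = Fin 0" unfolding y by simp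
    have tw: "Fin t \<otimes> Fin \<omega> = Fin (\<omega> * t)" "Fin t \<otimes> Fin (- \<omega>) = Fin (- (\<omega> * t))"
      using R_F[OF om(1)] R_F[OF mom] by (simp_all add: mult.commute)
    have G3: "gives N x0 [\<rho>, \<rho>] [\<omega> * t, - (\<omega> * t)] (\<lambda>i. if i = j then [s * e] else [])" unfolding N_def
      by (rule gives_relay[OF G z act_zero act_zero zero_F const_in_F(8,10,8,10) om(1) mom om(3,4) tw])
    have "pstate 2 N x0 t (\<lambda>i. if i = j then [s * e] else [])" unfolding pstate_def using hN fwd G3 by blast
    then show ?thesis using f by blast
  qed
  have "emin q + 2 \<le> e'" using assms(8) E_bounds P2 by (auto simp: e'_def i_def emin_eq)
  have "e' + 2 \<le> E" using assms(9) P2 E_bounds by (auto simp: e'_def i_def)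
  then have 1: "pw (e' + 2) \<le> pw E" by (simp only: pw_le_iff)
  have "\<omega> * pw e' \<le> 4 * pw e'" using omega_delta by (intro mult_right_mono) auto
  moreover have "pw (e' + 2) = 4 * pw e'" by (simp add: pw_add)
  ultimately have 2: "\<omega> * pw e' \<le> Omega p q" using 1 pwE_le by linarith
  have "P + 8 \<le> E" using E_bounds by simp
  then have 3: "pw (P + 8) \<le> pw E" by (simp only: pw_le_iff)
  have "P - 1 \<le> P + 6" by simp
  then have "pw (P - 1) \<le> pw (P + 6)" by (simp only: pw_le_iff)
  then have "max \<bar>h\<bar> (pw (P + 6)) \<le> pw (P + 6)" using assms(6) H by simp
  then have "\<omega> * max \<bar>h\<bar> (pw (P + 6)) \<le> 4 * pw (P + 6)" using omega_delta by (intro mult_mono) auto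
  also have "\<dots> = pw (P + 8)" using pw_add[of 2 "P + 6"] by (simp add: add.commute)
  finally have 4: "\<omega> * max \<bar>h\<bar> (pw (P + 6)) \<le> Omega p q" using 3 pwE_le by linarith
  show ?thesis using path_relay_ex[OF base \<open>emin q + 2 \<le> e'\<close> 2 assms(4,5) 4 assms(7,1)] by blast
qed

lemma saturating_cells: "cells p q a c d MM H (2 * B) \<kappa> \<omega> \<delta> 0 \<rho> (int q)"
proof (unfold_locales)
  show "emin q - P \<le> int q" "int q + 3 \<le> E" "int q \<le> int q" using E_bounds P2 by (auto simp: emin_eq)
  show "\<And>v. neg v \<Longrightarrow> sg v = Fin \<kappa> \<and> sg' v = Fin 0" by (rule act_neg)
  show "\<bar>0\<bar> \<le> 4 * pw (int q)" using q_pw by simp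
  show "\<exists>g e g'. Fin h \<otimes> Fin \<omega> = Fin g \<and> Fin g \<otimes> Fin \<delta> = Fin h \<and> Fin h \<otimes> Fin (- (2 * B)) = Fin e \<and>
      Fin h \<otimes> Fin (- \<omega>) = Fin (- g) \<and> Fin (- g) \<otimes> Fin \<delta> = Fin (- h) \<and> Fin (- h) \<otimes> Fin (- (2 * B)) = Fin g'"
    if h: "h \<in> F" "\<bar>h\<bar> \<le> H" for h
  proof -
    have "pw (P - 1) \<le> pw (E - 2)" using E_bounds by (subst pw_le_iff) auto
    then have om: "\<omega> * h \<in> F" "Fin (\<omega> * h) \<otimes> Fin \<delta> = Fin h" "Fin (- (\<omega> * h)) \<otimes> Fin \<delta> = Fin (- h)"
      using omega_mult_F[OF h(1)] h(2) H by simp_all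
    have mom: "- (\<omega> * h) \<in> F" using om by simp
    have tw: "Fin h \<otimes> Fin \<omega> = Fin (\<omega> * h)" "Fin h \<otimes> Fin (- \<omega>) = Fin (- (\<omega> * h))"
      using R_F[OF om(1)] R_F[OF mom] by (simp_all add: mult.commute)
    have "\<bar>h\<bar> * (2 * B) \<le> pw (P - 1) * (2 * B)" using h(2) H B_pos by (intro mult_right_mono) (auto simp: less_imp_le)
    also have "\<dots> = pw (P - 1 + (1 + int q))" unfolding B_def by (simp only: pw_add) simp
    also have "\<dots> \<le> pw E" using E_bounds by (subst pw_le_iff) auto
    finally have "\<bar>h * - (2 * B)\<bar> \<le> Omega p q" using pwE_le
      by (simp add: abs_mult abs_of_pos[OF B_pos])
    then obtain e where e: "R (h * - (2 * B)) = Fin e" using R_in_range by blast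
    have "- h * - (2 * B) = - (h * - (2 * B))" by simp
    then have "R (- h * - (2 * B)) = Fin (- e)" using R_minus_Fin[OF e] by (simp only:)
    then show ?thesis using om tw e by (intro exI[of _ "\<omega> * h"] exI[of _ e] exI[of _ "- e"]) simp
  qed
  show "\<exists>y. Fin \<omega> \<otimes> Fin v = Fin y \<and> Fin (- \<omega>) \<otimes> Fin v = Fin (- y)" if v: "v \<in> {\<rho>, \<kappa>}" for v
  proof -
    have vF: "v \<in> F" "\<bar>v\<bar> \<le> 1" using v rho_abs const_in_F \<kappa> by auto
    have "\<bar>v\<bar> \<le> pw (E - 2)"
    proof -
      have "pw 0 \<le> pw (E - 2)" using E_bounds by (subst pw_le_iff) auto
      then show ?thesis using vF by simp
    qed
    from omega_mult_F[OF vF(1) this] have "R (\<omega> * v) = Fin (\<omega> * v)" using R_F by blast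
    then show ?thesis using R_minus_Fin by auto
  qed
qed (use const_in_F act_zero B_mult_F detector_ex path_ex value_cells in auto)

end

section \<open>Real estimates for the activations\<close>

lemma erf_pos_eq: "0 \<le> x \<Longrightarrow> erf x = 2 / sqrt pi * integral {0..x} (\<lambda>t. exp (- (t ^ 2)))"
  by (simp add: erf_def)

lemma erf_minus: "erf (- x) = - erf x"
proof -
  have r: "integral {- x..0} (\<lambda>t. exp (- (t ^ 2))) = integral {0..x} (\<lambda>t::real. exp (- (t ^ 2)))" for x :: real
    using Henstock_Kurzweil_Integration.integral_reflect_real[of x 0 "\<lambda>t. exp (- (t ^ 2))"] by simp
  show ?thesis
  proof (cases "0 \<le> x")
    case True
    show ?thesis
    proof (cases "x = 0")
      case True
      then show ?thesis by (simp add: erf_def)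
    next
      case False
      then show ?thesis using \<open>0 \<le> x\<close> r[of x] by (simp add: erf_def)
    qed
  next
    case False
    then show ?thesis using r[of "- x"] by (simp add: erf_def)
  qed
qed

lemma erf_0 [simp]: "erf 0 = 0" by (simp add: erf_def)

text \<open>Shifting the lower limit to - A merges the two cases of the definition into a single
  integral near x, to which the fundamental theorem applies.\<close>

lemma erf_deriv: "(erf has_real_derivative 2 / sqrt pi * exp (- (x ^ 2))) (at x)"
proof -
  define A where "A = \<bar>x\<bar> + 1"
  have A: "- A < x" "x < A" "0 < A" by (simp_all add: A_def)
  let ?g = "\<lambda>t::real. exp (- (t ^ 2))"
  have int: "?g integrable_on {u..v}" for u v by (intro integrable_continuous_real continuous_intros)
  have eq: "erf y = 2 / sqrt pi * (integral {-A..y} ?g - integral {-A..0} ?g)" if "y \<in> {-A..A}" for y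
  proof (cases "0 \<le> y")
    case True
    have "integral {-A..0} ?g + integral {0..y} ?g = integral {-A..y} ?g"
      using True A int by (intro Henstock_Kurzweil_Integration.integral_combine) auto
    then show ?thesis using True by (simp add: erf_def)
  next
    case False
    have "integral {-A..y} ?g + integral {y..0} ?g = integral {-A..0} ?g"
      using False that int by (intro Henstock_Kurzweil_Integration.integral_combine) auto
    then have "integral {-A..y} ?g - integral {-A..0} ?g = - integral {y..0} ?g" by simp
    then show ?thesis using False by (simp add: erf_def)
  qed
  have "((\<lambda>y. integral {-A..y} ?g) has_real_derivative ?g x) (at x within {-A..A})"
    by (rule integral_has_real_derivative) (use A in \<open>auto intro!: continuous_intros\<close>)
  then have "((\<lambda>y. integral {-A..y} ?g) has_real_derivative ?g x) (at x)"
    unfolding at_within_Icc_at[OF A(1,2)] .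
  then have "((\<lambda>y. 2 / sqrt pi * (integral {-A..y} ?g - integral {-A..0} ?g)) has_real_derivative 2 / sqrt pi * (?g x - 0)) (at x)"
    by (intro DERIV_cmult DERIV_diff DERIV_const)
  then have d: "((\<lambda>y. 2 / sqrt pi * (integral {-A..y} ?g - integral {-A..0} ?g)) has_real_derivative 2 / sqrt pi * ?g x) (at x)"
    unfolding diff_zero .
  have ev: "\<forall>\<^sub>F y in nhds x. 2 / sqrt pi * (integral {-A..y} ?g - integral {-A..0} ?g) = erf y"
  proof -
    have "\<forall>\<^sub>F y in nhds x. y \<in> {-A<..<A}" by (intro eventually_nhds_in_open) (use A in auto)
    then show ?thesis by eventually_elim (use eq in auto)
  qed
  show ?thesis by (rule DERIV_cong_ev[OF refl ev refl, THEN iffD1, OF d])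
qed

text \<open>The Gaussian integral over the half line, transferred from the Lebesgue integral to the
  gauge integral on [0, y].\<close>

lemma erf_tendsto: "(erf \<longlongrightarrow> 1) at_top"
proof -
  let ?f = "\<lambda>x::real. indicator {0..} x *\<^sub>R exp (- x\<^sup>2)"
  have hb: "has_bochner_integral lborel ?f (sqrt pi / 2)" by (rule gaussian_moment_0)
  then have int: "integrable lborel ?f" and val: "integral\<^sup>L lborel ?f = sqrt pi / 2"
    by (auto simp: has_bochner_integral_iff)
  have "((\<lambda>y. \<integral>x. indicator {..y} x *\<^sub>R ?f x \<partial>lborel) \<longlongrightarrow> integral\<^sup>L lborel ?f) at_top"
    by (rule tendsto_integral_at_top[OF _ int]) simp
  then have lim: "((\<lambda>y. 2 / sqrt pi * (\<integral>x. indicator {..y} x *\<^sub>R ?f x \<partial>lborel)) \<longlongrightarrow> 2 / sqrt pi * (sqrt pi / 2)) at_top"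
    unfolding val by (intro tendsto_intros)
  have eq: "(\<integral>x. indicator {..y} x *\<^sub>R ?f x \<partial>lborel) = integral {0..y} (\<lambda>t. exp (- (t ^ 2)))" for y
  proof -
    have "set_integrable lborel {0..y} (\<lambda>t::real. exp (- (t ^ 2)))"
      by (rule borel_integrable_atLeastAtMost') (auto intro!: continuous_intros)
    then have "(LBINT t:{0..y}. exp (- (t ^ 2))) = integral {0..y} (\<lambda>t. exp (- (t ^ 2)))"
      by (rule set_borel_integral_eq_integral(2))
    moreover have "(\<lambda>x. indicator {..y} x *\<^sub>R ?f x) = (\<lambda>x. indicator {0..y} x *\<^sub>R exp (- x\<^sup>2))"
      by (auto simp: indicator_def fun_eq_iff)
    ultimately show ?thesis unfolding set_lebesgue_integral_def by simp
  qed
  have "\<forall>\<^sub>F y in at_top. 2 / sqrt pi * (\<integral>x. indicator {..y} x *\<^sub>R ?f x \<partial>lborel) = erf y"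
    unfolding eq using eventually_ge_at_top[of 0] by eventually_elim (simp add: erf_pos_eq)
  from tendsto_cong[THEN iffD1, OF this lim] show ?thesis by simp
qed

lemma erf_mono: "x < y \<Longrightarrow> erf x < erf y"
  by (rule DERIV_pos_imp_increasing[of x y erf]) (auto intro!: exI[of _ "2 / sqrt pi * exp (- (_ ^ 2))"] erf_deriv)

lemma erf_le_1: "erf x \<le> 1"
proof (rule tendsto_lowerbound[OF erf_tendsto])
  show "\<forall>\<^sub>F y in at_top. erf x \<le> erf y"
    using eventually_gt_at_top[of x] by eventually_elim (use erf_mono in \<open>auto simp: less_imp_le\<close>)
qed simp

lemma erf_ge: "- 1 \<le> erf x"
  using erf_le_1[of "- x"] by (simp add: erf_minus)

lemma sqrt_pi_bounds: "1 \<le> sqrt pi" "sqrt pi \<le> 2"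
proof -
  show "1 \<le> sqrt pi" using pi_gt3 by simp
  have "sqrt pi \<le> sqrt 4" using pi_less_4 by (subst real_sqrt_le_iff) simp
  then show "sqrt pi \<le> 2" by simp
qed

text \<open>For y \<ge> 1 the derivative of erf y + exp (- y^2) is at most exp (- y^2) * (2 - 2 *
  y), since sqrt pi \<ge> 1. So this sum is nonincreasing there, and its limit is 1.\<close>

lemma erf_tail: "1 \<le> x \<Longrightarrow> 1 - exp (- (x ^ 2)) \<le> erf x"
proof -
  assume x: "1 \<le> x"
  let ?g = "\<lambda>y. erf y + exp (- (y ^ 2))"
  have "((\<lambda>y::real. exp (- (y ^ 2))) \<longlongrightarrow> 0) at_top"
  proof (rule tendsto_sandwich[of "\<lambda>_. 0" _ _ "\<lambda>y. exp (- y)"])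
    show "\<forall>\<^sub>F y::real in at_top. exp (- (y ^ 2)) \<le> exp (- y)"
      using eventually_ge_at_top[of 1] by eventually_elim (simp add: power2_eq_square)
    show "((\<lambda>y::real. exp (- y)) \<longlongrightarrow> 0) at_top"
      by (rule filterlim_compose[OF exp_at_bot filterlim_uminus_at_bot_at_top])
  qed auto
  then have lim: "(?g \<longlongrightarrow> 1 + 0) at_top" by (intro tendsto_add erf_tendsto)
  have dec: "?g z \<le> ?g x" if "x \<le> z" for z
  proof (rule DERIV_nonpos_imp_nonincreasing[OF that])
    fix y assume y: "x \<le> y" "y \<le> z"
    have "(?g has_real_derivative 2 / sqrt pi * exp (- (y ^ 2)) + exp (- (y ^ 2)) * (- (2 * y))) (at y)"
      by (auto intro!: derivative_eq_intros erf_deriv)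
    moreover have "2 / sqrt pi * exp (- (y ^ 2)) + exp (- (y ^ 2)) * (- (2 * y)) \<le> 0"
    proof -
      have "2 / sqrt pi \<le> 2 / 1" using sqrt_pi_bounds by (intro divide_left_mono) auto
      then have "2 / sqrt pi + - (2 * y) \<le> 0" using x y by linarith
      then have "exp (- (y ^ 2)) * (2 / sqrt pi + - (2 * y)) \<le> 0" by (simp add: mult_le_0_iff)
      then show ?thesis by (simp add: algebra_simps)
    qed
    ultimately show "\<exists>D. (?g has_real_derivative D) (at y) \<and> D \<le> 0" by blast
  qed
  have "1 + 0 \<le> ?g x"
    by (rule tendsto_upperbound[OF lim]) (auto intro: eventually_mono[OF eventually_ge_at_top[of x]] dec)
  then show ?thesis by simp
qed

text \<open>The distribution function of the standard normal law.\<close>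

definition Phi :: "real \<Rightarrow> real" where "Phi t = (1 + erf (t / sqrt 2)) / 2"

lemma Phi_bounds: "0 \<le> Phi t" "Phi t \<le> 1" "0 < t \<Longrightarrow> 1 / 2 < Phi t" "Phi 0 = 1 / 2" "Phi (- t) = 1 - Phi t"
proof -
  show "Phi (- t) = 1 - Phi t" by (simp add: Phi_def erf_minus field_simps)
qed (use erf_ge[of "t / sqrt 2"] erf_le_1[of "t / sqrt 2"] erf_mono[of 0 "t / sqrt 2"]
  in \<open>auto simp: Phi_def\<close>)

lemma Phi_tail: "2 \<le> t \<Longrightarrow> 1 - exp (- t) / 2 \<le> Phi t"
proof -
  assume t: "2 \<le> t"
  have "sqrt 2 \<le> sqrt 4" by (subst real_sqrt_le_iff) simp
  then have "sqrt 2 \<le> 2" by simp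
  then have "1 \<le> t / sqrt 2" using t by (simp add: le_divide_eq)
  from erf_tail[OF this] have "1 - exp (- (t ^ 2 / 2)) \<le> erf (t / sqrt 2)" by (simp add: power_divide)
  moreover have "exp (- (t ^ 2 / 2)) \<le> exp (- t)" using t by (simp add: power2_eq_square)
  moreover have "1 - b / 2 \<le> (1 + e) / 2" if "1 - a \<le> e" "a \<le> b" for a b e :: real
    using that by (simp add: field_simps)
  ultimately show ?thesis unfolding Phi_def by blast
qed

text \<open>By the mean value theorem on [0, 1 / sqrt 2], an interval of length at least 1/2 on
  which the derivative of erf is at least 1/2.\<close>

lemma Phi_1: "5 / 8 \<le> Phi 1"
proof -
  define x where "x = 1 / sqrt 2"
  have x0: "0 < x" "x ^ 2 = 1 / 2" by (auto simp: x_def power_divide)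
  obtain \<xi> where \<xi>: "0 < \<xi>" "\<xi> < x" "erf x - erf 0 = (x - 0) * (2 / sqrt pi * exp (- (\<xi> ^ 2)))"
    using MVT2[OF x0(1), of erf "\<lambda>y. 2 / sqrt pi * exp (- (y ^ 2))"] erf_deriv by blast
  have "\<xi> ^ 2 \<le> x ^ 2" using \<xi> by (intro power_mono) auto
  then have "exp (- (1 / 2)) \<le> exp (- (\<xi> ^ 2))" using x0 by simp
  moreover have "1 + (- (1 / 2)) \<le> exp (- (1 / 2) :: real)" by (rule exp_ge_add_one_self)
  ultimately have e: "1 / 2 \<le> exp (- (\<xi> ^ 2))" by linarith
  have "2 / 2 \<le> 2 / sqrt pi" using sqrt_pi_bounds by (intro divide_left_mono) auto
  then have "1 * (1 / 2) \<le> 2 / sqrt pi * exp (- (\<xi> ^ 2))" using e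
    by (intro mult_mono[of 1 "2 / sqrt pi" "1 / 2" "exp (- (\<xi> ^ 2))"]) auto
  moreover have "1 / 2 \<le> x"
  proof -
    have "sqrt 2 \<le> sqrt 4" by (subst real_sqrt_le_iff) simp
    then have "sqrt 2 \<le> 2" by simp
    then show ?thesis unfolding x_def by (simp add: divide_simps)
  qed
  ultimately have "1 / 2 * (1 * (1 / 2)) \<le> x * (2 / sqrt pi * exp (- (\<xi> ^ 2)))"
    using x0 by (intro mult_mono[of "1 / 2" x]) auto
  then have "1 / 4 \<le> erf x" using \<xi>(3) by simp
  then show ?thesis by (simp add: Phi_def x_def)
qed

lemma x_exp_le: "0 \<le> t \<Longrightarrow> t * exp (- t) \<le> (1::real)"
proof -
  assume "0 \<le> t"
  have "t \<le> exp t" using exp_ge_add_one_self[of t] by linarith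
  then have "t * exp (- t) \<le> exp t * exp (- t)" by (intro mult_right_mono) auto
  then show ?thesis by (simp add: exp_minus)
qed

text \<open>The density of the standard normal law.\<close>

definition phi :: "real \<Rightarrow> real" where "phi t = exp (- (t ^ 2 / 2)) / sqrt (2 * pi)"

lemma Phi_deriv: "(Phi has_real_derivative phi t) (at t)"
proof -
  have "((\<lambda>t. erf (t / sqrt 2)) has_real_derivative (2 / sqrt pi * exp (- ((t / sqrt 2) ^ 2))) * (1 / sqrt 2)) (at t)"
    by (rule DERIV_chain2[OF erf_deriv DERIV_cdivide[OF DERIV_ident]])
  then have "((\<lambda>t. (1 + erf (t / sqrt 2)) / 2) has_real_derivative ((2 / sqrt pi * exp (- ((t / sqrt 2) ^ 2))) * (1 / sqrt 2)) / 2) (at t)"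
    by (auto intro!: derivative_eq_intros)
  moreover have "((2 / sqrt pi * exp (- ((t / sqrt 2) ^ 2))) * (1 / sqrt 2)) / 2 = phi t"
  proof -
    have "((2 / b * e) * (1 / a)) / 2 = e / (a * b)" for a b e :: real by simp
    then show ?thesis unfolding phi_def real_sqrt_mult power_divide by simp
  qed
  ultimately show ?thesis unfolding Phi_def by simp
qed

lemma gelu_Phi: "hat_sigma GELU t = t * Phi t"
  by (simp add: Phi_def)

lemma gelu_deriv: "deriv (hat_sigma GELU) t = Phi t + t * phi t"
proof -
  have "((\<lambda>t. t * Phi t) has_real_derivative Phi t + t * phi t) (at t)"
    by (auto intro!: derivative_eq_intros Phi_deriv)
  moreover have "hat_sigma GELU = (\<lambda>t. t * Phi t)" using gelu_Phi by blast
  ultimately show ?thesis by (simp add: DERIV_imp_deriv)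
qed

lemma phi_bounds: "0 \<le> phi t" "\<bar>t\<bar> * phi t \<le> 1" "2 \<le> \<bar>t\<bar> \<Longrightarrow> phi t \<le> exp (- \<bar>t\<bar>)"
proof -
  have s1: "1 \<le> sqrt (2 * pi)" using pi_gt3 by simp
  show "0 \<le> phi t" by (simp add: phi_def)
  have le: "phi t \<le> exp (- (t ^ 2 / 2))" unfolding phi_def using s1 by (simp add: divide_le_eq)
  have "\<bar>t\<bar> \<le> 1 + t ^ 2 / 2" using zero_le_power2[of "\<bar>t\<bar> - 1"] by (simp add: power2_eq_square algebra_simps)
  also have "\<dots> \<le> exp (t ^ 2 / 2)" by (rule exp_ge_add_one_self)
  finally have "\<bar>t\<bar> * exp (- (t ^ 2 / 2)) \<le> exp (t ^ 2 / 2) * exp (- (t ^ 2 / 2))" by (intro mult_right_mono) auto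
  then have "\<bar>t\<bar> * exp (- (t ^ 2 / 2)) \<le> 1" by (simp add: exp_minus)
  moreover have "\<bar>t\<bar> * phi t \<le> \<bar>t\<bar> * exp (- (t ^ 2 / 2))" using le by (intro mult_left_mono) auto
  ultimately show "\<bar>t\<bar> * phi t \<le> 1" by linarith
  assume t: "2 \<le> \<bar>t\<bar>"
  then have "2 * \<bar>t\<bar> \<le> \<bar>t\<bar> * \<bar>t\<bar>" by (intro mult_right_mono) auto
  then have "\<bar>t\<bar> \<le> t ^ 2 / 2" by (simp add: power2_eq_square)
  then have "exp (- (t ^ 2 / 2)) \<le> exp (- \<bar>t\<bar>)" by simp
  then show "phi t \<le> exp (- \<bar>t\<bar>)" using le by linarith
qed

section \<open>The logistic function and the derivatives of the activations\<close>

definition sigm :: "real \<Rightarrow> real" where "sigm t = 1 / (1 + exp (- t))"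

lemma sigm_bounds: "0 < sigm t" "sigm t < 1" "sigm (- t) = 1 - sigm t" "sigm t \<le> exp t" "1 - sigm t \<le> exp (- t)"
proof -
  have p: "0 < 1 + exp (- t)" by (smt (verit) exp_gt_zero)
  show "0 < sigm t" "sigm t < 1" using p by (auto simp: sigm_def)
  have "1 - sigm t = exp (- t) / (1 + exp (- t))" using p by (simp add: sigm_def field_simps)
  also have "\<dots> = 1 / (1 + exp t)" by (simp add: exp_minus field_simps)
  finally show m: "sigm (- t) = 1 - sigm t" by (simp add: sigm_def)
  have le: "sigm t \<le> exp t" for t
  proof -
    have "sigm t = exp t / (exp t + 1)" by (simp add: sigm_def exp_minus field_simps)
    also have "\<dots> \<le> exp t / 1" by (intro divide_left_mono) (auto simp: add_pos_pos)
    finally show ?thesis by simp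
  qed
  show "sigm t \<le> exp t" by (rule le)
  show "1 - sigm t \<le> exp (- t)" using le[of "- t"] m by simp
qed

lemma sigm_mono: "s \<le> t \<Longrightarrow> sigm s \<le> sigm t"
  unfolding sigm_def by (intro divide_left_mono) (auto simp: add_pos_pos)

lemma sigm_deriv: "(sigm has_real_derivative sigm t * (1 - sigm t)) (at t)"
proof -
  have p: "1 + exp (- t) \<noteq> 0" by (smt (verit) exp_gt_zero)
  have "((\<lambda>t. 1 / (1 + exp (- t))) has_real_derivative exp (- t) / (1 + exp (- t)) ^ 2) (at t)"
    using p by (auto intro!: derivative_eq_intros simp: power2_eq_square)
  moreover have "exp (- t) / (1 + exp (- t)) ^ 2 = sigm t * (1 - sigm t)"
    using p by (simp add: sigm_def field_simps power2_eq_square)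
  ultimately show ?thesis unfolding sigm_def by simp
qed

lemma swish_deriv: "deriv (hat_sigma Swish) t = sigm t + t * (sigm t * (1 - sigm t))"
proof -
  have "((\<lambda>t. t * sigm t) has_real_derivative sigm t + t * (sigm t * (1 - sigm t))) (at t)"
    by (auto intro!: derivative_eq_intros sigm_deriv)
  moreover have "hat_sigma Swish = (\<lambda>t. t * sigm t)" by (auto simp: sigm_def)
  ultimately show ?thesis by (simp add: DERIV_imp_deriv)
qed

lemma sigmoid_deriv: "deriv (hat_sigma Sigmoid) t = sigm t * (1 - sigm t)"
proof -
  have "hat_sigma Sigmoid = sigm" by (auto simp: sigm_def)
  then show ?thesis using sigm_deriv by (simp add: DERIV_imp_deriv)
qed

lemma tanh_deriv: "deriv (hat_sigma Tanh) t = 1 - tanh t ^ 2"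
proof -
  have "hat_sigma Tanh = tanh" by auto
  moreover have "(tanh has_real_derivative 1 - tanh t ^ 2) (at t)"
    by (rule derivative_eq_intros) (auto simp: cosh_real_pos less_imp_neq[symmetric])
  ultimately show ?thesis by (simp add: DERIV_imp_deriv)
qed

lemma tanh_sigm: "tanh t = 2 * sigm (2 * t) - 1"
proof -
  have "1 + exp (- (2 * t)) \<noteq> 0" by (smt (verit) exp_gt_zero)
  then show ?thesis by (simp add: tanh_real_altdef sigm_def field_simps)
qed

text \<open>Both branches have slope 1 at 0, so gluing them there yields a derivative at 0 as
  well.\<close>

lemma elu_deriv: "deriv (hat_sigma ELU) t = (if 0 \<le> t then 1 else exp t)"
proof -
  have f: "hat_sigma ELU = (\<lambda>t. if t \<in> {0..} then t else exp t - 1)" by auto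
  have "((\<lambda>t. if t \<in> {0..} then t else exp t - 1) has_vector_derivative (if t \<in> {0..} then 1 else exp t)) (at t within UNIV)"
    by (rule has_vector_derivative_If_within_closures[where S = "{0..}" and T = "{..<0}"])
      (auto intro!: derivative_eq_intros simp: has_real_derivative_iff_has_vector_derivative[symmetric])
  then have "(hat_sigma ELU has_real_derivative (if 0 \<le> t then 1 else exp t)) (at t)"
    unfolding f has_real_derivative_iff_has_vector_derivative by simp
  then show ?thesis by (rule DERIV_imp_deriv)
qed

section \<open>The activations satisfy the requirements\<close>

context net
begin

text \<open>An error of this size disappears in rounding, next to the limit 0 because it is below
  \<eta> / 2 and next to 1 or - 1 because it is at most 2^(-p-3).\<close>

definition tiny where "tiny = pw (- E - P - 2)"

lemma tiny_pos: "0 < tiny" by (simp add: tiny_def)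

lemma tiny_bounds: "tiny < \<eta> / 2" "tiny \<le> pw (- P - 3)"
proof -
  have "\<eta> = pw (- E - P + 1)" unfolding \<eta>_def emin_eq by (rule arg_cong) simp
  then have "\<eta> / 2 = pw (- E - P)" by (simp only: pw_Suc)
  moreover have "tiny < pw (- E - P)" unfolding tiny_def by (subst pw_less_iff) simp
  ultimately show "tiny < \<eta> / 2" by simp
  show "tiny \<le> pw (- P - 3)" unfolding tiny_def using E_bounds by (subst pw_le_iff) simp
qed

text \<open>The factor 1 + t accounts for GELU and Swish, whose distance from their asymptotes is t
  times a tail. The product stays below its value at B because 1 + t \<le> (1 + B) * (1 + (t - B)),
  and at B it is at most 2^(q + 1 - 2^q) with 2^q = 2 * (E + 1).\<close>

lemma tail: assumes "B \<le> t" shows "(1 + t) * exp (- t) \<le> tiny"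
proof -
  have B0: "0 < B" by simp
  have "0 \<le> B * (t - B)" using assms by (intro mult_nonneg_nonneg less_imp_le[OF B0]) simp
  then have "1 + t \<le> (1 + B) * (1 + (t - B))" by (simp add: algebra_simps)
  also have "\<dots> \<le> (1 + B) * exp (t - B)" using exp_ge_add_one_self[of "t - B"] by (intro mult_left_mono) (auto intro: less_imp_le[OF add_pos_pos[OF zero_less_one B0]])
  finally have "(1 + t) * exp (- t) \<le> (1 + B) * exp (t - B) * exp (- t)" by (intro mult_right_mono) simp_all
  also have "\<dots> = (1 + B) * exp (- B)"
    unfolding mult.assoc exp_add[symmetric] by simp
  finally have 1: "(1 + t) * exp (- t) \<le> (1 + B) * exp (- B)" .
  have Bn: "B = real (2 ^ q)" by (simp add: B_def)
  have e1: "(2::real) \<le> exp 1" using exp_ge_add_one_self[of 1] by simp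
  have "exp B = exp 1 ^ (2 ^ q)" unfolding Bn by (metis exp_of_nat_mult mult.right_neutral)
  then have "2 ^ (2 ^ q) \<le> exp B" using power_mono[OF e1, of "2 ^ q"] by simp
  then have "exp (- B) \<le> 1 / 2 ^ (2 ^ q)" unfolding exp_minus inverse_eq_divide by (intro divide_left_mono) auto
  also have "\<dots> = pw (- int (2 ^ q))" by (simp only: pw_neg pw_nat)
  finally have 2: "exp (- B) \<le> pw (- int (2 ^ q))" .
  have "pw 0 \<le> B" unfolding B_def by (subst pw_le_iff) auto
  then have 3: "1 + B \<le> pw (int q + 1)" unfolding pw_Suc B_def[symmetric] by simp
  have "(1 + B) * exp (- B) \<le> pw (int q + 1) * pw (- int (2 ^ q))" using 2 3 by (intro mult_mono) auto
  also have "\<dots> \<le> tiny" unfolding tiny_def pw_add[symmetric]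
  proof (subst pw_le_iff)
    obtain m where m: "q = Suc m" using q6 by (cases q) auto
    have "E + 1 = 2 ^ m" by (simp add: emax_def m)
    then have "int (2 ^ q) = 2 * (E + 1)" by (simp add: m)
    then show "int q + 1 + - int (2 ^ q) \<le> - E - P - 2" using E_bounds E_bound_q by simp
  qed
  finally show ?thesis using 1 by linarith
qed

lemma one_F: "1 \<in> F"
proof -
  have "pw 0 \<in> F" using E_bounds by (intro pw_F) (auto simp: emin_eq)
  then show ?thesis by simp
qed

lemma R_tiny:
  assumes "\<bar>y\<bar> \<le> tiny" shows "R y = Fin 0"
proof -
  have lt: "\<bar>y\<bar> < \<eta> / 2" using assms tiny_bounds by linarith
  have e: "0 < \<eta>" by simp
  have eF: "\<eta> \<in> F" unfolding \<eta>_def using E_bounds P2 by (intro pw_F) (auto simp: emin_eq)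
  have "- \<eta> \<le> y" "y \<le> \<eta>" using lt e by linarith+
  then obtain v where v: "v \<in> F" "R y = Fin v" using R_range[of "- \<eta>" y \<eta>] eF by auto
  have "\<bar>v - y\<bar> \<le> \<bar>0 - y\<bar>" using R_near[of y v 0] v zero_F by blast
  then have "\<bar>v\<bar> < \<eta>" using lt by linarith
  then have "\<not> \<eta> \<le> v" "\<not> \<eta> \<le> - v" by linarith+
  then have "v = 0" using F_pos_ge_\<eta>[of v] F_pos_ge_\<eta>[of "- v"] v by (metis linorder_neqE_linordered_idom minus_F neg_0_less_iff_less)
  then show ?thesis using v by simp
qed

lemma R_close:
  assumes "t \<in> F" "1 \<le> \<bar>t\<bar>" "\<bar>y - t\<bar> \<le> tiny" shows "R y = Fin t"
proof (rule R_absorb[OF assms(1)])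
  have "1 * pw (- P - 3) \<le> \<bar>t\<bar> * pw (- P - 3)" using assms by (intro mult_right_mono) auto
  then show "\<bar>y - t\<bar> \<le> \<bar>t\<bar> * pw (- P - 3)" using assms(3) tiny_bounds by linarith
qed

lemma B_ge_1: "1 \<le> B" "64 \<le> B"
proof -
  have "pw 6 \<le> B" unfolding B_def using q6 by (subst pw_le_iff) auto
  then show "64 \<le> B" by simp
  then show "1 \<le> B" by simp
qed

lemma R_to:
  assumes "\<kappa> \<in> {0, -1}" "\<bar>y - \<kappa>\<bar> \<le> tiny" shows "R y = Fin \<kappa>"
proof (cases "\<kappa> = 0")
  case True
  then show ?thesis using assms R_tiny[of y] by simp
next
  case False
  then have "\<kappa> = - 1" using assms by auto
  then show ?thesis using assms R_close[of "- 1" y] one_F by auto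
qed

lemma small_F: "2 \<in> F" "7 / 8 \<in> F" "5 / 8 \<in> F" "1 / 2 \<in> F" "1 / 4 \<in> F" "pw (- P - 1) \<in> F" "\<eta> \<in> F"
proof -
  have "of_int n * pw k \<in> F" if "\<bar>n\<bar> \<le> 7" "- 3 \<le> k" "k \<le> 1" for n k
    using E_bounds P2 that by (intro small_mult_F) (auto simp: emin_eq)
  from this[of 1 1] this[of 7 "- 3"] this[of 5 "- 3"] this[of 1 "- 1"] this[of 1 "- 2"]
  show "2 \<in> F" "7 / 8 \<in> F" "5 / 8 \<in> F" "1 / 2 \<in> F" "1 / 4 \<in> F" by (simp_all add: power_int_minus)
  show "pw (- P - 1) \<in> F" using E_bounds P2 by (intro pw_F) (auto simp: emin_eq)
  show "\<eta> \<in> F" unfolding \<eta>_def using E_bounds P2 by (intro pw_F) (auto simp: emin_eq)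
qed

text \<open>At the smallest gap every y above \<eta> / 2 rounds to at least \<eta>, so 5/8 suffices;
  this is the bound available for GELU and Swish at 1. Elsewhere 7/8 leaves room for a rounding
  error of another 1/8.\<close>

lemma fits_R:
  assumes s: "s \<in> {1, -1}" and k: "emin q - P \<le> k" "k \<le> E - P" and y: "y \<le> pw k"
    and lo: "7 / 8 * pw k \<le> y \<or> k = emin q - P \<and> 5 / 8 * pw k \<le> y"
  shows "\<exists>e. R (s * y) = Fin e \<and> fits s k e"
proof -
  have k0: "0 < pw k" by simp
  have y0: "0 \<le> y" using lo k0 by linarith
  have kF: "pw k \<in> F" using k E_bounds P2 by (intro pw_F) auto
  obtain e where e: "e \<in> F" "R y = Fin e" "0 \<le> e" "e \<le> pw k" using R_range[OF y0 y zero_F kF] by auto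
  have "pw k / 2 < e"
  proof (cases "k = emin q - P")
    case True
    have "\<eta> / 2 < y" using lo k0 unfolding \<eta>_def True[symmetric] by linarith
    then have "\<eta> \<le> e" using R_round_\<eta> e by blast
    then show ?thesis using k0 unfolding \<eta>_def True[symmetric] by linarith
  next
    case False
    have "\<bar>e - y\<bar> \<le> \<bar>pw k - y\<bar>" using R_near e kF by blast
    then show ?thesis using False lo y k0 by linarith
  qed
  then have "fits 1 k e" "fits (- 1) k (- e)" using e unfolding fits_def by auto
  moreover have "R (- y) = Fin (- e)" using R_minus_Fin e by blast
  ultimately show ?thesis using s e by auto
qed

lemma R_mult_le:
  assumes "x \<in> F" "\<bar>y\<bar> \<le> 1" shows "\<exists>z\<in>F. R (x * y) = Fin z \<and> \<bar>z\<bar> \<le> \<bar>x\<bar>"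
proof -
  have "\<bar>x * y\<bar> \<le> \<bar>x\<bar>" using assms mult_left_mono[of "\<bar>y\<bar>" 1 "\<bar>x\<bar>"] by (simp add: abs_mult)
  then have "- \<bar>x\<bar> \<le> x * y" "x * y \<le> \<bar>x\<bar>" by linarith+
  moreover have "\<bar>x\<bar> \<in> F" using assms by (simp add: abs_if)
  ultimately show ?thesis using R_range[of "- \<bar>x\<bar>" "x * y" "\<bar>x\<bar>"] by fastforce
qed

end

text \<open>Here the requirements are put on the real function f and its derivative f'.
  \<open>scaled\<close> concerns a value cell: the open gate has a value up to 2^i and the second
  neuron a pre-activation x up to 2^m, while a closed gate leads to an exact 0.\<close>

locale asymptotic_identity = net +
  fixes \<kappa> :: real and f f' :: "real \<Rightarrow> real"
  assumes \<kappa>: "\<kappa> \<in> {0, -1}"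
    and sg_Fin: "\<And>t. sg (Fin t) = R (f t)" and sg'_Fin: "\<And>t. sg' (Fin t) = R (f' t)"
    and sg_NInf: "sg NInf = Fin \<kappa>"
    and f_neg: "\<And>t. t \<le> 0 \<Longrightarrow> - 1 \<le> f t \<and> f t \<le> 0"
    and f_pos: "\<And>t. 0 < t \<Longrightarrow> t / 2 < f t \<and> f t \<le> t"
    and f_hi: "\<And>t. B \<le> t \<Longrightarrow> \<bar>f t - t\<bar> \<le> tiny \<and> \<bar>f' t - 1\<bar> \<le> tiny"
    and f_lo: "\<And>t. t \<le> - B \<Longrightarrow> \<bar>f t - \<kappa>\<bar> \<le> tiny \<and> \<bar>f' t\<bar> \<le> tiny"
    and f'_F: "\<And>t. \<bar>f' t\<bar> \<le> 2 \<or> f' t \<in> F"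
    and shift: "\<exists>bt s0. bt \<in> F \<and> s0 \<in> F \<and> \<bar>s0\<bar> \<le> 1 \<and> sg (Fin \<kappa> \<oplus> Fin bt) = Fin 0 \<and> sg' (Fin \<kappa> \<oplus> Fin bt) = Fin s0 \<and>
      (\<forall>n\<in>F. pw (E - P - 2) \<le> n \<longrightarrow> n \<le> 5 / 4 * pw E \<longrightarrow> (\<exists>n'\<in>F. Fin n \<oplus> Fin bt = Fin n' \<and> pw (E - P - 2) \<le> n'))"
    and scaled: "\<And>m i. 0 \<le> m \<Longrightarrow> m \<le> i \<Longrightarrow> int q + 1 \<le> i \<Longrightarrow> i \<le> E - P \<Longrightarrow>
      \<exists>vI \<beta> s0 x. {vI, \<beta>, s0, x} \<subseteq> F \<and> B \<le> vI \<and> vI \<le> pw i \<and> \<bar>s0\<bar> \<le> 1 \<and>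
        sg (Fin (pw (m - i)) \<otimes> Fin \<kappa> \<oplus> Fin \<beta>) = Fin 0 \<and> sg' (Fin (pw (m - i)) \<otimes> Fin \<kappa> \<oplus> Fin \<beta>) = Fin s0 \<and>
        Fin (pw (m - i)) \<otimes> Fin vI \<oplus> Fin \<beta> = Fin x \<and> 0 < x \<and> x \<le> pw m \<and> \<bar>f' x\<bar> \<le> 2 \<and> (int q \<le> m \<longrightarrow> sg' (Fin x) = Fin 1) \<and>
        (if m = 0 then 5 / 8 \<le> f x else 7 / 8 * pw m \<le> f x)"
begin

lemma act_hi: "t \<in> F \<Longrightarrow> B \<le> t \<Longrightarrow> sg (Fin t) = Fin t \<and> sg' (Fin t) = Fin 1"
proof -
  assume t: "t \<in> F" "B \<le> t"
  then have "1 \<le> \<bar>t\<bar>" using B_ge_1 by linarith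
  then show ?thesis unfolding sg_Fin sg'_Fin using f_hi[OF t(2)] t one_F by (auto intro!: R_close)
qed

lemma cell:
  assumes s: "s \<in> {1, -1}" and k: "emin q - P \<le> k" "k \<le> E - P"
  shows "value_cell (Omega p q) 1 (E - P - 2) \<kappa> s k"
proof -
  \<comment> \<open>The output weight has magnitude 2^(k - m). It has to be a float, which forces m
    = 0 at the smallest gap and permits m = 1 above it, and it must be at most 1 / 2 while m < q,
    where the slope of the second neuron may reach 2. From k = q on that slope is 1, and so is the
    magnitude of the weight.\<close>
  define m :: int where "m = (if k = emin q - P then 0 else if k \<le> 0 then 1 else if k < int q then k + 1 else k)"
  \<comment> \<open>2^i exceeds B, which leaves room for a gate value with slope 1, and is at least
    2^m, so that the weight w' does not magnify.\<close>
  define i where "i = max (int q + 1) k"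
  define w' where "w' = pw (m - i)"
  define w0 where "w0 = pw (k - m)"
  have m0: "0 \<le> m" "m \<le> i" using E_bounds P2 k by (auto simp: m_def i_def emin_eq)
  have i: "int q + 1 \<le> i" "i \<le> E - P" using E_bounds P2 k E_bound_q by (auto simp: i_def)
  obtain vI \<beta> s0 x where F1: "vI \<in> F" "\<beta> \<in> F" "s0 \<in> F" "x \<in> F" and vI: "B \<le> vI" "vI \<le> pw i" and s0: "\<bar>s0\<bar> \<le> 1"
    and off: "sg (Fin w' \<otimes> Fin \<kappa> \<oplus> Fin \<beta>) = Fin 0" "sg' (Fin w' \<otimes> Fin \<kappa> \<oplus> Fin \<beta>) = Fin s0"
    and on: "Fin w' \<otimes> Fin vI \<oplus> Fin \<beta> = Fin x" and x: "0 < x" "x \<le> pw m" "\<bar>f' x\<bar> \<le> 2" "int q \<le> m \<longrightarrow> sg' (Fin x) = Fin 1"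
    and fx: "if m = 0 then 5 / 8 \<le> f x else 7 / 8 * pw m \<le> f x"
    using scaled[OF m0 i] unfolding w'_def by auto
  have w'F: "w' \<in> F" unfolding w'_def using m0 i E_bounds P2 by (intro pw_F) (auto simp: emin_eq)
  have w'1: "0 < w'" "w' \<le> 1"
  proof -
    have "w' \<le> pw 0" unfolding w'_def using m0 by (subst pw_le_iff) simp
    then show "w' \<le> 1" by simp
  qed (simp add: w'_def)
  have w0F: "w0 \<in> F" unfolding w0_def using k E_bounds P2 by (intro pw_F) (auto simp: m_def emin_eq)
  have w01: "0 < w0" "w0 \<le> 1" "m < int q \<Longrightarrow> w0 \<le> 1 / 2"
  proof -
    have "w0 \<le> pw 0" unfolding w0_def using k E_bounds by (subst pw_le_iff) (auto simp: m_def emin_eq)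
    then show "w0 \<le> 1" by simp
    show "m < int q \<Longrightarrow> w0 \<le> 1 / 2"
    proof -
      assume "m < int q"
      then have "w0 \<le> pw (- 1)" unfolding w0_def using k E_bounds P2 by (subst pw_le_iff) (auto simp: m_def emin_eq split: if_splits)
      then show ?thesis by (simp add: power_int_minus)
    qed
  qed (simp_all add: w0_def m_def)
  have mF: "pw m \<in> F" using m0 i E_bounds P2 by (intro pw_F) (auto simp: emin_eq)
  have m1: "0 < pw m" "m \<noteq> 0 \<Longrightarrow> 7 / 8 * pw m \<in> F"
  proof -
    assume "m \<noteq> 0"
    have "of_int 7 * pw (m - 3) \<in> F" using m0 i E_bounds P2 by (intro small_mult_F) (auto simp: emin_eq)
    then show "7 / 8 * pw m \<in> F" by (simp add: pw_diff)
  qed simp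
  have fle: "f x \<le> pw m" using f_pos[OF x(1)] x by linarith
  obtain v where v: "v \<in> F" "R (f x) = Fin v" "v \<le> pw m" "if m = 0 then 5 / 8 \<le> v else 7 / 8 * pw m \<le> v"
  proof (cases "m = 0")
    case True
    then have "5 / 8 \<le> f x" using fx by simp
    from R_range[OF this fle small_F(3) mF] show ?thesis using that True by auto
  next
    case False
    then have "7 / 8 * pw m \<le> f x" using fx by simp
    from R_range[OF this fle m1(2)[OF False] mF] show ?thesis using that False by auto
  qed
  have km: "w0 * pw m = pw k" unfolding w0_def pw_add[symmetric] by simp
  have up: "w0 * v \<le> pw k" unfolding km[symmetric] using v w01 by (intro mult_left_mono) auto
  have lo: "7 / 8 * pw k \<le> w0 * v \<or> k = emin q - P \<and> 5 / 8 * pw k \<le> w0 * v"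
  proof (cases "m = 0")
    case True
    have "k = emin q - P" using True k E_bounds P2 by (auto simp: m_def split: if_splits)
    moreover have "w0 * (5 / 8) \<le> w0 * v" using v True w01 by (intro mult_left_mono) auto
    ultimately show ?thesis using km True by simp
  next
    case False
    have "w0 * (7 / 8 * pw m) \<le> w0 * v" using v False w01 by (intro mult_left_mono) auto
    then have "7 / 8 * (w0 * pw m) \<le> w0 * v" by (simp only: mult.left_commute)
    then show ?thesis unfolding km by blast
  qed
  obtain e where e: "R (s * (w0 * v)) = Fin e" "fits s k e" using fits_R[OF s k up lo] by blast
  obtain s1 where s1: "s1 \<in> F" "sg' (Fin x) = Fin s1" "\<bar>s1\<bar> \<le> 2" "m < int q \<or> \<bar>s1\<bar> \<le> 1"
  proof (cases "m < int q")
    case True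
    have "- 2 \<le> f' x" "f' x \<le> 2" using x by linarith+
    from R_range[OF this] small_F obtain y where "y \<in> F" "R (f' x) = Fin y" "- 2 \<le> y" "y \<le> 2" by auto
    then show ?thesis using that[of y] True unfolding sg'_Fin by auto
  next
    case False
    then show ?thesis using that[of 1] one_F x(4) by auto
  qed
  define w where "w = s * w0"
  have wF: "w \<in> F" and wabs: "\<bar>w\<bar> = w0" using s w0F w01 by (auto simp: w_def)
  have bw: "\<exists>g t0 e0 t1 e1 t2 e2. Fin h \<otimes> Fin w = Fin g \<and> Fin g \<otimes> Fin s0 = Fin t0 \<and> Fin t0 \<otimes> Fin w' = Fin e0 \<and>
      Fin g \<otimes> Fin s1 = Fin t1 \<and> Fin t1 \<otimes> Fin w' = Fin e1 \<and> Fin e1 \<otimes> Fin 1 = Fin t2 \<and> Fin t2 \<otimes> Fin (- 1) = Fin e2"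
    if h: "h \<in> F" "\<bar>h\<bar> \<le> Omega p q" for h
  proof -
    obtain g where g: "g \<in> F" "R (h * w) = Fin g" "\<bar>g\<bar> \<le> \<bar>h\<bar>" using R_mult_le[OF h(1), of w] wabs w01 by auto
    obtain t0 where t0: "t0 \<in> F" "R (g * s0) = Fin t0" using R_mult_le[OF g(1), of s0] s0 by auto
    obtain e0 where e0: "e0 \<in> F" "R (t0 * w') = Fin e0" using R_mult_le[OF t0(1), of w'] w'1 by auto
    have "\<bar>g * s1\<bar> \<le> Omega p q"
    proof (cases "m < int q")
      case True
      \<comment> \<open>The product h * w is rounded before it meets a slope of up to 2; since Omega
        / 2 is a float, the rounded product stays within Omega / 2.\<close>
      have half: "Omega p q / 2 \<in> F"
      proof -
        have eq: "of_int (2 ^ (p + 1) - 1) * pw (E - P - 1) = Omega p q / 2"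
          unfolding Omega_def by (simp add: pw_diff pw_neg pw_add field_simps)
        have "of_int (2 ^ (p + 1) - 1) * pw (E - P - 1) \<in> F"
        proof (rule F_intro)
          show "\<bar>of_int (2 ^ (p + 1) - 1) * pw (E - P - 1)\<bar> \<le> Omega p q" unfolding eq using Omega_bounds by simp
        qed (use E_bounds P2 in \<open>auto simp: emin_eq\<close>)
        then show ?thesis unfolding eq .
      qed
      have "\<bar>h * w\<bar> \<le> Omega p q * (1 / 2)" unfolding abs_mult wabs using h w01(1) w01(3)[OF True] by (intro mult_mono) auto
      then have "- (Omega p q / 2) \<le> h * w" "h * w \<le> Omega p q / 2" by linarith+
      then have "\<bar>g\<bar> \<le> Omega p q / 2" using R_range[of "- (Omega p q / 2)" "h * w" "Omega p q / 2"] half g(2) by auto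
      then have "\<bar>g\<bar> * \<bar>s1\<bar> \<le> Omega p q / 2 * 2" using s1 by (intro mult_mono) auto
      then show ?thesis by (simp add: abs_mult)
    next
      case False
      then have "\<bar>g\<bar> * \<bar>s1\<bar> \<le> Omega p q * 1" using s1 g h by (intro mult_mono) auto
      then show ?thesis by (simp add: abs_mult)
    qed
    then obtain t1 where t1: "t1 \<in> F" "R (g * s1) = Fin t1" using R_in_range R_Fin_F by blast
    obtain e1 where e1: "e1 \<in> F" "R (t1 * w') = Fin e1" using R_mult_le[OF t1(1), of w'] w'1 by auto
    show ?thesis using g t0 e0 t1 e1 R_F by auto
  qed
  have "4 * pw (E - P - 2) = pw (E - P)" by (simp add: pw_diff)
  moreover have "pw i \<le> pw (E - P)" using i by (subst pw_le_iff)
  moreover have "0 < B" by simp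
  ultimately have c1: "\<bar>vI\<bar> \<le> 4 * pw (E - P - 2)" using vI by linarith
  have c2: "sg (Fin vI) = Fin vI" "sg' (Fin vI) = Fin 1" using act_hi F1 vI by auto
  have c3: "Fin w \<otimes> Fin v = Fin e" using e by (simp add: w_def mult.assoc)
  have c4: "sg (Fin w' \<otimes> Fin vI \<oplus> Fin \<beta>) = Fin v" "sg' (Fin w' \<otimes> Fin vI \<oplus> Fin \<beta>) = Fin s1"
    unfolding on using s1 v sg_Fin by auto
  have c5: "{vI, vI, 1, w', \<beta>, v, s0, s1, w} \<subseteq> F" using F1 one_F w'F v s1 wF by auto
  show ?thesis unfolding value_cell_def
    by (rule exI[of _ vI], rule exI[of _ vI], rule exI[of _ 1], rule exI[of _ w'], rule exI[of _ \<beta>],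
        rule exI[of _ v], rule exI[of _ s0], rule exI[of _ s1], rule exI[of _ w], rule exI[of _ e],
        intro conjI ballI impI c1 c2 c3 c4 c5 off e(2)) (rule bw)
qed

lemma eventual_identity: "eventual_identity p q a c \<kappa>"
proof (unfold_locales)
  show "\<kappa> \<in> {0, -1}" by (rule \<kappa>)
next
  fix t :: real assume "t \<in> F" "t \<le> 0"
  then have "- 1 \<le> f t" "f t \<le> 0" using f_neg by auto
  from R_range[OF this] one_F zero_F show "\<exists>v\<in>F. sg (Fin t) = Fin v \<and> - 1 \<le> v \<and> v \<le> 0" unfolding sg_Fin by auto
next
  fix t assume t: "t \<in> F" "0 < t"
  have ft: "0 \<le> f t" "f t \<le> t" "t / 2 < f t" using f_pos[OF t(2)] t by linarith+
  from R_range[OF ft(1,2) zero_F t(1)] obtain v where v: "v \<in> F" "R (f t) = Fin v" "v \<le> t" by auto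
  have "\<eta> \<le> t" using t F_pos_ge_\<eta> by blast
  then have "\<eta> / 2 < f t" using ft by linarith
  then have "\<eta> \<le> v" using R_round_\<eta> v by blast
  moreover have "\<forall>z\<in>F. 2 * z \<le> t \<longrightarrow> z \<le> v" using R_ge[OF v(2)] ft by fastforce
  ultimately show "\<exists>v\<in>F. sg (Fin t) = Fin v \<and> \<eta> \<le> v \<and> v \<le> t \<and> (\<forall>z\<in>F. 2 * z \<le> t \<longrightarrow> z \<le> v)" unfolding sg_Fin using v by auto
next
  show "\<And>t. t \<in> F \<Longrightarrow> B \<le> t \<Longrightarrow> sg (Fin t) = Fin t \<and> sg' (Fin t) = Fin 1" by (rule act_hi)
next
  fix v assume "neg v"
  then consider "v = NInf" | r where "v = Fin r" "r \<le> - B" unfolding neg_def by blast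
  then show "sg v = Fin \<kappa> \<and> sg' v = Fin 0"
  proof cases
    case 1
    then show ?thesis using sg_NInf by simp
  next
    case 2
    show ?thesis unfolding 2(1) sg_Fin sg'_Fin using f_lo[OF 2(2)] R_to[OF \<kappa>] R_tiny by blast
  qed
next
  fix t
  consider "- 2 \<le> f' t" "f' t \<le> 2" | "f' t \<in> F" using f'_F[of t] by linarith
  then show "\<exists>s\<in>F. sg' (Fin t) = Fin s" unfolding sg'_Fin
  proof cases
    case 1
    from R_range[OF this] show "\<exists>s\<in>F. R (f' t) = Fin s" using small_F(1) by auto
  qed (use R_F in auto)
next
  show "\<exists>bt s0. bt \<in> F \<and> s0 \<in> F \<and> \<bar>s0\<bar> \<le> 1 \<and> sg (Fin \<kappa> \<oplus> Fin bt) = Fin 0 \<and> sg' (Fin \<kappa> \<oplus> Fin bt) = Fin s0 \<and>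
      (\<forall>n\<in>F. pw (E - P - 2) \<le> n \<longrightarrow> n \<le> 5 / 4 * pw E \<longrightarrow> (\<exists>n'\<in>F. Fin n \<oplus> Fin bt = Fin n' \<and> pw (E - P - 2) \<le> n'))" by (rule shift)
next
  show "\<And>s k. s \<in> {1, -1} \<Longrightarrow> emin q - P \<le> k \<Longrightarrow> k \<le> E - P \<Longrightarrow> value_cell (Omega p q) 1 (E - P - 2) \<kappa> s k" by (rule cell)
qed

lemma identity_cells: "cells p q a c d (pw (E - 2)) (Omega p q) 1 \<kappa> 1 1 B B (E - P - 2)"
  by (rule eventual_identity.eventual_identity_cells[OF eventual_identity])

end

section \<open>Numerical bounds for the logistic function, GELU and Swish\<close>

lemma exp_numeric: "7 \<le> exp (2::real)" "15 \<le> exp (4::real)"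
proof -
  have "1 + 1 / 4 + (1 / 4)\<^sup>2 / 2 \<le> exp (1 / 4 :: real)" by (rule exp_lower_Taylor_quadratic) simp
  then have "41 / 32 \<le> exp (1 / 4 :: real)" by (simp add: power2_eq_square)
  then have "(41 / 32) ^ 8 \<le> exp (1 / 4 :: real) ^ 8" by (intro power_mono) auto
  also have "\<dots> = exp 2" by (simp flip: exp_of_nat_mult)
  finally show 2: "7 \<le> exp (2::real)" by (simp add: power_divide)
  have "7 ^ 2 \<le> exp (2::real) ^ 2" using 2 by (intro power_mono) auto
  also have "\<dots> = exp 4" by (simp flip: exp_of_nat_mult)
  finally show "15 \<le> exp (4::real)" by simp
qed

lemma sigm_ge:
  assumes "0 < r" "r \<le> exp t" shows "r / (1 + r) \<le> sigm t"
proof -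
  have "exp (- t) \<le> 1 / r" unfolding exp_minus inverse_eq_divide using assms by (intro divide_left_mono) auto
  then have "1 / (1 + 1 / r) \<le> sigm t" unfolding sigm_def using assms by (intro divide_left_mono) (auto simp: add_pos_pos)
  moreover have "1 / (1 + 1 / r) = r / (1 + r)" using assms by (simp add: field_simps)
  ultimately show ?thesis by simp
qed

lemma sigm_0: "sigm 0 = 1 / 2" by (simp add: sigm_def)

lemma sigm_gt_half: "0 < t \<Longrightarrow> 1 / 2 < sigm t"
proof -
  assume "0 < t"
  then have "0 < 1 + exp (- t)" "exp (- t) < 1" by (auto simp: add_pos_pos)
  then show ?thesis by (simp add: sigm_def less_divide_eq)
qed

text \<open>The slope 1/6 is enough for \<open>R_above_half\<close>: 2^(1 - p) / 6 exceeds 2^(1 - p)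
  / 8 = 2^(-p-2), half the float spacing just above 1/2.\<close>

lemma sigm_slope:
  assumes "0 \<le> t" "t \<le> 1 / 2" shows "1 / 2 + t / 6 \<le> sigm t"
proof -
  define g where "g y = sigm y - y / 6" for y
  have "g 0 \<le> g t"
  proof (rule DERIV_nonneg_imp_nondecreasing[OF assms(1)])
    fix y assume y: "0 \<le> y" "y \<le> t"
    have d: "(g has_real_derivative sigm y * (1 - sigm y) - 1 / 6) (at y)"
      unfolding g_def by (intro DERIV_diff sigm_deriv DERIV_cdivide DERIV_ident)
    have "1 / 2 \<le> sigm y" using sigm_mono[OF y(1)] sigm_0 by simp
    moreover have "1 / 3 \<le> 1 - sigm y"
    proof -
      have "1 / 2 \<le> exp (- y)" using exp_ge_add_one_self[of "- y"] y assms by linarith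
      from sigm_ge[OF _ this] show ?thesis using sigm_bounds(3)[of y] by simp
    qed
    ultimately have "1 / 2 * (1 / 3) \<le> sigm y * (1 - sigm y)" by (intro mult_mono) auto
    then have "0 \<le> sigm y * (1 - sigm y) - 1 / 6" by simp
    then show "\<exists>D. (g has_real_derivative D) (at y) \<and> 0 \<le> D" using d by blast
  qed
  then show ?thesis by (simp add: g_def sigm_0)
qed

text \<open>All four errors are built from 1 - Phi t and phi t with at most a factor t, and both are
  bounded by exp (- t) for t \<ge> 2.\<close>

lemma gelu_le:
  assumes "2 \<le> t" shows "\<bar>hat_sigma GELU t - t\<bar> \<le> (1 + t) * exp (- t)" "\<bar>hat_sigma GELU (- t)\<bar> \<le> (1 + t) * exp (- t)"
    "\<bar>deriv (hat_sigma GELU) t - 1\<bar> \<le> (1 + t) * exp (- t)" "\<bar>deriv (hat_sigma GELU) (- t)\<bar> \<le> (1 + t) * exp (- t)"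
proof -
  define u where "u = 1 - Phi t"
  define x where "x = exp (- t)"
  have u: "0 \<le> u" "u \<le> x" using Phi_tail[OF assms] Phi_bounds(2)[of t] unfolding u_def x_def by (auto simp: field_simps)
  have ph: "0 \<le> phi t" "phi t \<le> x" using phi_bounds[of t] assms by (auto simp: x_def)
  have tu: "0 \<le> t * u" "t * u \<le> t * x" using u assms by (auto intro!: mult_left_mono)
  have tp: "0 \<le> t * phi t" "t * phi t \<le> t * x" using ph assms by (auto intro!: mult_left_mono)
  have x: "(1 + t) * exp (- t) = x + t * x" "0 \<le> x" by (auto simp: x_def algebra_simps)
  have e1: "hat_sigma GELU t - t = - (t * u)" unfolding gelu_Phi u_def by (simp add: algebra_simps)
  have e2: "hat_sigma GELU (- t) = - (t * u)" unfolding gelu_Phi Phi_bounds(5) u_def by simp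
  have e3: "deriv (hat_sigma GELU) t - 1 = t * phi t - u" unfolding gelu_deriv u_def by simp
  have pe: "phi (- t) = phi t" by (simp add: phi_def)
  have e4: "deriv (hat_sigma GELU) (- t) = u - t * phi t" unfolding gelu_deriv Phi_bounds(5) u_def pe by simp
  show "\<bar>hat_sigma GELU t - t\<bar> \<le> (1 + t) * exp (- t)" "\<bar>hat_sigma GELU (- t)\<bar> \<le> (1 + t) * exp (- t)"
    "\<bar>deriv (hat_sigma GELU) t - 1\<bar> \<le> (1 + t) * exp (- t)" "\<bar>deriv (hat_sigma GELU) (- t)\<bar> \<le> (1 + t) * exp (- t)"
    unfolding e1 e2 e3 e4 x(1) using u ph tu tp x(2) by linarith+
qed

lemma swish_sigm: "hat_sigma Swish t = t * sigm t"
  by (simp add: sigm_def)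

lemma swish_le:
  assumes "2 \<le> t" shows "\<bar>hat_sigma Swish t - t\<bar> \<le> (1 + t) * exp (- t)" "\<bar>hat_sigma Swish (- t)\<bar> \<le> (1 + t) * exp (- t)"
    "\<bar>deriv (hat_sigma Swish) t - 1\<bar> \<le> (1 + t) * exp (- t)" "\<bar>deriv (hat_sigma Swish) (- t)\<bar> \<le> (1 + t) * exp (- t)"
proof -
  define u where "u = 1 - sigm t"
  define x where "x = exp (- t)"
  have u: "0 \<le> u" "u \<le> x" "u \<le> 1" using sigm_bounds[of t] unfolding u_def x_def by auto
  define y where "y = (1 - u) * u"
  have y: "0 \<le> y" "y \<le> x" unfolding y_def using u mult_mono[of "1 - u" 1 u x] by auto
  have tu: "0 \<le> t * u" "t * u \<le> t * x" using u assms by (auto intro!: mult_left_mono)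
  have tp: "0 \<le> t * y" "t * y \<le> t * x" using y assms by (auto intro!: mult_left_mono)
  have x: "(1 + t) * exp (- t) = x + t * x" "0 \<le> x" by (auto simp: x_def algebra_simps)
  have e1: "hat_sigma Swish t - t = - (t * u)" unfolding swish_sigm u_def by (simp add: algebra_simps)
  have e2: "hat_sigma Swish (- t) = - (t * u)" unfolding swish_sigm sigm_bounds(3) u_def by simp
  have e3: "deriv (hat_sigma Swish) t - 1 = t * y - u" unfolding swish_deriv u_def y_def by simp
  have e4: "deriv (hat_sigma Swish) (- t) = u - t * y" unfolding swish_deriv sigm_bounds(3) u_def y_def by (simp add: mult.commute)
  show "\<bar>hat_sigma Swish t - t\<bar> \<le> (1 + t) * exp (- t)" "\<bar>hat_sigma Swish (- t)\<bar> \<le> (1 + t) * exp (- t)"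
    "\<bar>deriv (hat_sigma Swish) t - 1\<bar> \<le> (1 + t) * exp (- t)" "\<bar>deriv (hat_sigma Swish) (- t)\<bar> \<le> (1 + t) * exp (- t)"
    unfolding e1 e2 e3 e4 x(1) using u y tu tp x(2) by linarith+
qed

lemma gelu_bounds:
  "t \<le> 0 \<Longrightarrow> - 1 \<le> hat_sigma GELU t \<and> hat_sigma GELU t \<le> 0"
  "0 < t \<Longrightarrow> t / 2 < hat_sigma GELU t \<and> hat_sigma GELU t \<le> t"
  "\<bar>deriv (hat_sigma GELU) t\<bar> \<le> 2"
  "2 \<le> t \<Longrightarrow> 7 / 8 * t \<le> hat_sigma GELU t" "5 / 8 \<le> hat_sigma GELU 1"
proof -
  show "- 1 \<le> hat_sigma GELU t \<and> hat_sigma GELU t \<le> 0" if "t \<le> 0"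
  proof
    show "hat_sigma GELU t \<le> 0" unfolding gelu_Phi using that Phi_bounds(1)[of t] by (simp add: mult_le_0_iff)
    define r where "r = - t"
    have r: "0 \<le> r" "t = - r" using that by (auto simp: r_def)
    have "r * Phi t \<le> 1"
    proof (cases "2 \<le> r")
      case True
      have "Phi t \<le> exp (- r)" using Phi_tail[OF True] unfolding r(2) Phi_bounds(5) by (smt (verit) exp_gt_zero field_sum_of_halves)
      then have "r * Phi t \<le> r * exp (- r)" using r by (intro mult_left_mono) auto
      then show ?thesis using x_exp_le[OF r(1)] by linarith
    next
      case False
      have "1 / 2 \<le> Phi r"
      proof (cases "r = 0")
        case True
        then show ?thesis using Phi_bounds(4) by simp
      next
        case False
        then show ?thesis using Phi_bounds(3)[of r] r by simp
      qed
      then have "Phi t \<le> 1 / 2" unfolding r(2) Phi_bounds(5) by simp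
      then have "r * Phi t \<le> 2 * (1 / 2)" using False r Phi_bounds(1)[of t] by (intro mult_mono) auto
      then show ?thesis by simp
    qed
    then show "- 1 \<le> hat_sigma GELU t" unfolding gelu_Phi using r by simp
  qed
  show "t / 2 < hat_sigma GELU t \<and> hat_sigma GELU t \<le> t" if "0 < t"
    unfolding gelu_Phi using mult_strict_left_mono[OF Phi_bounds(3)[OF that] that] mult_left_mono[OF Phi_bounds(2), of t t] that by simp
  have "\<bar>t * phi t\<bar> \<le> 1" unfolding abs_mult using phi_bounds[of t] by simp
  then show "\<bar>deriv (hat_sigma GELU) t\<bar> \<le> 2" unfolding gelu_deriv using Phi_bounds(1,2)[of t] by linarith
  show "7 / 8 * t \<le> hat_sigma GELU t" if "2 \<le> t"
  proof -
    have "exp 2 \<le> exp t" using that by simp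
    then have "7 \<le> exp t" using exp_numeric by linarith
    then have "exp (- t) \<le> 1 / 7" unfolding exp_minus inverse_eq_divide by (intro divide_left_mono) auto
    then have "7 / 8 \<le> Phi t" using Phi_tail[OF that] by linarith
    then have "t * (7 / 8) \<le> t * Phi t" using that by (intro mult_left_mono) auto
    then show ?thesis unfolding gelu_Phi by linarith
  qed
  show "5 / 8 \<le> hat_sigma GELU 1" unfolding gelu_Phi using Phi_1 by simp
qed

lemma swish_bounds:
  "t \<le> 0 \<Longrightarrow> - 1 \<le> hat_sigma Swish t \<and> hat_sigma Swish t \<le> 0"
  "0 < t \<Longrightarrow> t / 2 < hat_sigma Swish t \<and> hat_sigma Swish t \<le> t"
  "\<bar>deriv (hat_sigma Swish) t\<bar> \<le> 2"
  "2 \<le> t \<Longrightarrow> 7 / 8 * t \<le> hat_sigma Swish t" "5 / 8 \<le> hat_sigma Swish 1"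
proof -
  have neg: "r * sigm (- r) \<le> 1" if "0 \<le> r" for r
  proof -
    have "r * sigm (- r) \<le> r * exp (- r)" using sigm_bounds(4)[of "- r"] that by (intro mult_left_mono) auto
    then show ?thesis using x_exp_le[OF that] by linarith
  qed
  show "- 1 \<le> hat_sigma Swish t \<and> hat_sigma Swish t \<le> 0" if "t \<le> 0"
    unfolding swish_sigm using neg[of "- t"] that sigm_bounds(1)[of t] by (simp add: mult_le_0_iff less_imp_le)
  show "t / 2 < hat_sigma Swish t \<and> hat_sigma Swish t \<le> t" if "0 < t"
    unfolding swish_sigm using mult_strict_left_mono[OF sigm_gt_half[OF that] that] mult_left_mono[OF less_imp_le[OF sigm_bounds(2)], of t t] that by simp
  have "\<bar>t * (sigm t * (1 - sigm t))\<bar> \<le> 1"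
  proof (cases "0 \<le> t")
    case True
    have "sigm t * (1 - sigm t) \<le> 1 * (1 - sigm t)" using sigm_bounds[of t] by (intro mult_right_mono) auto
    then have "t * (sigm t * (1 - sigm t)) \<le> t * sigm (- t)" using True sigm_bounds(3)[of t] by (intro mult_left_mono) auto
    then show ?thesis using neg[OF True] True sigm_bounds[of t] by (simp add: abs_mult)
  next
    case False
    have "sigm t * (1 - sigm t) \<le> sigm t * 1" using sigm_bounds[of t] by (intro mult_left_mono) auto
    then have "- t * (sigm t * (1 - sigm t)) \<le> - t * sigm t" using False by (intro mult_left_mono) auto
    moreover have "0 \<le> - t * (sigm t * (1 - sigm t))" using False sigm_bounds[of t] by (intro mult_nonneg_nonneg) auto
    moreover have "- t * sigm t \<le> 1" using neg[of "- t"] False by simp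
    ultimately show ?thesis unfolding mult_minus_left by linarith
  qed
  then show "\<bar>deriv (hat_sigma Swish) t\<bar> \<le> 2" unfolding swish_deriv using sigm_bounds[of t] by linarith
  show "7 / 8 * t \<le> hat_sigma Swish t" if "2 \<le> t"
  proof -
    have "exp 2 \<le> exp t" using that by simp
    then have "7 \<le> exp t" using exp_numeric by linarith
    then have "7 / 8 \<le> sigm t" using sigm_ge[of 7 t] by simp
    then have "t * (7 / 8) \<le> t * sigm t" using that by (intro mult_left_mono) auto
    then show ?thesis unfolding swish_sigm by linarith
  qed
  have "5 / 3 \<le> exp (1::real)" using exp_ge_add_one_self[of 1] by simp
  from sigm_ge[OF _ this] show "5 / 8 \<le> hat_sigma Swish 1" unfolding swish_sigm by simp
qed

section \<open>Cells for ReLU, ELU, GELU and Swish\<close>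

context net
begin

lemma B_le_imp_2_le: "B \<le> t \<Longrightarrow> 2 \<le> t"
  using B_ge_1 by linarith

lemma gap_F: "pw (E - P - 2) \<in> F" "1 \<le> pw (E - P - 2)"
proof -
  show "pw (E - P - 2) \<in> F" using E_bounds P2 by (intro pw_F) (auto simp: emin_eq)
  have "pw 0 \<le> pw (E - P - 2)" using E_bounds by (subst pw_le_iff) simp
  then show "1 \<le> pw (E - P - 2)" by simp
qed

lemma scaled_F:
  assumes "0 \<le> m" "m \<le> i" "int q + 1 \<le> i" "i \<le> E - P"
  shows "pw i \<in> F" "pw m \<in> F" "pw (m - i) \<in> F" "B \<le> pw i" "1 \<le> pw m" "pw (m - i) * pw i = pw m" "int q \<le> m \<Longrightarrow> B \<le> pw m"
proof -
  show "pw i \<in> F" "pw m \<in> F" "pw (m - i) \<in> F" using assms E_bounds P2 by (auto intro!: pw_F simp: emin_eq)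
  show "B \<le> pw i" unfolding B_def using assms by (subst pw_le_iff) simp
  have "pw 0 \<le> pw m" using assms by (subst pw_le_iff)
  then show "1 \<le> pw m" by simp
  show "pw (m - i) * pw i = pw m" unfolding pw_add[symmetric] by simp
  show "int q \<le> m \<Longrightarrow> B \<le> pw m" unfolding B_def by (subst pw_le_iff)
qed

text \<open>Both functions vanish at 0 with slope 1/2, so a closed gate, with \<kappa> = 0, is
  already mapped to an exact 0 by bias 0.\<close>

lemma smooth_cells:
  assumes a: "a = GELU \<or> a = Swish"
  shows "cells p q a c d (pw (E - 2)) (Omega p q) 1 0 1 1 B B (E - P - 2)"
proof -
  let ?f = "hat_sigma a" and ?f' = "deriv (hat_sigma a)"
  have sgF: "sg (Fin t) = R (?f t)" "sg' (Fin t) = R (?f' t)" for t using a by auto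
  have bnds: "t \<le> 0 \<Longrightarrow> - 1 \<le> ?f t \<and> ?f t \<le> 0" "0 < t \<Longrightarrow> t / 2 < ?f t \<and> ?f t \<le> t"
      "\<bar>?f' t\<bar> \<le> 2" "2 \<le> t \<Longrightarrow> 7 / 8 * t \<le> ?f t" "5 / 8 \<le> ?f 1" for t
    using a gelu_bounds(1-4)[of t] swish_bounds(1-4)[of t] gelu_bounds(5) swish_bounds(5) by (auto simp del: hat_sigma.simps)
  have le: "\<bar>?f t - t\<bar> \<le> (1 + t) * exp (- t)" "\<bar>?f (- t)\<bar> \<le> (1 + t) * exp (- t)"
    "\<bar>?f' t - 1\<bar> \<le> (1 + t) * exp (- t)" "\<bar>?f' (- t)\<bar> \<le> (1 + t) * exp (- t)" if "2 \<le> t" for t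
    using a gelu_le[OF that] swish_le[OF that] by (auto simp del: hat_sigma.simps)
  have hi: "\<bar>?f t - t\<bar> \<le> tiny \<and> \<bar>?f' t - 1\<bar> \<le> tiny" if t: "B \<le> t" for t
    using le(1,3)[OF B_le_imp_2_le[OF t]] tail[OF t] by linarith
  have z: "?f 0 = 0" "?f' 0 = 1 / 2"
    using a gelu_deriv[of 0] swish_deriv[of 0] Phi_bounds(4) sigm_0 by auto
  have z': "sg (Fin 0) = Fin 0" "sg' (Fin 0) = Fin (1 / 2)" unfolding sgF z using R_F[OF small_F(4)] by auto
  interpret asymptotic_identity p q a c d 0 ?f ?f'
  proof (unfold_locales)
    fix t assume t: "t \<le> - B"
    then have B: "B \<le> - t" by linarith
    show "\<bar>?f t - 0\<bar> \<le> tiny \<and> \<bar>?f' t\<bar> \<le> tiny"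
      using le(2,4)[OF B_le_imp_2_le[OF B]] tail[OF B] by simp
  next
    show "\<exists>bt s0. bt \<in> F \<and> s0 \<in> F \<and> \<bar>s0\<bar> \<le> 1 \<and> sg (Fin 0 \<oplus> Fin bt) = Fin 0 \<and> sg' (Fin 0 \<oplus> Fin bt) = Fin s0 \<and>
      (\<forall>n\<in>F. pw (E - P - 2) \<le> n \<longrightarrow> n \<le> 5 / 4 * pw E \<longrightarrow> (\<exists>n'\<in>F. Fin n \<oplus> Fin bt = Fin n' \<and> pw (E - P - 2) \<le> n'))"
      by (rule exI[of _ 0], rule exI[of _ "1 / 2"]) (use z' small_F R_F in auto)
  next
    fix m i :: int assume mi: "0 \<le> m" "m \<le> i" "int q + 1 \<le> i" "i \<le> E - P"
    note G = scaled_F[OF mi]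
    have on: "Fin (pw (m - i)) \<otimes> Fin (pw i) \<oplus> Fin 0 = Fin (pw m)" using R_F[OF G(2)] G(6) by simp
    have d1: "int q \<le> m \<longrightarrow> sg' (Fin (pw m)) = Fin 1"
    proof
      assume "int q \<le> m"
      from hi[OF G(7)[OF this]] show "sg' (Fin (pw m)) = Fin 1" unfolding sgF using R_close[of 1] one_F by simp
    qed
    have fx: "if m = 0 then 5 / 8 \<le> ?f (pw m) else 7 / 8 * pw m \<le> ?f (pw m)"
    proof (cases "m = 0")
      case True
      then show ?thesis using bnds(5) by simp
    next
      case False
      then have "pw 1 \<le> pw m" using mi by (subst pw_le_iff) simp
      then show ?thesis using bnds(4)[of "pw m"] False by simp
    qed
    show "\<exists>vI \<beta> s0 x. {vI, \<beta>, s0, x} \<subseteq> F \<and> B \<le> vI \<and> vI \<le> pw i \<and> \<bar>s0\<bar> \<le> 1 \<and>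
        sg (Fin (pw (m - i)) \<otimes> Fin 0 \<oplus> Fin \<beta>) = Fin 0 \<and> sg' (Fin (pw (m - i)) \<otimes> Fin 0 \<oplus> Fin \<beta>) = Fin s0 \<and>
        Fin (pw (m - i)) \<otimes> Fin vI \<oplus> Fin \<beta> = Fin x \<and> 0 < x \<and> x \<le> pw m \<and> \<bar>?f' x\<bar> \<le> 2 \<and> (int q \<le> m \<longrightarrow> sg' (Fin x) = Fin 1) \<and>
        (if m = 0 then 5 / 8 \<le> ?f x else 7 / 8 * pw m \<le> ?f x)"
      by (rule exI[of _ "pw i"], rule exI[of _ 0], rule exI[of _ "1 / 2"], rule exI[of _ "pw m"], intro conjI d1 fx bnds(3) on)
        (use G z' small_F in auto)
  qed (use sgF bnds hi a in auto)
  show ?thesis by (rule identity_cells)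
qed

text \<open>The slope c at 0 is an arbitrary float, so pre-activation 0 is avoided: the bias -
  \<eta> makes it negative, with value and slope 0, and is absorbed by every float from 1
  on.\<close>

lemma relu_cells:
  assumes a: "a = ReLU" and c: "c \<in> F"
  shows "cells p q a c d (pw (E - 2)) (Omega p q) 1 0 1 1 B B (E - P - 2)"
proof -
  let ?f = "max 0 :: real \<Rightarrow> real" and ?f' = "hat_sigma' c ReLU"
  have e: "0 < \<eta>" "\<eta> \<in> F" by (simp_all add: small_F)
  have tp: "0 \<le> tiny" "0 < B" using tiny_pos by simp_all
  have sgF: "sg (Fin t) = R (?f t)" "sg' (Fin t) = R (?f' t)" for t using a by auto
  have ne: "\<not> \<eta> < 0" "\<eta> \<noteq> 0" "0 \<le> \<eta>" using e(1) by linarith+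
  have off: "sg (Fin (- \<eta>)) = Fin 0" "sg' (Fin (- \<eta>)) = Fin 0" unfolding sgF using ne by auto
  have me: "R (- \<eta>) = Fin (- \<eta>)" by (rule R_F) (use e in simp)
  have absorb: "Fin n \<oplus> Fin (- \<eta>) = Fin n" if "n \<in> F" "1 \<le> n" for n
  proof -
    have "\<eta> \<le> 1 * pw (- P - 3)" unfolding \<eta>_def mult_1 using E_bounds by (subst pw_le_iff) (simp add: emin_eq)
    also have "\<dots> \<le> \<bar>n\<bar> * pw (- P - 3)" using that by (intro mult_right_mono) auto
    finally show ?thesis using R_absorb[OF that(1), of "n + - \<eta>"] e by simp
  qed
  interpret asymptotic_identity p q a c d 0 ?f ?f'
  proof (unfold_locales)
    show "\<exists>bt s0. bt \<in> F \<and> s0 \<in> F \<and> \<bar>s0\<bar> \<le> 1 \<and> sg (Fin 0 \<oplus> Fin bt) = Fin 0 \<and> sg' (Fin 0 \<oplus> Fin bt) = Fin s0 \<and>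
      (\<forall>n\<in>F. pw (E - P - 2) \<le> n \<longrightarrow> n \<le> 5 / 4 * pw E \<longrightarrow> (\<exists>n'\<in>F. Fin n \<oplus> Fin bt = Fin n' \<and> pw (E - P - 2) \<le> n'))"
    proof (rule exI[of _ "- \<eta>"], rule exI[of _ 0], intro conjI ballI impI)
      fix n assume n: "n \<in> F" "pw (E - P - 2) \<le> n" "n \<le> 5 / 4 * pw E"
      have "1 \<le> n" using n gap_F by linarith
      then show "\<exists>n'\<in>F. Fin n \<oplus> Fin (- \<eta>) = Fin n' \<and> pw (E - P - 2) \<le> n'" using absorb n by auto
    qed (use off e me in auto)
  next
    fix m i :: int assume mi: "0 \<le> m" "m \<le> i" "int q + 1 \<le> i" "i \<le> E - P"
    note G = scaled_F[OF mi]
    have on: "Fin (pw (m - i)) \<otimes> Fin (pw i) \<oplus> Fin (- \<eta>) = Fin (pw m)" using absorb[OF G(2,5)] R_F[OF G(2)] G(6) by simp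
    have d1: "int q \<le> m \<longrightarrow> sg' (Fin (pw m)) = Fin 1" unfolding sgF using R_F[OF one_F] by simp
    have off': "Fin (pw (m - i)) \<otimes> Fin 0 \<oplus> Fin (- \<eta>) = Fin (- \<eta>)" using me by simp
    show "\<exists>vI \<beta> s0 x. {vI, \<beta>, s0, x} \<subseteq> F \<and> B \<le> vI \<and> vI \<le> pw i \<and> \<bar>s0\<bar> \<le> 1 \<and>
        sg (Fin (pw (m - i)) \<otimes> Fin 0 \<oplus> Fin \<beta>) = Fin 0 \<and> sg' (Fin (pw (m - i)) \<otimes> Fin 0 \<oplus> Fin \<beta>) = Fin s0 \<and>
        Fin (pw (m - i)) \<otimes> Fin vI \<oplus> Fin \<beta> = Fin x \<and> 0 < x \<and> x \<le> pw m \<and> \<bar>?f' x\<bar> \<le> 2 \<and> (int q \<le> m \<longrightarrow> sg' (Fin x) = Fin 1) \<and>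
        (if m = 0 then 5 / 8 \<le> ?f x else 7 / 8 * pw m \<le> ?f x)"
      by (rule exI[of _ "pw i"], rule exI[of _ "- \<eta>"], rule exI[of _ 0], rule exI[of _ "pw m"], unfold off', intro conjI d1 on off)
        (use G e in auto)
  next
    fix t :: real assume "B \<le> t"
    then have "0 < t" using tp by linarith
    then show "\<bar>?f t - t\<bar> \<le> tiny \<and> \<bar>?f' t - 1\<bar> \<le> tiny" using tp by simp
  next
    fix t :: real assume "t \<le> - B"
    then have "t < 0" using tp by linarith
    then show "\<bar>?f t - 0\<bar> \<le> tiny \<and> \<bar>?f' t\<bar> \<le> tiny" using tp by simp
  qed (use sgF a c in auto)
  show ?thesis by (rule identity_cells)
qed

text \<open>\<kappa> = - 1 is moved to 0 by a bias equal to the weight: w' * (- 1) + w' = 0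
  exactly.\<close>

lemma elu_cells:
  assumes a: "a = ELU"
  shows "cells p q a c d (pw (E - 2)) (Omega p q) 1 (- 1) 1 1 B B (E - P - 2)"
proof -
  let ?f = "\<lambda>t::real. if 0 \<le> t then t else exp t - 1" and ?f' = "\<lambda>t::real. if 0 \<le> t then 1 else exp t"
  have tp: "0 \<le> tiny" "0 < B" using tiny_pos by simp_all
  have sgF: "sg (Fin t) = R (?f t)" "sg' (Fin t) = R (?f' t)" for t using a elu_deriv[of t] by auto
  have z: "sg (Fin 0) = Fin 0" "sg' (Fin 0) = Fin 1" unfolding sgF using R_F[OF one_F] by auto
  interpret asymptotic_identity p q a c d "- 1" ?f ?f'
  proof (unfold_locales)
    show "\<exists>bt s0. bt \<in> F \<and> s0 \<in> F \<and> \<bar>s0\<bar> \<le> 1 \<and> sg (Fin (- 1) \<oplus> Fin bt) = Fin 0 \<and> sg' (Fin (- 1) \<oplus> Fin bt) = Fin s0 \<and>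
      (\<forall>n\<in>F. pw (E - P - 2) \<le> n \<longrightarrow> n \<le> 5 / 4 * pw E \<longrightarrow> (\<exists>n'\<in>F. Fin n \<oplus> Fin bt = Fin n' \<and> pw (E - P - 2) \<le> n'))"
    proof (rule exI[of _ 1], rule exI[of _ 1], intro conjI ballI impI)
      fix n assume n: "n \<in> F" "pw (E - P - 2) \<le> n" "n \<le> 5 / 4 * pw E"
      have "pw 2 \<le> pw E" using E_bounds by (subst pw_le_iff) simp
      then have "\<bar>n + 1\<bar> \<le> Omega p q" using n gap_F Omega_bounds(1) by simp
      then obtain n' where n': "R (n + 1) = Fin n'" using R_in_range by blast
      moreover have "pw (E - P - 2) \<le> n'" by (rule R_ge[OF n']) (use n gap_F in auto)
      ultimately show "\<exists>n'\<in>F. Fin n \<oplus> Fin 1 = Fin n' \<and> pw (E - P - 2) \<le> n'" using R_Fin_F by auto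
    qed (use z one_F in auto)
  next
    fix m i :: int assume mi: "0 \<le> m" "m \<le> i" "int q + 1 \<le> i" "i \<le> E - P"
    note G = scaled_F[OF mi]
    define w' where "w' = pw (m - i)"
    have w'0: "0 < w'" by (simp add: w'_def)
    have off: "Fin w' \<otimes> Fin (- 1) \<oplus> Fin w' = Fin 0" using R_F[of "- w'"] G(3) by (simp add: w'_def)
    \<comment> \<open>The gate value is 7/8 of 2^i so that adding the bias w', at most 2^m / 8, does
      not lead beyond 2^m.\<close>
    have e7: "7 / 8 * pw k = of_int 7 * pw (k - 3)" for k by (simp add: pw_diff)
    have F7: "7 / 8 * pw i \<in> F" "7 / 8 * pw m \<in> F" unfolding e7 using mi E_bounds P2
      small_mult_F[of 7 "i - 3"] small_mult_F[of 7 "m - 3"] by (auto simp: emin_eq)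
    have "w' \<le> pw (m - 3)" unfolding w'_def using mi q6 by (subst pw_le_iff) simp
    then have w'le: "w' \<le> pw m / 8" by (simp add: pw_diff)
    have m0: "0 < pw m" by simp
    have "7 / 8 * pw m \<le> 7 / 8 * pw m + w'" "7 / 8 * pw m + w' \<le> pw m" using w'0 w'le m0 by linarith+
    from R_range[OF this F7(2) G(2)] obtain x where x: "x \<in> F" "R (7 / 8 * pw m + w') = Fin x" "7 / 8 * pw m \<le> x" "x \<le> pw m" by auto
    have wv: "w' * (7 / 8 * pw i) = 7 / 8 * pw m" using G(6) by (simp add: w'_def)
    have on: "Fin w' \<otimes> Fin (7 / 8 * pw i) \<oplus> Fin w' = Fin x" by (simp only: fmul.simps fadd.simps wv R_F[OF F7(2)] x(2))
    have x0: "0 < x" using x m0 by linarith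
    have d1: "int q \<le> m \<longrightarrow> sg' (Fin x) = Fin 1" unfolding sgF using R_F[OF one_F] x0 by simp
    have "pw (int q + 1) \<le> pw i" using mi by (subst pw_le_iff) simp
    then have vI: "B \<le> 7 / 8 * pw i" unfolding pw_Suc B_def[symmetric] using tp by linarith
    have vI': "7 / 8 * pw i \<le> pw i" by simp
    have fx: "if m = 0 then 5 / 8 \<le> ?f x else 7 / 8 * pw m \<le> ?f x" using x x0 by auto
    have f'x: "\<bar>?f' x\<bar> \<le> 2" using x0 by simp
    have FF: "{7 / 8 * pw i, w', 1, x} \<subseteq> F" using F7 G(3) one_F x(1) by (simp add: w'_def)
    show "\<exists>vI \<beta> s0 x. {vI, \<beta>, s0, x} \<subseteq> F \<and> B \<le> vI \<and> vI \<le> pw i \<and> \<bar>s0\<bar> \<le> 1 \<and>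
        sg (Fin (pw (m - i)) \<otimes> Fin (- 1) \<oplus> Fin \<beta>) = Fin 0 \<and> sg' (Fin (pw (m - i)) \<otimes> Fin (- 1) \<oplus> Fin \<beta>) = Fin s0 \<and>
        Fin (pw (m - i)) \<otimes> Fin vI \<oplus> Fin \<beta> = Fin x \<and> 0 < x \<and> x \<le> pw m \<and> \<bar>?f' x\<bar> \<le> 2 \<and> (int q \<le> m \<longrightarrow> sg' (Fin x) = Fin 1) \<and>
        (if m = 0 then 5 / 8 \<le> ?f x else 7 / 8 * pw m \<le> ?f x)"
      unfolding w'_def[symmetric]
      by (rule exI[of _ "7 / 8 * pw i"], rule exI[of _ w'], rule exI[of _ 1], rule exI[of _ x], unfold off, intro conjI d1 fx f'x on z FF vI vI' x0 x(4)) simp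
  next
    fix t :: real assume "B \<le> t"
    then have "0 < t" using tp by linarith
    then show "\<bar>?f t - t\<bar> \<le> tiny \<and> \<bar>?f' t - 1\<bar> \<le> tiny" using tp by simp
  next
    fix t :: real assume t: "t \<le> - B"
    then have B: "B \<le> - t" and t0: "t < 0" using tp by linarith+
    have "exp t \<le> (1 + (- t)) * exp (- (- t))" using t0 by simp
    then have "exp t \<le> tiny" using tail[OF B] by (rule order_trans)
    then show "\<bar>?f t - - 1\<bar> \<le> tiny \<and> \<bar>?f' t\<bar> \<le> tiny" using t0 by simp
  next
    show "- 1 \<le> ?f t \<and> ?f t \<le> 0" if "t \<le> 0" for t using that by (auto simp: less_imp_le)
    show "\<bar>?f' t\<bar> \<le> 2 \<or> ?f' t \<in> F" for t by (auto intro: order_trans[of _ 1])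
  qed (use sgF a in auto)
  show ?thesis by (rule identity_cells)
qed

end

section \<open>Cells for Sigmoid and tanh\<close>

lemma tanh_range: "\<bar>tanh t\<bar> \<le> (1::real)"
  using tanh_real_bounds[of t] by auto

lemma tanh_2: "7 / 8 \<le> tanh (2::real)"
proof -
  have "15 / (1 + 15) \<le> sigm 4" by (rule sigm_ge) (use exp_numeric in auto)
  then show ?thesis unfolding tanh_sigm by simp
qed

lemma tanh_tail:
  fixes t :: real
  assumes "0 \<le> t" shows "\<bar>tanh t - 1\<bar> \<le> 2 * exp (- t)" "\<bar>1 - (tanh t)\<^sup>2\<bar> \<le> 4 * exp (- t)"
proof -
  have "1 - sigm (2 * t) \<le> exp (- t)" using sigm_bounds(5)[of "2 * t"] assms by (smt (verit) exp_le_cancel_iff)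
  then show 1: "\<bar>tanh t - 1\<bar> \<le> 2 * exp (- t)" unfolding tanh_sigm using sigm_bounds(2)[of "2 * t"] by linarith
  have "\<bar>1 + tanh t\<bar> \<le> 2" using tanh_range[of t] by linarith
  then have "\<bar>tanh t - 1\<bar> * \<bar>1 + tanh t\<bar> \<le> 2 * exp (- t) * 2" using 1 by (intro mult_mono) auto
  moreover have "1 - (tanh t)\<^sup>2 = - ((tanh t - 1) * (1 + tanh t))" by (simp add: power2_eq_square algebra_simps)
  ultimately show "\<bar>1 - (tanh t)\<^sup>2\<bar> \<le> 4 * exp (- t)" by (simp add: abs_mult)
qed

context net
begin

lemma pw_half: "pw (1 - P) \<le> 1 / 2"
proof -
  have "pw (1 - P) \<le> pw (- 1)" using P2 by (subst pw_le_iff) simp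
  then show ?thesis by (simp add: power_int_minus)
qed

lemma tail4: "B \<le> t \<Longrightarrow> 4 * exp (- t) \<le> tiny"
proof -
  assume t: "B \<le> t"
  have "4 * exp (- t) \<le> (1 + t) * exp (- t)" using t B_ge_1 by (intro mult_right_mono) auto
  then show ?thesis using tail[OF t] by linarith
qed

lemma exp_tail: "B \<le> t \<Longrightarrow> exp (- t) \<le> tiny"
  using tail4[of t] exp_gt_zero[of "- t"] by linarith

text \<open>Between 1/2 and 1 floats are spaced by 2^(-p-1), so y lies above the midpoint of 1/2 and
  its successor and cannot be rounded to 1/2.\<close>

lemma R_above_half:
  assumes "1 / 2 + pw (- P - 2) < y" "R y = Fin v" shows "1 / 2 + pw (- P - 1) \<le> v"
proof (rule ccontr)
  assume na: "\<not> ?thesis"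
  define u where "u = pw (- P - 1)"
  have u0: "0 < u" by (simp add: u_def)
  have u2: "pw (- P - 2) = u / 2" unfolding u_def by (simp add: pw_diff pw_neg)
  have half: "1 / 2 = of_int (2 ^ p) * u" unfolding u_def by (simp add: pw_diff pw_neg)
  have vu: "v < 1 / 2 + u" using na by (simp add: u_def)
  have "of_int (2 ^ p + 1) * pw (- P - 1) \<in> F"
  proof (rule F_intro)
    show "\<bar>2 ^ p + 1\<bar> < (2::int) ^ (p + 1)" using p2 power_strict_increasing[of 0 p "2::int"] by simp
    show "emin q - P \<le> - P - 1" using E_bounds by (simp add: emin_eq)
    have "u \<le> pw 0" unfolding u_def by (subst pw_le_iff) simp
    moreover have "pw 1 \<le> pw E" using E_bounds by (subst pw_le_iff) simp
    ultimately have "1 / 2 + u \<le> Omega p q" using Omega_bounds(1) by simp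
    then show "\<bar>of_int (2 ^ p + 1) * pw (- P - 1)\<bar> \<le> Omega p q"
      unfolding u_def[symmetric] using half u0 by (simp add: algebra_simps)
  qed
  moreover have "of_int (2 ^ p + 1) * pw (- P - 1) = 1 / 2 + u"
    unfolding u_def[symmetric] half by (simp add: algebra_simps)
  ultimately have zF: "1 / 2 + u \<in> F" by (simp only:)
  have y: "y < 1 / 2 + u" using R_ge[OF assms(2) _ zF] vu by (rule_tac ccontr) auto
  have near: "\<bar>v - y\<bar> \<le> \<bar>(1 / 2 + u) - y\<bar>" by (rule R_near[OF assms(2) zF])
  have v: "1 / 2 < v" using near y assms(1) unfolding u2 by linarith
  obtain n e where n: "\<bar>n\<bar> < 2 ^ (p + 1)" "v = of_int n * pw e" using F_elim[OF R_Fin_F[OF assms(2)]] by blast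
  have e: "- P - 1 \<le> e"
  proof (rule ccontr)
    assume "\<not> ?thesis"
    then have "pw e \<le> pw (- P - 2)" by (subst pw_le_iff) simp
    moreover have "of_int n \<le> (2 ^ (p + 1) :: real)" using n(1) by (metis abs_le_D1 less_imp_le of_int_le_iff of_int_numeral of_int_power)
    ultimately have "of_int n * pw e \<le> 2 ^ (p + 1) * pw (- P - 2)" by (intro mult_mono) auto
    also have "\<dots> = 1 / 2" by (simp add: pw_diff pw_neg)
    finally show False using v n by simp
  qed
  define j where "j = nat (e - (- P - 1))"
  have ej: "e = (- P - 1) + int j" using e by (simp add: j_def)
  have vn: "v = of_int (n * 2 ^ j) * u" unfolding n(2) ej u_def pw_add by simp
  have "of_int (2 ^ p) * u < of_int (n * 2 ^ j) * u" using v unfolding half vn .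
  then have "2 ^ p < n * 2 ^ j" using u0 by (metis mult_less_cancel_right_pos of_int_less_iff)
  moreover have "of_int (n * 2 ^ j) * u < of_int (2 ^ p + 1) * u" using vu unfolding half vn by (simp add: algebra_simps)
  then have "n * 2 ^ j < 2 ^ p + 1" using u0 by (metis mult_less_cancel_right_pos of_int_less_iff)
  ultimately show False by simp
qed

lemma pw_le_E: "k \<le> E - P \<Longrightarrow> j \<le> P - 1 \<Longrightarrow> pw j * pw k \<le> Omega p q"
proof -
  assume "k \<le> E - P" "j \<le> P - 1"
  then have "pw (j + k) \<le> pw E" by (subst pw_le_iff) simp
  then show ?thesis unfolding pw_add using Omega_bounds(1) pw_pos[of E] by linarith
qed

text \<open>Values of the saturating activations are at most 1, so large outputs need output weights
  up to 2^(E - p). The bound 2^(p-1) on the seed, which \<open>H_sigma\<close> guarantees for them,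
  keeps the backward product within 2^E.\<close>

lemma bounded_weight:
  assumes s: "s \<in> {1, -1}" and k: "emin q - P \<le> k" "k \<le> E - P" and h: "\<bar>h\<bar> \<le> pw (P - 1)"
  shows "s * pw k \<in> F" "\<exists>g\<in>F. Fin h \<otimes> Fin (s * pw k) = Fin g"
proof -
  have kF: "pw k \<in> F" using k E_bounds P2 by (intro pw_F) auto
  then show "s * pw k \<in> F" using s by auto
  have "\<bar>h * (s * pw k)\<bar> = \<bar>h\<bar> * pw k" using s by (auto simp: abs_mult)
  also have "\<dots> \<le> pw (P - 1) * pw k" using h by (intro mult_right_mono) auto
  also have "\<dots> \<le> Omega p q" using k by (intro pw_le_E) auto
  finally show "\<exists>g\<in>F. Fin h \<otimes> Fin (s * pw k) = Fin g" using R_in_range R_Fin_F by fastforce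
qed

lemma B_multiples: "4 * B \<in> F" "- (3 * B) \<in> F" "R (4 * B) = Fin (4 * B)" "R (- (3 * B)) = Fin (- (3 * B))"
proof -
  have "of_int n * pw (int q) \<in> F" if "\<bar>n\<bar> \<le> 7" for n using E_bounds that by (intro small_mult_F) (auto simp: emin_eq)
  from this[of 4] this[of 3] show "4 * B \<in> F" "- (3 * B) \<in> F" by (simp_all add: B_def)
  then show "R (4 * B) = Fin (4 * B)" "R (- (3 * B)) = Fin (- (3 * B))" using R_F by auto
qed

text \<open>Both neurons of a value cell are saturated whether the gate is open or closed, so their
  slopes are exact zeros and the only backward product to control is h times the output
  weight.\<close>

lemma sigmoid_cells:
  assumes a: "a = Sigmoid"
  shows "cells p q a c d (pw (E - 1)) (2 ^ (p - 1)) (2 * B) 0 4 (1 / 4) 0 (1 / 2) (int q)"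
proof -
  have sgF: "sg (Fin t) = R (sigm t)" "sg' (Fin t) = R (sigm t * (1 - sigm t))" for t
    using a sigmoid_deriv[of t] by (auto simp: sigm_def)
  have prod: "0 \<le> sigm t * (1 - sigm t)" "sigm t * (1 - sigm t) \<le> 1 - sigm t" "sigm t * (1 - sigm t) \<le> sigm t" for t
    using sigm_bounds[of t] mult_right_mono[of "sigm t" 1 "1 - sigm t"] mult_left_mono[of "1 - sigm t" 1 "sigm t"] by auto
  have H: "2 ^ (p - 1) = pw (P - 1)"
  proof -
    have "P - 1 = int (p - 1)" using p2 by simp
    then show ?thesis by (simp only: pw_nat)
  qed
  have act_neg: "sg v = Fin 0 \<and> sg' v = Fin 0" if nv: "neg v" for v
  proof -
    consider "v = NInf" | t where "v = Fin t" "t \<le> - B" using nv unfolding neg_def by blast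
    then show ?thesis
    proof cases
      case 2
      then have B: "B \<le> - t" by linarith
      have "sigm t \<le> tiny" using exp_tail[OF B] sigm_bounds(4)[of t] by simp
      then have "\<bar>sigm t\<bar> \<le> tiny" "\<bar>sigm t * (1 - sigm t)\<bar> \<le> tiny" using prod[of t] sigm_bounds(1)[of t] by linarith+
      then show ?thesis unfolding 2(1) sgF using R_tiny by blast
    qed (simp add: a)
  qed
  have act_top: "sg v = Fin 1 \<and> sg' v = Fin 0" if pv: "v = PInf \<or> (\<exists>t\<in>F. v = Fin t \<and> B \<le> t)" for v
  proof -
    consider "v = PInf" | t where "v = Fin t" "B \<le> t" using pv by blast
    then show ?thesis
    proof cases
      case 2
      have "1 - sigm t \<le> tiny" using exp_tail[OF 2(2)] sigm_bounds(5)[of t] by linarith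
      then have "\<bar>sigm t - 1\<bar> \<le> tiny" "\<bar>sigm t * (1 - sigm t)\<bar> \<le> tiny" using prod[of t] sigm_bounds(2)[of t] by linarith+
      then show ?thesis unfolding 2(1) sgF using R_tiny R_close[of 1] one_F by simp
    qed (simp add: a)
  qed
  have neg3: "neg (Fin (- (3 * B)))" unfolding neg_def using B_multiples B_ge_1 by simp
  have pre: "Fin (4 * B) \<otimes> Fin 0 \<oplus> Fin (- (3 * B)) = Fin (- (3 * B))" using B_multiples by simp
  have pre1: "Fin (4 * B) \<otimes> Fin 1 \<oplus> Fin (- (3 * B)) = Fin B" using B_multiples R_F[OF B_F(1)] by simp
  have off: "sg (Fin (- (3 * B))) = Fin 0" "sg' (Fin (- (3 * B))) = Fin 0" using act_neg[OF neg3] by auto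
  have on: "sg (Fin B) = Fin 1" "sg' (Fin B) = Fin 0" using act_top[of "Fin B"] by auto
  have "saturating p q a c 0 4 (1 / 4) (1 / 2) (2 ^ (p - 1))"
  proof (unfold_locales)
    show "sg (Fin 0) = Fin (1 / 2)" "sg' (Fin 0) = Fin (1 / 4)" unfolding sgF sigm_0 using R_F[OF small_F(4)] R_F[OF small_F(5)] by simp_all
  next
    fix t :: real
    have 0: "0 \<le> sigm t" "sigm t \<le> 1" "0 \<le> sigm t * (1 - sigm t)" "sigm t * (1 - sigm t) \<le> 1"
      using prod[of t] sigm_bounds[of t] by linarith+
    show "\<exists>v\<in>F. \<exists>s\<in>F. sg (Fin t) = Fin v \<and> sg' (Fin t) = Fin s \<and> 0 \<le> v \<and> v \<le> 1"
      unfolding sgF using R_range[OF 0(1,2) zero_F one_F] R_range[OF 0(3,4) zero_F one_F] by blast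
  next
    fix t v assume t: "sg (Fin t) = Fin v" "t \<le> 0"
    then have "sigm t \<le> 1 / 2" using sigm_mono[of t 0] sigm_0 by simp
    then show "v \<le> 1 / 2" using R_le[of "sigm t" v "1 / 2"] t small_F unfolding sgF by blast
  next
    fix t v assume t: "sg (Fin t) = Fin v" "pw (1 - P) \<le> t"
    have t0: "0 < pw (1 - P)" by simp
    have "1 / 2 + pw (1 - P) / 6 \<le> sigm (pw (1 - P))" using sigm_slope[OF less_imp_le[OF t0] pw_half] .
    also have "\<dots> \<le> sigm t" by (rule sigm_mono[OF t(2)])
    finally have "1 / 2 + pw (1 - P) / 6 \<le> sigm t" .
    moreover have "pw (- P - 2) = pw (1 - P) / 8" by (simp add: pw_diff pw_neg)
    ultimately have "1 / 2 + pw (- P - 2) < sigm t" using t0 by linarith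
    then show "1 / 2 + pw (- P - 1) \<le> v" using R_above_half t(1) unfolding sgF by blast
  next
    show "\<exists>wt bt s0 v s1. {wt, bt, s0, v, s1} \<subseteq> F \<and> sg (Fin wt \<otimes> Fin 0 \<oplus> Fin bt) = Fin 0 \<and> sg' (Fin wt \<otimes> Fin 0 \<oplus> Fin bt) = Fin s0 \<and>
      (\<forall>g\<in>F. \<exists>t e. Fin g \<otimes> Fin s0 = Fin t \<and> Fin t \<otimes> Fin wt = Fin e) \<and>
      sg (Fin wt \<otimes> Fin 1 \<oplus> Fin bt) = Fin v \<and> sg' (Fin wt \<otimes> Fin 1 \<oplus> Fin bt) = Fin s1 \<and> 1 / 2 \<le> v \<and> v \<le> 1"
      by (rule exI[of _ "4 * B"], rule exI[of _ "- (3 * B)"], rule exI[of _ 0], rule exI[of _ 1], rule exI[of _ 0],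
        unfold pre pre1, intro conjI off on) (use B_multiples one_F in auto)
  next
    fix s :: real and k assume s: "s \<in> {1, -1}" and k: "emin q - P \<le> k" "k \<le> E - P"
    have wF: "s * pw k \<in> F" using bounded_weight(1)[OF s k, of 0] by simp
    have we: "Fin (s * pw k) \<otimes> Fin 1 = Fin (s * pw k)" using R_F[OF wF] by simp
    have fit: "fits s k (s * pw k)" unfolding fits_def using wF s by auto
    have FF: "{B, 1, 0, 4 * B, - (3 * B), 1, 0, 0, s * pw k} \<subseteq> F" using B_multiples one_F wF by auto
    have B4: "\<bar>B\<bar> \<le> 4 * pw (int q)" unfolding B_def[symmetric] using B_ge_1 by simp
    have bw: "\<exists>g t0 e0 t1 e1 t2 e2. Fin h \<otimes> Fin (s * pw k) = Fin g \<and> Fin g \<otimes> Fin 0 = Fin t0 \<and> Fin t0 \<otimes> Fin (4 * B) = Fin e0 \<and>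
      Fin g \<otimes> Fin 0 = Fin t1 \<and> Fin t1 \<otimes> Fin (4 * B) = Fin e1 \<and> Fin e1 \<otimes> Fin 0 = Fin t2 \<and> Fin t2 \<otimes> Fin (- (2 * B)) = Fin e2"
      if "h \<in> F" "\<bar>h\<bar> \<le> 2 ^ (p - 1)" for h
      using bounded_weight(2)[OF s k that(2)[unfolded H]] by auto
    show "value_cell (2 ^ (p - 1)) (2 * B) (int q) 0 s k" unfolding value_cell_def
      by (rule exI[of _ B], rule exI[of _ 1], rule exI[of _ 0], rule exI[of _ "4 * B"], rule exI[of _ "- (3 * B)"],
        rule exI[of _ 1], rule exI[of _ 0], rule exI[of _ 0], rule exI[of _ "s * pw k"], rule exI[of _ "s * pw k"],
        unfold pre pre1, intro conjI ballI impI FF B4 on off we fit) (rule bw)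
  qed (use act_neg act_top H in auto)
  then show ?thesis by (rule saturating.saturating_cells)
qed

text \<open>tanh vanishes at 0 with slope 1, so weight 1 and bias 1 take a closed gate from - 1 to 0
  and an open one from 1 to 2, where tanh is at least 7/8.\<close>

lemma tanh_cells:
  assumes a: "a = Tanh"
  shows "cells p q a c d (pw (E - 1)) (2 ^ (p - 2)) (2 * B) (- 1) 1 1 0 0 (int q)"
proof -
  have sgF: "sg (Fin t) = R (tanh t)" "sg' (Fin t) = R (1 - (tanh t)\<^sup>2)" for t
    using a tanh_deriv[of t] by auto
  have sq: "0 \<le> 1 - (tanh t)\<^sup>2" "1 - (tanh t)\<^sup>2 \<le> 1" for t :: real
    using tanh_range[of t] abs_square_le_1[of "tanh t"] by auto
  have H: "2 ^ (p - 2) \<le> pw (P - 1)"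
  proof -
    have "P - 1 = int (p - 1)" using p2 by simp
    then have "pw (P - 1) = 2 ^ (p - 1)" by (simp only: pw_nat)
    then show ?thesis by (simp add: power_increasing)
  qed
  have act_neg: "sg v = Fin (- 1) \<and> sg' v = Fin 0" if nv: "neg v" for v
  proof -
    consider "v = NInf" | t where "v = Fin t" "t \<le> - B" using nv unfolding neg_def by blast
    then show ?thesis
    proof cases
      case 2
      define r where "r = - t"
      have r: "B \<le> r" "t = - r" using 2 by (auto simp: r_def)
      have "0 \<le> r" using r B_ge_1 by linarith
      then have "\<bar>tanh r - 1\<bar> \<le> tiny" "\<bar>1 - (tanh r)\<^sup>2\<bar> \<le> tiny" using tanh_tail[of r] tail4[OF r(1)] exp_gt_zero[of "- r"] by linarith+
      then have "\<bar>tanh t - - 1\<bar> \<le> tiny" "\<bar>1 - (tanh t)\<^sup>2\<bar> \<le> tiny" unfolding r(2) by auto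
      then show ?thesis unfolding 2(1) sgF using R_tiny R_close[of "- 1"] one_F by simp
    qed (simp add: a)
  qed
  have act_top: "sg v = Fin 1 \<and> sg' v = Fin 0" if pv: "v = PInf \<or> (\<exists>t\<in>F. v = Fin t \<and> B \<le> t)" for v
  proof -
    consider "v = PInf" | t where "v = Fin t" "B \<le> t" using pv by blast
    then show ?thesis
    proof cases
      case 2
      have "0 \<le> t" using 2 B_ge_1 by linarith
      then have "\<bar>tanh t - 1\<bar> \<le> tiny" "\<bar>1 - (tanh t)\<^sup>2\<bar> \<le> tiny" using tanh_tail[of t] tail4[OF 2(2)] exp_gt_zero[of "- t"] by linarith+
      then show ?thesis unfolding 2(1) sgF using R_tiny R_close[of 1] one_F by simp
    qed (simp add: a)
  qed
  have m1: "- 1 \<in> F" using one_F by simp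
  have z: "sg (Fin 0) = Fin 0" "sg' (Fin 0) = Fin 1" unfolding sgF using R_F[OF one_F] by simp_all
  have pre: "Fin 1 \<otimes> Fin (- 1) \<oplus> Fin 1 = Fin 0" using R_F[OF m1] by simp
  have pre1: "Fin 1 \<otimes> Fin 1 \<oplus> Fin 1 = Fin 2" using R_F[OF one_F] R_F[OF small_F(1)] by simp
  have t2: "tanh 2 \<le> (1::real)" using tanh_range[of 2] by simp
  obtain v where v: "v \<in> F" "R (tanh 2) = Fin v" "7 / 8 \<le> v" "v \<le> 1" using R_range[OF tanh_2 t2 small_F(2) one_F] by auto
  obtain s1 where s1: "s1 \<in> F" "R (1 - (tanh 2)\<^sup>2) = Fin s1" "0 \<le> s1" "s1 \<le> 1" using R_range[OF sq(1)[of 2] sq(2)[of 2] zero_F one_F] by auto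
  have on: "sg (Fin 2) = Fin v" "sg' (Fin 2) = Fin s1" unfolding sgF using v s1 by auto
  have id: "Fin g \<otimes> Fin 1 = Fin g" if "g \<in> F" for g using R_F[OF that] by simp
  have "saturating p q a c (- 1) 1 1 0 (2 ^ (p - 2))"
  proof (unfold_locales)
    fix t :: real
    have 0: "- 1 \<le> tanh t" "tanh t \<le> 1" using tanh_range[of t] by auto
    show "\<exists>v\<in>F. \<exists>s\<in>F. sg (Fin t) = Fin v \<and> sg' (Fin t) = Fin s \<and> - 1 \<le> v \<and> v \<le> 1"
      unfolding sgF using R_range[OF 0 m1 one_F] R_range[OF sq[of t] zero_F one_F] by blast
  next
    fix t v assume t: "sg (Fin t) = Fin v" "t \<le> 0"
    then have "tanh t \<le> 0" by simp
    then show "v \<le> 0" using R_le[of "tanh t" v 0] t zero_F unfolding sgF by blast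
  next
    fix t v assume t: "sg (Fin t) = Fin v" "pw (1 - P) \<le> t"
    have t0: "0 < pw (1 - P)" by simp
    have "1 / 2 + pw (1 - P) / 6 \<le> sigm (pw (1 - P))" using sigm_slope[OF less_imp_le[OF t0] pw_half] .
    also have "\<dots> \<le> sigm (2 * t)" using t(2) t0 by (intro sigm_mono) linarith
    finally have "pw (1 - P) / 3 \<le> tanh t" unfolding tanh_sigm by linarith
    moreover have "pw (- P - 1) = pw (1 - P) / 4" by (simp add: pw_diff pw_neg)
    ultimately have "pw (- P - 1) \<le> tanh t" using t0 by linarith
    then show "0 + pw (- P - 1) \<le> v" using R_ge[of "tanh t" v "pw (- P - 1)"] t small_F unfolding sgF by simp
  next
    have bw: "\<forall>g\<in>F. \<exists>t e. Fin g \<otimes> Fin 1 = Fin t \<and> Fin t \<otimes> Fin 1 = Fin e" using id by blast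
    have FF: "{1, 1, 1, v, s1} \<subseteq> F" using one_F v s1 by simp
    have vh: "1 / 2 \<le> v" using v by simp
    show "\<exists>wt bt s0 v s1. {wt, bt, s0, v, s1} \<subseteq> F \<and> sg (Fin wt \<otimes> Fin (- 1) \<oplus> Fin bt) = Fin 0 \<and> sg' (Fin wt \<otimes> Fin (- 1) \<oplus> Fin bt) = Fin s0 \<and>
      (\<forall>g\<in>F. \<exists>t e. Fin g \<otimes> Fin s0 = Fin t \<and> Fin t \<otimes> Fin wt = Fin e) \<and>
      sg (Fin wt \<otimes> Fin 1 \<oplus> Fin bt) = Fin v \<and> sg' (Fin wt \<otimes> Fin 1 \<oplus> Fin bt) = Fin s1 \<and> 1 / 2 \<le> v \<and> v \<le> 1"
      by (rule exI[of _ 1], rule exI[of _ 1], rule exI[of _ 1], rule exI[of _ v], rule exI[of _ s1],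
        unfold pre pre1, intro conjI FF z on bw vh v)
  next
    fix s :: real and k assume s: "s \<in> {1, -1}" and k: "emin q - P \<le> k" "k \<le> E - P"
    have wF: "s * pw k \<in> F" using bounded_weight(1)[OF s k, of 0] by simp
    have "7 / 8 * pw k \<le> v * pw k" "v * pw k \<le> 1 * pw k" using v by (intro mult_right_mono; simp)+
    then obtain e where e: "R (s * (v * pw k)) = Fin e" "fits s k e" using fits_R[OF s k, of "v * pw k"] by auto
    have we: "Fin (s * pw k) \<otimes> Fin v = Fin e" using e(1) by (simp add: ac_simps)
    have FF: "{B, 1, 0, 1, 1, v, 1, s1, s * pw k} \<subseteq> F" using one_F wF v s1 by auto
    have B4: "\<bar>B\<bar> \<le> 4 * pw (int q)" unfolding B_def[symmetric] using B_ge_1 by simp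
    have onB: "sg (Fin B) = Fin 1" "sg' (Fin B) = Fin 0" using act_top[of "Fin B"] by auto
    have bw: "\<exists>g t0 e0 t1 e1 t2 e2. Fin h \<otimes> Fin (s * pw k) = Fin g \<and> Fin g \<otimes> Fin 1 = Fin t0 \<and> Fin t0 \<otimes> Fin 1 = Fin e0 \<and>
      Fin g \<otimes> Fin s1 = Fin t1 \<and> Fin t1 \<otimes> Fin 1 = Fin e1 \<and> Fin e1 \<otimes> Fin 0 = Fin t2 \<and> Fin t2 \<otimes> Fin (- (2 * B)) = Fin e2"
      if h: "h \<in> F" "\<bar>h\<bar> \<le> 2 ^ (p - 2)" for h
    proof -
      have "\<bar>h\<bar> \<le> pw (P - 1)" using h H by linarith
      then obtain g where g: "g \<in> F" "Fin h \<otimes> Fin (s * pw k) = Fin g" using bounded_weight(2)[OF s k] by blast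
      obtain t1 where t1: "t1 \<in> F" "Fin g \<otimes> Fin s1 = Fin t1" using R_mult_le[OF g(1), of s1] s1 by auto
      have "Fin t1 \<otimes> Fin 0 = Fin 0" "Fin 0 \<otimes> Fin (- (2 * B)) = Fin 0" by simp_all
      then show ?thesis using g t1 id[OF g(1)] id[OF t1(1)] by blast
    qed
    show "value_cell (2 ^ (p - 2)) (2 * B) (int q) (- 1) s k" unfolding value_cell_def
      by (rule exI[of _ B], rule exI[of _ 1], rule exI[of _ 0], rule exI[of _ 1], rule exI[of _ 1],
        rule exI[of _ v], rule exI[of _ 1], rule exI[of _ s1], rule exI[of _ "s * pw k"], rule exI[of _ e],
        unfold pre pre1, intro conjI ballI impI FF B4 onB z on we e(2)) (rule bw)
  qed (use act_neg act_top H z in auto)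
  then show ?thesis by (rule saturating.saturating_cells)
qed

end

theorem theorem3p1:
  fixes p q d L :: nat and a :: act and c :: real
    and fstar hstar :: "real list \<Rightarrow> real" and gstar :: "real list \<Rightarrow> real list"
  assumes "2 \<le> p" "p \<le> 2 ^ (q - 2)" "6 \<le> q"
    and "a = ReLU \<longrightarrow> c \<in> Fl p q"
    and "\<forall>x. length x = d \<and> set x \<subseteq> Fl p q \<inter> {- M_sigma q a .. M_sigma q a}
            \<longrightarrow> fstar x \<in> Fl p q"
    and "\<forall>x. length x = d \<and> set x \<subseteq> Fl p q \<inter> {- M_sigma q a .. M_sigma q a}
            \<longrightarrow> hstar x \<in> Fl p q \<inter> {- H_sigma p q a .. H_sigma p q a}"
    and "\<forall>x. length x = d \<and> set x \<subseteq> Fl p q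
            \<longrightarrow> length (gstar x) = d \<and> set (gstar x) \<subseteq> Fl p q"
    and "\<forall>x. length x = d \<and> set x \<subseteq> Fl p q \<inter> {- M_sigma q a .. M_sigma q a} \<and> hstar x = 0
            \<longrightarrow> gstar x = replicate d 0"
    and "9 \<le> L"
  shows "\<exists>ls. is_network p q d L ls \<and>
           (\<forall>x. length x = d \<and> set x \<subseteq> Fl p q \<inter> {- M_sigma q a .. M_sigma q a} \<longrightarrow>
              net_eval p q a ls (map Fin x) = [Fin (fstar x)] \<and>
              autodiff p q c a ls (map Fin x) [Fin (hstar x)] = map Fin (gstar x))"
proof -
  interpret net p q a c d using assms(1-3) by unfold_locales
  have main: ?thesis
    if C: "cells p q a c d (M_sigma q a) (H_sigma p q a) K \<kappa> \<omega> \<delta> bp vp kt" for K \<kappa> \<omega> \<delta> bp vp kt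
  proof -
    interpret cells p q a c d "M_sigma q a" "H_sigma p q a" K \<kappa> \<omega> \<delta> bp vp kt by (rule C)
    have gX: "x \<in> grid (M_sigma q a) \<longleftrightarrow> length x = d \<and> set x \<subseteq> F \<inter> {- M_sigma q a .. M_sigma q a}" for x
      by (simp add: grid_def)
    have hs: "hstar x \<in> F \<and> \<bar>hstar x\<bar> \<le> H_sigma p q a" if "x \<in> grid (M_sigma q a)" for x
    proof -
      have "hstar x \<in> F \<inter> {- H_sigma p q a .. H_sigma p q a}" using assms(6) that unfolding gX by blast
      then show ?thesis by auto
    qed
    have fs: "fstar x \<in> F" if "x \<in> grid (M_sigma q a)" for x
      using assms(5) that unfolding gX by blast
    have gs: "length (gstar x) = d \<and> set (gstar x) \<subseteq> F \<and> (hstar x = 0 \<longrightarrow> gstar x = replicate d 0)"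
      if "x \<in> grid (M_sigma q a)" for x
    proof -
      have x: "length x = d" "set x \<subseteq> F \<inter> {- M_sigma q a .. M_sigma q a}" using that unfolding gX by auto
      then have "set x \<subseteq> F" by blast
      then show ?thesis using assms(7,8) x by blast
    qed
    obtain ls where "is_network p q d L ls" "\<forall>x\<in>grid (M_sigma q a). net_eval p q a ls (map Fin x) = [Fin (fstar x)] \<and>
        autodiff p q c a ls (map Fin x) [Fin (hstar x)] = map Fin (gstar x)"
      using memorise[where hs = hstar and fst' = fstar and gst = gstar, OF assms(9) hs fs gs] by blast
    then show ?thesis unfolding gX[symmetric] by blast
  qed
  show ?thesis
  proof (cases a)
    case ReLU
    with assms(4) relu_cells show ?thesis by (intro main) (auto simp: M_sigma_def H_sigma_def)
  next
    case ELU
    with elu_cells show ?thesis by (intro main) (auto simp: M_sigma_def H_sigma_def)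
  next
    case GELU
    with smooth_cells show ?thesis by (intro main) (auto simp: M_sigma_def H_sigma_def)
  next
    case Swish
    with smooth_cells show ?thesis by (intro main) (auto simp: M_sigma_def H_sigma_def)
  next
    case Sigmoid
    with sigmoid_cells show ?thesis by (intro main) (auto simp: M_sigma_def H_sigma_def)
  next
    case Tanh
    with tanh_cells show ?thesis by (intro main) (auto simp: M_sigma_def H_sigma_def)
  qed
qed

end
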